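(* Let $k$ be a base field of characteristic $p > 0$, let $n \geqslant 1$ and $e_1 \geqslant e_2 \geqslant \dots \geqslant e_r \geqslant 1$ be integers (with $r \geqslant 1$), and set $\mathbf{e} = (e_1, \dots, e_r)$ and $s_i = e_1 + \dots + e_i$ for $i = 1, \dots, r$. Then \[ \tau(n, \mathbf{e}) = n \sum_{i=1}^r p^{s_i - i e_i} . \]
   Context: All fields are assumed to contain the base field $k$. Essential dimension of a field extension. A field extension $L/K$ of finite degree descends to a subfield $K_0 \subset K$ if there exists a subfield $K_0 \subset L_0 \subset L$ such that $L_0$ and $K$ generate $L$ and $[L_0:K_0] = [L:K]$ (equivalently, $L \simeq L_0 \otimes_{K_0} K$ over $K$). The essential dimension of $L/K$ (over $k$) is $\operatorname{ed}(L/K) = \min\{\operatorname{trdeg}(K_0/k) \mid k \subset K_0 \subset K \text{ and } L/K \text{ descends to } K_0\}$. Type. Let $L/S$ be a purely inseparable extension of finite degree. For $x \in L$ the exponent $e(x,S)$ is the smallest integer $e \geqslant 0$ with $x^{p^e} \in S$. An element $x \in L$ is normal in $L/S$ if $e(x,S) = \max\{e(y,S) \mid y \in L\}$. For a sequence $x_1,\dots,x_r \in L$ put $L_0 = S$ and $L_i = S(x_1,\dots,x_i)$. The sequence is a normal generating sequence of $L/S$ if $L = L_r$ and, for every $i = 1,\dots,r$, $x_i \notin L_{i-1}$ and $x_i$ is normal in $L/L_{i-1}$. Its type is $(e_1,\dots,e_r)$ with $e_i = e(x_i, L_{i-1})$; then $e_1 \geqslant \dots \geqslant e_r \geqslant 1$.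 Normal generating sequences exist, and (by a theorem of Pickert) the type does not depend on the choice of sequence; it is called the type of $L/S$. If $L/K$ is an inseparable field extension of finite degree and $S$ is the separable closure of $K$ in $L$, then $L/K$ is of type $(n,\mathbf{e})$ if $[S:K] = n$ and $L/S$ is of type $\mathbf{e}$. Definition of $\tau$: $\tau(n,\mathbf{e}) = \max\{\operatorname{ed}(L/K) \mid k \subset K \text{ and } L/K \text{ is a field extension of type } (n,\mathbf{e})\}$. *)

theory Defs
  imports "HOL-Algebra.Algebra" "HOL-Library.Extended_Nat"
begin

definition characteristic :: "('a, 'm) ring_scheme \<Rightarrow> nat" where
  "characteristic R =
     (if \<exists>m::nat>0. [m] \<cdot>\<^bsub>R\<^esub> \<one>\<^bsub>R\<^esub> = \<zero>\<^bsub>R\<^esub>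
      then LEAST m. m > 0 \<and> [m] \<cdot>\<^bsub>R\<^esub> \<one>\<^bsub>R\<^esub> = \<zero>\<^bsub>R\<^esub> else 0)"

text \<open>
  Throughout, the ambient ring is the top field \<open>L = carrier R\<close> of an extension;
  \<open>F\<close> is (the image of) the base field, and \<open>K\<close>, \<open>K0\<close>, \<open>L0\<close>, \<open>S\<close> are subfields of \<open>R\<close>.
\<close>

context ring
begin

text \<open>
  Multisets of elements of \<open>A\<close> encode monomials in variables indexed by \<open>A\<close>, so \<open>(M, c)\<close> is
  a polynomial with coefficients in \<open>F\<close> that is evaluated at the elements of \<open>A\<close> themselves.
\<close>

definition alg_independent :: "'a set \<Rightarrow> 'a set \<Rightarrow> bool" where
  "alg_independent F A \<longleftrightarrow> A \<subseteq> carrier R \<and>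
     (\<forall>M c. finite M \<and> (\<forall>m\<in>M. set_mset m \<subseteq> A) \<and> c \<in> M \<rightarrow> F \<and>
        (\<Oplus>m\<in>M. c m \<otimes> (\<Otimes>x\<in>set_mset m. x [^] count m x)) = \<zero>
        \<longrightarrow> (\<forall>m\<in>M. c m = \<zero>))"

text \<open>The value is \<open>\<infinity>\<close> exactly when the transcendence degree is an infinite cardinal.\<close>

definition trdeg :: "'a set \<Rightarrow> 'a set \<Rightarrow> enat" where
  "trdeg F E = (SUP A \<in> {A. finite A \<and> A \<subseteq> E \<and> alg_independent F A}. enat (card A))"

definition descends_to :: "'a set \<Rightarrow> 'a set \<Rightarrow> bool" where
  "descends_to K K0 \<longleftrightarrow> subfield K0 R \<and> K0 \<subseteq> K \<and>
     (\<exists>L0. subfield L0 R \<and> K0 \<subseteq> L0 \<and> generate_field R (L0 \<union> K) = carrier R \<and>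
        (\<exists>d. dimension d K0 L0 \<and> dimension d K (carrier R)))"

text \<open>The infimum is a minimum, as \<^typ>\<open>enat\<close> is well-ordered and \<open>K\<close> itself is admissible.\<close>

definition ess_dim :: "'a set \<Rightarrow> 'a set \<Rightarrow> enat" where
  "ess_dim F K = (INF K0 \<in> {K0. F \<subseteq> K0 \<and> descends_to K K0}. trdeg F K0)"

text \<open>
  Polynomials are coefficient lists with the leading coefficient first: the coefficient of
  \<open>X\<^sup>i\<close> in the derivative is \<open>i + 1\<close> times that of \<open>X\<^sup>i\<^sup>+\<^sup>1\<close> in \<open>f\<close>.
\<close>

definition formal_deriv :: "'a list \<Rightarrow> 'a list" where
  "formal_deriv f = normalize (map (\<lambda>i. [Suc i] \<cdot> coeff f (Suc i)) (rev [0..<degree f]))"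

text \<open>
  \<open>Irr K x\<close> is the minimal polynomial of \<open>x\<close>; it is required to be coprime in \<open>K[X]\<close>
  to its derivative.
\<close>

definition separable_over :: "'a set \<Rightarrow> 'a \<Rightarrow> bool" where
  "separable_over K x \<longleftrightarrow> algebraic K x \<and>
     (\<forall>d \<in> carrier (K[X]).
        d divides\<^bsub>K[X]\<^esub> (Irr K x) \<and> d divides\<^bsub>K[X]\<^esub> (formal_deriv (Irr K x))
        \<longrightarrow> d \<in> Units (K[X]))"

definition separable_closure :: "'a set \<Rightarrow> 'a set" where
  "separable_closure K = {x \<in> carrier R. separable_over K x}"

definition insep_exponent :: "'a set \<Rightarrow> 'a \<Rightarrow> nat" where
  "insep_exponent S x = (LEAST e. x [^] (characteristic R ^ e) \<in> S)"

definition purely_inseparable :: "'a set \<Rightarrow> bool" where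
  "purely_inseparable S \<longleftrightarrow> (\<forall>x\<in>carrier R. \<exists>e::nat. x [^] (characteristic R ^ e) \<in> S)"

definition normal_element :: "'a set \<Rightarrow> 'a \<Rightarrow> bool" where
  "normal_element S x \<longleftrightarrow> x \<in> carrier R \<and>
     (\<forall>y\<in>carrier R. insep_exponent S y \<le> insep_exponent S x)"

text \<open>\<open>partial_gen S xs i\<close> is \<open>S(x\<^sub>1, \<dots>, x\<^sub>i)\<close>; the list entry \<open>xs ! i\<close> is \<open>x\<^sub>i\<^sub>+\<^sub>1\<close>.\<close>

definition partial_gen :: "'a set \<Rightarrow> 'a list \<Rightarrow> nat \<Rightarrow> 'a set" where
  "partial_gen S xs i = generate_field R (S \<union> set (take i xs))"

definition normal_generating_sequence :: "'a set \<Rightarrow> 'a list \<Rightarrow> bool" where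
  "normal_generating_sequence S xs \<longleftrightarrow>
     set xs \<subseteq> carrier R \<and> partial_gen S xs (length xs) = carrier R \<and>
     (\<forall>i<length xs. xs ! i \<notin> partial_gen S xs i \<and>
        normal_element (partial_gen S xs i) (xs ! i))"

definition sequence_type :: "'a set \<Rightarrow> 'a list \<Rightarrow> nat list" where
  "sequence_type S xs =
     map (\<lambda>i. insep_exponent (partial_gen S xs i) (xs ! i)) [0..<length xs]"

definition insep_type :: "'a set \<Rightarrow> nat list \<Rightarrow> bool" where
  "insep_type S es \<longleftrightarrow> subfield S R \<and> finite_dimension S (carrier R) \<and>
     purely_inseparable S \<and>
     (\<exists>xs. normal_generating_sequence S xs \<and> sequence_type S xs = es)"

definition extension_type :: "'a set \<Rightarrow> nat \<Rightarrow> nat list \<Rightarrow> bool" where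
  "extension_type K n es \<longleftrightarrow> finite_dimension K (carrier R) \<and>
     separable_closure K \<noteq> carrier R \<and>
     dimension n K (separable_closure K) \<and> insep_type (separable_closure K) es"

end

text \<open>
  The values \<open>ed(L/K)\<close> for the extensions \<open>L/K\<close> of type \<open>(n, es)\<close> containing the base
  field \<open>k\<close>, where \<open>L\<close> ranges over the fields whose carrier is a subset of the type \<open>'b\<close>;
  \<open>k\<close> is contained in \<open>K\<close> through an arbitrary embedding \<open>\<iota>\<close>.
\<close>

definition ed_values ::
    "'b itself \<Rightarrow> ('a, 'm) ring_scheme \<Rightarrow> nat \<Rightarrow> nat list \<Rightarrow> enat set" where
  "ed_values _ k n es =
     {ring.ess_dim L (\<iota> ` carrier k) K | (L :: 'b ring) K \<iota>.
        field L \<and> subfield K L \<and> \<iota> \<in> ring_hom k L \<and> \<iota> ` carrier k \<subseteq> K \<and>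
        ring.extension_type L K n es}"

text \<open>Only meaningful when the set of values is finite and nonempty.\<close>

definition tau ::
    "'b itself \<Rightarrow> ('a, 'm) ring_scheme \<Rightarrow> nat \<Rightarrow> nat list \<Rightarrow> enat" where
  "tau U k n es = Max (ed_values U k n es)"

end

theory Submission
  imports Defs
begin

text \<open>
  Write \<open>q\<^sub>i = p ^ e\<^sub>i\<close>. Let \<open>x\<^sub>1, \<dots>, x\<^sub>r\<close> be a normal generating sequence of \<open>L/S\<close>. By Pickert's theorem, the
  power of \<open>x\<^sub>i\<close> with exponent \<open>q\<^sub>i\<close> lies in the field generated over \<open>S\<close> by the same powers of
  \<open>x\<^sub>1, \<dots>, x\<^sub>i\<^sub>-\<^sub>1\<close>, and after adding an element of \<open>S\<close> to \<open>x\<^sub>1\<close>, its power \<open>\<theta>\<close> with exponent \<open>q\<^sub>1\<close>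
  generates \<open>S/K\<close>. Hence \<open>L/K\<close> is defined over the field generated by the \<open>n\<close> coefficients of the
  minimal polynomial of \<open>\<theta>\<close> and by the coefficients of the powers of the \<open>x\<^sub>i\<close> (\<open>i > 1\<close>) in monomials in
  \<open>\<theta>\<close> and the powers of \<open>x\<^sub>1, \<dots>, x\<^sub>i\<^sub>-\<^sub>1\<close>. Counting these coefficients gives the upper bound.

  The bound is attained when all coefficients are independent variables over \<open>k\<close>: \<open>L\<close> is then purely
  transcendental over \<open>k\<close>, and \<open>K\<close> is generated by the coefficients. If \<open>L/K\<close> descends to \<open>L\<^sub>0/K\<^sub>0\<close>,
  then all \<open>p\<close>-th powers of elements of \<open>L\<close> lie in the compositum of \<open>L\<^sub>0\<close> and \<open>M = K\<^sub>0 K\<^sup>p\<close>, and so do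
  \<open>\<theta>\<close> and the relevant powers of the \<open>x\<^sub>i\<close>. An \<open>M\<close>-basis of that compositum is a \<open>K\<close>-basis of \<open>L\<close>, so
  the coefficients lie in \<open>M\<close>. Thus \<open>K = K\<^sub>0 K\<^sup>p\<close>; since \<open>K\<close> is finitely generated, it is algebraic
  over \<open>K\<^sub>0\<close>, and \<open>K\<^sub>0\<close> has full transcendence degree.
\<close>

text \<open>The exponents count monomials: after raising to the power q_i, an earlier x_j has degree
  at most p^(e_j - e_i) over its predecessors, and \<theta> contributes the factor n. The first
  generator needs no relation of its own, because its power is \<theta>; the minimal polynomial of
  \<theta> takes that place, so each index contributes one family of coefficients. The obstacle in
  the lower bound is that an unknown K_0 gives no hold on any particular element of L: the field L_0
  may miss all the x_i. Adjoining K^p repairs this for p-th powers only, which suffices since every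
  e_i is at least 1. It also loses nothing: Frobenius carries a basis of K over K_1(t) to p-th
  powers, so if these generated K over K_1(t^p), the degree of K over K_1(t^p) could not exceed that
  over K_1(t), which is impossible for t transcendental over K_1. The generic field is parametrised
  backwards: L is a rational function field in the x_i and in all coefficients except those of the
  trivial monomials, and the latter are solved for.\<close>

section \<open>Linear algebra over subfields\<close>

lemma Pi_subset: "c \<in> A \<rightarrow> B \<Longrightarrow> B \<subseteq> C \<Longrightarrow> c \<in> A \<rightarrow> C"
  by auto

lemma (in ring) subfield_closed:
  assumes "subfield E R"
  shows "E \<subseteq> carrier R" "\<zero> \<in> E" "\<one> \<in> E"
    "\<And>x y. x \<in> E \<Longrightarrow> y \<in> E \<Longrightarrow> x \<oplus> y \<in> E" "\<And>x y. x \<in> E \<Longrightarrow> y \<in> E \<Longrightarrow> x \<otimes> y \<in> E"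
    "\<And>x. x \<in> E \<Longrightarrow> \<ominus> x \<in> E" "\<And>x y. x \<in> E \<Longrightarrow> y \<in> E \<Longrightarrow> x \<ominus> y \<in> E"
  using subringE[OF subfieldE(1)[OF assms]] by (auto simp: a_minus_def)

lemma (in ring) subfield_pow:
  assumes "subfield E R" "x \<in> E" shows "x [^] (n::nat) \<in> E"
  by (induction n) (use subfield_closed[OF assms(1)] assms(2) in auto)

lemma (in ring) subfield_inv:
  assumes "subfield E R" "x \<in> E" "x \<noteq> \<zero>" shows "inv x \<in> E"
  using subfield_m_inv(1)[OF assms(1), of x] assms by auto

lemma (in ring) subfield_finsum:
  assumes "subfield E R" "f \<in> A \<rightarrow> E" shows "finsum R f A \<in> E"
proof -
  have "finite A \<Longrightarrow> f \<in> A \<rightarrow> E \<Longrightarrow> finsum R f A \<in> E"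
  proof (induction A rule: finite_induct)
    case empty thus ?case using subfield_closed[OF assms(1)] by simp
  next
    case (insert a A)
    hence "f \<in> A \<rightarrow> carrier R" "f a \<in> carrier R" using subfield_closed[OF assms(1)] by auto
    thus ?case using insert subfield_closed[OF assms(1)] by (simp add: Pi_iff)
  qed
  thus ?thesis using assms subfield_closed[OF assms(1)]
    by (cases "finite A") (auto simp: finsum_infinite)
qed

section \<open>Fields generated over a subfield\<close>

context field
begin

abbreviation adjoin :: "'a set \<Rightarrow> 'a set \<Rightarrow> 'a set" where
  "adjoin E A \<equiv> generate_field R (E \<union> A)"

lemma adjoin_subfield: "E \<subseteq> carrier R \<Longrightarrow> A \<subseteq> carrier R \<Longrightarrow> subfield (adjoin E A) R"
  by (rule generate_field_is_subfield) auto

lemma adjoin_incl: "E \<subseteq> adjoin E A" "A \<subseteq> adjoin E A"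
  by (auto intro: generate_field.incl)

lemma adjoin_least:
  assumes "subfield E' R" "E \<subseteq> E'" "A \<subseteq> E'" shows "adjoin E A \<subseteq> E'"
proof (rule generate_field_min_subfield1)
  show "E \<union> A \<subseteq> carrier R" "E \<union> A \<subseteq> E'"
    using assms(2,3) subfield_closed(1)[OF assms(1)] by auto
qed (rule assms(1))

lemma adjoin_mono:
  assumes "E \<subseteq> E'" "A \<subseteq> A'" "E' \<subseteq> carrier R" "A' \<subseteq> carrier R"
  shows "adjoin E A \<subseteq> adjoin E' A'"
  by (rule mono_generate_field) (use assms in auto)

lemma adjoin_adjoin:
  assumes "E \<subseteq> carrier R" "A \<subseteq> carrier R" "Y \<subseteq> carrier R"
  shows "adjoin (adjoin E A) Y = adjoin E (A \<union> Y)"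
proof
  have sf: "subfield (adjoin E A) R" "subfield (adjoin E (A \<union> Y)) R"
    "subfield (adjoin (adjoin E A) Y) R"
    using assms adjoin_subfield[of E A] adjoin_subfield[of E "A \<union> Y"]
      adjoin_subfield[of "adjoin E A" Y] subfield_closed(1) by auto
  show "adjoin (adjoin E A) Y \<subseteq> adjoin E (A \<union> Y)"
  proof (rule adjoin_least[OF sf(2)])
    show "adjoin E A \<subseteq> adjoin E (A \<union> Y)" by (rule adjoin_mono) (use assms in auto)
    show "Y \<subseteq> adjoin E (A \<union> Y)" using adjoin_incl(2)[of "A \<union> Y" E] by blast
  qed
  show "adjoin E (A \<union> Y) \<subseteq> adjoin (adjoin E A) Y"
  proof (intro adjoin_least[OF sf(3)] Un_least)
    show "E \<subseteq> adjoin (adjoin E A) Y" "A \<subseteq> adjoin (adjoin E A) Y"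
      using subset_trans[OF adjoin_incl(1)[of E A] adjoin_incl(1)]
        subset_trans[OF adjoin_incl(2)[of A E] adjoin_incl(1)] by simp_all
  qed (rule adjoin_incl)
qed

lemma adjoin_id: "subfield E R \<Longrightarrow> A \<subseteq> E \<Longrightarrow> adjoin E A = E"
  using adjoin_least[of E E A] adjoin_incl[of E A] by auto

end


section \<open>Finite families indexed by natural numbers\<close>

definition (in ring) lincomb :: "(nat \<Rightarrow> 'a) \<Rightarrow> (nat \<Rightarrow> 'a) \<Rightarrow> nat \<Rightarrow> 'a" where
  "lincomb c v D = (\<Oplus>i\<in>{..<D}. c i \<otimes> v i)"

definition (in ring) lin_indep :: "'a set \<Rightarrow> (nat \<Rightarrow> 'a) \<Rightarrow> nat \<Rightarrow> bool" where
  "lin_indep E v D \<longleftrightarrow> v \<in> {..<D} \<rightarrow> carrier R \<and>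
     (\<forall>c \<in> {..<D} \<rightarrow> E. lincomb c v D = \<zero> \<longrightarrow> (\<forall>i<D. c i = \<zero>))"

definition (in ring) lin_span :: "'a set \<Rightarrow> (nat \<Rightarrow> 'a) \<Rightarrow> nat \<Rightarrow> 'a set" where
  "lin_span E v D = {lincomb c v D | c. c \<in> {..<D} \<rightarrow> E}"

context ring
begin

declare Span.simps [simp del]

lemma lincomb_0 [simp]: "lincomb c v 0 = \<zero>"
  by (simp add: lincomb_def)

lemma lincomb_Suc:
  assumes "c \<in> {..<Suc D} \<rightarrow> carrier R" "v \<in> {..<Suc D} \<rightarrow> carrier R"
  shows "lincomb c v (Suc D) = c D \<otimes> v D \<oplus> lincomb c v D"
proof -
  have "(\<lambda>i. c i \<otimes> v i) \<in> {..<D} \<rightarrow> carrier R" "c D \<otimes> v D \<in> carrier R"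
    using assms by (auto simp: Pi_iff)
  thus ?thesis unfolding lincomb_def lessThan_Suc by (subst finsum_insert) auto
qed

lemma lincomb_closed [intro]:
  assumes "c \<in> {..<D} \<rightarrow> carrier R" "v \<in> {..<D} \<rightarrow> carrier R"
  shows "lincomb c v D \<in> carrier R"
  unfolding lincomb_def by (intro finsum_closed) (use assms in auto)

lemma lincomb_cong:
  assumes "\<And>i. i < D \<Longrightarrow> c i = c' i" "\<And>i. i < D \<Longrightarrow> v i = v' i"
    "c' \<in> {..<D} \<rightarrow> carrier R" "v' \<in> {..<D} \<rightarrow> carrier R"
  shows "lincomb c v D = lincomb c' v' D"
  unfolding lincomb_def by (rule finsum_cong') (use assms in auto)

text \<open>Bridge to the list-based \<open>combine\<close>, \<open>Span\<close> and
  \<open>independent\<close>: dimension theory is imported through lists, whereas families indexed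
  by numbers can be split, regrouped and swapped by arithmetic on the index.\<close>

lemma combine_eq_lincomb:
  assumes "c \<in> {..<D} \<rightarrow> carrier R" "v \<in> {..<D} \<rightarrow> carrier R"
  shows "combine (map c [0..<D]) (map v [0..<D]) = lincomb c v D"
  using assms
proof (induction D)
  case (Suc D)
  have s: "set (map c [0..<D]) \<subseteq> carrier R" "set (map v [0..<D]) \<subseteq> carrier R"
    "set [c D] \<subseteq> carrier R" "set [v D] \<subseteq> carrier R"
    using Suc.prems by (auto simp: Pi_iff)
  have "combine (map c [0..<Suc D]) (map v [0..<Suc D]) =
    combine (map c [0..<D]) (map v [0..<D]) \<oplus> combine [c D] [v D]"
    using combine_append[OF _ s(1,2) s(3,4)] by simp
  also have "\<dots> = lincomb c v D \<oplus> c D \<otimes> v D" using Suc by (simp add: Pi_iff)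
  also have "\<dots> = lincomb c v (Suc D)"
    using Suc.prems lincomb_closed[of c D v] by (subst lincomb_Suc) (auto simp: Pi_iff a_comm)
  finally show ?case .
qed simp

lemma lin_span_eq_Span:
  assumes "subfield E R" "v \<in> {..<D} \<rightarrow> carrier R"
  shows "lin_span E v D = Span E (map v [0..<D])"
proof -
  have s: "set (map v [0..<D]) \<subseteq> carrier R" using assms by auto
  have Ec: "E \<subseteq> carrier R" using subfield_closed[OF assms(1)] by auto
  show ?thesis
  proof (intro subset_antisym subsetI)
    fix x assume "x \<in> lin_span E v D"
    then obtain c where c: "c \<in> {..<D} \<rightarrow> E" "x = lincomb c v D" by (auto simp: lin_span_def)
    hence "x = combine (map c [0..<D]) (map v [0..<D])"
      using combine_eq_lincomb[OF Pi_subset[OF c(1) Ec] assms(2)] by simp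
    moreover have "set (map c [0..<D]) \<subseteq> E" using c by auto
    ultimately show "x \<in> Span E (map v [0..<D])"
      unfolding Span_eq_combine_set[OF assms(1) s] by blast
  next
    fix x assume "x \<in> Span E (map v [0..<D])"
    then obtain Ks where K: "set Ks \<subseteq> E" "length Ks = D" "x = combine Ks (map v [0..<D])"
      unfolding Span_eq_combine_set_length_version[OF assms(1) s] by auto
    have "Ks = map (\<lambda>i. Ks ! i) [0..<D]" using K(2) map_nth[of Ks] by simp
    moreover have c: "(\<lambda>i. Ks ! i) \<in> {..<D} \<rightarrow> E"
        using K by (auto simp: subset_iff)
    ultimately have "x = lincomb (\<lambda>i. Ks ! i) v D"
      using combine_eq_lincomb[OF Pi_subset[OF _ Ec] assms(2)] K by metis
    thus "x \<in> lin_span E v D" unfolding lin_span_def using c by blast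
  qed
qed

lemma lin_indep_iff_independent:
  assumes "subfield E R" "v \<in> {..<D} \<rightarrow> carrier R"
  shows "lin_indep E v D \<longleftrightarrow> independent E (map v [0..<D])"
proof -
  have s: "set (map v [0..<D]) \<subseteq> carrier R" using assms by auto
  have Ec: "E \<subseteq> carrier R" using subfield_closed[OF assms(1)] by auto
  show ?thesis
  proof
    assume L: "lin_indep E v D"
    show "independent E (map v [0..<D])"
    proof (rule ccontr)
      assume "\<not> ?thesis"
      then obtain Ks where K: "length Ks = length (map v [0..<D])"
        "combine Ks (map v [0..<D]) = \<zero>" "set Ks \<subseteq> E" "set Ks \<noteq> {\<zero>}"
        using dependent_imp_non_trivial_combine[OF assms(1) s] by metis
      have "Ks = map (\<lambda>i. Ks ! i) [0..<D]" using K(1) map_nth[of Ks] by simp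
      moreover have c: "(\<lambda>i. Ks ! i) \<in> {..<D} \<rightarrow> E"
        using K by (auto simp: subset_iff)
      ultimately have "lincomb (\<lambda>i. Ks ! i) v D = \<zero>"
        using combine_eq_lincomb[OF Pi_subset[OF _ Ec] assms(2)] K by metis
      hence z: "\<forall>i<D. Ks ! i = \<zero>" using L c unfolding lin_indep_def by blast
      hence "set Ks \<subseteq> {\<zero>}" using K(1) by (auto simp: in_set_conv_nth)
      moreover have "D \<noteq> 0"
        using \<open>\<not> independent E (map v [0..<D])\<close> by (metis li_Nil list.map(1) upt_0)
      ultimately show False using K by (cases Ks) auto
    qed
  next
    assume I: "independent E (map v [0..<D])"
    show "lin_indep E v D" unfolding lin_indep_def
    proof (intro conjI ballI impI allI assms(2))
      fix c i assume c: "c \<in> {..<D} \<rightarrow> E" "lincomb c v D = \<zero>" and i: "i < D"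
      have "combine (map c [0..<D]) (map v [0..<D]) = \<zero>"
        using combine_eq_lincomb[OF Pi_subset[OF c(1) Ec] assms(2)] c(2) by simp
      moreover have "set (map c [0..<D]) \<subseteq> E" using c by auto
      ultimately have "set (take (length (map v [0..<D])) (map c [0..<D])) \<subseteq> {\<zero>}"
        using independent_imp_trivial_combine[OF assms(1) I] by blast
      thus "c i = \<zero>" using i by (auto simp: image_subset_iff)
    qed
  qed
qed

lemma lin_indep_carrier: "lin_indep E v D \<Longrightarrow> v \<in> {..<D} \<rightarrow> carrier R"
  by (simp add: lin_indep_def)

lemma lin_indepD:
  "lin_indep E v D \<Longrightarrow> c \<in> {..<D} \<rightarrow> E \<Longrightarrow> lincomb c v D = \<zero> \<Longrightarrow> i < D \<Longrightarrow> c i = \<zero>"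
  by (simp add: lin_indep_def)

lemma lin_indep_mono:
  assumes "lin_indep E v D" "E' \<subseteq> E" shows "lin_indep E' v D"
  using assms unfolding lin_indep_def by (meson Pi_mono subset_iff PiE Pi_I)

lemma lin_indep_dimension:
  assumes "subfield E R" "lin_indep E v D"
  shows "dimension D E (lin_span E v D)"
  using dimension_independent[of E "map v [0..<D]"] lin_indep_iff_independent[OF assms(1)]
    lin_span_eq_Span[OF assms(1)] lin_indep_carrier[OF assms(2)] assms(2) by auto

text \<open>The final disjunction records that a dependent list spans a space of dimension less than
  its length. A spanning family with as many members as the dimension is therefore independent,
  which is how several bases below are recognised.\<close>

lemma Span_dimension_le:
  assumes "subfield E R" "set Us \<subseteq> carrier R"
  shows "\<exists>d\<le>length Us. dimension d E (Span E Us) \<and> (independent E Us \<or> d < length Us)"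
  using assms(2)
proof (induction Us)
  case Nil thus ?case by (simp add: Span.simps)
next
  case (Cons u Us)
  then obtain d where d: "d \<le> length Us" "dimension d E (Span E Us)" "independent E Us \<or> d < length Us" by auto
  show ?case
  proof (cases "u \<in> Span E Us")
    case True
    hence "set (u # Us) \<subseteq> Span E Us" using Span_base_incl[OF assms(1)] Cons.prems by auto
    hence "Span E (u # Us) = Span E Us"
      using mono_Span_subset[OF assms(1), of "u # Us" Us] mono_Span[OF assms(1), of Us u] Cons.prems
      by auto
    thus ?thesis using d by (intro exI[of _ d]) simp
  next
    case False
    hence "dimension (Suc d) E (Span E (u # Us))" using Suc_dim[of u "Span E Us"] d Cons.prems
      by (simp add: Span.simps)
    moreover have "independent E Us \<Longrightarrow> independent E (u # Us)" using False Cons.prems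
      by (auto intro: li_Cons)
    ultimately show ?thesis using d by (intro exI[of _ "Suc d"]) auto
  qed
qed

lemma lin_span_dimension_le:
  assumes "subfield E R" "v \<in> {..<D} \<rightarrow> carrier R"
  obtains d where "d \<le> D" "dimension d E (lin_span E v D)" "lin_indep E v D \<or> d < D"
proof -
  have "set (map v [0..<D]) \<subseteq> carrier R" using assms by auto
  from Span_dimension_le[OF assms(1) this] show ?thesis
    using that lin_span_eq_Span[OF assms] lin_indep_iff_independent[OF assms] by auto
qed

lemma dimension_basis:
  assumes "subfield E R" "dimension d E V"
  obtains v where "lin_indep E v d" "lin_span E v d = V"
proof -
  obtain Vs where Vs: "set Vs \<subseteq> carrier R" "independent E Vs" "length Vs = d" "Span E Vs = V"
    using exists_base[OF assms] by auto
  have m: "Vs = map (\<lambda>i. Vs ! i) [0..<d]" using Vs(3) map_nth[of Vs] by simp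
  have "(\<lambda>i. Vs ! i) \<in> {..<d} \<rightarrow> carrier R" using Vs by (auto simp: subset_iff)
  thus ?thesis using that[of "\<lambda>i. Vs ! i"] Vs m
      lin_indep_iff_independent[OF assms(1)] lin_span_eq_Span[OF assms(1)] by metis
qed

lemma lin_indep_le_dimension:
  assumes "subfield E R" "dimension d E V" "lin_indep E v D" "v \<in> {..<D} \<rightarrow> V"
  shows "D \<le> d"
  using independent_length_le_dimension[OF assms(1,2), of "map v [0..<D]"]
    lin_indep_iff_independent[OF assms(1) lin_indep_carrier[OF assms(3)]] assms
  by (auto simp: Pi_iff image_subset_iff)

lemma lin_indep_eq_dimension:
  assumes "subfield E R" "dimension D E V" "lin_indep E v D" "v \<in> {..<D} \<rightarrow> V"
  shows "lin_span E v D = V"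
  using independent_length_eq_dimension[OF assms(1,2), of "map v [0..<D]"]
    lin_indep_iff_independent[OF assms(1) lin_indep_carrier[OF assms(3)]]
    lin_span_eq_Span[OF assms(1) lin_indep_carrier[OF assms(3)]] assms
  by (auto simp: Pi_iff image_subset_iff)

lemma lin_span_indep:
  assumes "subfield E R" "dimension d E (lin_span E v D)" "D \<le> d" "v \<in> {..<D} \<rightarrow> carrier R"
  shows "lin_indep E v D" "D = d"
proof -
  obtain d' where d': "d' \<le> D" "dimension d' E (lin_span E v D)" "lin_indep E v D \<or> d' < D"
    using lin_span_dimension_le[OF assms(1,4)] .
  have "d' = d" using dimension_is_inj[OF assms(1)] d' assms by blast
  thus "lin_indep E v D" "D = d" using d' assms by auto
qed

text \<open>Induction for spans. A typical \<open>W\<close> consists of the elements whose product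
  with a fixed element falls into a prescribed span.\<close>

lemma lin_span_minimal:
  assumes "\<zero> \<in> W" "\<And>x y. x \<in> W \<Longrightarrow> y \<in> W \<Longrightarrow> x \<oplus> y \<in> W"
    "\<And>c i. c \<in> E \<Longrightarrow> i < D \<Longrightarrow> c \<otimes> v i \<in> W" "E \<subseteq> carrier R" "v \<in> {..<D} \<rightarrow> carrier R"
  shows "lin_span E v D \<subseteq> W"
proof -
  have "lincomb c v D \<in> W" if "c \<in> {..<D} \<rightarrow> E" for c
  proof -
    have "n \<le> D \<Longrightarrow> lincomb c v n \<in> W" for n
    proof (induction n)
      case (Suc n)
      have "c \<in> {..<Suc n} \<rightarrow> carrier R" "v \<in> {..<Suc n} \<rightarrow> carrier R"
        using that Suc assms by (auto simp: Pi_iff subset_iff)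
      thus ?case using Suc assms that by (subst lincomb_Suc) (auto simp: Pi_iff)
    qed (use assms in simp)
    thus ?thesis by simp
  qed
  thus ?thesis by (auto simp: lin_span_def)
qed

lemma lin_span_closed:
  assumes "subfield E R" "v \<in> {..<D} \<rightarrow> carrier R"
  shows "lin_span E v D \<subseteq> carrier R" "\<zero> \<in> lin_span E v D"
    "\<And>x y. x \<in> lin_span E v D \<Longrightarrow> y \<in> lin_span E v D \<Longrightarrow> x \<oplus> y \<in> lin_span E v D"
    "\<And>x. x \<in> lin_span E v D \<Longrightarrow> \<ominus> x \<in> lin_span E v D"
    "\<And>c x. c \<in> E \<Longrightarrow> x \<in> lin_span E v D \<Longrightarrow> c \<otimes> x \<in> lin_span E v D"
    "\<And>i. i < D \<Longrightarrow> v i \<in> lin_span E v D"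
proof -
  have s: "set (map v [0..<D]) \<subseteq> carrier R" using assms by auto
  note e = lin_span_eq_Span[OF assms]
  show "lin_span E v D \<subseteq> carrier R" "\<zero> \<in> lin_span E v D"
    "\<And>x y. x \<in> lin_span E v D \<Longrightarrow> y \<in> lin_span E v D \<Longrightarrow> x \<oplus> y \<in> lin_span E v D"
    "\<And>x. x \<in> lin_span E v D \<Longrightarrow> \<ominus> x \<in> lin_span E v D"
    "\<And>c x. c \<in> E \<Longrightarrow> x \<in> lin_span E v D \<Longrightarrow> c \<otimes> x \<in> lin_span E v D"
    "\<And>i. i < D \<Longrightarrow> v i \<in> lin_span E v D"
    unfolding e using Span_subgroup_props[OF assms(1) s] Span_smult_closed[OF assms(1) s]
      Span_base_incl[OF assms(1) s] by (auto simp: image_subset_iff)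
qed

lemma lin_span_mono:
  assumes "E \<subseteq> E'" shows "lin_span E v D \<subseteq> lin_span E' v D"
  unfolding lin_span_def using assms by (simp add: Pi_iff) blast

lemma dimension_oneD:
  assumes "subfield E R" "subfield V R" "E \<subseteq> V" "dimension d E V" "d \<le> 1"
  shows "V = E"
proof -
  have o: "\<one> \<in> E" "\<one> \<noteq> \<zero>" using subfield_closed[OF assms(1)] subfieldE(6)[OF assms(1)] by auto
  have "d \<noteq> 0"
  proof
    assume "d = 0"
    hence "V = {\<zero>}" using dimension_zero[OF assms(1)] assms(4) by simp
    thus False using o assms(3) by auto
  qed
  hence "d = 1" using assms by simp
  have i: "independent E [\<one>]" using o by (auto intro!: li_Cons simp: Span.simps)
  have "Span E [\<one>] = V"
    using independent_length_eq_dimension[OF assms(1,4) i] o assms \<open>d = 1\<close> by auto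
  moreover have "Span E [\<one>] = E"
    using independent_length_eq_dimension[OF assms(1) dimension_one[OF assms(1)] i] o by auto
  ultimately show ?thesis by simp
qed

end

section \<open>Spans that are fields\<close>

context field
begin

text \<open>The inverse of \<open>x\<close> already lies in \<open>simple_extension E x\<close>,
  which is a field because finite dimension makes \<open>x\<close> algebraic.\<close>

lemma finite_dimension_subring_is_subfield:
  assumes "subfield E R" "subring V R" "E \<subseteq> V" "finite_dimension E V"
  shows "subfield V R"
proof (rule subfieldI'[OF assms(2)])
  fix x assume x: "x \<in> V - {\<zero>}"
  have xc: "x \<in> carrier R" using x subringE(1)[OF assms(2)] by auto
  have "algebraic E x" using finite_dimension_imp_algebraic[OF assms(1,2,4)] x by (simp add: over_def)
  hence sf: "subfield (simple_extension E x) R"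
    using simple_extension_is_subfield[OF assms(1) xc] by (simp add: over_def)
  have "x \<in> simple_extension E x"
    using simple_extension_mem[OF subfieldE(1)[OF assms(1)] xc] .
  hence "inv x \<in> simple_extension E x" using subfield_inv[OF sf] x by auto
  thus "inv x \<in> V" using simple_extension_subring_incl[OF assms(2,3)] x by auto
qed

text \<open>Multiplicative closure passes from the family to its span by linearity, first in the
  left factor and then in the right one; inverses come from finite dimension.\<close>

lemma lin_span_subfield:
  assumes "subfield E R" "v \<in> {..<D} \<rightarrow> carrier R" "\<one> \<in> lin_span E v D"
    "\<And>i j. i < D \<Longrightarrow> j < D \<Longrightarrow> v i \<otimes> v j \<in> lin_span E v D"
  shows "subfield (lin_span E v D) R" "E \<subseteq> lin_span E v D"
proof -
  let ?V = "lin_span E v D"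
  note Ec = subfield_closed(1)[OF assms(1)]
  note c = lin_span_closed[OF assms(1,2)]
  have vc: "v i \<in> carrier R" if "i < D" for i using that assms by auto
  show inc: "E \<subseteq> ?V"
  proof
    fix x assume "x \<in> E"
    thus "x \<in> ?V" using c(5)[of x \<one>] assms(3) Ec by auto
  qed
  have 1: "x \<otimes> v j \<in> ?V" if x: "x \<in> ?V" and j: "j < D" for x j
  proof -
    have "?V \<subseteq> {x \<in> carrier R. x \<otimes> v j \<in> ?V}"
    proof (rule lin_span_minimal)
      show "c \<otimes> v i \<in> {x \<in> carrier R. x \<otimes> v j \<in> ?V}" if "c \<in> E" "i < D" for c i
      proof -
        have "c \<otimes> v i \<otimes> v j = c \<otimes> (v i \<otimes> v j)" using that vc j Ec by (auto intro: m_assoc)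
        thus ?thesis using that vc j Ec assms(4) c(5) by auto
      qed
    qed (use c vc j assms(2) Ec in \<open>auto simp: l_distr\<close>)
    thus ?thesis using x by auto
  qed
  have 2: "x \<otimes> y \<in> ?V" if x: "x \<in> ?V" and y: "y \<in> ?V" for x y
  proof -
    have xc: "x \<in> carrier R" using x c by auto
    have "?V \<subseteq> {y \<in> carrier R. x \<otimes> y \<in> ?V}"
    proof (rule lin_span_minimal)
      show "e \<otimes> v i \<in> {y \<in> carrier R. x \<otimes> y \<in> ?V}" if "e \<in> E" "i < D" for e i
      proof -
        have "x \<otimes> (e \<otimes> v i) = e \<otimes> (x \<otimes> v i)"
          using that vc xc Ec by (metis m_lcomm subsetD)
        thus ?thesis using that vc xc Ec 1[OF x] c(5) by auto
      qed
    qed (use c xc assms(2) Ec in \<open>auto simp: r_distr\<close>)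
    thus ?thesis using y by auto
  qed
  have sr: "subring ?V R"
    by (rule subringI) (auto intro: c(1,3,4) 2 assms(3) simp: subsetD[OF c(1)])
  obtain d where "dimension d E ?V" using lin_span_dimension_le[OF assms(1,2)] by metis
  thus "subfield ?V R"
    using finite_dimension_subring_is_subfield[OF assms(1) sr inc] finite_dimensionI by blast
qed

end

section \<open>The Frobenius endomorphism\<close>

lemma (in cring) binomial_theorem:
  assumes x: "x \<in> carrier R" and y: "y \<in> carrier R"
  shows "(x \<oplus> y) [^] n = (\<Oplus>k\<in>{..n}. [(n choose k)] \<cdot> (x [^] k \<otimes> y [^] (n - k)))"
proof (induction n)
  case 0 thus ?case using x y by (simp add: add.nat_pow_eone)
next
  case (Suc n)
  let ?f = "\<lambda>k. [(n choose k)] \<cdot> (x [^] k \<otimes> y [^] (n - k))"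
  let ?g = "\<lambda>k. [(n choose k)] \<cdot> (x [^] k \<otimes> y [^] (Suc n - k))"
  let ?h = "\<lambda>k. [(Suc n choose k)] \<cdot> (x [^] k \<otimes> y [^] (Suc n - k))"
  have mon: "x [^] (k::nat) \<otimes> y [^] (l::nat) \<in> carrier R" for k l using x y by simp
  have cl: "[m] \<cdot> (x [^] (k::nat) \<otimes> y [^] (l::nat)) \<in> carrier R" for k l m :: nat
    using mon add.nat_pow_closed by blast
  have f: "?f \<in> {..n} \<rightarrow> carrier R" and F: "finsum R ?f {..n} \<in> carrier R"
    using cl by (auto intro!: finsum_closed)
  have xS: "finsum R ?f {..n} \<otimes> x = (\<Oplus>k\<in>{..n}. [(n choose k)] \<cdot> (x [^] Suc k \<otimes> y [^] (n - k)))"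
    using x y cl by (subst finsum_ldistr)
      (auto intro!: finsum_cong' simp: add_pow_ldistr add_pow_rdistr m_ac)
  have yS: "finsum R ?f {..n} \<otimes> y = finsum R ?g {..n}"
    using x y cl by (subst finsum_ldistr)
      (auto intro!: finsum_cong' simp: add_pow_ldistr add_pow_rdistr m_ac Suc_diff_le)
  have "finsum R ?g {..Suc n} = ?g (Suc n) \<oplus> finsum R ?g {..n}"
    using cl by (subst finsum_Suc) (auto intro!: a_comm finsum_closed)
  also have "\<dots> = finsum R ?g {..n}"
  proof -
    have "?g (Suc n) = \<zero>" by (simp add: binomial_eq_0)
    thus ?thesis using cl by (simp only: l_zero finsum_closed Pi_iff) (intro l_zero finsum_closed, blast)
  qed
  finally have g1: "finsum R ?f {..n} \<otimes> y = finsum R ?g {..Suc n}" using yS by simp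
  also have "\<dots> = (\<Oplus>k\<in>{..n}. ?g (Suc k)) \<oplus> ?g 0"
    using x y by (subst finsum_Suc2) auto
  finally have yS': "finsum R ?f {..n} \<otimes> y = (\<Oplus>k\<in>{..n}. ?g (Suc k)) \<oplus> ?g 0" .
  have G: "(\<Oplus>k\<in>{..n}. ?g (Suc k)) \<in> carrier R" using x y by (intro finsum_closed) auto
  have A: "(\<Oplus>k\<in>{..n}. [(n choose k)] \<cdot> (x [^] Suc k \<otimes> y [^] (n - k))) \<in> carrier R"
    using cl by (intro finsum_closed) blast
  have "finsum R ?h {..Suc n} = (\<Oplus>k\<in>{..n}. ?h (Suc k)) \<oplus> ?h 0"
    using x y by (subst finsum_Suc2) auto
  also have "(\<Oplus>k\<in>{..n}. ?h (Suc k)) =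
    (\<Oplus>k\<in>{..n}. [(n choose k)] \<cdot> (x [^] Suc k \<otimes> y [^] (n - k)) \<oplus> ?g (Suc k))"
    using x y by (intro finsum_cong') (auto simp: add.nat_pow_mult)
  also have "\<dots> = (\<Oplus>k\<in>{..n}. [(n choose k)] \<cdot> (x [^] Suc k \<otimes> y [^] (n - k))) \<oplus>
      (\<Oplus>k\<in>{..n}. ?g (Suc k))"
    using cl by (intro finsum_addf) blast+
  finally have "finsum R ?h {..Suc n} = finsum R ?f {..n} \<otimes> x \<oplus> finsum R ?f {..n} \<otimes> y"
    using G A cl x y unfolding xS yS' by (simp add: a_assoc)
  also have "\<dots> = (x \<oplus> y) [^] Suc n" using Suc F x y by (simp add: r_distr)
  finally show ?case by simp
qed

lemma (in cring) add_pow_multiple_zero: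
  assumes "[p] \<cdot> \<one> = \<zero>" "p dvd (m::nat)" "z \<in> carrier R" shows "[m] \<cdot> z = \<zero>"
proof -
  obtain j where j: "m = p * j" using assms(2) by auto
  have "[p] \<cdot> z = \<zero>" using add_pow_ldistr[of \<one> z p] assms by simp
  hence "[j] \<cdot> ([p] \<cdot> z) = \<zero>" by (simp add: add.nat_pow_one)
  thus ?thesis using add.nat_pow_pow[OF assms(3), of j p] j by (simp add: mult.commute)
qed

lemma (in cring) frobenius_add:
  assumes p: "Factorial_Ring.prime (p::nat)" "[p] \<cdot> \<one> = \<zero>" and x: "x \<in> carrier R" and y: "y \<in> carrier R"
  shows "(x \<oplus> y) [^] p = x [^] p \<oplus> y [^] p"
proof -
  let ?f = "\<lambda>k. [(p choose k)] \<cdot> (x [^] k \<otimes> y [^] (p - k))"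
  have p0: "0 < p" using p(1) prime_gt_0_nat by blast
  have cl: "?f k \<in> carrier R" for k using x y by simp
  have "(x \<oplus> y) [^] p = finsum R ?f {..p}" by (rule binomial_theorem[OF x y])
  also have "\<dots> = finsum R ?f {0, p}"
  proof (rule add.finprod_mono_neutral_cong_right)
    show "?f i = \<zero>" if i: "i \<in> {..p} - {0, p}" for i
    proof -
      have "p dvd (p choose i)" using p(1) i by (intro dvd_choose_prime) auto
      thus "?f i = \<zero>" using add_pow_multiple_zero[OF p(2)] x y by simp
    qed
  qed (use cl p0 in auto)
  also have "\<dots> = ?f 0 \<oplus> ?f p"
  proof -
    have "finsum R ?f {0, p} = ?f 0 \<oplus> finsum R ?f {p}"
      by (rule finsum_insert) (use p0 x y in auto)
    moreover have "finsum R ?f {p} = ?f p \<oplus> finsum R ?f {}"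
      by (rule finsum_insert) (use x y in auto)
    ultimately show ?thesis using cl[of p] by (simp only: finsum_empty r_zero)
  qed
  also have "\<dots> = x [^] p \<oplus> y [^] p" using x y by (simp add: a_comm)
  finally show ?thesis .
qed

lemma (in field) pow_eq_zero: "x \<in> carrier R \<Longrightarrow> x [^] (n::nat) = \<zero> \<Longrightarrow> x = \<zero>"
  by (induction n) (auto simp: integral_iff)

section \<open>Frobenius on fields of characteristic p\<close>

locale char_p_field = field R for R (structure) +
  fixes p :: nat
  assumes characteristic_eq: "characteristic R = p" and p_pos: "0 < p"
begin

lemma char_one: "[p] \<cdot> \<one> = \<zero>" and char_min: "0 < m \<Longrightarrow> m < p \<Longrightarrow> [(m::nat)] \<cdot> \<one> \<noteq> \<zero>"
proof -
  let ?P = "\<lambda>m::nat. m > 0 \<and> [m] \<cdot> \<one> = \<zero>"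
  have ex: "\<exists>m. ?P m" and L: "p = Least ?P"
    using characteristic_eq p_pos unfolding characteristic_def by (auto split: if_splits)
  show "[p] \<cdot> \<one> = \<zero>" using LeastI_ex[OF ex] unfolding L by simp
  show "0 < m \<Longrightarrow> m < p \<Longrightarrow> [m] \<cdot> \<one> \<noteq> \<zero>" using not_less_Least[of m ?P] unfolding L by simp
qed

lemma prime_p: "Factorial_Ring.prime p"
proof -
  have "p \<noteq> 1" using char_one one_not_zero by (auto simp: add.nat_pow_eone)
  moreover have "a = 1 \<or> a = p" if a: "a dvd p" for a
  proof -
    obtain b where b: "p = a * b" using a by auto
    hence ab: "a > 0" "b > 0" using p_pos by (metis bot_nat_0.not_eq_extremum mult_0 mult_0_right)+
    have "([a] \<cdot> \<one>) \<otimes> ([b] \<cdot> \<one>) = [p] \<cdot> \<one>"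
      unfolding b by (simp add: add_pow_ldistr add.nat_pow_pow mult.commute)
    hence "[a] \<cdot> \<one> = \<zero> \<or> [b] \<cdot> \<one> = \<zero>" using char_one integral by simp
    hence "\<not> a < p \<or> \<not> b < p" using char_min ab by blast
    thus ?thesis using b ab p_pos
      by (metis One_nat_def Suc_lessI mult.commute mult.right_neutral n_less_n_mult_m not_less_iff_gr_or_eq)
  qed
  ultimately show ?thesis using p_pos by (auto simp: prime_nat_iff)
qed

lemma p_gt_1: "1 < p" using prime_p prime_gt_1_nat by blast

lemma frob_zero: "\<zero> [^] (p ^ e) = \<zero>"
  using p_pos by (intro nat_pow_zero) auto

lemma frob_add:
  assumes "x \<in> carrier R" "y \<in> carrier R"
  shows "(x \<oplus> y) [^] (p ^ e) = x [^] (p ^ e) \<oplus> y [^] (p ^ e)"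
proof (induction e)
  case (Suc e)
  have e: "z [^] (p ^ Suc e) = (z [^] (p ^ e)) [^] p" if "z \<in> carrier R" for z
    using that by (simp add: nat_pow_pow mult.commute)
  show ?case using assms Suc frobenius_add[OF prime_p char_one] by (simp add: e del: power_Suc)
qed (use assms in \<open>simp add: nat_pow_eone\<close>)

lemma frob_mult:
  assumes "x \<in> carrier R" "y \<in> carrier R"
  shows "(x \<otimes> y) [^] (p ^ e) = x [^] (p ^ e) \<otimes> y [^] (p ^ e)"
  using nat_pow_distrib assms by blast

lemma frob_minus:
  assumes "x \<in> carrier R" shows "(\<ominus> x) [^] (p ^ e) = \<ominus> (x [^] (p ^ e))"
proof -
  have "(\<ominus> x) [^] (p ^ e) \<oplus> x [^] (p ^ e) = \<zero>"
    using frob_add[of "\<ominus> x" x e] assms frob_zero by (simp add: l_neg)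
  thus ?thesis using assms minus_equality[of "(\<ominus> x) [^] (p ^ e)" "x [^] (p ^ e)"] by simp
qed

lemma frob_inv:
  assumes "x \<in> carrier R" "x \<noteq> \<zero>" shows "(inv x) [^] (n::nat) = inv (x [^] n)"
proof -
  have u: "x \<in> Units R" "x [^] n \<in> Units R"
    using assms pow_eq_zero[of x n] by (auto simp: field_Units)
  have "(inv x) [^] n \<otimes> x [^] n = \<one>"
    using u assms(1) nat_pow_distrib[of "inv x" x n] by (simp add: Units_l_inv)
  thus ?thesis using u by (metis Units_inv_closed inv_char nat_pow_closed m_comm Units_closed)
qed

lemma frob_inj:
  assumes "x \<in> carrier R" "y \<in> carrier R" "x [^] (p ^ e) = y [^] (p ^ e)" shows "x = y"
proof -
  have "(x \<ominus> y) [^] (p ^ e) = \<zero>"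
    using frob_add[of x "\<ominus> y" e] assms by (simp add: a_minus_def frob_minus r_neg)
  hence "x \<ominus> y = \<zero>" using pow_eq_zero assms by blast
  thus ?thesis using assms by simp
qed

lemma frob_lincomb:
  assumes "c \<in> {..<D} \<rightarrow> carrier R" "v \<in> {..<D} \<rightarrow> carrier R"
  shows "(lincomb c v D) [^] (p ^ e) = lincomb (\<lambda>i. c i [^] (p ^ e)) (\<lambda>i. v i [^] (p ^ e)) D"
  using assms
proof (induction D)
  case (Suc D)
  have "lincomb c v D \<in> carrier R" using Suc.prems by (intro lincomb_closed) (auto simp: Pi_iff)
  moreover have "c \<in> {..<D} \<rightarrow> carrier R" "v \<in> {..<D} \<rightarrow> carrier R" "c D \<in> carrier R" "v D \<in> carrier R"
    using Suc.prems by (auto simp: Pi_iff)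
  ultimately show ?case
    using Suc by (simp add: lincomb_Suc frob_add frob_mult Pi_iff)
qed (simp add: frob_zero)

text \<open>Reduces the claim that all p^e-th powers of a field lie in \<open>E\<close> to a check
  on generators; \<open>frob_adjoin\<close> is this use.\<close>

lemma frob_vimage_subfield:
  assumes "subfield E R" shows "subfield {y \<in> carrier R. y [^] (p ^ e) \<in> E} R"
proof (rule subfieldI'[OF subringI])
  show "inv k \<in> {y \<in> carrier R. y [^] (p ^ e) \<in> E}"
    if k: "k \<in> {y \<in> carrier R. y [^] (p ^ e) \<in> E} - {\<zero>}" for k
  proof -
    have "k [^] (p ^ e) \<noteq> \<zero>" using pow_eq_zero k by auto
    thus ?thesis using k subfield_inv[OF assms, of "k [^] (p ^ e)"] frob_inv[of k "p ^ e"]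
      by (auto simp: field_Units)
  qed
qed (use subfield_closed[OF assms] in \<open>auto simp: frob_add frob_mult frob_minus\<close>)

lemma frob_adjoin:
  assumes "subfield E R" "E' \<subseteq> carrier R" "A \<subseteq> carrier R"
    "\<And>x. x \<in> E' \<Longrightarrow> x [^] (p ^ e) \<in> E" "\<And>x. x \<in> A \<Longrightarrow> x [^] (p ^ e) \<in> E" "y \<in> adjoin E' A"
  shows "y [^] (p ^ e) \<in> E"
  using adjoin_least[OF frob_vimage_subfield[OF assms(1), of e], of E' A] assms by auto

lemma frob_image_subfield:
  assumes "subfield E R" shows "subfield ((\<lambda>x. x [^] (p ^ e)) ` E) R"
proof -
  let ?f = "\<lambda>x. x [^] (p ^ e)"
  note c = subfield_closed[OF assms]
  show ?thesis
  proof (rule subfieldI'[OF subringI])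
    show "\<one> \<in> ?f ` E" using c by (intro image_eqI[of _ _ \<one>]) auto
    show "\<ominus> h \<in> ?f ` E" if h: "h \<in> ?f ` E" for h
    proof -
      obtain x where x: "x \<in> E" "h = ?f x" using h by auto
      thus ?thesis using c by (intro image_eqI[of _ _ "\<ominus> x"]) (auto simp: frob_minus subsetD)
    qed
    show "h \<otimes> h' \<in> ?f ` E" "h \<oplus> h' \<in> ?f ` E" if hh: "h \<in> ?f ` E" "h' \<in> ?f ` E" for h h'
    proof -
      obtain x x' where x: "x \<in> E" "h = ?f x" "x' \<in> E" "h' = ?f x'" using hh by auto
      show "h \<otimes> h' \<in> ?f ` E" using c x
        by (intro image_eqI[of _ _ "x \<otimes> x'"]) (auto simp: frob_mult subsetD)
      show "h \<oplus> h' \<in> ?f ` E" using c x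
        by (intro image_eqI[of _ _ "x \<oplus> x'"]) (auto simp: frob_add subsetD)
    qed
    show "inv h \<in> ?f ` E" if hh: "h \<in> ?f ` E - {\<zero>}" for h
    proof -
      obtain x where x: "x \<in> E" "h = ?f x" "h \<noteq> \<zero>" using hh by auto
      hence "x \<noteq> \<zero>" using frob_zero by auto
      thus ?thesis using x c subfield_inv[OF assms x(1)]
        by (intro image_eqI[of _ _ "inv x"]) (auto simp: frob_inv subsetD)
    qed
  qed (use c in auto)
qed

text \<open>If \<open>b\<close> spans the field \<open>E'\<close> over \<open>E1\<close>, then its
  Frobenius powers span over \<open>E2\<close> a space that contains the powers of all elements of
  \<open>E'\<close>. In particular it contains those of the products b_i b_j, so it is closed under
  multiplication.\<close>

lemma frob_span_subfield:
  assumes "subfield E1 R" "subfield E2 R" "subfield E' R" "b \<in> {..<D} \<rightarrow> carrier R"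
    "lin_span E1 b D = E'" "\<And>x. x \<in> E1 \<Longrightarrow> x [^] (p ^ e) \<in> E2"
  shows "subfield (lin_span E2 (\<lambda>i. b i [^] (p ^ e)) D) R"
    "E2 \<subseteq> lin_span E2 (\<lambda>i. b i [^] (p ^ e)) D"
    "\<And>x. x \<in> E' \<Longrightarrow> x [^] (p ^ e) \<in> lin_span E2 (\<lambda>i. b i [^] (p ^ e)) D"
proof -
  let ?V = "lin_span E2 (\<lambda>i. b i [^] (p ^ e)) D"
  have bq: "(\<lambda>i. b i [^] (p ^ e)) \<in> {..<D} \<rightarrow> carrier R" using assms(4) by auto
  show fr: "x [^] (p ^ e) \<in> ?V" if xE: "x \<in> E'" for x
  proof -
    obtain c where c: "c \<in> {..<D} \<rightarrow> E1" "x = lincomb c b D"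
      using xE unfolding assms(5)[symmetric] lin_span_def by auto
    have "x [^] (p ^ e) = lincomb (\<lambda>i. c i [^] (p ^ e)) (\<lambda>i. b i [^] (p ^ e)) D"
      unfolding c(2) by (rule frob_lincomb) (use Pi_subset[OF c(1)] subfield_closed(1)[OF assms(1)] assms(4) in auto)
    thus ?thesis unfolding lin_span_def using c(1) assms(6) by (intro CollectI exI conjI) auto
  qed
  have one: "\<one> \<in> ?V" using fr[OF subfield_closed(3)[OF assms(3)]] by simp
  have mul: "b i [^] (p ^ e) \<otimes> b j [^] (p ^ e) \<in> ?V" if "i < D" "j < D" for i j
  proof -
    have "b i \<in> E'" "b j \<in> E'" using lin_span_closed(6)[OF assms(1,4)] that assms(5) by auto
    thus ?thesis using fr[of "b i \<otimes> b j"] subfield_closed[OF assms(3)] by (auto simp: frob_mult subsetD)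
  qed
  show "subfield ?V R" "E2 \<subseteq> ?V" using lin_span_subfield[OF assms(2) bq one mul] by blast+
qed

text \<open>Degree comparison on which both the separability and the transcendence arguments rest.
  For a basis b of \<open>K\<close> over \<open>E1\<close>, the \<open>d\<close> powers b_i^p span
  over \<open>E\<close> a field containing \<open>E\<close> and K^p, hence all of \<open>K\<close>.
  So [K:E] is at most [K:E1], and \<open>E1\<close> has degree 1 over \<open>E\<close>.\<close>

lemma subfield_eq_of_frobenius_span:
  assumes sf: "subfield E R" "subfield E1 R" "subfield K R" and inc: "E \<subseteq> E1" "E1 \<subseteq> K"
    and dim: "dimension d E1 K" "finite_dimension E E1"
    and fr: "\<And>x. x \<in> E1 \<Longrightarrow> x [^] p \<in> E" and gen: "K \<subseteq> adjoin E ((\<lambda>x. x [^] p) ` K)"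
  shows "E1 = E"
proof -
  obtain b where b: "lin_indep E1 b d" "lin_span E1 b d = K" using dimension_basis[OF sf(2) dim(1)] .
  have bc: "b \<in> {..<d} \<rightarrow> carrier R" using b(1) lin_indep_carrier by blast
  have bK: "b i \<in> K" if "i < d" for i using lin_span_closed(6)[OF sf(2) bc] that b(2) by auto
  define V where "V = lin_span E (\<lambda>i. b i [^] p) d"
  have V: "subfield V R" "E \<subseteq> V" "\<And>x. x \<in> K \<Longrightarrow> x [^] p \<in> V"
    using frob_span_subfield[OF sf(2,1,3) bc b(2), of 1] fr unfolding V_def by auto
  have bp: "(\<lambda>i. b i [^] p) \<in> {..<d} \<rightarrow> carrier R" using bc by auto
  have "K \<subseteq> V" using gen adjoin_least[OF V(1,2), of "(\<lambda>x. x [^] p) ` K"] V(3) by auto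
  moreover have "V \<subseteq> K" unfolding V_def
    by (rule lin_span_minimal)
      (use subfield_closed[OF sf(3)] subfield_closed(1)[OF sf(1)] inc bK subfield_pow[OF sf(3)] bp in auto)
  ultimately have "V = K" by auto
  then obtain d' where d': "d' \<le> d" "dimension d' E K"
    using lin_span_dimension_le[OF sf(1) bp] unfolding V_def by metis
  obtain f where f: "dimension f E E1" using dim(2) by (auto simp: finite_dimension_def)
  have "f * d = d'" using dimension_is_inj[OF sf(1) telescopic_base[OF sf(1,2) f dim(1)] d'(2)] .
  moreover have "d \<noteq> 0"
  proof
    assume "d = 0"
    hence "K = {\<zero>}" using dimension_zero[OF sf(2)] dim(1) by simp
    thus False using subfieldE(6)[OF sf(3)] subfield_closed(3)[OF sf(3)] by auto
  qed
  ultimately have "f \<le> 1" using d'(1) by (metis One_nat_def mult_le_cancel2 nat_mult_1 bot_nat_0.not_eq_extremum One_nat_def)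
  thus ?thesis using dimension_oneD[OF sf(1,2) inc(1) f] by blast
qed

end

section \<open>Algebraic elements\<close>

text \<open>The simplifier would otherwise destroy \<open>E \<union> {x}\<close>, the argument of \<open>adjoin E {x}\<close>.\<close>

declare Un_insert_right [simp del]

section \<open>Regrouping linear combinations\<close>

context ring
begin

lemma lincomb_append:
  assumes "c \<in> {..<m + n} \<rightarrow> carrier R" "v \<in> {..<m + n} \<rightarrow> carrier R"
  shows "lincomb c v (m + n) = lincomb c v m \<oplus> lincomb (\<lambda>i. c (m + i)) (\<lambda>i. v (m + i)) n"
  using assms
proof (induction n)
  case 0
  hence "lincomb c v m \<in> carrier R" by (intro lincomb_closed) auto
  thus ?case by simp
next
  case (Suc n)
  have c: "c \<in> {..<m + n} \<rightarrow> carrier R" "v \<in> {..<m + n} \<rightarrow> carrier R"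
    "c \<in> {..<m} \<rightarrow> carrier R" "v \<in> {..<m} \<rightarrow> carrier R"
    "(\<lambda>i. c (m + i)) \<in> {..<n} \<rightarrow> carrier R" "(\<lambda>i. v (m + i)) \<in> {..<n} \<rightarrow> carrier R"
    "c (m + n) \<in> carrier R" "v (m + n) \<in> carrier R"
    using Suc.prems by (auto simp: Pi_iff)
  have "lincomb c v (m + Suc n) = c (m + n) \<otimes> v (m + n) \<oplus> lincomb c v (m + n)"
    using lincomb_Suc[of c "m + n" v] Suc.prems by simp
  also have "lincomb c v (m + n) = lincomb c v m \<oplus> lincomb (\<lambda>i. c (m + i)) (\<lambda>i. v (m + i)) n"
    using Suc.IH c by blast
  also have "c (m + n) \<otimes> v (m + n) \<oplus> \<dots> = lincomb c v m \<oplus>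
      (c (m + n) \<otimes> v (m + n) \<oplus> lincomb (\<lambda>i. c (m + i)) (\<lambda>i. v (m + i)) n)"
    using c lincomb_closed[OF c(3,4)] lincomb_closed[OF c(5,6)] by (simp add: a_lcomm)
  also have "c (m + n) \<otimes> v (m + n) \<oplus> lincomb (\<lambda>i. c (m + i)) (\<lambda>i. v (m + i)) n
      = lincomb (\<lambda>i. c (m + i)) (\<lambda>i. v (m + i)) (Suc n)"
    using Suc.prems by (subst lincomb_Suc) (auto simp: Pi_iff)
  finally show ?case .
qed

lemma lincomb_zero:
  assumes "\<And>i. i < D \<Longrightarrow> c i = \<zero>" "v \<in> {..<D} \<rightarrow> carrier R" shows "lincomb c v D = \<zero>"
  unfolding lincomb_def by (rule add.finprod_one_eqI) (use assms in \<open>auto simp: Pi_iff\<close>)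

lemma lincomb_add:
  assumes "c \<in> {..<D} \<rightarrow> carrier R" "c' \<in> {..<D} \<rightarrow> carrier R" "v \<in> {..<D} \<rightarrow> carrier R"
  shows "lincomb (\<lambda>i. c i \<oplus> c' i) v D = lincomb c v D \<oplus> lincomb c' v D"
proof -
  have "lincomb (\<lambda>i. c i \<oplus> c' i) v D = (\<Oplus>i\<in>{..<D}. c i \<otimes> v i \<oplus> c' i \<otimes> v i)"
    unfolding lincomb_def by (rule finsum_cong') (use assms in \<open>auto simp: l_distr Pi_iff\<close>)
  thus ?thesis unfolding lincomb_def using assms by (subst finsum_addf[symmetric]) (auto simp: Pi_iff)
qed

lemma lincomb_smult:
  assumes "c \<in> {..<D} \<rightarrow> carrier R" "a \<in> carrier R" "v \<in> {..<D} \<rightarrow> carrier R"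
  shows "lincomb (\<lambda>i. a \<otimes> c i) v D = a \<otimes> lincomb c v D"
proof -
  have "lincomb (\<lambda>i. a \<otimes> c i) v D = (\<Oplus>i\<in>{..<D}. a \<otimes> (c i \<otimes> v i))"
    unfolding lincomb_def by (rule finsum_cong') (use assms in \<open>auto simp: m_assoc Pi_iff\<close>)
  thus ?thesis unfolding lincomb_def using assms by (subst finsum_rdistr) (auto simp: Pi_iff)
qed

lemma lincomb_delta:
  assumes "k < D" "a \<in> carrier R" "v \<in> {..<D} \<rightarrow> carrier R"
  shows "lincomb (\<lambda>i. if i = k then a else \<zero>) v D = a \<otimes> v k"
proof -
  have "lincomb (\<lambda>i. if i = k then a else \<zero>) v D = (\<Oplus>i\<in>{..<D}. if k = i then a \<otimes> v i else \<zero>)"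
    unfolding lincomb_def by (rule finsum_cong') (use assms in \<open>auto simp: Pi_iff\<close>)
  also have "\<dots> = a \<otimes> v k" by (rule add.finprod_singleton) (use assms in \<open>auto simp: Pi_iff\<close>)
  finally show ?thesis .
qed

lemma lin_indep_le:
  assumes "\<zero> \<in> E" "E \<subseteq> carrier R" "lin_indep E v D" "n \<le> D" shows "lin_indep E v n"
  unfolding lin_indep_def
proof (intro conjI ballI impI allI)
  have v: "v \<in> {..<D} \<rightarrow> carrier R" using assms lin_indep_carrier by blast
  thus vn: "v \<in> {..<n} \<rightarrow> carrier R" using assms(4) by (auto simp: Pi_iff)
  fix c i assume c: "c \<in> {..<n} \<rightarrow> E" "lincomb c v n = \<zero>" and i: "i < n"
  let ?c = "\<lambda>i. if i < n then c i else \<zero>"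
  obtain k where k: "D = n + k" using assms(4) le_Suc_ex by blast
  have cE: "?c \<in> {..<D} \<rightarrow> E" using c assms by auto
  have cn: "c \<in> {..<n} \<rightarrow> carrier R" using c(1) assms(2) by auto
  have "lincomb ?c v D = lincomb ?c v n \<oplus> lincomb (\<lambda>i. ?c (n + i)) (\<lambda>i. v (n + i)) k"
    unfolding k by (rule lincomb_append) (use v cE assms(2) k in \<open>auto simp: Pi_iff\<close>)
  also have "lincomb ?c v n = \<zero>"
    using lincomb_cong[of n ?c c v v] cn vn c(2) by simp
  also have "lincomb (\<lambda>i. ?c (n + i)) (\<lambda>i. v (n + i)) k = \<zero>"
    by (rule lincomb_zero) (use v k in \<open>auto simp: Pi_iff\<close>)
  finally have "lincomb ?c v D = \<zero>" by simp
  hence "?c i = \<zero>" using lin_indepD[OF assms(3) cE, of i] i assms(4) by simp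
  thus "c i = \<zero>" using i by simp
qed

end

context cring
begin

text \<open>The index \<open>j\<close> is read as a two-digit number with low digit
  \<open>j mod d\<close> and high digit \<open>j div d\<close>; this is the product basis of a tower
  of two extensions.\<close>

lemma lincomb_blocks:
  assumes "c \<in> {..<d * m} \<rightarrow> carrier R" "u \<in> {..<d} \<rightarrow> carrier R" "w \<in> {..<m} \<rightarrow> carrier R"
  shows "lincomb c (\<lambda>j. u (j mod d) \<otimes> w (j div d)) (d * m)
    = lincomb (\<lambda>b. lincomb (\<lambda>a. c (d * b + a)) u d) w m"
  using assms
proof (induction m)
  case (Suc m)
  show ?case
  proof (cases "d = 0")
    case True
    thus ?thesis using Suc.prems(3) lincomb_zero[of "Suc m" "\<lambda>_. \<zero>" w] by simp
  next
    case False
    let ?v = "\<lambda>j. u (j mod d) \<otimes> w (j div d)"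
    have div: "j div d < k" if "j < d * k" for j k using that by (simp add: less_mult_imp_div_less mult.commute)
    have v: "?v \<in> {..<d * Suc m} \<rightarrow> carrier R"
      using Suc.prems(2,3) False div by (auto simp: Pi_iff simp del: mult_Suc_right)
    have cb: "(\<lambda>a. c (d * b + a)) \<in> {..<d} \<rightarrow> carrier R" if "b \<le> m" for b
    proof
      fix a assume "a \<in> {..<d}"
      hence "d * b + a < d * Suc b" by simp
      also have "\<dots> \<le> d * Suc m" using that by (intro mult_le_mono) auto
      finally show "c (d * b + a) \<in> carrier R" using Suc.prems(1) by auto
    qed
    have w: "w m \<in> carrier R" "w \<in> {..<m} \<rightarrow> carrier R" using Suc.prems(3) by (auto simp: Pi_iff)
    have c: "c \<in> {..<d * m} \<rightarrow> carrier R" using Suc.prems(1) by (auto simp: Pi_iff)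
    have in_closed: "lincomb (\<lambda>a. c (d * b + a)) u d \<in> carrier R" if "b \<le> m" for b
      using lincomb_closed[OF cb[OF that] Suc.prems(2)] .
    have "lincomb (\<lambda>i. c (d * m + i)) (\<lambda>i. ?v (d * m + i)) d = lincomb (\<lambda>i. w m \<otimes> c (d * m + i)) u d"
      unfolding lincomb_def
      by (rule finsum_cong') (use w cb[of m] Suc.prems(2) in \<open>auto simp: Pi_iff m_ac\<close>)
    also have "\<dots> = w m \<otimes> lincomb (\<lambda>i. c (d * m + i)) u d"
      by (rule lincomb_smult) (use w cb[of m] Suc.prems(2) in auto)
    finally have last: "lincomb (\<lambda>i. c (d * m + i)) (\<lambda>i. ?v (d * m + i)) d =
        w m \<otimes> lincomb (\<lambda>i. c (d * m + i)) u d" .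
    have "lincomb c ?v (d * Suc m) = lincomb c ?v (d * m + d)" by (simp add: add.commute)
    also have "\<dots> = lincomb c ?v (d * m) \<oplus> lincomb (\<lambda>i. c (d * m + i)) (\<lambda>i. ?v (d * m + i)) d"
      by (rule lincomb_append) (use Suc.prems(1) v in \<open>auto simp: add.commute\<close>)
    also have "\<dots> = lincomb (\<lambda>b. lincomb (\<lambda>a. c (d * b + a)) u d) w m \<oplus>
       w m \<otimes> lincomb (\<lambda>i. c (d * m + i)) u d"
      unfolding last using Suc.IH[OF c Suc.prems(2) w(2)] by simp
    also have "\<dots> = lincomb (\<lambda>b. lincomb (\<lambda>a. c (d * b + a)) u d) w (Suc m)"
      using Suc.prems(3) in_closed w lincomb_closed[of "\<lambda>b. lincomb (\<lambda>a. c (d * b + a)) u d" m w]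
      by (subst lincomb_Suc) (auto simp: Pi_iff a_comm m_comm)
    finally show ?thesis .
  qed
qed simp

text \<open>Sorts a polynomial in \<open>x\<close> by the residue of the exponent modulo
  \<open>d\<close>; the inner sums are polynomials in x^d. For d = p this separates the exponents
  divisible by p from the others.\<close>

lemma lincomb_residues:
  assumes "c \<in> {..<d * m} \<rightarrow> carrier R" "x \<in> carrier R"
  shows "lincomb c (\<lambda>j. x [^] j) (d * m)
    = lincomb (\<lambda>a. lincomb (\<lambda>b. c (d * b + a)) (\<lambda>b. (x [^] d) [^] b) m) (\<lambda>a. x [^] a) d"
  using assms(1)
proof (induction m)
  case 0
  show ?case using assms(2) by (simp add: lincomb_zero)
next
  case (Suc m)
  let ?F = "\<lambda>m a. lincomb (\<lambda>b. c (d * b + a)) (\<lambda>b. (x [^] d) [^] b) m"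
  have cin: "c (d * b + a) \<in> carrier R" if "b \<le> m" "a < d" for a b
  proof -
    have "d * b + a < d * Suc b" using that by simp
    also have "\<dots> \<le> d * Suc m" using that by (intro mult_le_mono) auto
    finally show ?thesis using Suc.prems by auto
  qed
  have Fc: "?F k a \<in> carrier R" if "k \<le> Suc m" "a < d" for k a
    by (rule lincomb_closed) (use that cin assms(2) in auto)
  have c: "c \<in> {..<d * m} \<rightarrow> carrier R" using Suc.prems by (auto simp: Pi_iff)
  have "lincomb c (\<lambda>j. x [^] j) (d * Suc m) = lincomb c (\<lambda>j. x [^] j) (d * m + d)"
    by (simp add: add.commute)
  also have "\<dots> = lincomb c (\<lambda>j. x [^] j) (d * m) \<oplus> lincomb (\<lambda>a. c (d * m + a)) (\<lambda>a. x [^] (d * m + a)) d"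
    by (rule lincomb_append) (use Suc.prems assms(2) in \<open>auto simp: add.commute\<close>)
  also have "lincomb (\<lambda>a. c (d * m + a)) (\<lambda>a. x [^] (d * m + a)) d =
      lincomb (\<lambda>a. c (d * m + a) \<otimes> (x [^] d) [^] m) (\<lambda>a. x [^] a) d"
    unfolding lincomb_def
    by (rule finsum_cong') (use cin assms(2) in \<open>auto simp: nat_pow_pow nat_pow_mult m_assoc\<close>)
  also have "lincomb c (\<lambda>j. x [^] j) (d * m) = lincomb (?F m) (\<lambda>a. x [^] a) d" by (rule Suc.IH[OF c])
  also have "lincomb (?F m) (\<lambda>a. x [^] a) d \<oplus> lincomb (\<lambda>a. c (d * m + a) \<otimes> (x [^] d) [^] m) (\<lambda>a. x [^] a) d
     = lincomb (\<lambda>a. ?F m a \<oplus> c (d * m + a) \<otimes> (x [^] d) [^] m) (\<lambda>a. x [^] a) d"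
    by (rule lincomb_add[symmetric]) (use Fc cin assms(2) in auto)
  also have "\<dots> = lincomb (?F (Suc m)) (\<lambda>a. x [^] a) d"
  proof (rule lincomb_cong)
    show "?F m a \<oplus> c (d * m + a) \<otimes> (x [^] d) [^] m = ?F (Suc m) a" if "a < d" for a
      using Fc[of m a] cin that assms(2) by (subst lincomb_Suc) (auto simp: a_comm)
  qed (use Fc assms(2) in auto)
  finally show ?case .
qed

lemma eval_map_rev:
  assumes "c \<in> {..<n} \<rightarrow> carrier R" "x \<in> carrier R"
  shows "eval (map c (rev [0..<n])) x = lincomb c (\<lambda>i. x [^] i) n"
  using assms(1)
proof (induction n)
  case (Suc n)
  have "c \<in> {..<n} \<rightarrow> carrier R" using Suc.prems by (auto simp: Pi_iff)
  thus ?case using Suc assms(2) by (subst lincomb_Suc) (auto simp: Pi_iff)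
qed simp

lemma eval_eq_lincomb:
  assumes "set f \<subseteq> carrier R" "x \<in> carrier R"
  shows "eval f x = lincomb (coeff f) (\<lambda>i. x [^] i) (length f)"
  using eval_map_rev[of "coeff f" "length f" x] assms coeff_list[of f] by auto

end

section \<open>Relations between powers, and degrees\<close>

context field
begin

lemma algebraicI_relation:
  assumes "subfield K R" "x \<in> carrier R" "c \<in> {..<n} \<rightarrow> K" "lincomb c (\<lambda>i. x [^] i) n = \<zero>"
    "i < n" "c i \<noteq> \<zero>"
  shows "algebraic K x"
proof -
  let ?f = "map c (rev [0..<n])"
  have s: "set ?f \<subseteq> K" using assms(3) by auto
  note Kc = subfield_closed(1)[OF assms(1)]
  have e: "eval (normalize ?f) x = \<zero>"
    using eval_normalize[of ?f x] eval_map_rev[of c n x] Pi_subset[OF assms(3) Kc] s Kc assms(2,4) by auto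
  have "normalize ?f \<noteq> []"
  proof
    assume "normalize ?f = []"
    hence "coeff ?f i = \<zero>" using normalize_coeff[of ?f] by simp
    moreover have "coeff ?f i = c i" using assms(5) by (simp add: coeff_nth rev_nth)
    ultimately show False using assms(6) by simp
  qed
  moreover have "normalize ?f \<in> carrier (K[X])"
    using normalize_gives_polynomial[OF s] by (simp add: univ_poly_carrier)
  ultimately show ?thesis using algebraicI e by (simp add: over_def)
qed

lemma not_algebraic_lin_indep:
  assumes "subfield K R" "x \<in> carrier R" "\<not> algebraic K x"
  shows "lin_indep K (\<lambda>i. x [^] i) n"
  unfolding lin_indep_def using algebraicI_relation[OF assms(1,2)] assms by auto

lemma algebraic_relation:
  assumes "subfield K R" "x \<in> carrier R" "algebraic K x"
  obtains d where "d \<ge> 1" "lin_indep K (\<lambda>i. x [^] i) d" "lin_span K (\<lambda>i. x [^] i) d = adjoin K {x}"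
    "dimension d K (adjoin K {x})" "d = degree (Irr K x)"
proof -
  note Kc = subfield_closed(1)[OF assms(1)]
  have a: "(algebraic over K) x" using assms(3) by (simp add: over_def)
  let ?d = "degree (Irr K x)" and ?S = "simple_extension K x"
  have sf: "subfield ?S R" using simple_extension_is_subfield[OF assms(1,2)] a by simp
  have S: "?S = adjoin K {x}"
  proof
    show "?S \<subseteq> adjoin K {x}"
      using simple_extension_subring_incl[OF subfieldE(1)[OF adjoin_subfield[OF Kc, of "{x}"]]]
        adjoin_incl[of K "{x}"] adjoin_incl[of "{x}" K] assms(2) by auto
    show "adjoin K {x} \<subseteq> ?S"
      using adjoin_least[OF sf] simple_extension_incl[OF Kc assms(2)]
        simple_extension_mem[OF subfieldE(1)[OF assms(1)] assms(2)] by simp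
  qed
  have dim: "dimension ?d K (adjoin K {x})"
    using dimension_simple_extension[OF assms(1,2) a] S by simp
  have pc: "(\<lambda>i. x [^] i) \<in> {..<?d} \<rightarrow> carrier R" using assms(2) by auto
  have sp: "lin_span K (\<lambda>i. x [^] i) ?d = adjoin K {x}"
  proof -
    have "lin_span K (\<lambda>i. x [^] i) ?d = Span K (map (\<lambda>i. x [^] i) [0..<?d])"
      using lin_span_eq_Span[OF assms(1) pc] .
    also have "\<dots> = Span K (exp_base x ?d)"
      by (rule Span_same_set[OF assms(1)]) (use assms(2) in \<open>auto simp: exp_base_def\<close>)
    finally show ?thesis using Span_exp_base[OF assms(1,2) a] S by simp
  qed
  have "?d \<ge> 1" using pirreducible_degree[OF assms(1)] IrrE[OF assms(1,2) a] by blast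
  thus ?thesis using that[of ?d] sp dim lin_span_indep(1)[OF assms(1), of ?d "\<lambda>i. x [^] i" ?d] pc by simp
qed

lemma algebraic_of_finite_dimension:
  assumes "subfield K R" "subfield V R" "finite_dimension K V" "x \<in> V"
  shows "algebraic K x"
  using finite_dimension_imp_algebraic[OF assms(1) subfieldE(1)[OF assms(2)] assms(3,4)]
  by (simp add: over_def)

text \<open>The hypothesis is a monic relation of degree \<open>n\<close>, possibly larger than the
  minimal one. It makes the span stable under multiplication by \<open>x\<close>, so that it
  contains every power of \<open>x\<close>.\<close>

lemma adjoin_eq_lin_span:
  assumes "subfield K R" "x \<in> carrier R" "0 < n" "x [^] n \<in> lin_span K (\<lambda>i. x [^] i) n"
  shows "lin_span K (\<lambda>i. x [^] i) n = adjoin K {x}"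
proof -
  let ?V = "lin_span K (\<lambda>i. x [^] i) n"
  note Kc = subfield_closed(1)[OF assms(1)]
  have pc: "(\<lambda>i. x [^] i) \<in> {..<n} \<rightarrow> carrier R" using assms(2) by auto
  note V = lin_span_closed[OF assms(1) pc]
  have x: "x \<otimes> y \<in> ?V" if "y \<in> ?V" for y
  proof -
    have "?V \<subseteq> {y \<in> carrier R. x \<otimes> y \<in> ?V}"
    proof (rule lin_span_minimal)
      fix c i assume ci: "c \<in> K" "i < n"
      hence "x \<otimes> (c \<otimes> x [^] i) = c \<otimes> x [^] Suc i"
        using assms(2) Kc by (simp add: m_comm m_lcomm nat_pow_Suc2 subsetD)
      moreover have "x [^] Suc i \<in> ?V"
        using ci assms(4) V(6)[of "Suc i"] by (cases "Suc i = n") auto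
      ultimately have "x \<otimes> (c \<otimes> x [^] i) \<in> ?V" using V(5)[OF ci(1)] by simp
      thus "c \<otimes> x [^] i \<in> {y \<in> carrier R. x \<otimes> y \<in> ?V}" using ci assms(2) Kc by auto
    qed (use V assms(2) Kc pc in \<open>auto simp: r_distr\<close>)
    thus ?thesis using that by auto
  qed
  have m: "x [^] m \<in> ?V" for m :: nat
  proof (induction m)
    case 0 show ?case using V(6)[OF assms(3)] by simp
  next
    case (Suc m) thus ?case using x[OF Suc] assms(2) by (simp add: m_comm)
  qed
  have sf: "subfield ?V R" "K \<subseteq> ?V"
    using lin_span_subfield[OF assms(1) pc] m[of 0] m assms(2) by (auto simp: nat_pow_mult)
  show ?thesis
  proof
    show "adjoin K {x} \<subseteq> ?V" using adjoin_least[OF sf] m[of 1] assms(2) by (simp add: nat_pow_eone)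
    have A: "subfield (adjoin K {x}) R" using adjoin_subfield[OF Kc, of "{x}"] assms(2) by simp
    show "?V \<subseteq> adjoin K {x}"
      by (rule lin_span_minimal)
        (use subfield_closed[OF A] subfield_pow[OF A] adjoin_incl[of K "{x}"] adjoin_incl[of "{x}" K] Kc pc in auto)
  qed
qed

lemma adjoin_dimension_le:
  assumes "subfield K R" "x \<in> carrier R" "0 < n" "x [^] n \<in> lin_span K (\<lambda>i. x [^] i) n"
  obtains d where "d \<le> n" "dimension d K (adjoin K {x})"
  using lin_span_dimension_le[OF assms(1), of "\<lambda>i. x [^] i" n] adjoin_eq_lin_span[OF assms] assms(2) by auto

lemma adjoin_dimension_le_pow:
  assumes "subfield K R" "x \<in> carrier R" "0 < n" "x [^] n \<in> K"
  obtains d where "d \<le> n" "dimension d K (adjoin K {x})"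
proof -
  have pc: "(\<lambda>i. x [^] i) \<in> {..<n} \<rightarrow> carrier R" using assms(2) by auto
  have "x [^] n \<otimes> x [^] (0::nat) \<in> lin_span K (\<lambda>i. x [^] i) n"
    using lin_span_closed(5,6)[OF assms(1) pc] assms(3,4) by blast
  thus ?thesis using adjoin_dimension_le[OF assms(1,2,3)] that assms(2) by auto
qed

lemma finite_dimension_trans:
  assumes "subfield K R" "subfield E R" "finite_dimension K E" "finite_dimension E V"
  shows "finite_dimension K V"
  using telescopic_base[OF assms(1,2)] assms(3,4) by (meson finite_dimension_def)

lemma finite_dimension_adjoin:
  assumes "subfield K R" "finite A" "A \<subseteq> carrier R" "\<And>a. a \<in> A \<Longrightarrow> algebraic K a"
  shows "finite_dimension K (adjoin K A)"
  using assms(2-)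
proof (induction A rule: finite_induct)
  case empty
  have "adjoin K {} = K" using adjoin_id[OF assms(1), of "{}"] by simp
  moreover have "finite_dimension K K"
    using dimension_one[OF assms(1)] by (auto simp: finite_dimension_def)
  ultimately show ?case by (simp only:)
next
  case (insert a A)
  note Kc = subfield_closed(1)[OF assms(1)]
  have sf: "subfield (adjoin K A) R" using adjoin_subfield[OF Kc] insert by simp
  have "algebraic (adjoin K A) a" using algebraic_mono[OF adjoin_incl(1)[of K A], of a] insert
    by (auto simp: over_def)
  then obtain d where "dimension d (adjoin K A) (adjoin (adjoin K A) {a})"
    using algebraic_relation[OF sf, of a] insert by auto
  moreover have "adjoin (adjoin K A) {a} = adjoin K (insert a A)"
    using adjoin_adjoin[OF Kc, of A "{a}"] insert by (simp add: Un_insert_right)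
  ultimately show ?case
    using finite_dimension_trans[OF assms(1) sf] insert by (auto simp: finite_dimension_def)
qed

lemma algebraic_coefficients:
  assumes "subfield E R" "x \<in> carrier R" "algebraic E x"
  obtains n c where "c \<in> {..<n} \<rightarrow> E" "lincomb c (\<lambda>i. x [^] i) n = \<zero>" "\<exists>i<n. c i \<noteq> \<zero>"
proof -
  obtain f where f: "f \<in> carrier (E[X])" "f \<noteq> []" "eval f x = \<zero>"
    using algebraicE[OF subfieldE(1)[OF assms(1)] assms(2)] assms(3) by (auto simp: over_def)
  note Ec = subfield_closed(1)[OF assms(1)]
  have s: "set f \<subseteq> E" "lead_coeff f \<noteq> \<zero>"
    using f(1,2) by (auto simp: univ_poly_carrier[symmetric] polynomial_def)
  have "lincomb (coeff f) (\<lambda>i. x [^] i) (length f) = \<zero>"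
    using eval_eq_lincomb[of f x] s Ec assms(2) f(3) by auto
  moreover have "coeff f \<in> {..<length f} \<rightarrow> E" using coeff_img_restrict[of f] s by auto
  moreover have "degree f < length f" "coeff f (degree f) \<noteq> \<zero>"
    using s f(2) lead_coeff_simp[OF f(2)] by simp_all
  ultimately show ?thesis using that by blast
qed

text \<open>The finitely many coefficients of a relation for \<open>x\<close> over \<open>E\<close>
  generate a finite extension of \<open>K\<close>, over which \<open>x\<close> is algebraic.\<close>

lemma algebraic_trans:
  assumes "subfield K R" "subfield E R" "\<And>e. e \<in> E \<Longrightarrow> algebraic K e" "x \<in> carrier R" "algebraic E x"
  shows "algebraic K x"
proof -
  obtain n c where c: "c \<in> {..<n} \<rightarrow> E" "lincomb c (\<lambda>i. x [^] i) n = \<zero>" "\<exists>i<n. c i \<noteq> \<zero>"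
    using algebraic_coefficients[OF assms(2,4,5)] .
  note Kc = subfield_closed(1)[OF assms(1)] and Ec = subfield_closed(1)[OF assms(2)]
  let ?C = "c ` {..<n}"
  have C: "?C \<subseteq> E" using c(1) by auto
  have fd: "finite_dimension K (adjoin K ?C)"
    by (rule finite_dimension_adjoin[OF assms(1)]) (use C Ec assms(3) in auto)
  have sf: "subfield (adjoin K ?C) R" using adjoin_subfield[OF Kc] C Ec by auto
  have "c \<in> {..<n} \<rightarrow> adjoin K ?C" using adjoin_incl(2)[of ?C K] by auto
  hence "algebraic (adjoin K ?C) x" using algebraicI_relation[OF sf assms(4)] c by blast
  then obtain d where "dimension d (adjoin K ?C) (adjoin (adjoin K ?C) {x})"
    using algebraic_relation[OF sf assms(4)] by metis
  hence "finite_dimension K (adjoin (adjoin K ?C) {x})"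
    using finite_dimension_trans[OF assms(1) sf fd] finite_dimensionI by blast
  thus ?thesis
    using algebraic_of_finite_dimension[OF assms(1) adjoin_subfield, of "adjoin K ?C" "{x}"]
      subfield_closed(1)[OF sf] assms(4) adjoin_incl(2)[of "{x}" "adjoin K ?C"] by auto
qed

lemma finite_dimension_upper:
  assumes "subfield K R" "subfield E R" "subfield V R" "K \<subseteq> E" "E \<subseteq> V" "finite_dimension K V"
  shows "finite_dimension E V"
proof -
  obtain d where "dimension d K V" using assms(6) by (auto simp: finite_dimension_def)
  then obtain b where b: "lin_indep K b d" "lin_span K b d = V"
    using dimension_basis[OF assms(1)] by metis
  have bc: "b \<in> {..<d} \<rightarrow> carrier R" using lin_indep_carrier b by blast
  have "V \<subseteq> lin_span E b d" using lin_span_mono[OF assms(4)] b(2) by blast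
  moreover have "lin_span E b d \<subseteq> V"
    by (rule lin_span_minimal)
      (use subfield_closed[OF assms(3)] subfield_closed[OF assms(2)] assms(5) bc
          lin_span_closed(6)[OF assms(1) bc] b(2) in auto)
  ultimately show ?thesis
    using lin_span_dimension_le[OF assms(2) bc] finite_dimensionI by (metis subset_antisym)
qed

lemma finite_dimension_lower:
  assumes "subfield K R" "subfield E R" "K \<subseteq> E" "E \<subseteq> V" "finite_dimension K V"
  shows "finite_dimension K E"
proof (rule subalbegra_incl_imp_finite_dimension[OF assms(1,5) _ assms(4)])
  show "subalgebra K E R"
    using subring.axioms(1)[OF subfieldE(1)[OF assms(2)]] subfield_closed(5)[OF assms(2)] assms(3)
    by (intro subalgebra.intro) (auto simp: subalgebra_axioms_def subset_iff)
qed

end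

section \<open>Purely inseparable and separable elements\<close>

context field
begin

text \<open>Induction on \<open>n\<close>. If \<open>a\<close> is a root of \<open>f\<close>, one
  factor X - a is cancelled on both sides; otherwise the prime X - a must divide the cofactor of
  \<open>f\<close> and is cancelled there.\<close>

lemma monic_divisor_of_linear_power:
  assumes a: "a \<in> carrier R" and "f \<in> carrier (poly_ring R)" "f \<noteq> []" "lead_coeff f = \<one>"
    "f pdivides ([\<one>, \<ominus> a] [^]\<^bsub>poly_ring R\<^esub> (n::nat))"
  shows "\<exists>m::nat. f = [\<one>, \<ominus> a] [^]\<^bsub>poly_ring R\<^esub> m"
  using assms(2-)
proof (induction n arbitrary: f)
  interpret UP: principal_domain "poly_ring R"
    using univ_poly_is_principal[OF carrier_is_subfield] .
  let ?q = "[\<one>, \<ominus> a]"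
  have q: "?q \<in> carrier (poly_ring R)" using a by (simp add: univ_poly_carrier[symmetric] polynomial_def)
  have qz: "?q \<noteq> \<zero>\<^bsub>poly_ring R\<^esub>" by (simp add: univ_poly_zero)
  {
    case 0
    then obtain h where h: "h \<in> carrier (poly_ring R)" "\<one>\<^bsub>poly_ring R\<^esub> = f \<otimes>\<^bsub>poly_ring R\<^esub> h"
      by (auto simp: pdivides_def factor_def)
    hence "f \<in> Units (poly_ring R)" using 0(1) UP.m_comm by (auto simp: Units_def)
    then obtain k where "f = [k]" using univ_poly_carrier_units by auto
    hence "f = ?q [^]\<^bsub>poly_ring R\<^esub> (0::nat)" using 0(3) by (simp add: univ_poly_one)
    thus ?case by blast
  next
    case (Suc n)
    let ?qn = "?q [^]\<^bsub>poly_ring R\<^esub> n"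
    have qn: "?qn \<in> carrier (poly_ring R)" using q by simp
    obtain h where h: "h \<in> carrier (poly_ring R)" "?qn \<otimes>\<^bsub>poly_ring R\<^esub> ?q = f \<otimes>\<^bsub>poly_ring R\<^esub> h"
      using Suc.prems(4) by (auto simp: pdivides_def factor_def)
    show ?case
    proof (cases "eval f a = \<zero>")
      case True
      hence "?q pdivides f" using is_root_imp_pdivides[OF Suc.prems(1), of a] a Suc.prems(2) by (simp add: is_root_def)
      then obtain g where g: "g \<in> carrier (poly_ring R)" "f = ?q \<otimes>\<^bsub>poly_ring R\<^esub> g"
        by (auto simp: pdivides_def factor_def)
      have gn: "g \<noteq> []" using g Suc.prems(2) q UP.r_null[of ?q] by (auto simp: univ_poly_zero)
      have "lead_coeff f = \<one> \<otimes> lead_coeff g"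
        using poly_mult_lead_coeff[OF carrier_is_subring, of ?q g] q g gn
        by (simp add: univ_poly_carrier univ_poly_mult)
      hence gl: "lead_coeff g = \<one>"
        using Suc.prems(3) gn lead_coeff_in_carrier[OF carrier_is_subring, of "hd g" "tl g"] g(1)
        by (simp add: univ_poly_carrier)
      have "?q \<otimes>\<^bsub>poly_ring R\<^esub> ?qn = ?q \<otimes>\<^bsub>poly_ring R\<^esub> (g \<otimes>\<^bsub>poly_ring R\<^esub> h)"
        using h g q qn by (simp add: UP.m_ac)
      hence "?qn = g \<otimes>\<^bsub>poly_ring R\<^esub> h" using UP.m_lcancel[OF qz q qn] g h by simp
      hence "g pdivides ?qn" using h by (auto simp: pdivides_def factor_def)
      then obtain m :: nat where "g = ?q [^]\<^bsub>poly_ring R\<^esub> m" using Suc.IH[OF g(1) gn gl] by blast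
      hence "f = ?q [^]\<^bsub>poly_ring R\<^esub> (Suc m)" using g q UP.m_comm by simp
      thus ?thesis by blast
    next
      case False
      have nd: "\<not> ?q pdivides f"
        using pdivides_imp_is_root[OF Suc.prems(2) a] False by (auto simp: is_root_def)
      have "pirreducible (carrier R) ?q"
        using degree_one_imp_pirreducible[OF carrier_is_subfield q] by simp
      hence "pprime (carrier R) ?q" using pprime_iff_pirreducible[OF carrier_is_subfield q] by simp
      moreover have "?q pdivides (f \<otimes>\<^bsub>poly_ring R\<^esub> h)"
        unfolding h(2)[symmetric] UP.m_comm[OF qn q] pdivides_def factor_def using qn by blast
      ultimately have "?q pdivides h"
        using pprimeE(3)[OF carrier_is_subfield q _ Suc.prems(1) h(1)] nd by blast
      then obtain g where g: "g \<in> carrier (poly_ring R)" "h = ?q \<otimes>\<^bsub>poly_ring R\<^esub> g"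
        by (auto simp: pdivides_def factor_def)
      have "?q \<otimes>\<^bsub>poly_ring R\<^esub> ?qn = ?q \<otimes>\<^bsub>poly_ring R\<^esub> (f \<otimes>\<^bsub>poly_ring R\<^esub> g)"
        using h g q qn Suc.prems(1) by (simp add: UP.m_ac)
      hence "?qn = f \<otimes>\<^bsub>poly_ring R\<^esub> g" using UP.m_lcancel[OF qz q qn] g Suc.prems(1) by simp
      hence "f pdivides ?qn" using g by (auto simp: pdivides_def factor_def)
      thus ?thesis using Suc.IH[OF Suc.prems(1-3)] by blast
    qed
  }
qed

text \<open>Bezout: with d u = m v + 1, the element z is the quotient of z^(d u) by z^(m v).\<close>

lemma coprime_powers_mem:
  assumes "subfield E R" "z \<in> carrier R" "z [^] (d::nat) \<in> E" "z [^] (m::nat) \<in> E" "coprime d m" "d \<noteq> 0"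
  shows "z \<in> E"
proof (cases "z = \<zero>")
  case True thus ?thesis using subfield_closed[OF assms(1)] by simp
next
  case False
  obtain u v where uv: "d * u = m * v + 1" using bezout_nat[OF assms(6), of m] assms(5) by auto
  have zu: "z \<in> Units R" "z [^] (m * v) \<in> Units R" using assms(2) False pow_eq_zero[OF assms(2), of "m * v"] by (auto simp: field_Units)
  have "z [^] (d * u) \<in> E" "z [^] (m * v) \<in> E"
    using subfield_pow[OF assms(1,3), of u] subfield_pow[OF assms(1,4), of v] assms(2) by (auto simp: nat_pow_pow)
  moreover have "z [^] (m * v) \<noteq> \<zero>" using pow_eq_zero[OF assms(2)] False by blast
  ultimately have "inv (z [^] (m * v)) \<otimes> z [^] (d * u) \<in> E"
    using subfield_inv[OF assms(1)] subfield_closed(5)[OF assms(1)] by blast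
  moreover have "inv (z [^] (m * v)) \<otimes> z [^] (d * u) = z"
    unfolding uv using zu assms(2) by (simp add: m_assoc[symmetric] Units_l_inv)
  ultimately show ?thesis by simp
qed

end

context char_p_field
begin

text \<open>In characteristic p, (X - y)^p = X^p + (-y)^p, so only y^p enters the
  coefficients.\<close>

lemma linear_power_coeffs:
  assumes "subfield E R" "y \<in> carrier R" "y [^] p \<in> E"
  shows "[\<one>, \<ominus> y] [^]\<^bsub>poly_ring R\<^esub> p \<in> carrier (E[X])"
proof -
  interpret UP: principal_domain "poly_ring R"
    using univ_poly_is_principal[OF carrier_is_subfield] .
  interpret H: ring_hom_ring R "poly_ring R" poly_of_const
    using canonical_embedding_ring_hom[OF carrier_is_subring] by simp
  note sr = subfieldE(1)[OF assms(1)]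
  \<comment> \<open>The Frobenius identity is applied in the polynomial ring, so the vanishing of p
    is first transported there along the constants.\<close>
  have "[n] \<cdot>\<^bsub>poly_ring R\<^esub> \<one>\<^bsub>poly_ring R\<^esub> = poly_of_const ([n] \<cdot> \<one>)" for n :: nat
    by (induction n) (simp_all add: add.nat_pow_Suc UP.add.nat_pow_Suc)
  hence ch: "[p] \<cdot>\<^bsub>poly_ring R\<^esub> \<one>\<^bsub>poly_ring R\<^esub> = \<zero>\<^bsub>poly_ring R\<^esub>" using char_one by simp
  have Xc: "X \<in> carrier (poly_ring R)" using var_closed[OF carrier_is_subring] by simp
  have c: "poly_of_const (\<ominus> y) \<in> carrier (poly_ring R)" using assms(2) by simp
  have q: "[\<one>, \<ominus> y] = X \<oplus>\<^bsub>poly_ring R\<^esub> poly_of_const (\<ominus> y)"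
    using assms(2) by (auto simp: var_def univ_poly_add poly_of_const_def)
  have "[\<one>, \<ominus> y] [^]\<^bsub>poly_ring R\<^esub> p = X [^]\<^bsub>poly_ring R\<^esub> p \<oplus>\<^bsub>poly_ring R\<^esub> poly_of_const (\<ominus> y) [^]\<^bsub>poly_ring R\<^esub> p"
    unfolding q by (rule UP.frobenius_add[OF prime_p ch Xc c])
  also have "X [^]\<^bsub>poly_ring R\<^esub> p = monom \<one> p" using unitary_monom_eq_var_pow[OF carrier_is_subring] by simp
  also have "poly_of_const (\<ominus> y) [^]\<^bsub>poly_ring R\<^esub> p = poly_of_const ((\<ominus> y) [^] p)"
    using H.hom_nat_pow assms(2) by simp
  finally have e: "[\<one>, \<ominus> y] [^]\<^bsub>poly_ring R\<^esub> p = poly_add (monom \<one> p) (poly_of_const ((\<ominus> y) [^] p))"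
    by (simp add: univ_poly_add)
  have "(\<ominus> y) [^] p \<in> E"
    using frob_minus[of y 1] assms subfield_closed[OF assms(1)] by simp
  hence "set (poly_of_const ((\<ominus> y) [^] p)) \<subseteq> E"
    by (simp add: poly_of_const_def)
  moreover have "set (monom \<one> p) \<subseteq> E" using subfield_closed[OF assms(1)] by (auto simp: monom_def)
  ultimately show ?thesis
    unfolding e univ_poly_carrier[symmetric] using poly_add_is_polynomial[OF sr] by blast
qed

text \<open>Over the large field the minimal polynomial of \<open>y\<close> divides (X - y)^p, hence
  is (X - y)^d. Its constant term puts y^d into \<open>E\<close> up to sign; if d < p, then d is
  prime to p and \<open>y\<close> itself would lie in \<open>E\<close>.\<close>

lemma lin_indep_powers_insep:
  assumes E: "subfield E R" and y: "y \<in> carrier R" "y [^] p \<in> E" "y \<notin> E"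
  shows "lin_indep E (\<lambda>i. y [^] i) p"
proof -
  interpret UP: principal_domain "poly_ring R"
    using univ_poly_is_principal[OF carrier_is_subfield] .
  note Ec = subfield_closed(1)[OF E]
  let ?q = "[\<one>, \<ominus> y]"
  have q: "?q \<in> carrier (poly_ring R)" using y by (simp add: univ_poly_carrier[symmetric] polynomial_def)
  obtain d' where d': "d' \<le> p" "dimension d' E (adjoin E {y})"
    using adjoin_dimension_le_pow[OF E y(1) p_pos y(2)] .
  have "algebraic E y"
    by (rule algebraic_of_finite_dimension[OF E adjoin_subfield[OF Ec] finite_dimensionI[OF d'(2)]])
      (use y adjoin_incl(2)[of "{y}" E] in auto)
  then obtain d where d: "d \<ge> 1" "lin_indep E (\<lambda>i. y [^] i) d" "d = degree (Irr E y)"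
    using algebraic_relation[OF E y(1)] by metis
  have a: "(algebraic over E) y" using \<open>algebraic E y\<close> by (simp add: over_def)
  let ?f = "Irr E y"
  note f = IrrE[OF E y(1) a]
  show ?thesis
  proof (cases "p \<le> d")
    case True thus ?thesis using lin_indep_le[OF _ Ec d(2)] subfield_closed[OF E] by auto
  next
    case False
    have fp: "?f \<in> carrier (poly_ring R)" using carrier_polynomial_shell[OF subfieldE(1)[OF E] f(1)] .
    have fn: "?f \<noteq> []" using d by auto
    interpret ev: ring_hom_ring "poly_ring R" R "\<lambda>g. eval g y" using eval_ring_hom[OF carrier_is_subring y(1)] .
    interpret ev0: ring_hom_ring "poly_ring R" R "\<lambda>g. eval g \<zero>" using eval_ring_hom[OF carrier_is_subring zero_closed] .
    have "eval (?q [^]\<^bsub>poly_ring R\<^esub> p) y = \<zero>"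
      using ev.hom_nat_pow[OF q, of p] y p_pos by (simp add: r_neg nat_pow_zero)
    hence "?f pdivides (?q [^]\<^bsub>poly_ring R\<^esub> p)"
      using Irr_minimal[OF E y(1) a linear_power_coeffs[OF E y(1,2)]] by blast
    then obtain m :: nat where m: "?f = ?q [^]\<^bsub>poly_ring R\<^esub> m"
      using monic_divisor_of_linear_power[OF y(1) fp fn f(3)] by blast
    have "degree ?f = m" using polynomial_pow_degree[OF q, of m] m by simp
    hence m': "m = d" using d by simp
    have "eval ?f \<zero> \<in> E" using const_term_simprules_shell(1)[OF subfieldE(1)[OF E] f(1)] by (simp add: const_term_def)
    moreover have "eval ?f \<zero> = (\<ominus> y) [^] d"
      unfolding m m' using ev0.hom_nat_pow[OF q, of d] y by simp
    ultimately have "(\<ominus> y) [^] d \<in> E" by simp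
    moreover have "(\<ominus> y) [^] p \<in> E" using frob_minus[of y 1] y subfield_closed[OF E] by simp
    moreover have "coprime d p"
      using prime_p d(1) False by (metis coprime_commute dvd_imp_le less_le_trans not_le prime_imp_coprime_nat less_one)
    ultimately have "\<ominus> y \<in> E" using coprime_powers_mem[OF E, of "\<ominus> y" d p] y d by auto
    hence "\<ominus> (\<ominus> y) \<in> E" using subfield_closed(6)[OF E] by blast
    thus ?thesis using y by simp
  qed
qed

lemma dimension_insep_step:
  assumes E: "subfield E R" and y: "y \<in> carrier R" "y [^] p \<in> E" "y \<notin> E"
  shows "dimension p E (adjoin E {y})"
proof -
  have "y [^] p \<otimes> y [^] (0::nat) \<in> lin_span E (\<lambda>i. y [^] i) p"
    using lin_span_closed(5)[OF E _ y(2) lin_span_closed(6)[OF E _ p_pos]] y(1) by blast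
  hence "lin_span E (\<lambda>i. y [^] i) p = adjoin E {y}" using adjoin_eq_lin_span[OF E y(1) p_pos] y by simp
  thus ?thesis using lin_indep_dimension[OF E lin_indep_powers_insep[OF assms]] by simp
qed

text \<open>One factor p at a time: for exponent e + 1 the bottom step adjoins y = x^(p^e). Over
  E(y) the exponent of \<open>x\<close> drops by exactly one, because p-th powers of elements of
  E(y) lie in \<open>E\<close>.\<close>

lemma dimension_insep:
  assumes "subfield E R" "x \<in> carrier R" "x [^] (p ^ e) \<in> E" "e = 0 \<or> x [^] (p ^ (e - 1)) \<notin> E"
  shows "dimension (p ^ e) E (adjoin E {x})"
  using assms
proof (induction e arbitrary: E)
  case 0
  hence "adjoin E {x} = E" by (intro adjoin_id) (auto simp: nat_pow_eone)
  thus ?case using dimension_one[OF 0(1)] by simp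
next
  case (Suc e)
  note Ec = subfield_closed(1)[OF Suc.prems(1)]
  define y where "y = x [^] (p ^ e)"
  have y: "y \<in> carrier R" "y \<notin> E" "y [^] p \<in> E"
    using Suc.prems by (auto simp: y_def nat_pow_pow mult.commute)
  let ?E = "adjoin E {y}"
  have dE: "dimension p E ?E" by (rule dimension_insep_step) (use y Suc.prems in auto)
  have sf: "subfield ?E R" using adjoin_subfield[OF Ec] y by simp
  have "dimension (p ^ e) ?E (adjoin ?E {x})"
  proof (rule Suc.IH[OF sf Suc.prems(2)])
    show "x [^] (p ^ e) \<in> ?E" using adjoin_incl(2)[of "{y}" E] by (simp add: y_def)
    show "e = 0 \<or> x [^] (p ^ (e - 1)) \<notin> ?E"
    proof (rule ccontr)
      assume "\<not> ?thesis"
      hence e: "e \<noteq> 0" "x [^] (p ^ (e - 1)) \<in> ?E" by auto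
      have "(x [^] (p ^ (e - 1))) [^] (p ^ 1) \<in> E"
        by (rule frob_adjoin[OF Suc.prems(1) Ec, of "{y}"]) (use y e subfield_pow[OF Suc.prems(1)] in auto)
      moreover have "(x [^] (p ^ (e - 1))) [^] (p ^ 1) = y"
        using e(1) Suc.prems(2) by (cases e) (auto simp: y_def nat_pow_pow mult.commute)
      ultimately show False using y by simp
    qed
  qed
  moreover have "adjoin ?E {x} = adjoin E {x}"
  proof -
    have "adjoin ?E {x} = adjoin E ({y} \<union> {x})" using adjoin_adjoin[OF Ec] y Suc.prems by simp
    also have "\<dots> = adjoin (adjoin E {x}) {y}"
      using adjoin_adjoin[OF Ec, of "{x}" "{y}"] y Suc.prems by (simp add: Un_commute)
    also have "\<dots> = adjoin E {x}"
      by (rule adjoin_id[OF adjoin_subfield[OF Ec]])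
        (use Suc.prems adjoin_incl(2)[of "{x}" E] subfield_pow[OF adjoin_subfield[OF Ec, of "{x}"]] in \<open>auto simp: y_def\<close>)
    finally show ?thesis .
  qed
  ultimately show ?case using telescopic_base[OF Suc.prems(1) sf dE] by simp
qed

section \<open>Separability expressed through p-th powers\<close>

lemma nat_mult_eq_zero:
  assumes "z \<in> carrier R" "z \<noteq> \<zero>" "[(m::nat)] \<cdot> z = \<zero>" shows "p dvd m"
proof -
  have "([m] \<cdot> \<one>) \<otimes> z = \<zero>" using assms by (simp add: add_pow_ldistr)
  hence m: "[m] \<cdot> \<one> = \<zero>" using integral[of "[m] \<cdot> \<one>" z] assms by simp
  have "[m] \<cdot> \<one> = [(p * (m div p))] \<cdot> \<one> \<oplus> [(m mod p)] \<cdot> \<one>"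
    by (subst add.nat_pow_mult) auto
  also have "\<dots> = [(m mod p)] \<cdot> \<one>"
    using add_pow_multiple_zero[OF char_one, of "p * (m div p)" \<one>] by simp
  finally have "[(m mod p)] \<cdot> \<one> = \<zero>" using m by simp
  hence "m mod p = 0" using char_min[of "m mod p"] p_pos by fastforce
  thus ?thesis by auto
qed

text \<open>The powers of \<open>x\<close> below p are independent over K(x^p), so in a relation
  each residue class of exponents modulo p vanishes separately. The class of a nonzero residue a can
  be divided by x^a; the result has degree below \<open>n\<close>, where the powers of
  \<open>x\<close> are independent over \<open>K\<close>.\<close>

lemma relation_coeff_zero:
  assumes K: "subfield K R" and x: "x \<in> carrier R" "x \<notin> adjoin K {x [^] p}"
    and c: "c \<in> {..<Suc n} \<rightarrow> K" "lincomb c (\<lambda>i. x [^] i) (Suc n) = \<zero>"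
    and ind: "lin_indep K (\<lambda>i. x [^] i) n" and j: "j \<le> n" "\<not> p dvd j"
  shows "c j = \<zero>"
proof -
  note Kc = subfield_closed(1)[OF K]
  let ?E = "adjoin K {x [^] p}"
  have E: "subfield ?E R" using adjoin_subfield[OF Kc] x by simp
  have KE: "K \<subseteq> ?E" "x [^] p \<in> ?E" using adjoin_incl[of K "{x [^] p}"] adjoin_incl(2)[of "{x [^] p}" K] by auto
  \<comment> \<open>Padding with zeros up to \<open>p * m\<close> terms, so that the exponents split
    evenly into residue classes.\<close>
  define c' where "c' = (\<lambda>i. if i \<le> n then c i else \<zero>)"
  have c'K: "c' i \<in> K" for i using c(1) subfield_closed[OF K] by (auto simp: c'_def)
  hence c'c: "c' \<in> A \<rightarrow> carrier R" for A using Kc by auto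
  define m where "m = Suc n"
  have mp: "Suc n \<le> p * m" using mult_le_mono1[of 1 p "Suc n"] p_pos by (simp add: m_def)
  then obtain k where k: "p * m = Suc n + k" using le_Suc_ex by blast
  have "lincomb c' (\<lambda>i. x [^] i) (p * m) = lincomb c' (\<lambda>i. x [^] i) (Suc n) \<oplus>
      lincomb (\<lambda>i. c' (Suc n + i)) (\<lambda>i. x [^] (Suc n + i)) k"
    unfolding k by (rule lincomb_append) (use c'K Kc x in auto)
  also have "lincomb (\<lambda>i. c' (Suc n + i)) (\<lambda>i. x [^] (Suc n + i)) k = \<zero>"
    by (rule lincomb_zero) (use x in \<open>auto simp: c'_def\<close>)
  also have "lincomb c' (\<lambda>i. x [^] i) (Suc n) = lincomb c (\<lambda>i. x [^] i) (Suc n)"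
    by (rule lincomb_cong) (use x c Kc in \<open>auto simp: c'_def\<close>)
  finally have "lincomb c' (\<lambda>i. x [^] i) (p * m) = \<zero>" using c by simp
  hence r: "lincomb (\<lambda>a. lincomb (\<lambda>b. c' (p * b + a)) (\<lambda>b. (x [^] p) [^] b) m) (\<lambda>a. x [^] a) p = \<zero>"
    using lincomb_residues[OF c'c x(1), of p m] by simp
  have inE: "lincomb (\<lambda>b. c' (p * b + a)) (\<lambda>b. (x [^] p) [^] b) m \<in> ?E" for a
    unfolding lincomb_def
    by (rule subfield_finsum[OF E]) (use c'K KE subfield_closed(5)[OF E] subfield_pow[OF E] in blast)
  define a where "a = j mod p"
  have a: "a < p" "0 < a" using p_pos j by (auto simp: a_def mod_greater_zero_iff_not_dvd)
  have "lincomb (\<lambda>b. c' (p * b + a)) (\<lambda>b. (x [^] p) [^] b) m = \<zero>"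
    using lin_indepD[OF lin_indep_powers_insep[OF E x(1) KE(2) x(2)] _ r a(1)] inE by auto
  hence r0: "lincomb (\<lambda>b. c' (p * b + a)) (\<lambda>b. (x [^] p) [^] b) m = \<zero>" .
  \<comment> \<open>The class of \<open>a\<close> divided by x^a: its exponents are the multiples of
    p, with zeros in between.\<close>
  define c2 where "c2 = (\<lambda>i. if p dvd i then c' (i + a) else \<zero>)"
  have c2K: "c2 i \<in> K" for i using c'K subfield_closed[OF K] by (auto simp: c2_def)
  hence c2c: "c2 \<in> A \<rightarrow> carrier R" for A using Kc by auto
  have "lincomb c2 (\<lambda>i. x [^] i) (p * m) =
     lincomb (\<lambda>a. lincomb (\<lambda>b. c2 (p * b + a)) (\<lambda>b. (x [^] p) [^] b) m) (\<lambda>a. x [^] a) p"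
    using lincomb_residues[OF c2c x(1), of p m] by simp
  also have "\<dots> = lincomb (\<lambda>_. \<zero>) (\<lambda>a. x [^] a) p"
  proof (rule lincomb_cong)
    fix i assume i: "i < p"
    show "lincomb (\<lambda>b. c2 (p * b + i)) (\<lambda>b. (x [^] p) [^] b) m = \<zero>"
    proof (cases "i = 0")
      case True
      have "lincomb (\<lambda>b. c2 (p * b + i)) (\<lambda>b. (x [^] p) [^] b) m = lincomb (\<lambda>b. c' (p * b + a)) (\<lambda>b. (x [^] p) [^] b) m"
        by (rule lincomb_cong) (use True x c'K Kc in \<open>auto simp: c2_def\<close>)
      thus ?thesis using r0 by simp
    next
      case False
      hence "\<not> p dvd (p * b + i)" for b using i by (metis dvd_add_right_iff dvd_triv_left nat_dvd_not_less neq0_conv)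
      thus ?thesis by (intro lincomb_zero) (use x in \<open>auto simp: c2_def\<close>)
    qed
  qed (use x in auto)
  also have "\<dots> = \<zero>" by (rule lincomb_zero) (use x in auto)
  finally have z: "lincomb c2 (\<lambda>i. x [^] i) (p * m) = \<zero>" .
  have "n \<le> p * m" using mp by simp
  then obtain k' where k': "p * m = n + k'" using le_Suc_ex by blast
  have "lincomb c2 (\<lambda>i. x [^] i) (p * m) = lincomb c2 (\<lambda>i. x [^] i) n \<oplus>
      lincomb (\<lambda>i. c2 (n + i)) (\<lambda>i. x [^] (n + i)) k'"
    unfolding k' by (rule lincomb_append) (use c2K Kc x in auto)
  also have "lincomb (\<lambda>i. c2 (n + i)) (\<lambda>i. x [^] (n + i)) k' = \<zero>"
    by (rule lincomb_zero) (use x a in \<open>auto simp: c2_def c'_def\<close>)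
  finally have "lincomb c2 (\<lambda>i. x [^] i) n = \<zero>"
    using z lincomb_closed[OF c2c, of "\<lambda>i. x [^] i" n] x by simp
  moreover have aj: "a \<le> j" by (simp add: a_def)
  moreover have ja: "j - a < n" "p dvd (j - a)" "j - a + a = j"
    using a j aj by (linarith, simp_all add: a_def minus_mod_eq_mult_div)
  ultimately have "c2 (j - a) = \<zero>" using lin_indepD[OF ind] c2K by blast
  thus ?thesis using ja j by (simp add: c2_def c'_def)
qed

text \<open>For an irreducible polynomial, coprimality to the derivative means that the derivative
  is nonzero. If it vanishes, then x^p satisfies a monic relation of degree d/p, and K(x^p) is too
  small to contain \<open>x\<close>. If \<open>x\<close> is not in K(x^p), then
  \<open>relation_coeff_zero\<close> kills every coefficient that contributes to the
  derivative.\<close>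

lemma separable_over_iff:
  assumes K: "subfield K R" and x: "x \<in> carrier R" "algebraic K x"
  shows "separable_over K x \<longleftrightarrow> x \<in> adjoin K {x [^] p}"
proof -
  interpret UK: principal_domain "K[X]" using univ_poly_is_principal[OF K] .
  note Kc = subfield_closed(1)[OF K]
  note sr = subfieldE(1)[OF K]
  have a: "(algebraic over K) x" using x by (simp add: over_def)
  let ?f = "Irr K x"
  note f = IrrE[OF K x(1) a]
  obtain d where d: "d \<ge> 1" "lin_indep K (\<lambda>i. x [^] i) d" "lin_span K (\<lambda>i. x [^] i) d = adjoin K {x}"
    "dimension d K (adjoin K {x})" "d = degree ?f"
    using algebraic_relation[OF K x] .
  have len: "length ?f = Suc d" and fn: "?f \<noteq> []" using d by auto
  have setf: "set ?f \<subseteq> K" using f(1) polynomial_incl by (auto simp: univ_poly_carrier[symmetric])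
  have cK: "coeff ?f i \<in> K" for i
  proof -
    have "coeff ?f i \<in> set ?f \<union> {\<zero>}" unfolding coeff_img(3)[symmetric] by (rule rangeI)
    thus ?thesis using setf subfield_closed(2)[OF K] by auto
  qed
  have cc: "coeff ?f \<in> A \<rightarrow> carrier R" for A using cK Kc by auto
  have cd: "coeff ?f d = \<one>" using lead_coeff_simp[OF fn] f(3) d(5) by simp
  have rel: "lincomb (coeff ?f) (\<lambda>i. x [^] i) (Suc d) = \<zero>"
    using eval_eq_lincomb[of ?f x] setf Kc x f(4) len by auto
  let ?D = "map (\<lambda>i. [Suc i] \<cdot> coeff ?f (Suc i)) (rev [0..<d])"
  have fd: "formal_deriv ?f = normalize ?D" unfolding formal_deriv_def d(5) ..
  have nK: "[(m::nat)] \<cdot> z \<in> K" if "z \<in> K" for m z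
    by (induction m) (use that Kc subfield_closed[OF K] in \<open>auto simp: add.nat_pow_Suc\<close>)
  have setD: "set ?D \<subseteq> K" using nK[OF cK] by (auto simp del: add.nat_pow_Suc)
  have fdK: "formal_deriv ?f \<in> carrier (K[X])"
    unfolding fd univ_poly_carrier[symmetric] by (rule normalize_gives_polynomial[OF setD])
  \<comment> \<open>The factor j in front of the j-th coefficient vanishes in the field only if p
    divides j.\<close>
  have fd0: "formal_deriv ?f = [] \<longleftrightarrow> (\<forall>j\<le>d. \<not> p dvd j \<longrightarrow> coeff ?f j = \<zero>)"
  proof
    assume "formal_deriv ?f = []"
    hence cz: "coeff ?D i = \<zero>" for i using normalize_coeff[of ?D] unfolding fd by simp
    show "\<forall>j\<le>d. \<not> p dvd j \<longrightarrow> coeff ?f j = \<zero>"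
    proof (intro allI impI)
      fix j assume j: "j \<le> d" "\<not> p dvd j"
      then obtain i where i: "j = Suc i" by (cases j) auto
      have "coeff ?D i = [Suc i] \<cdot> coeff ?f (Suc i)" using j i by (simp add: coeff_nth rev_nth)
      hence "[j] \<cdot> coeff ?f j = \<zero>" using cz i by simp
      thus "coeff ?f j = \<zero>" using nat_mult_eq_zero[of "coeff ?f j" j] cK Kc j by blast
    qed
  next
    assume h: "\<forall>j\<le>d. \<not> p dvd j \<longrightarrow> coeff ?f j = \<zero>"
    have "[Suc i] \<cdot> coeff ?f (Suc i) = \<zero>" if "i < d" for i
    proof (cases "p dvd Suc i")
      case True thus ?thesis using add_pow_multiple_zero[OF char_one True] cK Kc by blast
    next
      case False
      hence "coeff ?f (Suc i) = \<zero>" using h that by (meson Suc_leI)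
      thus ?thesis by (simp only: add.nat_pow_one)
    qed
    hence "?D = map (\<lambda>_. \<zero>) (rev [0..<d])" by auto
    also have "\<dots> = replicate d \<zero> @ []" by (simp add: map_replicate_const)
    finally show "formal_deriv ?f = []" unfolding fd using normalize_replicate_zero[of d "[]"] by simp
  qed
  show ?thesis
  proof
    assume sep: "separable_over K x"
    show "x \<in> adjoin K {x [^] p}"
    proof (rule ccontr)
      assume nx: "x \<notin> adjoin K {x [^] p}"
      have "coeff ?f j = \<zero>" if "j \<le> d" "\<not> p dvd j" for j
        by (rule relation_coeff_zero[OF K x(1) nx _ rel d(2) that]) (use cK in auto)
      hence "formal_deriv ?f = []" using fd0 by blast
      hence "?f divides\<^bsub>K[X]\<^esub> formal_deriv ?f"
        using UK.divides_zero[OF f(1)] by (simp add: univ_poly_zero)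
      moreover have "?f divides\<^bsub>K[X]\<^esub> ?f" using UK.divides_refl[OF f(1)] .
      ultimately have "?f \<in> Units (K[X])" using sep f(1) unfolding separable_over_def by blast
      thus False using pirreducibleE(2)[OF sr f(1,2)] by simp
    qed
  next
    assume xin: "x \<in> adjoin K {x [^] p}"
    have nz: "formal_deriv ?f \<noteq> []"
    proof
      assume "formal_deriv ?f = []"
      hence h: "\<And>j. j \<le> d \<Longrightarrow> \<not> p dvd j \<Longrightarrow> coeff ?f j = \<zero>" using fd0 by blast
      have "p dvd d" using h[of d] cd by auto
      then obtain m where m: "d = p * m" by auto
      have m0: "0 < m" "m < d" using m d(1) p_gt_1 by (auto simp: Suc_le_eq)
      have k: "p * Suc m = Suc d + (p - 1)" using m p_pos by simp
      have "lincomb (coeff ?f) (\<lambda>i. x [^] i) (p * Suc m) = lincomb (coeff ?f) (\<lambda>i. x [^] i) (Suc d) \<oplus>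
         lincomb (\<lambda>i. coeff ?f (Suc d + i)) (\<lambda>i. x [^] (Suc d + i)) (p - 1)"
        unfolding k by (rule lincomb_append) (use cK Kc x in auto)
      also have "lincomb (\<lambda>i. coeff ?f (Suc d + i)) (\<lambda>i. x [^] (Suc d + i)) (p - 1) = \<zero>"
        by (rule lincomb_zero) (use x len coeff_length[of ?f] in auto)
      finally have z: "lincomb (coeff ?f) (\<lambda>i. x [^] i) (p * Suc m) = \<zero>" using rel by simp
      let ?F = "\<lambda>a. lincomb (\<lambda>b. coeff ?f (p * b + a)) (\<lambda>b. (x [^] p) [^] b) (Suc m)"
      have F: "?F a \<in> carrier R" for a by (rule lincomb_closed) (use cK Kc x in auto)
      have "lincomb ?F (\<lambda>a. x [^] a) p = \<zero>"
        using lincomb_residues[OF cc x(1), of p "Suc m"] z by simp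
      \<comment> \<open>All exponents with nonzero coefficient are multiples of p, so only the
        residue 0 survives.\<close>
      moreover have "lincomb ?F (\<lambda>a. x [^] a) p = lincomb (\<lambda>a. if a = 0 then ?F 0 else \<zero>) (\<lambda>a. x [^] a) p"
      proof (rule lincomb_cong)
        fix a assume a: "a < p"
        have "?F a = \<zero>" if "a \<noteq> 0"
        proof (rule lincomb_zero)
          fix b
          have "\<not> p dvd (p * b + a)" using a that by (metis dvd_add_right_iff dvd_triv_left nat_dvd_not_less neq0_conv)
          thus "coeff ?f (p * b + a) = \<zero>"
            using h[of "p * b + a"] coeff_length[of ?f "p * b + a"] len by linarith
        qed (use x in auto)
        thus "?F a = (if a = 0 then ?F 0 else \<zero>)" by auto
      qed (use F[of 0] x in auto)
      moreover have "\<dots> = ?F 0 \<otimes> x [^] (0::nat)"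
        by (rule lincomb_delta[OF p_pos F]) (use x in auto)
      ultimately have F0: "?F 0 = \<zero>" using F[of 0] by simp
      have xp: "(\<lambda>b. (x [^] p) [^] b) \<in> {..<k} \<rightarrow> carrier R" for k :: nat using x by auto
      have lc: "lincomb (\<lambda>b. coeff ?f (p * b)) (\<lambda>b. (x [^] p) [^] b) m \<in> lin_span K (\<lambda>b. (x [^] p) [^] b) m"
        unfolding lin_span_def using cK by (intro CollectI exI conjI) auto
      have "(x [^] p) [^] m \<oplus> lincomb (\<lambda>b. coeff ?f (p * b)) (\<lambda>b. (x [^] p) [^] b) m = \<zero>"
        using F0 cK Kc x m cd by (subst (asm) lincomb_Suc) auto
      hence "(x [^] p) [^] m = \<ominus> lincomb (\<lambda>b. coeff ?f (p * b)) (\<lambda>b. (x [^] p) [^] b) m"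
        using lin_span_closed(1)[OF K xp, of m] lc x by (intro minus_equality[symmetric]) auto
      hence "(x [^] p) [^] m \<in> lin_span K (\<lambda>b. (x [^] p) [^] b) m"
        using lin_span_closed(4)[OF K xp lc] by simp
      then obtain d' where d': "d' \<le> m" "dimension d' K (adjoin K {x [^] p})"
        using adjoin_dimension_le[OF K _ m0(1), of "x [^] p"] x by auto
      have A: "subfield (adjoin K {x [^] p}) R" using adjoin_subfield[OF Kc] x by simp
      have "d \<le> d'"
        by (rule lin_indep_le_dimension[OF K d'(2) d(2)]) (use subfield_pow[OF A xin] in auto)
      thus False using d' m0 by simp
    qed
    show "separable_over K x" unfolding separable_over_def
    proof (intro conjI ballI impI x(2))
      fix g assume g: "g \<in> carrier (K[X])" "g divides\<^bsub>K[X]\<^esub> ?f \<and> g divides\<^bsub>K[X]\<^esub> formal_deriv ?f"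
      show "g \<in> Units (K[X])"
      proof (rule ccontr)
        assume "g \<notin> Units (K[X])"
        hence "g \<sim>\<^bsub>K[X]\<^esub> ?f" using divides_pirreducible_condition[OF f(2) g(1)] g(2) by blast
        hence "?f divides\<^bsub>K[X]\<^esub> g" by (simp add: associated_def)
        hence "?f divides\<^bsub>K[X]\<^esub> formal_deriv ?f" using g UK.divides_trans f(1) by blast
        hence "?f pdivides formal_deriv ?f" using pdivides_iff_shell[OF K f(1) fdK] by simp
        hence "degree ?f \<le> degree (formal_deriv ?f)" using pdivides_imp_degree_le[OF sr f(1) fdK nz] by simp
        also have "degree (formal_deriv ?f) < d"
          using normalize_length_le[of ?D] d(1) unfolding fd by simp
        finally show False using d(5) by simp
      qed
    qed
  qed
qed

text \<open>Frobenius turns x in K(x^(p^e)) into x^p in K(x^(p^(e+1))), and x lies in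
  K(x^p).\<close>

lemma separable_adjoin_pow:
  assumes K: "subfield K R" and x: "x \<in> carrier R" "x \<in> adjoin K {x [^] p}"
  shows "x \<in> adjoin K {x [^] (p ^ e)}"
proof (induction e)
  case 0 thus ?case using adjoin_incl(2)[of "{x}" K] x by (simp add: nat_pow_eone)
next
  case (Suc e)
  note Kc = subfield_closed(1)[OF K]
  let ?E = "adjoin K {x [^] (p ^ Suc e)}"
  have E: "subfield ?E R" using adjoin_subfield[OF Kc] x by simp
  have "x [^] (p ^ 1) \<in> ?E"
  proof (rule frob_adjoin[OF E Kc _ _ _ Suc.IH])
    show "y [^] (p ^ 1) \<in> ?E" if "y \<in> K" for y
      using that subfield_pow[OF K that] adjoin_incl(1)[of K] by blast
    show "y [^] (p ^ 1) \<in> ?E" if "y \<in> {x [^] (p ^ e)}" for y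
      using that x(1) adjoin_incl(2)[of "{x [^] (p ^ Suc e)}" K] by (simp add: nat_pow_pow mult.commute)
  qed (use x in auto)
  hence "adjoin K {x [^] p} \<subseteq> ?E" using adjoin_least[OF E adjoin_incl(1)] by simp
  thus ?case using x(2) by blast
qed

text \<open>Compare K(x^p) with K(x) inside K(t) by \<open>subfield_eq_of_frobenius_span\<close>:
  since t lies in K(t^p), the field K(t) is generated over \<open>K\<close> by p-th powers, so the
  two fields coincide.\<close>

lemma simple_separable:
  assumes K: "subfield K R" and t: "t \<in> carrier R" "algebraic K t" "t \<in> adjoin K {t [^] p}"
    and x: "x \<in> adjoin K {t}"
  shows "x \<in> adjoin K {x [^] p}"
proof -
  note Kc = subfield_closed(1)[OF K]
  let ?S = "adjoin K {t}" and ?E = "adjoin K {x [^] p}" and ?E1 = "adjoin K {x}"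
  have S: "subfield ?S R" using adjoin_subfield[OF Kc] t by simp
  have xc: "x \<in> carrier R" using x subfield_closed(1)[OF S] by auto
  have E: "subfield ?E R" "subfield ?E1 R" using adjoin_subfield[OF Kc] xc by auto
  have fS: "finite_dimension K ?S" using finite_dimension_adjoin[OF K, of "{t}"] t by auto
  have KS: "K \<subseteq> ?S" "K \<subseteq> ?E" "K \<subseteq> ?E1" by (rule adjoin_incl)+
  have xs: "x \<in> ?E1" "x [^] p \<in> ?E" "x [^] p \<in> ?E1"
    using adjoin_incl(2)[of "{x}" K] adjoin_incl(2)[of "{x [^] p}" K] subfield_pow[OF E(2)] by auto
  have EE: "?E \<subseteq> ?E1" "?E1 \<subseteq> ?S" using adjoin_least[OF E(2) KS(3), of "{x [^] p}"]
      adjoin_least[OF S KS(1), of "{x}"] xs x by auto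
  obtain d where d: "dimension d ?E1 ?S"
    using finite_dimension_upper[OF K E(2) S KS(3) EE(2) fS] by (auto simp: finite_dimension_def)
  have f: "finite_dimension ?E ?E1"
    using finite_dimension_upper[OF K E(1) E(2) KS(2) EE(1)] finite_dimension_lower[OF K E(2) KS(3) EE(2) fS] by blast
  have "?E1 = ?E"
  proof (rule subfield_eq_of_frobenius_span[OF E S EE d f])
    show "y [^] p \<in> ?E" if "y \<in> ?E1" for y
    proof -
      have "y [^] (p ^ 1) \<in> ?E"
        by (rule frob_adjoin[OF E(1) Kc _ _ _ that]) (use xc xs KS subfield_pow[OF K] in auto)
      thus ?thesis by simp
    qed
    let ?B = "adjoin ?E ((\<lambda>x. x [^] p) ` ?S)"
    have Sp: "(\<lambda>x. x [^] p) ` ?S \<subseteq> carrier R" using subfield_closed(1)[OF S] by auto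
    have B: "subfield ?B R" by (rule adjoin_subfield[OF subfield_closed(1)[OF E(1)] Sp])
    have KB: "K \<subseteq> ?B" using KS(2) adjoin_incl(1)[of ?E] by blast
    have "t \<in> ?S" using adjoin_incl(2)[of "{t}" K] by auto
    hence "t [^] p \<in> ?B" using adjoin_incl(2)[of "(\<lambda>x. x [^] p) ` ?S" ?E] by auto
    hence "t \<in> ?B" using t(3) adjoin_least[OF B KB, of "{t [^] p}"] by auto
    thus "?S \<subseteq> ?B" using adjoin_least[OF B KB, of "{t}"] by auto
  qed
  thus ?thesis using xs by simp
qed

end

section \<open>Algebraic hulls and transcendence degree\<close>

context cring
begin

lemma lincomb_swap:
  assumes "\<And>i j. i < n \<Longrightarrow> j < m \<Longrightarrow> a i j \<in> carrier R" "u \<in> {..<m} \<rightarrow> carrier R" "w \<in> {..<n} \<rightarrow> carrier R"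
  shows "lincomb (\<lambda>i. lincomb (a i) u m) w n = lincomb (\<lambda>j. lincomb (\<lambda>i. a i j) w n) u m"
  using assms(1,3)
proof (induction n)
  case 0 thus ?case using assms(2) by (simp add: lincomb_zero)
next
  case (Suc n)
  have w: "w \<in> {..<n} \<rightarrow> carrier R" "w n \<in> carrier R" using Suc.prems by (auto simp: Pi_iff)
  have a: "a i \<in> {..<m} \<rightarrow> carrier R" if "i \<le> n" for i using Suc.prems(1) that by auto
  have l: "lincomb (a i) u m \<in> carrier R" if "i \<le> n" for i using lincomb_closed[OF a[OF that] assms(2)] .
  have r: "lincomb (\<lambda>i. a i j) w n \<in> carrier R" if "j < m" for j
    by (rule lincomb_closed) (use Suc.prems(1) that w in auto)
  have "lincomb (\<lambda>i. lincomb (a i) u m) w (Suc n) =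
      lincomb (a n) u m \<otimes> w n \<oplus> lincomb (\<lambda>i. lincomb (a i) u m) w n"
    by (rule lincomb_Suc) (use l Suc.prems in auto)
  also have "\<dots> = lincomb (\<lambda>j. w n \<otimes> a n j) u m \<oplus> lincomb (\<lambda>j. lincomb (\<lambda>i. a i j) w n) u m"
    using Suc.IH[OF _ w(1)] Suc.prems(1) lincomb_smult[OF a[of n] w(2) assms(2)] l[of n] w by (simp add: m_comm)
  also have "\<dots> = lincomb (\<lambda>j. w n \<otimes> a n j \<oplus> lincomb (\<lambda>i. a i j) w n) u m"
    by (rule lincomb_add[symmetric]) (use a[of n] r w assms(2) in \<open>auto simp: Pi_iff\<close>)
  also have "\<dots> = lincomb (\<lambda>j. lincomb (\<lambda>i. a i j) w (Suc n)) u m"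
  proof (rule lincomb_cong)
    fix j assume j: "j < m"
    show "w n \<otimes> a n j \<oplus> lincomb (\<lambda>i. a i j) w n = lincomb (\<lambda>i. a i j) w (Suc n)"
      using Suc.prems j w by (subst lincomb_Suc) (auto simp: m_comm Pi_iff)
  next
    show "(\<lambda>j. lincomb (\<lambda>i. a i j) w (Suc n)) \<in> {..<m} \<rightarrow> carrier R"
      using Suc.prems by (intro Pi_I lincomb_closed) auto
  qed (use assms(2) in auto)
  finally show ?case .
qed

end

section \<open>Clearing denominators and exchange\<close>

context field
begin

lemma generate_field_subring:
  assumes "subring D R"
  shows "generate_field R D = {u \<otimes> inv v | u v. u \<in> D \<and> v \<in> D - {\<zero>}}" (is "_ = ?T")
proof
  note D = subringE[OF assms]
  have inv: "inv v \<in> carrier R" "v \<otimes> inv v = \<one>" "inv v \<noteq> \<zero>" "inv (inv v) = v" if "v \<in> D - {\<zero>}" for v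
  proof -
    have v: "v \<in> Units R" using that D(1) by (auto simp: field_Units)
    thus i: "inv v \<in> carrier R" "v \<otimes> inv v = \<one>" "inv (inv v) = v" by auto
    show "inv v \<noteq> \<zero>" using i v by (metis Units_closed r_null zero_not_one)
  qed
  have Dc: "x \<in> carrier R" if "x \<in> D" for x using that D(1) by auto
  have sub: "subfield ?T R"
  proof (rule subfieldI'[OF subringI])
    show "?T \<subseteq> carrier R" using Dc inv by auto
    show "\<one> \<in> ?T" using D(3) by (intro CollectI exI[of _ \<one>] conjI) auto
    fix h assume "h \<in> ?T"
    then obtain u v where uv: "u \<in> D" "v \<in> D - {\<zero>}" "h = u \<otimes> inv v" by auto
    show "\<ominus> h \<in> ?T" using uv D(5) Dc inv
      by (intro CollectI exI[of _ "\<ominus> u"] exI[of _ v] conjI) (auto simp: l_minus)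
    fix h' assume "h' \<in> ?T"
    then obtain u' v' where uv': "u' \<in> D" "v' \<in> D - {\<zero>}" "h' = u' \<otimes> inv v'" by auto
    have vv: "v \<otimes> v' \<in> D - {\<zero>}" using uv(2) uv'(2) D(6) Dc by (auto simp: integral_iff)
    have i: "inv (v \<otimes> v') = inv v \<otimes> inv v'"
    proof (rule comm_inv_char)
      have "v \<otimes> v' \<otimes> (inv v \<otimes> inv v') = (v \<otimes> inv v) \<otimes> (v' \<otimes> inv v')"
        using uv(2) uv'(2) Dc inv(1) by (simp add: m_ac)
      thus "v \<otimes> v' \<otimes> (inv v \<otimes> inv v') = \<one>" using inv(2) uv uv' by simp
    qed (use uv uv' Dc inv(1) in auto)
    have "h \<otimes> h' = u \<otimes> u' \<otimes> inv (v \<otimes> v')"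
      unfolding i uv(3) uv'(3) using uv(1,2) uv'(1,2) Dc inv(1) by (simp add: m_ac)
    thus "h \<otimes> h' \<in> ?T" using vv D(6)[OF uv(1) uv'(1)] by blast
    have "h \<oplus> h' = (u \<otimes> v' \<oplus> u' \<otimes> v) \<otimes> inv (v \<otimes> v')"
    proof -
      have "(u \<otimes> v' \<oplus> u' \<otimes> v) \<otimes> inv (v \<otimes> v') = u \<otimes> inv v \<otimes> (v' \<otimes> inv v') \<oplus> u' \<otimes> inv v' \<otimes> (v \<otimes> inv v)"
        unfolding i using uv uv' Dc inv(1) by (simp add: l_distr r_distr m_ac)
      thus ?thesis using uv uv' Dc inv(1,2) by simp
    qed
    thus "h \<oplus> h' \<in> ?T" using uv uv' vv D(6,7)
      by (intro CollectI exI[of _ "u \<otimes> v' \<oplus> u' \<otimes> v"] exI[of _ "v \<otimes> v'"] conjI) auto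
  next
    fix h assume "h \<in> ?T - {\<zero>}"
    then obtain u v where uv: "u \<in> D" "v \<in> D - {\<zero>}" "h = u \<otimes> inv v" "h \<noteq> \<zero>" by auto
    hence u: "u \<in> D - {\<zero>}" using inv by auto
    have "inv h = v \<otimes> inv u" unfolding uv(3)
    proof (rule comm_inv_char)
      have "u \<otimes> inv v \<otimes> (v \<otimes> inv u) = (u \<otimes> inv u) \<otimes> (v \<otimes> inv v)"
        using u uv Dc inv(1) by (simp add: m_ac)
      thus "u \<otimes> inv v \<otimes> (v \<otimes> inv u) = \<one>" using inv(2) u uv by simp
    qed (use u uv Dc inv in auto)
    thus "inv h \<in> ?T" using u uv by auto
  qed
  have DT: "D \<subseteq> ?T"
  proof
    fix x assume x: "x \<in> D"
    thus "x \<in> ?T" using D(3) Dc by (intro CollectI exI[of _ x] exI[of _ \<one>] conjI) auto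
  qed
  show "generate_field R D \<subseteq> ?T" by (rule generate_field_min_subfield1[OF D(1) sub DT])
  have G: "subfield (generate_field R D) R" by (rule generate_field_is_subfield[OF D(1)])
  show "?T \<subseteq> generate_field R D"
    using subfield_closed(5)[OF G] subfield_inv[OF G] generate_field.incl[of _ D R] by blast
qed

lemma common_denominator:
  assumes "subring D R" "\<And>i. i < (n::nat) \<Longrightarrow> c i \<in> generate_field R D"
  shows "\<exists>w \<in> D - {\<zero>}. \<forall>i<n. w \<otimes> c i \<in> D"
  using assms(2)
proof (induction n)
  note D = subringE[OF assms(1)]
  {
    case 0 show ?case using D(3) by auto
  next
    case (Suc n)
    then obtain w where w: "w \<in> D - {\<zero>}" "\<And>i. i < n \<Longrightarrow> w \<otimes> c i \<in> D" by force
    obtain u v where uv: "u \<in> D" "v \<in> D - {\<zero>}" "c n = u \<otimes> inv v"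
      using Suc.prems[of n] unfolding generate_field_subring[OF assms(1)] by auto
    have cc: "c i \<in> carrier R" if "i < Suc n" for i
      using Suc.prems[OF that] generate_field_in_carrier[OF D(1)] by blast
    have Dc: "x \<in> carrier R" if "x \<in> D" for x using that D(1) by auto
    have vi: "inv v \<in> carrier R" "v \<otimes> inv v = \<one>" using uv Dc by (auto simp: field_Units)
    have "w \<otimes> v \<in> D - {\<zero>}" using w(1) uv(2) D(6) Dc by (auto simp: integral_iff)
    moreover have "w \<otimes> v \<otimes> c i \<in> D" if i: "i < Suc n" for i
    proof (cases "i = n")
      case True
      have "w \<otimes> v \<otimes> c i = w \<otimes> (u \<otimes> (v \<otimes> inv v))"
        unfolding True uv(3) using w(1) uv Dc vi(1) by (simp add: m_ac)
      also have "\<dots> = w \<otimes> u" using vi(2) uv Dc by simp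
      finally show ?thesis using w uv D(6) by simp
    next
      case False
      hence "w \<otimes> c i \<in> D" using w i by simp
      moreover have "w \<otimes> v \<otimes> c i = v \<otimes> (w \<otimes> c i)" using w uv Dc cc[OF i] by (simp add: m_ac)
      ultimately show ?thesis using uv D(6) by simp
    qed
    ultimately show ?case by blast
  }
qed

lemma algebraic_clear_denominators:
  assumes "subring D R" "x \<in> carrier R" "algebraic (generate_field R D) x"
  obtains n c where "c \<in> {..<n} \<rightarrow> D" "lincomb c (\<lambda>i. x [^] i) n = \<zero>" "\<exists>i<n. c i \<noteq> \<zero>"
proof -
  note D = subringE[OF assms(1)]
  have G: "subfield (generate_field R D) R" by (rule generate_field_is_subfield[OF D(1)])
  obtain n c where c: "c \<in> {..<n} \<rightarrow> generate_field R D" "lincomb c (\<lambda>i. x [^] i) n = \<zero>" "\<exists>i<n. c i \<noteq> \<zero>"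
    using algebraic_coefficients[OF G assms(2,3)] .
  have cc: "c \<in> {..<n} \<rightarrow> carrier R" using Pi_subset[OF c(1) subfield_closed(1)[OF G]] .
  obtain w where w: "w \<in> D - {\<zero>}" "\<And>i. i < n \<Longrightarrow> w \<otimes> c i \<in> D"
    using common_denominator[OF assms(1), of n c] c(1) by auto
  have wc: "w \<in> carrier R" using w D(1) by auto
  have "lincomb (\<lambda>i. w \<otimes> c i) (\<lambda>i. x [^] i) n = \<zero>"
    using lincomb_smult[OF cc wc, of "\<lambda>i. x [^] i"] c(2) assms(2) wc by auto
  moreover have "\<exists>i<n. w \<otimes> c i \<noteq> \<zero>" using c(3) w(1) wc cc integral by (metis DiffE PiE insertI1 lessThan_iff)
  ultimately show ?thesis using that[of "\<lambda>i. w \<otimes> c i" n] w by auto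
qed

lemma lin_span_le:
  assumes "subfield E R" "v \<in> {..<n} \<rightarrow> carrier R" "m \<le> n"
  shows "lin_span E v m \<subseteq> lin_span E v n"
  by (rule lin_span_minimal)
    (use lin_span_closed[OF assms(1,2)] subfield_closed(1)[OF assms(1)] assms in \<open>auto simp: Pi_iff\<close>)

lemma simple_extension_eq_lin_span:
  assumes "subfield E R" "x \<in> carrier R"
  shows "y \<in> simple_extension E x \<longleftrightarrow> (\<exists>n. y \<in> lin_span E (\<lambda>i. x [^] i) n)"
proof
  note Ec = subfield_closed(1)[OF assms(1)]
  assume "y \<in> simple_extension E x"
  then obtain f where f: "f \<in> carrier (E[X])" "y = eval f x"
    using simple_extension_as_eval_img[OF Ec assms(2)] by auto
  have s: "set f \<subseteq> E" using f(1) polynomial_incl by (auto simp: univ_poly_carrier[symmetric])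
  have "y = lincomb (coeff f) (\<lambda>i. x [^] i) (length f)"
    using eval_eq_lincomb[of f x] s Ec assms(2) f(2) by auto
  moreover have "coeff f \<in> {..<length f} \<rightarrow> E" using coeff_img_restrict[of f] s by auto
  ultimately show "\<exists>n. y \<in> lin_span E (\<lambda>i. x [^] i) n" by (auto simp: lin_span_def)
next
  note Ec = subfield_closed(1)[OF assms(1)]
  assume "\<exists>n. y \<in> lin_span E (\<lambda>i. x [^] i) n"
  then obtain n where n: "y \<in> lin_span E (\<lambda>i. x [^] i) n" by auto
  note S = subringE[OF simple_extension_is_subring[OF subfieldE(1)[OF assms(1)] assms(2)]]
  have xS: "x \<in> simple_extension E x" "E \<subseteq> simple_extension E x"
    using simple_extension_mem[OF subfieldE(1)[OF assms(1)] assms(2)] simple_extension_incl[OF Ec assms(2)] by auto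
  have xp: "x [^] (i::nat) \<in> simple_extension E x" for i by (induction i) (use S xS in auto)
  have "lin_span E (\<lambda>i. x [^] i) n \<subseteq> simple_extension E x"
    by (rule lin_span_minimal) (use S xS xp Ec assms(2) in auto)
  thus "y \<in> simple_extension E x" using n by auto
qed

lemma adjoin_eq_generate_field_simple_extension:
  assumes "subfield E R" "x \<in> carrier R"
  shows "adjoin E {x} = generate_field R (simple_extension E x)"
proof
  note Ec = subfield_closed(1)[OF assms(1)]
  note sr = simple_extension_is_subring[OF subfieldE(1)[OF assms(1)] assms(2)]
  have A: "subfield (adjoin E {x}) R" using adjoin_subfield[OF Ec] assms(2) by simp
  have "E \<union> {x} \<subseteq> simple_extension E x"
    using simple_extension_mem[OF subfieldE(1)[OF assms(1)] assms(2)] simple_extension_incl[OF Ec assms(2)] by simp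
  thus "adjoin E {x} \<subseteq> generate_field R (simple_extension E x)"
    by (rule mono_generate_field) (rule subringE(1)[OF sr])
  have "simple_extension E x \<subseteq> adjoin E {x}"
    by (rule simple_extension_subring_incl[OF subfieldE(1)[OF A] adjoin_incl(1)])
      (use adjoin_incl(2)[of "{x}" E] in simp)
  thus "generate_field R (simple_extension E x) \<subseteq> adjoin E {x}"
    by (rule generate_field_min_subfield1[OF subringE(1)[OF sr] A])
qed

lemma simple_extension_uniform:
  fixes n :: nat
  assumes E: "subfield E R" and x: "x \<in> carrier R" and c: "\<And>i. i < n \<Longrightarrow> c i \<in> simple_extension E x"
  shows "\<exists>m a. \<forall>i<n. a i \<in> {..<m} \<rightarrow> E \<and> c i = lincomb (a i) (\<lambda>i. x [^] i) m"
proof -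
  have "\<exists>m. \<forall>i<k. c i \<in> lin_span E (\<lambda>i. x [^] i) m" if "k \<le> n" for k
    using that
  proof (induction k)
    case (Suc k)
    then obtain m where m: "\<And>i. i < k \<Longrightarrow> c i \<in> lin_span E (\<lambda>i. x [^] i) m" by auto
    obtain m' where m': "c k \<in> lin_span E (\<lambda>i. x [^] i) m'"
      using c[of k] Suc.prems simple_extension_eq_lin_span[OF E x, of "c k"] by auto
    have "lin_span E (\<lambda>i. x [^] i) m \<subseteq> lin_span E (\<lambda>i. x [^] i) (max m m')"
      "lin_span E (\<lambda>i. x [^] i) m' \<subseteq> lin_span E (\<lambda>i. x [^] i) (max m m')"
      using lin_span_le[OF E, of "\<lambda>i. x [^] i" "max m m'"] x by auto
    thus ?case using m m' by (intro exI[of _ "max m m'"]) (auto simp: less_Suc_eq)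
  qed simp
  then obtain m where "\<And>i. i < n \<Longrightarrow> c i \<in> lin_span E (\<lambda>i. x [^] i) m" by blast
  hence "\<forall>i. \<exists>a. i < n \<longrightarrow> a \<in> {..<m} \<rightarrow> E \<and> c i = lincomb a (\<lambda>i. x [^] i) m"
    unfolding lin_span_def by blast
  then obtain a where a: "\<And>i. i < n \<Longrightarrow> a i \<in> {..<m} \<rightarrow> E" "\<And>i. i < n \<Longrightarrow> c i = lincomb (a i) (\<lambda>i. x [^] i) m"
    by metis
  thus ?thesis by blast
qed

text \<open>Cleared of denominators, the relation for \<open>y\<close> over E(x) is a polynomial
  relation between \<open>x\<close> and \<open>y\<close>. Swapping the two sums makes it a relation
  for \<open>x\<close> over E(y), which is nontrivial because \<open>y\<close> is transcendental
  over \<open>E\<close>.\<close>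

lemma algebraic_exchange:
  assumes E: "subfield E R" and xy: "x \<in> carrier R" "y \<in> carrier R"
    and alg: "algebraic (adjoin E {x}) y" "\<not> algebraic E y"
  shows "algebraic (adjoin E {y}) x"
proof -
  note Ec = subfield_closed(1)[OF E]
  have sr: "subring (simple_extension E x) R"
    using simple_extension_is_subring[OF subfieldE(1)[OF E] xy(1)] .
  obtain n c where c: "c \<in> {..<n} \<rightarrow> simple_extension E x" "lincomb c (\<lambda>i. y [^] i) n = \<zero>" "\<exists>i<n. c i \<noteq> \<zero>"
    using algebraic_clear_denominators[OF sr xy(2) alg(1)[unfolded adjoin_eq_generate_field_simple_extension[OF E xy(1)]]] .
  have cs: "\<And>i. i < n \<Longrightarrow> c i \<in> simple_extension E x" using c(1) by auto
  obtain a m where a: "\<And>i. i < n \<Longrightarrow> a i \<in> {..<m} \<rightarrow> E" "\<And>i. i < n \<Longrightarrow> c i = lincomb (a i) (\<lambda>i. x [^] i) m"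
    using simple_extension_uniform[OF E xy(1), of n c] cs by blast
  have ac: "a i j \<in> carrier R" if "i < n" "j < m" for i j using a(1)[OF that(1)] that Ec by auto
  have pc: "(\<lambda>i. x [^] (i::nat)) \<in> B \<rightarrow> carrier R" "(\<lambda>i. y [^] (i::nat)) \<in> B \<rightarrow> carrier R" for B
    using xy by auto
  define b where "b = (\<lambda>j. lincomb (\<lambda>i. a i j) (\<lambda>i. y [^] i) n)"
  have Ey: "subfield (adjoin E {y}) R" using adjoin_subfield[OF Ec] xy by simp
  have Eys: "E \<subseteq> adjoin E {y}" "y \<in> adjoin E {y}" using adjoin_incl(1)[of E] adjoin_incl(2)[of "{y}" E] by auto
  have bE: "b j \<in> adjoin E {y}" if "j < m" for j
    unfolding b_def lincomb_def
  proof (intro subfield_finsum[OF Ey] Pi_I subfield_closed(5)[OF Ey] subfield_pow[OF Ey Eys(2)])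
    fix i assume "i \<in> {..<n}"
    hence "a i j \<in> E" using a(1)[of i] that by auto
    thus "a i j \<in> adjoin E {y}" using Eys(1) by blast
  qed
  have "\<zero> = lincomb (\<lambda>i. lincomb (a i) (\<lambda>i. x [^] i) m) (\<lambda>i. y [^] i) n"
    unfolding c(2)[symmetric]
  proof (rule lincomb_cong)
    show "c i = lincomb (a i) (\<lambda>i. x [^] i) m" if "i < n" for i using a(2)[OF that] .
    show "(\<lambda>i. lincomb (a i) (\<lambda>i. x [^] i) m) \<in> {..<n} \<rightarrow> carrier R"
      by (intro Pi_I lincomb_closed pc) (use ac in simp)
  qed (use pc in auto)
  also have "\<dots> = lincomb b (\<lambda>i. x [^] i) m" unfolding b_def by (rule lincomb_swap) (use ac pc in auto)
  finally have rel: "lincomb b (\<lambda>i. x [^] i) m = \<zero>" by simp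
  have "\<exists>j<m. b j \<noteq> \<zero>"
  proof (rule ccontr)
    assume "\<not> ?thesis"
    hence b0: "b j = \<zero>" if "j < m" for j using that by blast
    have "a i j = \<zero>" if "i < n" "j < m" for i j
      using lin_indepD[OF not_algebraic_lin_indep[OF E xy(2) alg(2)], of "\<lambda>i. a i j" n i] b0[OF that(2)] a(1) that
      unfolding b_def by (auto simp: Pi_iff)
    hence "c i = \<zero>" if "i < n" for i
      using a(2)[OF that] lincomb_zero[of m "a i" "\<lambda>i. x [^] i"] pc that by simp
    thus False using c(3) by blast
  qed
  thus ?thesis using algebraicI_relation[OF Ey xy(1) _ rel] bE by auto
qed

section \<open>The closure operator of algebraic dependence\<close>

definition algebraic_hull :: "'a set \<Rightarrow> 'a set \<Rightarrow> 'a set" where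
  "algebraic_hull F A = {x \<in> carrier R. algebraic (adjoin F A) x}"

text \<open>Independence for the closure operator \<open>algebraic_hull\<close>. Comparing
  cardinalities then rests on exchange and the closure properties alone; polynomials return only
  when this notion is matched with \<open>alg_independent\<close>.\<close>

definition hull_independent :: "'a set \<Rightarrow> 'a set \<Rightarrow> bool" where
  "hull_independent F A \<longleftrightarrow> (\<forall>a\<in>A. a \<notin> algebraic_hull F (A - {a}))"

lemma algebraic_hull_subfield:
  assumes "F \<subseteq> carrier R" "A \<subseteq> carrier R" shows "subfield (algebraic_hull F A) R"
  using subfield_of_algebraics[OF adjoin_subfield[OF assms]]
  by (simp add: algebraic_hull_def over_def)

lemma algebraic_hull_incl:
  assumes "F \<subseteq> carrier R" "A \<subseteq> carrier R"
  shows "adjoin F A \<subseteq> algebraic_hull F A" "F \<subseteq> algebraic_hull F A" "A \<subseteq> algebraic_hull F A"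
proof -
  have sf: "subfield (adjoin F A) R" by (rule adjoin_subfield[OF assms])
  show "adjoin F A \<subseteq> algebraic_hull F A"
    using algebraic_self[OF subfieldE(1)[OF sf]] subfield_closed(1)[OF sf]
    by (auto simp: algebraic_hull_def over_def)
  thus "F \<subseteq> algebraic_hull F A" "A \<subseteq> algebraic_hull F A"
    using adjoin_incl(1)[of F A] adjoin_incl(2)[of A F] by blast+
qed

lemma algebraic_hull_idem:
  assumes "F \<subseteq> carrier R" "A \<subseteq> carrier R" "F' \<subseteq> algebraic_hull F A" "B \<subseteq> algebraic_hull F A"
  shows "algebraic_hull F' B \<subseteq> algebraic_hull F A"
proof
  note H = algebraic_hull_subfield[OF assms(1,2)]
  fix x assume x: "x \<in> algebraic_hull F' B"
  hence xc: "x \<in> carrier R" by (simp add: algebraic_hull_def)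
  have "adjoin F' B \<subseteq> algebraic_hull F A" by (rule adjoin_least[OF H assms(3,4)])
  hence "algebraic (algebraic_hull F A) x"
    using x algebraic_mono[of "adjoin F' B" "algebraic_hull F A" x]
    by (auto simp: algebraic_hull_def over_def)
  hence "algebraic (adjoin F A) x"
    using algebraic_trans[OF adjoin_subfield[OF assms(1,2)] H _ xc] by (auto simp: algebraic_hull_def)
  thus "x \<in> algebraic_hull F A" using xc by (simp add: algebraic_hull_def)
qed

lemma algebraic_hull_mono:
  assumes "F \<subseteq> carrier R" "A \<subseteq> B" "B \<subseteq> carrier R"
  shows "algebraic_hull F A \<subseteq> algebraic_hull F B"
  by (rule algebraic_hull_idem[OF assms(1,3)]) (use algebraic_hull_incl[OF assms(1,3)] assms in auto)

lemma algebraic_hull_exchange: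
  assumes "F \<subseteq> carrier R" "A \<subseteq> carrier R" "x \<in> carrier R"
    "y \<in> algebraic_hull F (insert x A)" "y \<notin> algebraic_hull F A"
  shows "x \<in> algebraic_hull F (insert y A)"
proof -
  have y: "y \<in> carrier R" using assms(4) by (simp add: algebraic_hull_def)
  have e: "adjoin (adjoin F A) {z} = adjoin F (insert z A)" if "z \<in> carrier R" for z
    using adjoin_adjoin[OF assms(1,2), of "{z}"] that by (simp add: Un_insert_right)
  show ?thesis
    using algebraic_exchange[OF adjoin_subfield[OF assms(1,2)] assms(3) y] assms(3-5) y
    by (simp add: algebraic_hull_def e)
qed

text \<open>Steinitz replacement, by induction on the number of elements of \<open>A\<close> outside
  \<open>C\<close>. Some \<open>c\<close> in \<open>C\<close> escapes the hull of \<open>A\<close>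
  without \<open>a\<close>, since otherwise \<open>a\<close>, lying in the hull of \<open>C\<close>,
  would lie in that hull too. Exchanging \<open>a\<close> for \<open>c\<close> keeps independence
  and cardinality.\<close>

theorem hull_independent_card_le:
  assumes F: "F \<subseteq> carrier R" and A: "finite A" "A \<subseteq> carrier R" "hull_independent F A"
    and C: "finite C" "C \<subseteq> carrier R" "A \<subseteq> algebraic_hull F C"
  shows "card A \<le> card C"
  using A C(3)
proof (induction "card (A - C)" arbitrary: A rule: less_induct)
  case less
  show ?case
  proof (cases "A \<subseteq> C")
    case True thus ?thesis using card_mono[OF C(1)] by blast
  next
    case False
    then obtain a where a: "a \<in> A" "a \<notin> C" by blast
    let ?B = "A - {a}"
    have Bc: "?B \<subseteq> carrier R" using less.prems by auto
    have anot: "a \<notin> algebraic_hull F ?B" using less.prems(3) a(1) by (auto simp: hull_independent_def)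
    have "\<not> C \<subseteq> algebraic_hull F ?B"
    proof
      assume "C \<subseteq> algebraic_hull F ?B"
      hence "algebraic_hull F C \<subseteq> algebraic_hull F ?B"
        using algebraic_hull_idem[OF F Bc] algebraic_hull_incl[OF F Bc] by blast
      thus False using less.prems(4) a anot by blast
    qed
    then obtain c where c: "c \<in> C" "c \<notin> algebraic_hull F ?B" by blast
    have cc: "c \<in> carrier R" using c C by auto
    have cA: "c \<notin> A" using c a algebraic_hull_incl(3)[OF F Bc] by auto
    let ?A = "insert c ?B"
    have ind: "hull_independent F ?A" unfolding hull_independent_def
    proof
      fix z assume z: "z \<in> ?A"
      show "z \<notin> algebraic_hull F (?A - {z})"
      proof (cases "z = c")
        case True
        hence "?A - {z} = ?B" using cA by auto
        thus ?thesis using c True by simp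
      next
        case False
        hence zB: "z \<in> ?B" using z by auto
        let ?D = "?B - {z}"
        have Dc: "?D \<subseteq> carrier R" "z \<in> carrier R" using Bc zB by auto
        have e: "?A - {z} = insert c ?D" using False cA by auto
        have "z \<notin> algebraic_hull F ?D"
        proof
          assume "z \<in> algebraic_hull F ?D"
          hence "z \<in> algebraic_hull F (A - {z})"
            using algebraic_hull_mono[OF F, of ?D "A - {z}"] less.prems(2) by blast
          thus False using less.prems(3) zB by (auto simp: hull_independent_def)
        qed
        moreover have "insert z ?D = ?B" using zB by auto
        ultimately show ?thesis unfolding e
          using algebraic_hull_exchange[OF F Dc(1) cc, of z] c(2) by metis
      qed
    qed
    have "?A - C = (A - C) - {a}" using c by auto
    moreover have "a \<in> A - C" using a by auto
    ultimately have lt: "card (?A - C) < card (A - C)"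
      using less.prems(1) by (metis card_Diff1_less finite_Diff)
    have "?A \<subseteq> algebraic_hull F C" using less.prems(4) algebraic_hull_incl(3)[OF F C(2)] c(1) by auto
    hence "card ?A \<le> card C" using less.hyps[OF lt _ _ ind] less.prems(1) Bc cc by auto
    moreover have "card ?A = card A"
      using cA a less.prems(1) by (metis Diff_iff card_insert_disjoint card_Suc_Diff1 finite_Diff)
    ultimately show ?thesis by simp
  qed
qed

section \<open>Polynomial values and algebraic independence\<close>

abbreviation monomial_value :: "'a multiset \<Rightarrow> 'a" where
  "monomial_value m \<equiv> (\<Otimes>x\<in>set_mset m. x [^] count m x)"

lemma monomial_value_closed: "set_mset m \<subseteq> carrier R \<Longrightarrow> monomial_value m \<in> carrier R"
  by (rule finprod_closed) auto

lemma monomial_value_split: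
  assumes "set_mset m \<subseteq> carrier R" "a \<in> carrier R"
  shows "monomial_value m = monomial_value (filter_mset (\<lambda>x. x \<noteq> a) m) \<otimes> a [^] count m a"
proof (cases "a \<in># m")
  case False
  hence "filter_mset (\<lambda>x. x \<noteq> a) m = m" by (auto simp: filter_mset_eq_conv)
  thus ?thesis using False monomial_value_closed[OF assms(1)] by (simp add: not_in_iff)
next
  case True
  let ?m = "filter_mset (\<lambda>x. x \<noteq> a) m"
  have s: "set_mset m = insert a (set_mset ?m)" using True by auto
  have "monomial_value m = a [^] count m a \<otimes> (\<Otimes>x\<in>set_mset ?m. x [^] count m x)"
    unfolding s by (rule finprod_insert) (use assms in auto)
  also have "(\<Otimes>x\<in>set_mset ?m. x [^] count m x) = monomial_value ?m"
    by (rule finprod_cong') (use assms in auto)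
  finally show ?thesis using assms monomial_value_closed[of ?m] by (simp add: m_comm subset_iff)
qed

text \<open>A polynomial in \<open>B\<close> and a new variable \<open>a\<close>, sorted by powers
  of \<open>a\<close>. The multiset \<open>m + replicate_mset i a\<close> codes the monomial m a^i;
  as \<open>a\<close> is not in \<open>B\<close>, both \<open>i\<close> and \<open>m\<close> can be
  read off by \<open>count\<close> and \<open>filter_mset\<close>, so the blocks do not
  overlap.\<close>

lemma monomial_sum_new_variable:
  assumes F: "F \<subseteq> carrier R" and B: "B \<subseteq> carrier R" "a \<in> carrier R" "a \<notin> B"
    and M: "\<And>i. i < n \<Longrightarrow> finite (M i)" "\<And>i m. i < n \<Longrightarrow> m \<in> M i \<Longrightarrow> set_mset m \<subseteq> B"
      "\<And>i. i < n \<Longrightarrow> c i \<in> M i \<rightarrow> F"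
  shows "(\<Oplus>m\<in>(\<Union>i\<in>{..<n}. (\<lambda>m. m + replicate_mset i a) ` M i).
        c (count m a) (filter_mset (\<lambda>x. x \<noteq> a) m) \<otimes> monomial_value m)
    = lincomb (\<lambda>i. \<Oplus>m\<in>M i. c i m \<otimes> monomial_value m) (\<lambda>i. a [^] i) n"
proof -
  define N where "N = (\<Union>i\<in>{..<n}. (\<lambda>m. m + replicate_mset i a) ` M i)"
  define C where "C = (\<lambda>m. c (count m a) (filter_mset (\<lambda>x. x \<noteq> a) m))"
  have na: "a \<notin># m" if "i < n" "m \<in> M i" for i m using M(2)[OF that] B(3) by auto
  have fl: "filter_mset (\<lambda>x. x \<noteq> a) (m + replicate_mset i a) = m" "count (m + replicate_mset i a) a = i"
    if "i < n" "m \<in> M i" for i m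
    using na[OF that] by (auto simp: filter_mset_eq_conv not_in_iff multiset_eq_iff)
  have Cm: "C (m + replicate_mset i a) = c i m" if "i < n" "m \<in> M i" for i m
    unfolding C_def using fl[OF that] by simp
  have fN: "finite N" unfolding N_def using M(1) by auto
  have sN: "set_mset m \<subseteq> insert a B" if mN: "m \<in> N" for m
  proof -
    obtain i m' where "i < n" "m' \<in> M i" "m = m' + replicate_mset i a" using mN unfolding N_def by auto
    thus ?thesis using M(2)[of i m'] by (auto split: if_splits)
  qed
  have CF: "C \<in> N \<rightarrow> F" unfolding N_def using Cm M(3) by (auto simp: Pi_iff)
  have mc: "monomial_value m \<in> carrier R" if "i < n" "m \<in> M i" for i m
    using M(2)[OF that] B by (intro monomial_value_closed) auto
  have cc: "c i m \<in> carrier R" if "i < n" "m \<in> M i" for i m using M(3)[OF that(1)] that(2) F by auto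
  have tc: "C m \<otimes> monomial_value m \<in> carrier R" if "m \<in> N" for m
    using CF that F sN[OF that] B by (intro m_closed monomial_value_closed) auto
  have "(\<Oplus>m\<in>N. C m \<otimes> monomial_value m) =
    (\<Oplus>i\<in>{..<n}. \<Oplus>m\<in>(\<lambda>m. m + replicate_mset i a) ` M i. C m \<otimes> monomial_value m)"
    unfolding N_def
  proof (rule add.finprod_UN_disjoint)
    show "pairwise (\<lambda>i j. disjnt ((\<lambda>m. m + replicate_mset i a) ` M i) ((\<lambda>m. m + replicate_mset j a) ` M j)) {..<n}"
      unfolding pairwise_def disjnt_def using fl(2) by (metis (no_types, lifting) disjoint_iff imageE lessThan_iff)
    show "C m \<otimes> monomial_value m \<in> carrier R" if "i \<in> {..<n}" "m \<in> (\<lambda>m. m + replicate_mset i a) ` M i" for i m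
      using tc that unfolding N_def by blast
  qed (use M(1) in auto)
  also have "\<dots> = (\<Oplus>i\<in>{..<n}. (\<Oplus>m\<in>M i. c i m \<otimes> monomial_value m) \<otimes> a [^] i)"
  proof (rule finsum_cong')
    show "(\<lambda>i. (\<Oplus>m\<in>M i. c i m \<otimes> monomial_value m) \<otimes> a [^] i) \<in> {..<n} \<rightarrow> carrier R"
      using cc mc B by (auto intro!: finsum_closed)
    fix i assume i: "i \<in> {..<n}"
    have inj: "inj_on (\<lambda>m. m + replicate_mset i a) (M i)" by (auto intro: inj_onI)
    have "(\<Oplus>m\<in>(\<lambda>m. m + replicate_mset i a) ` M i. C m \<otimes> monomial_value m) =
      (\<Oplus>m\<in>M i. C (m + replicate_mset i a) \<otimes> monomial_value (m + replicate_mset i a))"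
      by (rule finsum_reindex[OF _ inj]) (use tc i in \<open>auto simp: N_def\<close>)
    also have "\<dots> = (\<Oplus>m\<in>M i. (c i m \<otimes> monomial_value m) \<otimes> a [^] i)"
    proof (rule finsum_cong')
      fix m assume m: "m \<in> M i"
      have "set_mset (m + replicate_mset i a) \<subseteq> carrier R" using M(2)[of i m] i m B by (auto split: if_splits)
      hence "monomial_value (m + replicate_mset i a) = monomial_value m \<otimes> a [^] i"
        using monomial_value_split[of "m + replicate_mset i a" a] B(2) fl[OF _ m, unfolded lessThan_iff[symmetric], OF i]
        by (simp only: refl)
      thus "C (m + replicate_mset i a) \<otimes> monomial_value (m + replicate_mset i a) = c i m \<otimes> monomial_value m \<otimes> a [^] i"
        using Cm[of i m] i m cc[of i m] mc[of i m] B by (simp add: m_assoc)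
    qed (use cc mc i B in auto)
    also have "\<dots> = (\<Oplus>m\<in>M i. c i m \<otimes> monomial_value m) \<otimes> a [^] i"
      by (rule finsum_ldistr[symmetric]) (use cc mc i B M(1) in auto)
    finally show "(\<Oplus>m\<in>(\<lambda>m. m + replicate_mset i a) ` M i. C m \<otimes> monomial_value m) =
       (\<Oplus>m\<in>M i. c i m \<otimes> monomial_value m) \<otimes> a [^] i" .
  qed simp
  finally show ?thesis unfolding lincomb_def N_def C_def .
qed

lemma simple_extension_lincomb:
  assumes "D \<subseteq> carrier R" "x \<in> carrier R" "y \<in> simple_extension D x"
  obtains n c where "c \<in> {..<n} \<rightarrow> D" "y = lincomb c (\<lambda>i. x [^] i) n"
proof -
  obtain f where f: "f \<in> carrier (D[X])" "y = eval f x"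
    using simple_extension_as_eval_img[OF assms(1,2)] assms(3) by auto
  have s: "set f \<subseteq> D" using f(1) polynomial_incl by (auto simp: univ_poly_carrier[symmetric])
  have "y = lincomb (coeff f) (\<lambda>i. x [^] i) (length f)"
    using eval_eq_lincomb[of f x] s assms(1,2) f(2) by auto
  moreover have "coeff f \<in> {..<length f} \<rightarrow> D" using coeff_img_restrict[of f] s by auto
  ultimately show ?thesis using that by blast
qed

definition polynomial_sum :: "'a set \<Rightarrow> 'a set \<Rightarrow> 'a multiset set \<Rightarrow> ('a multiset \<Rightarrow> 'a) \<Rightarrow> bool" where
  "polynomial_sum F B M c \<longleftrightarrow> finite M \<and> (\<forall>m\<in>M. set_mset m \<subseteq> B) \<and> c \<in> M \<rightarrow> F"

lemma finite_extension_polynomial_sum: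
  assumes F: "subfield F R" and "distinct bs" "set bs \<subseteq> carrier R" "y \<in> finite_extension F bs"
  shows "\<exists>M c. polynomial_sum F (set bs) M c \<and> y = (\<Oplus>m\<in>M. c m \<otimes> monomial_value m)"
  using assms(2-)
proof (induction bs arbitrary: y)
  case Nil
  hence y: "y \<in> F" "y \<in> carrier R" using subfield_closed(1)[OF F] by auto
  have "(\<Oplus>m\<in>{{#}}. y \<otimes> monomial_value m) = y"
    using y by (subst finsum_insert) auto
  thus ?case using y by (intro exI[of _ "{{#}}"] exI[of _ "\<lambda>_. y"]) (simp add: polynomial_sum_def)
next
  case (Cons b bs)
  let ?D = "finite_extension F bs"
  note Fc = subfield_closed(1)[OF F]
  have b: "b \<in> carrier R" "b \<notin> set bs" "set bs \<subseteq> carrier R" using Cons.prems by auto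
  have Dc: "?D \<subseteq> carrier R" using finite_extension_in_carrier[OF Fc b(3)] .
  have "y \<in> simple_extension ?D b" using Cons.prems by simp
  then obtain n c where c: "c \<in> {..<n} \<rightarrow> ?D" "y = lincomb c (\<lambda>i. b [^] i) n"
    using simple_extension_lincomb[OF Dc b(1)] by metis
  define Q where "Q = (\<lambda>i M C. polynomial_sum F (set bs) M C \<and> c i = (\<Oplus>m\<in>M. C m \<otimes> monomial_value m))"
  have "\<exists>M C. i < n \<longrightarrow> Q i M C" for i unfolding Q_def
    using Cons.IH[of "c i"] Cons.prems b c(1) by (cases "i < n") auto
  then obtain M C where "\<And>i. i < n \<Longrightarrow> Q i (M i) (C i)" by metis
  hence MC: "\<And>i. i < n \<Longrightarrow> polynomial_sum F (set bs) (M i) (C i)"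
    "\<And>i. i < n \<Longrightarrow> c i = (\<Oplus>m\<in>M i. C i m \<otimes> monomial_value m)" by (simp_all add: Q_def)
  let ?N = "\<Union>i\<in>{..<n}. (\<lambda>m. m + replicate_mset i b) ` M i"
  let ?C = "\<lambda>m. C (count m b) (filter_mset (\<lambda>x. x \<noteq> b) m)"
  have fl: "filter_mset (\<lambda>x. x \<noteq> b) (m + replicate_mset i b) = m" "count (m + replicate_mset i b) b = i"
    if "i < n" "m \<in> M i" for i m
  proof -
    have "b \<notin># m" using MC(1)[OF that(1)] that(2) b(2) by (auto simp: polynomial_sum_def)
    thus "filter_mset (\<lambda>x. x \<noteq> b) (m + replicate_mset i b) = m" "count (m + replicate_mset i b) b = i"
      by (auto simp: filter_mset_eq_conv not_in_iff multiset_eq_iff)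
  qed
  have "(\<Oplus>m\<in>?N. ?C m \<otimes> monomial_value m) = lincomb (\<lambda>i. \<Oplus>m\<in>M i. C i m \<otimes> monomial_value m) (\<lambda>i. b [^] i) n"
    by (rule monomial_sum_new_variable[OF Fc b(3,1,2)]) (use MC(1) in \<open>auto simp: polynomial_sum_def\<close>)
  also have "\<dots> = y" unfolding c(2)
    by (rule lincomb_cong) (simp_all add: MC(2)[symmetric] Pi_subset[OF c(1) Dc] b(1))
  finally have "y = (\<Oplus>m\<in>?N. ?C m \<otimes> monomial_value m)" by simp
  moreover have "polynomial_sum F (set (b # bs)) ?N ?C" unfolding polynomial_sum_def
  proof (intro conjI ballI Pi_I)
    show "finite ?N" using MC(1) by (auto simp: polynomial_sum_def)
    fix m assume "m \<in> ?N"
    then obtain i m' where m: "i < n" "m' \<in> M i" "m = m' + replicate_mset i b" by auto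
    show "set_mset m \<subseteq> set (b # bs)" using MC(1)[OF m(1)] m by (auto simp: polynomial_sum_def split: if_splits)
    show "?C m \<in> F" using MC(1)[OF m(1)] m fl[OF m(1,2)] by (auto simp: polynomial_sum_def)
  qed
  ultimately show ?case by blast
qed

lemma generate_field_finite_extension:
  assumes "subfield F R" "set bs \<subseteq> carrier R"
  shows "generate_field R (finite_extension F bs) = adjoin F (set bs)"
proof
  note Fc = subfield_closed(1)[OF assms(1)]
  have sr: "subring (finite_extension F bs) R"
    using finite_extension_is_subring[OF subfieldE(1)[OF assms(1)] assms(2)] .
  have A: "subfield (adjoin F (set bs)) R" by (rule adjoin_subfield[OF Fc assms(2)])
  have "F \<union> set bs \<subseteq> finite_extension F bs"
    using finite_extension_incl[OF Fc assms(2)] finite_extension_mem[OF subfieldE(1)[OF assms(1)] assms(2)] by simp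
  thus "adjoin F (set bs) \<subseteq> generate_field R (finite_extension F bs)"
    by (rule mono_generate_field) (rule subringE(1)[OF sr])
  have "finite_extension F bs \<subseteq> adjoin F (set bs)"
    by (rule finite_extension_subring_incl[OF subfieldE(1)[OF A] adjoin_incl])
  thus "generate_field R (finite_extension F bs) \<subseteq> adjoin F (set bs)"
    by (rule generate_field_min_subfield1[OF subringE(1)[OF sr] A])
qed

lemma alg_independentD:
  assumes "alg_independent F A" "polynomial_sum F A M c" "(\<Oplus>m\<in>M. c m \<otimes> monomial_value m) = \<zero>" "m \<in> M"
  shows "c m = \<zero>"
  using assms unfolding alg_independent_def polynomial_sum_def by blast

text \<open>A relation for \<open>a\<close> over F(B) is cleared of denominators and its
  coefficients are expanded as polynomials in \<open>B\<close>. The result is a single polynomial in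
  \<open>insert a B\<close>, all of whose coefficients vanish by independence.\<close>

lemma alg_independent_insert_imp_transcendental:
  assumes F: "subfield F R" and B: "finite B" "a \<notin> B" and ind: "alg_independent F (insert a B)"
  shows "a \<notin> algebraic_hull F B"
proof
  assume "a \<in> algebraic_hull F B"
  hence a: "a \<in> carrier R" "algebraic (adjoin F B) a" by (auto simp: algebraic_hull_def)
  have Bc: "B \<subseteq> carrier R" using ind by (auto simp: alg_independent_def)
  note Fc = subfield_closed(1)[OF F]
  obtain bs where bs: "set bs = B" "distinct bs" using finite_distinct_list[OF B(1)] by blast
  let ?D = "finite_extension F bs"
  have sr: "subring ?D R" using finite_extension_is_subring[OF subfieldE(1)[OF F]] bs Bc by simp
  have g: "generate_field R ?D = adjoin F B" using generate_field_finite_extension[OF F] bs Bc by simp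
  obtain n c where c: "c \<in> {..<n} \<rightarrow> ?D" "lincomb c (\<lambda>i. a [^] i) n = \<zero>" "\<exists>i<n. c i \<noteq> \<zero>"
    using algebraic_clear_denominators[OF sr a(1)] a(2) unfolding g by metis
  define Q where "Q = (\<lambda>i M C. polynomial_sum F B M C \<and> c i = (\<Oplus>m\<in>M. C m \<otimes> monomial_value m))"
  have "\<exists>M C. i < n \<longrightarrow> Q i M C" for i unfolding Q_def
    using finite_extension_polynomial_sum[OF F bs(2), of "c i"] bs(1) Bc c(1) by (cases "i < n") auto
  then obtain M C where "\<And>i. i < n \<Longrightarrow> Q i (M i) (C i)" by metis
  hence MC: "\<And>i. i < n \<Longrightarrow> polynomial_sum F B (M i) (C i)"
    "\<And>i. i < n \<Longrightarrow> c i = (\<Oplus>m\<in>M i. C i m \<otimes> monomial_value m)" by (simp_all add: Q_def)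
  let ?N = "\<Union>i\<in>{..<n}. (\<lambda>m. m + replicate_mset i a) ` M i"
  let ?C = "\<lambda>m. C (count m a) (filter_mset (\<lambda>x. x \<noteq> a) m)"
  have fl: "filter_mset (\<lambda>x. x \<noteq> a) (m + replicate_mset i a) = m" "count (m + replicate_mset i a) a = i"
    if "i < n" "m \<in> M i" for i m
  proof -
    have "a \<notin># m" using MC(1)[OF that(1)] that(2) B(2) by (auto simp: polynomial_sum_def)
    thus "filter_mset (\<lambda>x. x \<noteq> a) (m + replicate_mset i a) = m" "count (m + replicate_mset i a) a = i"
      by (auto simp: filter_mset_eq_conv not_in_iff multiset_eq_iff)
  qed
  have "(\<Oplus>m\<in>?N. ?C m \<otimes> monomial_value m) = lincomb (\<lambda>i. \<Oplus>m\<in>M i. C i m \<otimes> monomial_value m) (\<lambda>i. a [^] i) n"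
    by (rule monomial_sum_new_variable[OF Fc Bc a(1) B(2)]) (use MC(1) in \<open>auto simp: polynomial_sum_def\<close>)
  also have "\<dots> = lincomb c (\<lambda>i. a [^] i) n"
    by (rule lincomb_cong) (simp_all add: MC(2)[symmetric] Pi_subset[OF c(1) subringE(1)[OF sr]] a(1))
  finally have z: "(\<Oplus>m\<in>?N. ?C m \<otimes> monomial_value m) = \<zero>" using c(2) by simp
  have ps: "polynomial_sum F (insert a B) ?N ?C" unfolding polynomial_sum_def
  proof (intro conjI ballI Pi_I)
    show "finite ?N" using MC(1) by (auto simp: polynomial_sum_def)
    fix m assume "m \<in> ?N"
    then obtain i m' where m: "i < n" "m' \<in> M i" "m = m' + replicate_mset i a" by auto
    show "set_mset m \<subseteq> insert a B" using MC(1)[OF m(1)] m by (auto simp: polynomial_sum_def split: if_splits)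
    show "?C m \<in> F" using MC(1)[OF m(1)] m fl[OF m(1,2)] by (auto simp: polynomial_sum_def)
  qed
  have "c i = \<zero>" if i: "i < n" for i
  proof -
    have "C i m = \<zero>" if m: "m \<in> M i" for m
    proof -
      have "m + replicate_mset i a \<in> ?N" using i m by auto
      hence "?C (m + replicate_mset i a) = \<zero>" by (rule alg_independentD[OF ind ps z])
      thus ?thesis using fl[OF i m] by simp
    qed
    moreover have "monomial_value m \<in> carrier R" if "m \<in> M i" for m
      using MC(1)[OF i] that Bc by (intro monomial_value_closed) (auto simp: polynomial_sum_def)
    ultimately show ?thesis unfolding MC(2)[OF i] by (intro add.finprod_one_eqI) simp
  qed
  thus False using c(3) by blast
qed

text \<open>A relation is sorted by powers of \<open>a\<close>: transcendence kills the polynomial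
  in front of each power, and independence of \<open>B\<close> then kills its coefficients.\<close>

lemma alg_independent_insert:
  assumes F: "subfield F R" and B: "finite B" "alg_independent F B"
    and a: "a \<in> carrier R" "a \<notin> algebraic_hull F B"
  shows "alg_independent F (insert a B)"
  unfolding alg_independent_def
proof (intro conjI allI impI)
  have Bc: "B \<subseteq> carrier R" using B by (auto simp: alg_independent_def)
  thus "insert a B \<subseteq> carrier R" using a by simp
  note Fc = subfield_closed(1)[OF F]
  have aB: "a \<notin> B" using a(2) algebraic_hull_incl(3)[OF Fc Bc] by auto
  fix N C
  assume NC: "finite N \<and> (\<forall>m\<in>N. set_mset m \<subseteq> insert a B) \<and> C \<in> N \<rightarrow> F \<and>
    (\<Oplus>m\<in>N. C m \<otimes> monomial_value m) = \<zero>"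
  obtain n where n: "\<And>m. m \<in> N \<Longrightarrow> count m a < n"
  proof -
    have "finite ((\<lambda>m. count m a) ` N)" using NC by simp
    then obtain k where "\<forall>x\<in>(\<lambda>m. count m a) ` N. x \<le> k" using finite_nat_set_iff_bounded_le by blast
    thus ?thesis using that[of "Suc k"] by (simp add: less_Suc_eq_le)
  qed
  define M where "M = (\<lambda>i. filter_mset (\<lambda>x. x \<noteq> a) ` {m \<in> N. count m a = i})"
  define c where "c = (\<lambda>i m. C (m + replicate_mset i a))"
  have rec: "filter_mset (\<lambda>x. x \<noteq> a) m + replicate_mset (count m a) a = m" for m
    by (rule multiset_eqI) auto
  have ps: "polynomial_sum F B (M i) (c i)" for i
    unfolding polynomial_sum_def
  proof (intro conjI ballI Pi_I)
    show "finite (M i)" using NC by (simp add: M_def)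
    fix m assume "m \<in> M i"
    then obtain m' where m': "m' \<in> N" "count m' a = i" "m = filter_mset (\<lambda>x. x \<noteq> a) m'" by (auto simp: M_def)
    show "set_mset m \<subseteq> B" using NC m' by auto
    have "c i m = C m'" using rec[of m'] m' by (simp add: c_def)
    thus "c i m \<in> F" using NC m' by auto
  qed
  have Ne: "(\<Union>i\<in>{..<n}. (\<lambda>m. m + replicate_mset i a) ` M i) = N"
  proof (intro subset_antisym subsetI)
    fix m assume "m \<in> (\<Union>i\<in>{..<n}. (\<lambda>m. m + replicate_mset i a) ` M i)"
    thus "m \<in> N" using rec by (auto simp: M_def)
  next
    fix m assume m: "m \<in> N"
    have "m = filter_mset (\<lambda>x. x \<noteq> a) m + replicate_mset (count m a) a" using rec by simp
    moreover have "filter_mset (\<lambda>x. x \<noteq> a) m \<in> M (count m a)" using m by (auto simp: M_def)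
    ultimately show "m \<in> (\<Union>i\<in>{..<n}. (\<lambda>m. m + replicate_mset i a) ` M i)" using n[OF m] by blast
  qed
  let ?d = "\<lambda>i. \<Oplus>m\<in>M i. c i m \<otimes> monomial_value m"
  have mv: "monomial_value m \<in> carrier R" if "set_mset m \<subseteq> insert a B" for m
    by (rule monomial_value_closed) (use that a Bc in auto)
  have "lincomb ?d (\<lambda>i. a [^] i) n = (\<Oplus>m\<in>N. c (count m a) (filter_mset (\<lambda>x. x \<noteq> a) m) \<otimes> monomial_value m)"
    unfolding Ne[symmetric]
    by (rule monomial_sum_new_variable[OF Fc Bc a(1) aB, symmetric])
      (use ps in \<open>auto simp: polynomial_sum_def\<close>)
  also have "\<dots> = (\<Oplus>m\<in>N. C m \<otimes> monomial_value m)"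
    by (rule finsum_cong') (use NC mv Fc in \<open>auto simp: c_def rec\<close>)
  finally have z: "lincomb ?d (\<lambda>i. a [^] i) n = \<zero>" using NC by simp
  have A: "subfield (adjoin F B) R" by (rule adjoin_subfield[OF Fc Bc])
  have dA: "?d i \<in> adjoin F B" for i
  proof (intro subfield_finsum[OF A] Pi_I subfield_closed(5)[OF A])
    fix m assume m: "m \<in> M i"
    show "c i m \<in> adjoin F B" using ps[of i] m adjoin_incl(1)[of F B] by (auto simp: polynomial_sum_def)
    have mB: "set_mset m \<subseteq> B" using ps[of i] m by (auto simp: polynomial_sum_def)
    have "finite S \<Longrightarrow> S \<subseteq> B \<Longrightarrow> (\<Otimes>x\<in>S. x [^] count m x) \<in> adjoin F B" for S
    proof (induction S rule: finite_induct)
      case empty thus ?case using subfield_closed(3)[OF A] by simp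
    next
      case (insert x S)
      have "x [^] count m x \<in> adjoin F B"
        using subfield_pow[OF A] adjoin_incl(2)[of B F] insert.prems by auto
      thus ?case using insert Bc subfield_closed(5)[OF A]
        by (subst finprod_insert) (auto simp: subset_iff)
    qed
    thus "monomial_value m \<in> adjoin F B" using mB by simp
  qed
  have "\<not> algebraic (adjoin F B) a" using a by (simp add: algebraic_hull_def)
  hence d0: "?d i = \<zero>" if "i < n" for i
    using lin_indepD[OF not_algebraic_lin_indep[OF A a(1)] _ z that] dA by blast
  show "\<forall>m\<in>N. C m = \<zero>"
  proof
    fix m assume m: "m \<in> N"
    have "filter_mset (\<lambda>x. x \<noteq> a) m \<in> M (count m a)" using m by (auto simp: M_def)
    hence "c (count m a) (filter_mset (\<lambda>x. x \<noteq> a) m) = \<zero>"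
      using alg_independentD[OF B(2) ps d0[OF n[OF m]]] by blast
    thus "C m = \<zero>" by (simp add: c_def rec)
  qed
qed

lemma alg_independent_empty:
  assumes "F \<subseteq> carrier R" shows "alg_independent F {}"
  unfolding alg_independent_def
proof (intro conjI allI impI ballI)
  fix M c m
  assume M: "finite M \<and> (\<forall>m\<in>M. set_mset m \<subseteq> {}) \<and> c \<in> M \<rightarrow> F \<and> (\<Oplus>m\<in>M. c m \<otimes> monomial_value m) = \<zero>"
    and m: "m \<in> M"
  hence "M = {{#}}" by auto
  hence "(\<Oplus>m\<in>{{#}}. c m \<otimes> monomial_value m) = \<zero>" "c {#} \<in> carrier R" "m = {#}" using M m assms by auto
  thus "c m = \<zero>" by (subst (asm) finsum_insert) auto
qed simp

section \<open>Bounds for the transcendence degree\<close>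

theorem trdeg_le:
  assumes F: "subfield F R" and C: "finite C" "C \<subseteq> carrier R" "E \<subseteq> algebraic_hull F C"
  shows "trdeg F E \<le> enat (card C)"
  unfolding trdeg_def
proof (rule SUP_least)
  fix A assume "A \<in> {A. finite A \<and> A \<subseteq> E \<and> alg_independent F A}"
  hence A: "finite A" "A \<subseteq> E" "alg_independent F A" by auto
  have Ac: "A \<subseteq> carrier R" using A(3) by (simp add: alg_independent_def)
  have "hull_independent F A" unfolding hull_independent_def
  proof
    fix a assume a: "a \<in> A"
    hence "insert a (A - {a}) = A" by auto
    thus "a \<notin> algebraic_hull F (A - {a})"
      using alg_independent_insert_imp_transcendental[OF F, of "A - {a}" a] A by auto
  qed
  thus "enat (card A) \<le> enat (card C)"
    using hull_independent_card_le[OF subfield_closed(1)[OF F] A(1) Ac _ C(1,2)] A(2) C(3) by auto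
qed

text \<open>\<open>B\<close> is only algebraic over \<open>E\<close>, so an independent subset of
  \<open>E\<close> itself has to be built. As long as \<open>A\<close> has fewer elements than
  \<open>B\<close>, the set \<open>E\<close> cannot be algebraic over F(A): otherwise
  \<open>B\<close> would be, against \<open>hull_independent_card_le\<close>.\<close>

theorem trdeg_ge:
  assumes F: "subfield F R" and E: "E \<subseteq> carrier R"
    and B: "finite B" "B \<subseteq> carrier R" "hull_independent F B" "B \<subseteq> algebraic_hull F E"
  shows "enat (card B) \<le> trdeg F E"
proof -
  note Fc = subfield_closed(1)[OF F]
  have "\<exists>A. finite A \<and> A \<subseteq> E \<and> alg_independent F A \<and> card A = k" if "k \<le> card B" for k
    using that
  proof (induction k)
    case 0 show ?case using alg_independent_empty[OF Fc] by (intro exI[of _ "{}"]) auto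
  next
    case (Suc k)
    then obtain A where A: "finite A" "A \<subseteq> E" "alg_independent F A" "card A = k" by auto
    have Ac: "A \<subseteq> carrier R" using A E by auto
    have "\<not> E \<subseteq> algebraic_hull F A"
    proof
      assume "E \<subseteq> algebraic_hull F A"
      hence "B \<subseteq> algebraic_hull F A"
        using algebraic_hull_idem[OF Fc Ac algebraic_hull_incl(2)[OF Fc Ac]] B(4) by blast
      thus False using hull_independent_card_le[OF Fc B(1-3) A(1) Ac] A(4) Suc.prems by simp
    qed
    then obtain y where y: "y \<in> E" "y \<notin> algebraic_hull F A" by blast
    have "y \<notin> A" using y algebraic_hull_incl(3)[OF Fc Ac] by auto
    thus ?case using alg_independent_insert[OF F A(1,3) _ y(2)] y A E
      by (intro exI[of _ "insert y A"]) auto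
  qed
  then obtain A where "finite A" "A \<subseteq> E" "alg_independent F A" "card A = card B" by blast
  thus ?thesis unfolding trdeg_def by (metis (mono_tags, lifting) SUP_upper mem_Collect_eq)
qed

end

section \<open>Normal generating sequences\<close>

context field
begin

lemma lin_indep_Suc:
  assumes E: "subfield E R" and v: "lin_indep E v m" "v m \<in> carrier R" "v m \<notin> lin_span E v m"
  shows "lin_indep E v (Suc m)"
  unfolding lin_indep_def
proof (intro conjI ballI impI allI)
  note Ec = subfield_closed(1)[OF E]
  have vc: "v \<in> {..<m} \<rightarrow> carrier R" using v lin_indep_carrier by blast
  thus vS: "v \<in> {..<Suc m} \<rightarrow> carrier R" using v by (auto simp: less_Suc_eq)
  fix c i assume c: "c \<in> {..<Suc m} \<rightarrow> E" "lincomb c v (Suc m) = \<zero>" and i: "i < Suc m"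
  have cm: "c m \<in> E" "c \<in> {..<m} \<rightarrow> E" using c(1) by auto
  have cc: "c m \<in> carrier R" "lincomb c v m \<in> carrier R" using cm Ec Pi_subset[OF cm(2) Ec] vc by auto
  have eq: "c m \<otimes> v m \<oplus> lincomb c v m = \<zero>" using lincomb_Suc[OF Pi_subset[OF c(1) Ec] vS] c(2) by simp
  have c0: "c m = \<zero>"
  proof (rule ccontr)
    assume nz: "c m \<noteq> \<zero>"
    have iE: "inv (c m) \<in> E" using subfield_inv[OF E cm(1) nz] .
    have ic: "inv (c m) \<in> carrier R" "inv (c m) \<otimes> c m = \<one>" using nz cc by (auto simp: field_Units)
    have "c m \<otimes> v m = \<ominus> lincomb c v m" using eq cc v(2) by (intro minus_equality[symmetric]) auto
    hence "inv (c m) \<otimes> (c m \<otimes> v m) = inv (c m) \<otimes> (\<ominus> lincomb c v m)" by simp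
    moreover have "inv (c m) \<otimes> (c m \<otimes> v m) = v m"
      using ic cc v(2) by (simp add: m_assoc[symmetric])
    moreover have "inv (c m) \<otimes> (\<ominus> lincomb c v m) \<in> lin_span E v m"
    proof (rule lin_span_closed(5)[OF E vc iE lin_span_closed(4)[OF E vc]])
      show "lincomb c v m \<in> lin_span E v m" unfolding lin_span_def using cm(2) by blast
    qed
    ultimately show False using v(3) by simp
  qed
  hence "lincomb c v m = \<zero>" using eq cc v(2) by simp
  thus "c i = \<zero>" using lin_indepD[OF v(1) cm(2)] c0 i by (cases "i = m") auto
qed

lemma lincomb_comm:
  assumes "c \<in> {..<D} \<rightarrow> carrier R" "v \<in> {..<D} \<rightarrow> carrier R"
  shows "lincomb c v D = lincomb v c D"
  unfolding lincomb_def by (rule finsum_cong') (use assms in \<open>auto simp: m_comm Pi_iff\<close>)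

lemma lincomb_in_subfield:
  assumes "subfield E R" "\<And>i. i < D \<Longrightarrow> c i \<in> E" "\<And>i. i < D \<Longrightarrow> v i \<in> E"
  shows "lincomb c v D \<in> E"
  unfolding lincomb_def
  by (intro subfield_finsum[OF assms(1)] Pi_I subfield_closed(5)[OF assms(1)]) (use assms in auto)

text \<open>Products of members of \<open>b\<close> lie in \<open>L0\<close>, hence in the K-span of
  \<open>b\<close>, which is therefore a field containing \<open>K\<close> and
  \<open>L0\<close>.\<close>

lemma compositum_lin_span:
  assumes K0: "subfield K0 R" and L0: "subfield L0 R" and K: "subfield K R" "K0 \<subseteq> K"
    and b: "b \<in> {..<m} \<rightarrow> carrier R" "lin_span K0 b m = L0"
  shows "lin_span K b m = adjoin K L0"
proof
  have inc: "L0 \<subseteq> lin_span K b m" using lin_span_mono[OF K(2), of b m] b(2) by simp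
  have bL: "b i \<in> L0" if "i < m" for i using lin_span_closed(6)[OF K0 b(1) that] b(2) by simp
  have one: "\<one> \<in> lin_span K b m" using subfield_closed(3)[OF L0] inc by blast
  have mul: "b i \<otimes> b j \<in> lin_span K b m" if "i < m" "j < m" for i j
    using subfield_closed(5)[OF L0 bL[OF that(1)] bL[OF that(2)]] inc by blast
  note V = lin_span_subfield[OF K(1) b(1) one mul]
  show "adjoin K L0 \<subseteq> lin_span K b m" by (rule adjoin_least[OF V(1,2) inc])
  have A: "subfield (adjoin K L0) R"
    by (rule adjoin_subfield[OF subfield_closed(1)[OF K(1)] subfield_closed(1)[OF L0]])
  show "lin_span K b m \<subseteq> adjoin K L0"
  proof (rule lin_span_minimal)
    show "c \<otimes> b i \<in> adjoin K L0" if "c \<in> K" "i < m" for c i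
      using subfield_closed(5)[OF A] that bL adjoin_incl(1)[of K L0] adjoin_incl(2)[of L0 K] by blast
  qed (use subfield_closed[OF A] subfield_closed(1)[OF K(1)] b in auto)
qed

lemma image_lessThan_Suc: "y ` {..<Suc j} = insert (y j) (y ` {..<j})"
  by (auto simp: less_Suc_eq)

lemma adjoin_image_Suc:
  assumes "E \<subseteq> carrier R" "\<And>i. i < Suc j \<Longrightarrow> y i \<in> carrier R"
  shows "adjoin (adjoin E (y ` {..<j})) {y j} = adjoin E (y ` {..<Suc j})"
proof -
  have "adjoin (adjoin E (y ` {..<j})) {y j} = adjoin E (y ` {..<j} \<union> {y j})"
    by (rule adjoin_adjoin) (use assms in auto)
  thus ?thesis unfolding image_lessThan_Suc by (simp add: Un_insert_right)
qed

section \<open>Towers of simple extensions and their monomials\<close>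

lemma tower_dimension:
  fixes m :: nat
  assumes E: "subfield E R" and y: "\<And>j. j < m \<Longrightarrow> y j \<in> carrier R"
    and d: "\<And>j. j < m \<Longrightarrow> dimension (d j) (adjoin E (y ` {..<j})) (adjoin (adjoin E (y ` {..<j})) {y j})"
  shows "dimension (\<Prod>j<m. d j) E (adjoin E (y ` {..<m}))"
  using y d
proof (induction m)
  case 0
  have "adjoin E (y ` {..<0}) = E" using adjoin_id[OF E, of "{}"] by simp
  thus ?case using dimension_one[OF E] by simp
next
  case (Suc m)
  have yc: "y ` {..<m} \<subseteq> carrier R" using Suc.prems by auto
  have sf: "subfield (adjoin E (y ` {..<m})) R" by (rule adjoin_subfield[OF subfield_closed(1)[OF E] yc])
  have "dimension (\<Prod>j<m. d j) E (adjoin E (y ` {..<m}))" using Suc by simp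
  from telescopic_base[OF E sf this Suc.prems(2)[of m]]
  have "dimension ((\<Prod>j<m. d j) * d m) E (adjoin (adjoin E (y ` {..<m})) {y m})" by simp
  also have "adjoin (adjoin E (y ` {..<m})) {y m} = adjoin E (y ` {..<Suc m})"
    by (rule adjoin_image_Suc[OF subfield_closed(1)[OF E]]) (use Suc.prems in auto)
  finally show ?case by (simp add: mult.commute)
qed

lemma tower_dimension_le:
  fixes m :: nat
  assumes E: "subfield E R" and y: "\<And>j. j < m \<Longrightarrow> y j \<in> carrier R"
    and d: "\<And>j. j < m \<Longrightarrow> 0 < D j \<and> y j [^] D j \<in> adjoin E (y ` {..<j})"
  obtains d where "d \<le> (\<Prod>j<m. D j)" "dimension d E (adjoin E (y ` {..<m}))"
proof -
  have "\<exists>f. j < m \<longrightarrow> f \<le> D j \<and> dimension f (adjoin E (y ` {..<j})) (adjoin (adjoin E (y ` {..<j})) {y j})" for j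
  proof (cases "j < m")
    case True
    have sf: "subfield (adjoin E (y ` {..<j})) R"
      by (rule adjoin_subfield[OF subfield_closed(1)[OF E]]) (use y True in auto)
    show ?thesis using adjoin_dimension_le_pow[OF sf y[OF True]] d[OF True] by metis
  qed auto
  then obtain f where f: "\<And>j. j < m \<Longrightarrow> f j \<le> D j"
    "\<And>j. j < m \<Longrightarrow> dimension (f j) (adjoin E (y ` {..<j})) (adjoin (adjoin E (y ` {..<j})) {y j})"
    by metis
  have "dimension (\<Prod>j<m. f j) E (adjoin E (y ` {..<m}))" by (rule tower_dimension[OF E y f(2)])
  moreover have "(\<Prod>j<m. f j) \<le> (\<Prod>j<m. D j)" by (rule prod_mono) (use f in auto)
  ultimately show ?thesis using that by blast
qed

text \<open>
  Products of powers of \<open>y\<^sub>1, y\<^sub>2, \<dots>\<close> with exponents bounded by \<open>d\<^sub>1, d\<^sub>2, \<dots>\<close>, enumerated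
  by reading the index as a mixed radix number; index \<open>0\<close> is the empty product.
\<close>

fun mixed :: "('a \<times> nat) list \<Rightarrow> nat \<Rightarrow> 'a" where
  "mixed [] j = \<one>"
| "mixed ((y, d) # ps) j = y [^] (j mod d) \<otimes> mixed ps (j div d)"

lemma mixed_zero [simp]: "fst ` set ps \<subseteq> carrier R \<Longrightarrow> mixed ps 0 = \<one>"
  by (induction ps "0::nat" rule: mixed.induct) auto

lemma mixed_in_subfield:
  assumes "subfield E R" "fst ` set ps \<subseteq> E" shows "mixed ps j \<in> E"
  using assms(2)
proof (induction ps j rule: mixed.induct)
  case (1 j) thus ?case using subfield_closed[OF assms(1)] by simp
next
  case (2 y d ps j)
  thus ?case using subfield_closed(5)[OF assms(1)] subfield_pow[OF assms(1)] by auto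
qed

lemma mixed_closed: "fst ` set ps \<subseteq> carrier R \<Longrightarrow> mixed ps j \<in> carrier R"
  using mixed_in_subfield[OF carrier_is_subfield] .

text \<open>Two one-sided conditions on the same kind of list. In \<open>chain_spans\<close> each
  \<open>y\<close> satisfies a monic relation of degree \<open>d\<close> over its predecessors, so
  the products span; in \<open>chain_indep\<close> its powers below \<open>d\<close> are independent
  over them, so the products are independent. The upper bound uses the first, the generic extension
  the second.\<close>

fun chain_spans :: "'a set \<Rightarrow> ('a \<times> nat) list \<Rightarrow> bool" where
  "chain_spans E [] \<longleftrightarrow> True"
| "chain_spans E ((y, d) # ps) \<longleftrightarrow> y \<in> carrier R \<and> 0 < d \<and>
     y [^] d \<in> lin_span E (\<lambda>i. y [^] i) d \<and> chain_spans (adjoin E {y}) ps"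

fun chain_indep :: "'a set \<Rightarrow> ('a \<times> nat) list \<Rightarrow> bool" where
  "chain_indep E [] \<longleftrightarrow> True"
| "chain_indep E ((y, d) # ps) \<longleftrightarrow> y \<in> carrier R \<and> 0 < d \<and>
     lin_indep E (\<lambda>i. y [^] i) d \<and> chain_indep (adjoin E {y}) ps"

lemma chain_spans_carrier: "chain_spans E ps \<Longrightarrow> fst ` set ps \<subseteq> carrier R"
  by (induction E ps rule: chain_spans.induct) auto

lemma chain_indep_carrier: "chain_indep E ps \<Longrightarrow> fst ` set ps \<subseteq> carrier R"
  by (induction E ps rule: chain_indep.induct) auto

lemma mixed_Cons_fun: "mixed ((y, d) # ps) = (\<lambda>j. (\<lambda>i. y [^] i) (j mod d) \<otimes> mixed ps (j div d))"
  by (rule ext) simp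

lemma mixed_span:
  assumes "subfield E R" "chain_spans E ps"
  shows "adjoin E (fst ` set ps) \<subseteq> lin_span E (mixed ps) (prod_list (map snd ps))"
  using assms
proof (induction E ps rule: chain_spans.induct)
  case (1 E)
  have "adjoin E {} = E" using adjoin_id[OF 1(1), of "{}"] by simp
  moreover have "E \<subseteq> lin_span E (mixed []) 1"
  proof
    fix x assume x: "x \<in> E"
    have "\<one> \<in> lin_span E (mixed []) 1"
      using lin_span_closed(6)[OF 1(1), of "mixed []" 1 0] by simp
    hence "x \<otimes> \<one> \<in> lin_span E (mixed []) 1"
      using lin_span_closed(5)[OF 1(1), of "mixed []" 1 x \<one>] x by simp
    thus "x \<in> lin_span E (mixed []) 1" using x subfield_closed(1)[OF 1(1)] by auto
  qed
  ultimately show ?case by (simp only: list.set image_empty list.map prod_list.Nil)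
next
  case (2 E y d ps)
  note E = 2(2)
  note Ec = subfield_closed(1)[OF E]
  have y: "y \<in> carrier R" "0 < d" "y [^] d \<in> lin_span E (\<lambda>i. y [^] i) d" "chain_spans (adjoin E {y}) ps"
    using 2(3) by auto
  have psc: "fst ` set ps \<subseteq> carrier R" using chain_spans_carrier[OF y(4)] .
  have sf: "subfield (adjoin E {y}) R" using adjoin_subfield[OF Ec] y(1) by simp
  let ?D = "prod_list (map snd ps)"
  have e: "adjoin (adjoin E {y}) (fst ` set ps) = adjoin E (fst ` set ((y, d) # ps))"
    using adjoin_adjoin[OF Ec, of "{y}" "fst ` set ps"] y(1) psc by simp
  show ?case
  proof
    fix w assume "w \<in> adjoin E (fst ` set ((y, d) # ps))"
    hence "w \<in> lin_span (adjoin E {y}) (mixed ps) ?D" using 2(1)[OF sf y(4)] e by auto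
    then obtain c where c: "c \<in> {..<?D} \<rightarrow> adjoin E {y}" "w = lincomb c (mixed ps) ?D"
      by (auto simp: lin_span_def)
    have "\<exists>a. b < ?D \<longrightarrow> a \<in> {..<d} \<rightarrow> E \<and> c b = lincomb a (\<lambda>i. y [^] i) d" for b
      using c(1) adjoin_eq_lin_span[OF E y(1,2,3)] unfolding lin_span_def by (cases "b < ?D") blast+
    then obtain a where a: "\<And>b. b < ?D \<Longrightarrow> a b \<in> {..<d} \<rightarrow> E"
      "\<And>b. b < ?D \<Longrightarrow> c b = lincomb (a b) (\<lambda>i. y [^] i) d" by metis
    \<comment> \<open>The low digit selects the power of \<open>y\<close>, the high digit the
      product of the remaining generators.\<close>
    define C where "C = (\<lambda>j. a (j div d) (j mod d))"
    have CE: "C \<in> {..<d * ?D} \<rightarrow> E"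
    proof
      fix j assume "j \<in> {..<d * ?D}"
      hence "j div d < ?D" by (simp add: less_mult_imp_div_less mult.commute)
      thus "C j \<in> E" using a(1)[of "j div d"] y(2) by (auto simp: C_def)
    qed
    have pc: "(\<lambda>i. y [^] i) \<in> {..<d} \<rightarrow> carrier R" using y by auto
    have "lincomb C (mixed ((y, d) # ps)) (d * ?D) =
      lincomb (\<lambda>b. lincomb (\<lambda>a. C (d * b + a)) (\<lambda>i. y [^] i) d) (mixed ps) ?D"
      unfolding mixed_Cons_fun
      by (rule lincomb_blocks[OF Pi_subset[OF CE Ec] pc]) (use mixed_closed[OF psc] in auto)
    also have "\<dots> = lincomb c (mixed ps) ?D"
    proof (rule lincomb_cong)
      fix b assume b: "b < ?D"
      have "lincomb (\<lambda>a. C (d * b + a)) (\<lambda>i. y [^] i) d = lincomb (a b) (\<lambda>i. y [^] i) d"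
        by (rule lincomb_cong) (use a(1)[OF b] Ec pc in \<open>auto simp: C_def\<close>)
      thus "lincomb (\<lambda>a. C (d * b + a)) (\<lambda>i. y [^] i) d = c b" using a(2)[OF b] by simp
    qed (use Pi_subset[OF c(1) subfield_closed(1)[OF sf]] mixed_closed[OF psc] in auto)
    finally have "w = lincomb C (mixed ((y, d) # ps)) (d * ?D)" using c(2) by simp
    thus "w \<in> lin_span E (mixed ((y, d) # ps)) (prod_list (map snd ((y, d) # ps)))"
      using CE by (auto simp: lin_span_def)
  qed
qed

lemma mixed_indep:
  assumes "subfield E R" "chain_indep E ps"
  shows "lin_indep E (mixed ps) (prod_list (map snd ps))"
  using assms
proof (induction E ps rule: chain_indep.induct)
  case (1 E)
  have "c 0 = \<zero>" if "c \<in> {..<1} \<rightarrow> E" "lincomb c (mixed []) 1 = \<zero>" for c :: "nat \<Rightarrow> 'a"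
  proof -
    have c: "c 0 \<in> carrier R" using that(1) subfield_closed(1)[OF 1(1)] by auto
    have "lincomb c (mixed []) (Suc 0) = c 0 \<otimes> \<one> \<oplus> \<zero>" using c by (subst lincomb_Suc) auto
    thus ?thesis using that(2) c by simp
  qed
  thus ?case unfolding lin_indep_def by auto
next
  case (2 E y d ps)
  note E = 2(2)
  note Ec = subfield_closed(1)[OF E]
  have y: "y \<in> carrier R" "0 < d" "lin_indep E (\<lambda>i. y [^] i) d" "chain_indep (adjoin E {y}) ps"
    using 2(3) by auto
  have psc: "fst ` set ps \<subseteq> carrier R" using chain_indep_carrier[OF y(4)] .
  have sf: "subfield (adjoin E {y}) R" using adjoin_subfield[OF Ec] y(1) by simp
  have Ey: "E \<subseteq> adjoin E {y}" "y \<in> adjoin E {y}" using adjoin_incl(1)[of E] adjoin_incl(2)[of "{y}" E] by auto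
  let ?D = "prod_list (map snd ps)"
  have pc: "(\<lambda>i. y [^] i) \<in> {..<d} \<rightarrow> carrier R" using y by auto
  have mc: "mixed ps \<in> {..<?D} \<rightarrow> carrier R" using mixed_closed[OF psc] by auto
  show ?case unfolding lin_indep_def
  proof (intro conjI ballI impI allI)
    show "mixed ((y, d) # ps) \<in> {..<prod_list (map snd ((y, d) # ps))} \<rightarrow> carrier R"
      using mixed_closed[of "(y, d) # ps"] y(1) psc by (simp add: Pi_iff del: mixed.simps)
    fix C j
    assume C: "C \<in> {..<prod_list (map snd ((y, d) # ps))} \<rightarrow> E"
      "lincomb C (mixed ((y, d) # ps)) (prod_list (map snd ((y, d) # ps))) = \<zero>"
      and j: "j < prod_list (map snd ((y, d) # ps))"
    have C': "C \<in> {..<d * ?D} \<rightarrow> E" "lincomb C (mixed ((y, d) # ps)) (d * ?D) = \<zero>" "j < d * ?D"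
      using C j by simp_all
    have CE: "C (d * b + a) \<in> E" if "b < ?D" "a < d" for a b
    proof -
      have "d * b + a < d * Suc b" using that by simp
      also have "\<dots> \<le> d * ?D" using that by (intro mult_le_mono) auto
      finally show ?thesis using C' by auto
    qed
    have "lincomb C (mixed ((y, d) # ps)) (d * ?D) =
      lincomb (\<lambda>b. lincomb (\<lambda>a. C (d * b + a)) (\<lambda>i. y [^] i) d) (mixed ps) ?D"
      unfolding mixed_Cons_fun by (rule lincomb_blocks[OF Pi_subset[OF C'(1) Ec] pc mc])
    hence z: "lincomb (\<lambda>b. lincomb (\<lambda>a. C (d * b + a)) (\<lambda>i. y [^] i) d) (mixed ps) ?D = \<zero>"
      using C'(2) by simp
    have "lincomb (\<lambda>a. C (d * b + a)) (\<lambda>i. y [^] i) d \<in> adjoin E {y}" if "b < ?D" for b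
      by (rule lincomb_in_subfield[OF sf]) (use CE[OF that] Ey subfield_pow[OF sf] in auto)
    hence z2: "lincomb (\<lambda>a. C (d * b + a)) (\<lambda>i. y [^] i) d = \<zero>" if "b < ?D" for b
      using lin_indepD[OF 2(1)[OF sf y(4)] _ z that] by auto
    have jd: "j div d < ?D" "j mod d < d"
      using C'(3) y(2) by (auto simp: less_mult_imp_div_less mult.commute)
    have "C (d * (j div d) + j mod d) = \<zero>"
      using lin_indepD[OF y(3) _ z2[OF jd(1)] jd(2)] CE[OF jd(1)] by auto
    thus "C j = \<zero>" by simp
  qed
qed

lemma subfield_subset_lin_span_powers:
  assumes "subfield E R" "x \<in> carrier R" "0 < d" shows "E \<subseteq> lin_span E (\<lambda>i. x [^] i) d"
proof
  fix e assume e: "e \<in> E"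
  have pc: "(\<lambda>i. x [^] i) \<in> {..<d} \<rightarrow> carrier R" using assms by auto
  have "e \<otimes> x [^] (0::nat) \<in> lin_span E (\<lambda>i. x [^] i) d"
    by (rule lin_span_closed(5)[OF assms(1) pc e lin_span_closed(6)[OF assms(1) pc assms(3)]])
  thus "e \<in> lin_span E (\<lambda>i. x [^] i) d" using e subfield_closed(1)[OF assms(1)] by auto
qed

end

section \<open>Normal towers and Pickert's theorem\<close>

context char_p_field
begin

text \<open>Normal generating sequences with exponents written as conditions on powers: the power of
  \<open>x i\<close> one step below \<open>e i\<close> is not yet in the preceding field, which
  fixes its exponent, and the power p^(e i) of every element is, which is normality.\<close>

definition normal_tower :: "'a set \<Rightarrow> (nat \<Rightarrow> 'a) \<Rightarrow> (nat \<Rightarrow> nat) \<Rightarrow> nat \<Rightarrow> bool" where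
  "normal_tower S x e r \<longleftrightarrow> subfield S R \<and> (\<forall>i<r. x i \<in> carrier R \<and> 1 \<le> e i \<and>
      x i [^] (p ^ (e i - 1)) \<notin> adjoin S (x ` {..<i}) \<and>
      (\<forall>y\<in>carrier R. y [^] (p ^ e i) \<in> adjoin S (x ` {..<i}))) \<and>
    adjoin S (x ` {..<r}) = carrier R"

lemma set_take_eq_image: "i \<le> length xs \<Longrightarrow> set (take i xs) = (\<lambda>j. xs ! j) ` {..<i}"
  by (metis atLeast0LessThan nth_image)

lemma insep_type_imp_normal_tower:
  assumes "insep_type S es" "\<forall>e\<in>set es. e \<ge> 1"
  obtains x where "normal_tower S x (\<lambda>i. es ! i) (length es)"
proof -
  obtain xs where S: "subfield S R" and pi: "purely_inseparable S"
    and xs: "normal_generating_sequence S xs" "sequence_type S xs = es"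
    using assms(1) unfolding insep_type_def by blast
  have len: "length xs = length es" using xs(2) by (auto simp: sequence_type_def)
  have pg: "partial_gen S xs i = adjoin S ((\<lambda>j. xs ! j) ` {..<i})" if "i \<le> length es" for i
    using that len by (simp add: partial_gen_def set_take_eq_image)
  have ei: "es ! i = insep_exponent (partial_gen S xs i) (xs ! i)" if "i < length es" for i
    using that len unfolding xs(2)[symmetric] sequence_type_def by simp
  have ex: "y [^] (p ^ insep_exponent (partial_gen S xs i) y) \<in> partial_gen S xs i" if y: "y \<in> carrier R" for y i
  proof -
    obtain e :: nat where "y [^] (p ^ e) \<in> S" using pi y by (auto simp: purely_inseparable_def characteristic_eq)
    hence "y [^] (p ^ e) \<in> partial_gen S xs i" unfolding partial_gen_def by (auto intro: generate_field.incl)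
    thus ?thesis unfolding insep_exponent_def characteristic_eq by (rule LeastI)
  qed
  have carr: "xs ! i \<in> carrier R" if "i < length es" for i
    using xs(1) that len by (auto simp: normal_generating_sequence_def)
  have "normal_tower S (\<lambda>i. xs ! i) (\<lambda>i. es ! i) (length es)" unfolding normal_tower_def
  proof (intro conjI allI impI ballI S)
    fix i assume i: "i < length es"
    show "xs ! i \<in> carrier R" by (rule carr[OF i])
    show e1: "1 \<le> es ! i" using assms(2) i by simp
    have "es ! i - 1 < insep_exponent (partial_gen S xs i) (xs ! i)" using e1 ei[OF i] by simp
    hence "xs ! i [^] (p ^ (es ! i - 1)) \<notin> partial_gen S xs i"
      unfolding insep_exponent_def characteristic_eq by (rule not_less_Least)
    thus "xs ! i [^] (p ^ (es ! i - 1)) \<notin> adjoin S ((\<lambda>i. xs ! i) ` {..<i})" using pg[of i] i by simp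
    fix y assume y: "y \<in> carrier R"
    let ?k = "insep_exponent (partial_gen S xs i) y"
    have "?k \<le> es ! i" using xs(1) i len y ei[OF i]
      unfolding normal_generating_sequence_def normal_element_def by auto
    then obtain l where l: "es ! i = ?k + l" using le_Suc_ex by blast
    have A: "subfield (adjoin S ((\<lambda>i. xs ! i) ` {..<i})) R"
      by (rule adjoin_subfield[OF subfield_closed(1)[OF S]]) (use carr i in auto)
    have "y [^] (p ^ es ! i) = (y [^] (p ^ ?k)) [^] (p ^ l)"
      unfolding l using y by (simp add: nat_pow_pow power_add)
    thus "y [^] (p ^ es ! i) \<in> adjoin S ((\<lambda>i. xs ! i) ` {..<i})"
      using subfield_pow[OF A] ex[OF y, of i] pg[of i] i by simp
  next
    show "adjoin S ((\<lambda>i. xs ! i) ` {..<length es}) = carrier R"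
      using xs(1) pg[of "length es"] len by (simp add: normal_generating_sequence_def)
  qed
  thus ?thesis by (rule that)
qed

lemma normal_tower_imp_insep_type:
  assumes nt: "normal_tower S x e r" and r: "0 < r" and fd: "finite_dimension S (carrier R)"
  shows "insep_type S (map e [0..<r])"
proof -
  have S: "subfield S R" using nt by (simp add: normal_tower_def)
  have xc: "x i \<in> carrier R" if "i < r" for i using nt that by (simp add: normal_tower_def)
  let ?xs = "map x [0..<r]"
  have pg: "partial_gen S ?xs i = adjoin S (x ` {..<i})" if "i \<le> r" for i
  proof -
    have "set (take i ?xs) = x ` {..<i}" using that by (auto simp: take_map)
    thus ?thesis by (simp add: partial_gen_def)
  qed
  have A: "subfield (adjoin S (x ` {..<i})) R" if "i \<le> r" for i
    by (rule adjoin_subfield[OF subfield_closed(1)[OF S]]) (use xc that in auto)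
  have le: "insep_exponent (adjoin S (x ` {..<i})) y \<le> e i" if "i < r" "y \<in> carrier R" for i y
    unfolding insep_exponent_def characteristic_eq
    by (rule Least_le) (use nt that in \<open>auto simp: normal_tower_def\<close>)
  have eq: "insep_exponent (adjoin S (x ` {..<i})) (x i) = e i" if i: "i < r" for i
  proof (rule antisym[OF le[OF i xc[OF i]]], rule ccontr)
    let ?k = "insep_exponent (adjoin S (x ` {..<i})) (x i)"
    assume "\<not> e i \<le> ?k"
    hence "?k \<le> e i - 1" by linarith
    then obtain l where l: "e i - 1 = ?k + l" using le_Suc_ex by blast
    have "x i [^] (p ^ e i) \<in> adjoin S (x ` {..<i})" using nt i by (auto simp: normal_tower_def)
    hence k: "x i [^] (p ^ ?k) \<in> adjoin S (x ` {..<i})"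
      unfolding insep_exponent_def characteristic_eq by (rule LeastI)
    have "x i [^] (p ^ (e i - 1)) = (x i [^] (p ^ ?k)) [^] (p ^ l)"
      unfolding l using xc[OF i] by (simp add: nat_pow_pow power_add)
    hence "x i [^] (p ^ (e i - 1)) \<in> adjoin S (x ` {..<i})" using subfield_pow[OF A k] i by simp
    thus False using nt i by (auto simp: normal_tower_def)
  qed
  have xn: "x i \<notin> adjoin S (x ` {..<i})" if i: "i < r" for i
  proof
    assume "x i \<in> adjoin S (x ` {..<i})"
    hence "x i [^] (p ^ (e i - 1)) \<in> adjoin S (x ` {..<i})" using subfield_pow[OF A] i by simp
    thus False using nt i by (auto simp: normal_tower_def)
  qed
  have "normal_generating_sequence S ?xs"
    unfolding normal_generating_sequence_def normal_element_def
    using xc xn eq le nt pg by (auto simp: normal_tower_def)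
  moreover have "sequence_type S ?xs = map e [0..<r]"
    unfolding sequence_type_def using pg eq by auto
  moreover have "purely_inseparable S" unfolding purely_inseparable_def characteristic_eq
  proof
    fix y assume "y \<in> carrier R"
    hence "y [^] (p ^ e 0) \<in> adjoin S (x ` {..<0})" using nt r by (auto simp: normal_tower_def)
    moreover have "adjoin S (x ` {..<0}) = S" using adjoin_id[OF S, of "{}"] by simp
    ultimately show "\<exists>e. y [^] (p ^ e) \<in> S" by auto
  qed
  ultimately show ?thesis unfolding insep_type_def using S fd by blast
qed

lemma normal_tower_dimension:
  assumes nt: "normal_tower S x e r"
  shows "dimension (\<Prod>j<r. p ^ e j) S (carrier R)"
proof -
  have S: "subfield S R" using nt by (simp add: normal_tower_def)
  have "dimension (\<Prod>j<r. p ^ e j) S (adjoin S (x ` {..<r}))"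
  proof (rule tower_dimension[OF S])
    fix j assume j: "j < r"
    show "x j \<in> carrier R" using nt j by (simp add: normal_tower_def)
    show "dimension (p ^ e j) (adjoin S (x ` {..<j})) (adjoin (adjoin S (x ` {..<j})) {x j})"
      by (rule dimension_insep[OF adjoin_subfield[OF subfield_closed(1)[OF S]]])
        (use nt j in \<open>auto simp: normal_tower_def\<close>)
  qed
  thus ?thesis using nt by (simp add: normal_tower_def)
qed

text \<open>
  Pickert's theorem, by comparing degrees: \<open>L\<^sub>i\<close> has degree \<open>q\<^sup>i\<close> over \<open>S(L\<^sup>q)\<close>, and at most
  \<open>q\<^sup>i\<close> over its subfield \<open>S(x\<^sub>0\<^sup>q, \<dots>, x\<^sub>i\<^sub>-\<^sub>1\<^sup>q)\<close>.
\<close>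

lemma pickert:
  assumes nt: "normal_tower S x e r" and anti: "\<And>j. j < i \<Longrightarrow> e i \<le> e j" and i: "i < r"
  shows "x i [^] (p ^ e i) \<in> adjoin S ((\<lambda>j. x j [^] (p ^ e i)) ` {..<i})"
proof -
  have S: "subfield S R" using nt by (simp add: normal_tower_def)
  note Sc = subfield_closed(1)[OF S]
  have xc: "x j \<in> carrier R" if "j < r" for j using nt that by (simp add: normal_tower_def)
  have e1: "1 \<le> e j" if "j < r" for j using nt that by (simp add: normal_tower_def)
  define q where "q = p ^ e i"
  have q0: "0 < q" using p_pos by (simp add: q_def)
  define L where "L = (\<lambda>j. adjoin S (x ` {..<j}))"
  have L: "subfield (L j) R" if "j \<le> r" for j
    unfolding L_def by (rule adjoin_subfield[OF Sc]) (use xc that in auto)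
  have all: "y [^] (p ^ e j) \<in> L j" if "j < r" "y \<in> carrier R" for j y
    using nt that by (auto simp: normal_tower_def L_def)
  define F where "F = adjoin S ((\<lambda>y. y [^] q) ` carrier R)"
  define W where "W = adjoin S ((\<lambda>j. x j [^] q) ` {..<i})"
  have F: "subfield F R" unfolding F_def by (rule adjoin_subfield[OF Sc]) auto
  have W: "subfield W R" unfolding W_def by (rule adjoin_subfield[OF Sc]) (use xc i in auto)
  note Fc = subfield_closed(1)[OF F] and Wc = subfield_closed(1)[OF W]
  have WF: "W \<subseteq> F" unfolding W_def F_def by (rule adjoin_mono) (use xc i Sc in auto)
  have SL: "S \<subseteq> L i" "S \<subseteq> W" unfolding L_def W_def by (rule adjoin_incl)+
  have FL: "F \<subseteq> L i" unfolding F_def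
    by (rule adjoin_least[OF L SL(1)]) (use all[OF i] i in \<open>auto simp: q_def\<close>)
  have xi: "x ` {..<i} \<subseteq> carrier R" "x ` {..<i} \<subseteq> L i"
    using xc i adjoin_incl(2)[of "x ` {..<i}" S] by (auto simp: L_def)
  have eqL: "adjoin E (x ` {..<i}) = L i" if E: "S \<subseteq> E" "E \<subseteq> L i" for E
  proof
    show "adjoin E (x ` {..<i}) \<subseteq> L i" by (rule adjoin_least[OF L]) (use i E xi in auto)
    show "L i \<subseteq> adjoin E (x ` {..<i})" unfolding L_def
      by (rule adjoin_mono[OF E(1) subset_refl]) (use E xi subfield_closed(1)[OF L[of i]] i in auto)
  qed
  have "dimension (\<Prod>j<i. q) F (adjoin F (x ` {..<i}))"
  proof (rule tower_dimension[OF F])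
    fix j assume j: "j < i"
    hence jr: "j < r" using i by simp
    show "x j \<in> carrier R" using xc jr .
    have xj: "x ` {..<j} \<subseteq> carrier R" using xc jr by auto
    have A: "subfield (adjoin F (x ` {..<j})) R" by (rule adjoin_subfield[OF Fc xj])
    show "dimension q (adjoin F (x ` {..<j})) (adjoin (adjoin F (x ` {..<j})) {x j})"
      unfolding q_def
    proof (rule dimension_insep[OF A xc[OF jr]])
      have "x j [^] q \<in> F" unfolding F_def using adjoin_incl(2)[of "(\<lambda>y. y [^] q) ` carrier R" S] xc[OF jr] by blast
      thus "x j [^] (p ^ e i) \<in> adjoin F (x ` {..<j})" using adjoin_incl(1)[of F] by (auto simp: q_def)
      obtain l where l: "e j = e i + l" using anti[OF j] le_Suc_ex by blast
      \<comment> \<open>Raised to the power q_j / q_i, elements of \<open>F\<close> become elements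
        of S(L^(q_j)), which lies in \<open>L j\<close>. The assumption would thus lower the
        exponent of x_j over \<open>L j\<close>.\<close>
      have "x j [^] (p ^ (e i - 1)) \<notin> adjoin F (x ` {..<j})"
      proof
        assume "x j [^] (p ^ (e i - 1)) \<in> adjoin F (x ` {..<j})"
        hence "(x j [^] (p ^ (e i - 1))) [^] (p ^ l) \<in> L j"
        proof (rule frob_adjoin[OF L Fc xj, rotated -1])
          show "z [^] (p ^ l) \<in> L j" if z: "z \<in> F" for z
            using z unfolding F_def
          proof (rule frob_adjoin[OF L Sc, rotated -1])
            show "w [^] (p ^ l) \<in> L j" if "w \<in> S" for w
              using subfield_pow[OF S that] adjoin_incl(1)[of S "x ` {..<j}"] by (auto simp: L_def)
            show "w [^] (p ^ l) \<in> L j" if w: "w \<in> (\<lambda>y. y [^] q) ` carrier R" for w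
            proof -
              obtain y where y: "y \<in> carrier R" "w = y [^] q" using w by auto
              have "w [^] (p ^ l) = y [^] (p ^ e j)" unfolding y(2) l q_def using y(1) by (simp add: nat_pow_pow power_add)
              thus ?thesis using all[OF jr y(1)] by simp
            qed
          qed (use jr in auto)
          show "w [^] (p ^ l) \<in> L j" if "w \<in> x ` {..<j}" for w
            using that adjoin_incl(2)[of "x ` {..<j}" S] subfield_pow[OF L[of j]] jr by (auto simp: L_def)
        qed (use jr in auto)
        moreover have "(x j [^] (p ^ (e i - 1))) [^] (p ^ l) = x j [^] (p ^ (e j - 1))"
          using xc[OF jr] e1[OF i] unfolding l by (simp add: nat_pow_pow power_add[symmetric])
        ultimately show False using nt jr by (auto simp: normal_tower_def L_def)
      qed
      thus "e i = 0 \<or> x j [^] (p ^ (e i - 1)) \<notin> adjoin F (x ` {..<j})" by simp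
    qed
  qed
  hence dF: "dimension (q ^ i) F (L i)" using eqL[of F] SL WF FL by simp
  have "\<And>j. j < i \<Longrightarrow> 0 < q \<and> x j [^] q \<in> adjoin W (x ` {..<j})"
  proof -
    fix j assume "j < i"
    hence "x j [^] q \<in> W" unfolding W_def using adjoin_incl(2)[of "(\<lambda>j. x j [^] q) ` {..<i}" S] by blast
    thus "0 < q \<and> x j [^] q \<in> adjoin W (x ` {..<j})" using q0 adjoin_incl(1)[of W] by blast
  qed
  then obtain d where d: "d \<le> (\<Prod>j<i. q)" "dimension d W (adjoin W (x ` {..<i}))"
    using tower_dimension_le[OF W, of i x "\<lambda>_. q"] xc i by auto
  have dW: "dimension d W (L i)" using d(2) eqL[of W] SL WF FL by auto
  obtain f where f: "dimension f W F"
    using finite_dimension_lower[OF W F WF FL finite_dimensionI[OF dW]] by (auto simp: finite_dimension_def)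
  have "f * q ^ i = d" using dimension_is_inj[OF W telescopic_base[OF W F f dF] dW] .
  hence "f \<le> 1" using d(1) q0 by (metis card_lessThan mult_le_cancel2 nat_mult_1 prod_constant zero_less_power)
  hence "F = W" using dimension_oneD[OF W F WF f] by simp
  moreover have "x i [^] q \<in> F" unfolding F_def
    using adjoin_incl(2)[of "(\<lambda>y. y [^] q) ` carrier R" S] xc[OF i] by blast
  ultimately show ?thesis by (simp add: W_def q_def)
qed

end

section \<open>Primitive elements\<close>

context field
begin

lemma lin_indep_cong:
  assumes E: "subfield E R" and f: "lin_indep E f m" and eq: "\<And>i. i < m \<Longrightarrow> f i = g i"
  shows "lin_indep E g m" "lin_span E g m = lin_span E f m"
proof -
  have fc: "f \<in> {..<m} \<rightarrow> carrier R" using lin_indep_carrier[OF f] .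
  hence gc: "g \<in> {..<m} \<rightarrow> carrier R" using eq by (auto simp: Pi_iff)
  have m: "map f [0..<m] = map g [0..<m]" using eq by simp
  show "lin_indep E g m" "lin_span E g m = lin_span E f m"
    using f unfolding lin_indep_iff_independent[OF E fc] lin_indep_iff_independent[OF E gc]
      lin_span_eq_Span[OF E fc] lin_span_eq_Span[OF E gc] m by simp_all
qed

lemma chain_spans_snoc:
  assumes "subfield E R" "fst ` set ps \<subseteq> carrier R"
  shows "chain_spans E (ps @ [(y, d)]) \<longleftrightarrow> chain_spans E ps \<and> y \<in> carrier R \<and> 0 < d \<and>
     y [^] d \<in> lin_span (adjoin E (fst ` set ps)) (\<lambda>i. y [^] i) d"
  using assms
proof (induction E ps rule: chain_spans.induct)
  case (1 E)
  have "adjoin E {} = E" using adjoin_id[OF 1(1), of "{}"] by simp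
  thus ?case by simp
next
  case (2 E z k ps)
  note Ec = subfield_closed(1)[OF 2(2)]
  have "adjoin (adjoin E {z}) (fst ` set ps) = adjoin E ({z} \<union> fst ` set ps)"
    by (rule adjoin_adjoin) (use 2 Ec in auto)
  moreover have "subfield (adjoin E {z}) R" using adjoin_subfield[OF Ec, of "{z}"] 2 by auto
  ultimately show ?case using 2 by simp
qed

lemma chain_indep_snoc:
  assumes "subfield E R" "fst ` set ps \<subseteq> carrier R"
  shows "chain_indep E (ps @ [(y, d)]) \<longleftrightarrow> chain_indep E ps \<and> y \<in> carrier R \<and> 0 < d \<and>
     lin_indep (adjoin E (fst ` set ps)) (\<lambda>i. y [^] i) d"
  using assms
proof (induction E ps rule: chain_indep.induct)
  case (1 E)
  have "adjoin E {} = E" using adjoin_id[OF 1(1), of "{}"] by simp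
  thus ?case by simp
next
  case (2 E z k ps)
  note Ec = subfield_closed(1)[OF 2(2)]
  have "adjoin (adjoin E {z}) (fst ` set ps) = adjoin E ({z} \<union> fst ` set ps)"
    by (rule adjoin_adjoin) (use 2 Ec in auto)
  moreover have "subfield (adjoin E {z}) R" using adjoin_subfield[OF Ec, of "{z}"] 2 by auto
  ultimately show ?case using 2 by simp
qed

lemma chain_spans_map:
  assumes E: "subfield E R"
    and "\<And>j. j < m \<Longrightarrow> y j \<in> carrier R \<and> 0 < d j \<and> y j [^] d j \<in> adjoin E (y ` {..<j})"
  shows "chain_spans E (map (\<lambda>j. (y j, d j)) [0..<m])"
  using assms(2)
proof (induction m)
  case (Suc m)
  let ?ps = "map (\<lambda>j. (y j, d j)) [0..<m]"
  have yc: "y ` {..<m} \<subseteq> carrier R" using Suc.prems by auto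
  have f: "fst ` set ?ps = y ` {..<m}" by (auto simp: image_image)
  have sf: "subfield (adjoin E (y ` {..<m})) R" by (rule adjoin_subfield[OF subfield_closed(1)[OF E] yc])
  have "y m [^] d m \<in> lin_span (adjoin E (y ` {..<m})) (\<lambda>i. y m [^] i) (d m)"
    using subfield_subset_lin_span_powers[OF sf, of "y m" "d m"] Suc.prems[of m] by auto
  hence "chain_spans E (?ps @ [(y m, d m)])"
    unfolding chain_spans_snoc[OF E, of ?ps, unfolded f, OF yc] using Suc by auto
  thus ?case by simp
qed simp

end

context char_p_field
begin

text \<open>
  For a separable extension with basis \<open>\<beta>\<^sub>i\<close>, the powers \<open>\<beta>\<^sub>i\<^sup>Q\<close> also form a basis. If \<open>\<gamma>\<close> generates
  a subextension \<open>E\<close> of degree \<open>d\<close>, then the coordinates of \<open>\<gamma>\<close> in this basis lie in the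
  \<open>K\<^sup>Q\<close>-span of the \<open>d\<close> coordinates of \<open>\<gamma>\<close> in the basis of \<open>Q\<close>-th powers of a basis of \<open>E\<close>.
  Hence \<open>\<gamma>\<close> is primitive as soon as its coordinates are linearly independent over \<open>K\<^sup>Q\<close>,
  which is achieved by choosing them one by one, as \<open>K\<close> is imperfect.
\<close>

lemma primitive_element:
  assumes K: "subfield K R" and S: "subfield S R" "K \<subseteq> S" "dimension n K S"
    and sep: "\<And>y. y \<in> S \<Longrightarrow> y \<in> adjoin K {y [^] p}"
    and t: "t \<in> K" "\<And>z. z \<in> K \<Longrightarrow> z [^] p \<noteq> t" and b: "b \<in> S"
  shows "\<exists>s\<in>S. adjoin K {b \<oplus> s [^] (p ^ e)} = S"
proof -
  note Kc = subfield_closed(1)[OF K] and Sc = subfield_closed(1)[OF S(1)]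
  have n0: "0 < n"
  proof (rule ccontr)
    assume "\<not> 0 < n"
    hence "S = {\<zero>}" using dimension_zero[OF K] S(3) by simp
    thus False using subfieldE(6)[OF S(1)] subfield_closed(3)[OF S(1)] by auto
  qed
  \<comment> \<open>Q = P q. The element s will have coordinates z_i along the powers \<beta>_i^P,
    so that s^q has coordinates z_i^q in the basis of Q-th powers. The choice P = p^n >= n leaves
    room for n independent coordinates over K^Q.\<close>
  define q where "q = p ^ e"
  define P where "P = p ^ n"
  define Q where "Q = p ^ (n + e)"
  have PQ: "(x [^] P) [^] q = x [^] Q" if "x \<in> carrier R" for x
    using that by (simp add: P_def q_def Q_def nat_pow_pow power_add)
  have nP: "n \<le> P" unfolding P_def using power_gt_expt[of p n] p_gt_1 by simp
  define KQ where "KQ = (\<lambda>x. x [^] Q) ` K"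
  have KQ: "subfield KQ R" unfolding KQ_def Q_def by (rule frob_image_subfield[OF K])
  have KQK: "KQ \<subseteq> K" unfolding KQ_def using subfield_pow[OF K] by auto
  obtain \<beta> where \<beta>: "lin_indep K \<beta> n" "lin_span K \<beta> n = S" using dimension_basis[OF K S(3)] .
  have \<beta>c: "\<beta> \<in> {..<n} \<rightarrow> carrier R" using lin_indep_carrier \<beta>(1) by blast
  have \<beta>S: "\<beta> i \<in> S" if "i < n" for i using lin_span_closed(6)[OF K \<beta>c that] \<beta>(2) by simp
  define \<beta>Q where "\<beta>Q = (\<lambda>i. \<beta> i [^] Q)"
  have \<beta>Qc: "\<beta>Q \<in> {..<n} \<rightarrow> carrier R" using \<beta>c by (auto simp: \<beta>Q_def)
  \<comment> \<open>As g lies in K(g^Q), the Q-th powers of a spanning family of K(g) span K(g)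
    again.\<close>
  have powE: "E \<subseteq> lin_span K (\<lambda>i. v i [^] Q) m"
    if E: "subfield E R" "E = adjoin K {g}" "g \<in> S" and v: "v \<in> {..<m} \<rightarrow> carrier R" "lin_span K v m = E" for E g v m
  proof -
    let ?V = "lin_span K (\<lambda>i. v i [^] Q) m"
    have V: "subfield ?V R" "K \<subseteq> ?V" "\<And>x. x \<in> E \<Longrightarrow> x [^] Q \<in> ?V"
      using frob_span_subfield[OF K K E(1) v, of "n + e"] subfield_pow[OF K] unfolding Q_def by blast+
    have "g \<in> E" using E(2) adjoin_incl(2)[of "{g}" K] by auto
    hence "adjoin K {g [^] Q} \<subseteq> ?V" using adjoin_least[OF V(1,2)] V(3) by simp
    moreover have "g \<in> adjoin K {g [^] Q}"
      unfolding Q_def by (rule separable_adjoin_pow[OF K]) (use E Sc sep in auto)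
    ultimately show ?thesis unfolding E(2) using adjoin_least[OF V(1,2), of "{g}"] by auto
  qed
  have \<beta>Qspan: "lin_span K \<beta>Q n = S"
  proof
    show "lin_span K \<beta>Q n \<subseteq> S"
      by (rule lin_span_minimal)
        (use subfield_closed[OF S(1)] S(2) \<beta>S subfield_pow[OF S(1)] \<beta>Qc Kc in \<open>auto simp: \<beta>Q_def\<close>)
    let ?V = "lin_span K (\<lambda>i. \<beta> i [^] Q) n"
    have V: "subfield ?V R" "K \<subseteq> ?V" "\<And>x. x \<in> S \<Longrightarrow> x [^] Q \<in> ?V"
      using frob_span_subfield[OF K K S(1) \<beta>c \<beta>(2), of "n + e"] subfield_pow[OF K] unfolding Q_def by blast+
    show "S \<subseteq> lin_span K \<beta>Q n" unfolding \<beta>Q_def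
    proof
      fix y assume y: "y \<in> S"
      have "y \<in> adjoin K {y [^] Q}"
        unfolding Q_def by (rule separable_adjoin_pow[OF K]) (use y Sc sep in auto)
      thus "y \<in> ?V" using adjoin_least[OF V(1,2), of "{y [^] Q}"] V(3)[OF y] by auto
    qed
  qed
  have \<beta>Q: "lin_indep K \<beta>Q n" using lin_span_indep(1)[OF K _ _ \<beta>Qc, of n] \<beta>Qspan S(3) by simp
  obtain bc where bc: "bc \<in> {..<n} \<rightarrow> K" "b = lincomb bc \<beta>Q n"
    using b unfolding \<beta>Qspan[symmetric] lin_span_def by auto
  \<comment> \<open>The coordinates of the prospective primitive element are made independent over
    K^Q one at a time.\<close>
  have "\<exists>z. (\<forall>i. z i \<in> K) \<and> lin_indep KQ (\<lambda>i. bc i \<oplus> z i [^] q) m" if "m \<le> n" for m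
    using that
  proof (induction m)
    case 0
    show ?case using subfield_closed(2)[OF K] by (intro exI[of _ "\<lambda>_. \<zero>"]) (simp add: lin_indep_def)
  next
    case (Suc m)
    then obtain z where z: "\<And>i. z i \<in> K" "lin_indep KQ (\<lambda>i. bc i \<oplus> z i [^] q) m" by auto
    let ?v = "\<lambda>i. bc i \<oplus> z i [^] q"
    have vc: "?v \<in> {..<m} \<rightarrow> carrier R" using lin_indep_carrier[OF z(2)] .
    have bm: "bc m \<in> K" using bc(1) Suc.prems by auto
    note V = lin_span_closed[OF KQ vc]
    \<comment> \<open>If no w worked, w = 0 would put \<open>bc m\<close> into the span, and then
      all of K^q would lie in a space of dimension m < n over K^Q. But t^q has exponent n over K^Q,
      as t is not a p-th power, so its first p^n powers are independent.\<close>
    have "\<exists>w\<in>K. bc m \<oplus> w [^] q \<notin> lin_span KQ ?v m"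
    proof (rule ccontr)
      assume "\<not> ?thesis"
      hence h: "bc m \<oplus> w [^] q \<in> lin_span KQ ?v m" if "w \<in> K" for w using that by blast
      have "bc m \<oplus> \<zero> [^] q \<in> lin_span KQ ?v m" by (rule h[OF subfield_closed(2)[OF K]])
      hence bV: "bc m \<in> lin_span KQ ?v m" using bm Kc frob_zero by (auto simp: q_def)
      have wV: "w [^] q \<in> lin_span KQ ?v m" if w: "w \<in> K" for w
      proof -
        have "\<ominus> bc m \<oplus> (bc m \<oplus> w [^] q) \<in> lin_span KQ ?v m" using V(3)[OF V(4)[OF bV] h[OF w]] .
        moreover have "\<ominus> bc m \<oplus> (bc m \<oplus> w [^] q) = w [^] q" using bm w Kc r_neg1[of "bc m" "w [^] q"] by auto
        ultimately show ?thesis by simp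
      qed
      let ?x = "t [^] q"
      have tc: "t \<in> carrier R" using t Kc by auto
      have xP: "?x [^] (p ^ n) \<in> KQ" unfolding KQ_def Q_def q_def using tc t(1)
        by (intro image_eqI[of _ _ t]) (auto simp: nat_pow_pow power_add mult.commute)
      have xn: "?x [^] (p ^ (n - 1)) \<notin> KQ"
      proof
        assume "?x [^] (p ^ (n - 1)) \<in> KQ"
        then obtain z where z: "z \<in> K" "?x [^] (p ^ (n - 1)) = z [^] Q" by (auto simp: KQ_def)
        have "?x [^] (p ^ (n - 1)) = t [^] (p ^ (n - 1 + e))"
          using tc by (simp add: q_def nat_pow_pow power_add mult.commute)
        moreover have "z [^] Q = (z [^] p) [^] (p ^ (n - 1 + e))"
          using z(1) Kc n0 unfolding Q_def by (cases n) (auto simp: nat_pow_pow subset_iff)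
        ultimately have "t [^] (p ^ (n - 1 + e)) = (z [^] p) [^] (p ^ (n - 1 + e))" using z(2) by simp
        hence "t = z [^] p" using frob_inj[of t "z [^] p"] tc z(1) Kc by auto
        thus False using t(2)[OF z(1)] by simp
      qed
      have xc: "?x \<in> carrier R" using tc by simp
      have P0: "0 < P" using p_pos by (simp add: P_def)
      have pc: "(\<lambda>i. ?x [^] i) \<in> {..<P} \<rightarrow> carrier R" using xc by auto
      have "lin_span KQ (\<lambda>i. ?x [^] i) P = adjoin KQ {?x}"
        by (rule adjoin_eq_lin_span[OF KQ xc P0])
          (use subfield_subset_lin_span_powers[OF KQ xc P0] xP in \<open>auto simp: P_def\<close>)
      moreover have "dimension P KQ (adjoin KQ {?x})"
        unfolding P_def by (rule dimension_insep[OF KQ xc xP]) (use xn in simp)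
      ultimately have "lin_indep KQ (\<lambda>i. ?x [^] i) P" using lin_span_indep(1)[OF KQ _ _ pc, of P] by simp
      moreover have "?x [^] i \<in> lin_span KQ ?v m" for i :: nat
      proof -
        have "?x [^] i = (t [^] i) [^] q" using tc by (simp add: nat_pow_pow mult.commute)
        thus ?thesis using wV[OF subfield_pow[OF K t(1), of i]] by simp
      qed
      ultimately have "P \<le> m"
        using lin_indep_le_dimension[OF KQ lin_indep_dimension[OF KQ z(2)]] by blast
      thus False using nP Suc.prems by simp
    qed
    then obtain w where w: "w \<in> K" "bc m \<oplus> w [^] q \<notin> lin_span KQ ?v m" by blast
    let ?z = "z(m := w)"
    have "?v i = bc i \<oplus> ?z i [^] q" if "i < m" for i using that by simp
    note zz = lin_indep_cong[OF KQ z(2) this]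
    have "lin_indep KQ (\<lambda>i. bc i \<oplus> ?z i [^] q) (Suc m)"
      by (rule lin_indep_Suc[OF KQ zz(1)]) (use zz(2) w bm Kc in auto)
    thus ?case using z(1) w(1) by (intro exI[of _ ?z]) auto
  qed
  then obtain z where z: "\<And>i. z i \<in> K" "lin_indep KQ (\<lambda>i. bc i \<oplus> z i [^] q) n" by auto
  define s where "s = lincomb z (\<lambda>i. \<beta> i [^] P) n"
  have sS: "s \<in> S" unfolding s_def
    by (rule lincomb_in_subfield[OF S(1)]) (use z(1) S(2) subfield_pow[OF S(1)] \<beta>S in auto)
  define \<gamma> where "\<gamma> = b \<oplus> s [^] q"
  have \<gamma>S: "\<gamma> \<in> S" unfolding \<gamma>_def using subfield_closed(4)[OF S(1) b] subfield_pow[OF S(1) sS] by simp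
  have zc: "z \<in> A \<rightarrow> carrier R" for A using z(1) Kc by auto
  have bcc: "bc \<in> {..<n} \<rightarrow> carrier R" using Pi_subset[OF bc(1) Kc] .
  have "s [^] q = lincomb (\<lambda>i. z i [^] q) (\<lambda>i. (\<beta> i [^] P) [^] q) n"
    unfolding s_def q_def by (rule frob_lincomb) (use zc \<beta>c in \<open>auto simp: Pi_iff\<close>)
  also have "\<dots> = lincomb (\<lambda>i. z i [^] q) \<beta>Q n"
  proof (rule lincomb_cong)
    show "(\<beta> i [^] P) [^] q = \<beta>Q i" if "i < n" for i using PQ[of "\<beta> i"] \<beta>c that by (auto simp: \<beta>Q_def)
  qed (use z(1) Kc \<beta>Qc in auto)
  finally have "\<gamma> = lincomb bc \<beta>Q n \<oplus> lincomb (\<lambda>i. z i [^] q) \<beta>Q n" unfolding \<gamma>_def bc(2) by simp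
  also have "\<dots> = lincomb (\<lambda>i. bc i \<oplus> z i [^] q) \<beta>Q n"
    by (rule lincomb_add[symmetric, OF bcc _ \<beta>Qc]) (use z(1) Kc in auto)
  finally have \<gamma>1: "\<gamma> = lincomb (\<lambda>i. bc i \<oplus> z i [^] q) \<beta>Q n" .
  let ?E = "adjoin K {\<gamma>}"
  have E: "subfield ?E R" using adjoin_subfield[OF Kc, of "{\<gamma>}"] \<gamma>S Sc by auto
  have ES: "?E \<subseteq> S" by (rule adjoin_least[OF S(1,2)]) (use \<gamma>S in simp)
  obtain d where d: "dimension d K ?E"
    using finite_dimension_lower[OF K E adjoin_incl(1) ES finite_dimensionI[OF S(3)]]
    by (auto simp: finite_dimension_def)
  obtain \<epsilon> where \<epsilon>: "lin_indep K \<epsilon> d" "lin_span K \<epsilon> d = ?E" using dimension_basis[OF K d] .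
  have \<epsilon>c: "\<epsilon> \<in> {..<d} \<rightarrow> carrier R" using lin_indep_carrier \<epsilon>(1) by blast
  have \<epsilon>S: "\<epsilon> j \<in> S" if "j < d" for j using lin_span_closed(6)[OF K \<epsilon>c that] \<epsilon>(2) ES by auto
  have "\<gamma> \<in> ?E" using adjoin_incl(2)[of "{\<gamma>}" K] by auto
  hence "\<gamma> \<in> lin_span K (\<lambda>i. \<epsilon> i [^] Q) d" using powE[OF E refl \<gamma>S \<epsilon>c \<epsilon>(2)] by auto
  then obtain \<kappa> where \<kappa>: "\<kappa> \<in> {..<d} \<rightarrow> K" "\<gamma> = lincomb \<kappa> (\<lambda>i. \<epsilon> i [^] Q) d" by (auto simp: lin_span_def)
  have "\<exists>a. j < d \<longrightarrow> a \<in> {..<n} \<rightarrow> K \<and> \<epsilon> j = lincomb a \<beta> n" for j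
    using \<epsilon>S[of j] unfolding \<beta>(2)[symmetric] lin_span_def by (cases "j < d") blast+
  then obtain a where a: "\<And>j. j < d \<Longrightarrow> a j \<in> {..<n} \<rightarrow> K" "\<And>j. j < d \<Longrightarrow> \<epsilon> j = lincomb (a j) \<beta> n" by metis
  define A where "A = (\<lambda>j i. a j i [^] Q)"
  have AK: "A j i \<in> KQ" if "j < d" "i < n" for i j using a(1)[OF that(1)] that by (auto simp: A_def KQ_def)
  have Ac: "A j i \<in> carrier R" if "j < d" "i < n" for i j using AK[OF that] subfield_closed(1)[OF KQ] by auto
  have \<epsilon>Q: "\<epsilon> j [^] Q = lincomb (A j) \<beta>Q n" if "j < d" for j
    unfolding a(2)[OF that] A_def \<beta>Q_def Q_def
    by (rule frob_lincomb[OF Pi_subset[OF a(1)[OF that] Kc] \<beta>c])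
  have \<kappa>c: "\<kappa> \<in> {..<d} \<rightarrow> carrier R" using Pi_subset[OF \<kappa>(1) Kc] .
  have \<epsilon>Qc: "(\<lambda>j. \<epsilon> j [^] Q) \<in> {..<d} \<rightarrow> carrier R" using \<epsilon>c by auto
  have "\<gamma> = lincomb (\<lambda>j. \<epsilon> j [^] Q) \<kappa> d" unfolding \<kappa>(2) by (rule lincomb_comm[OF \<kappa>c \<epsilon>Qc])
  also have "\<dots> = lincomb (\<lambda>j. lincomb (A j) \<beta>Q n) \<kappa> d"
  proof (rule lincomb_cong)
    show "(\<lambda>j. lincomb (A j) \<beta>Q n) \<in> {..<d} \<rightarrow> carrier R"
      by (intro Pi_I lincomb_closed \<beta>Qc) (use Ac in auto)
  qed (use \<epsilon>Q \<kappa>c in auto)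
  also have "\<dots> = lincomb (\<lambda>i. lincomb (\<lambda>j. A j i) \<kappa> d) \<beta>Q n"
    by (rule lincomb_swap[OF Ac \<beta>Qc \<kappa>c])
  finally have \<gamma>2: "\<gamma> = lincomb (\<lambda>i. lincomb (\<lambda>j. A j i) \<kappa> d) \<beta>Q n" .
  \<comment> \<open>Two expansions of \<gamma> in the basis of Q-th powers are compared. Since the
    \<open>A j i\<close> lie in K^Q, each coordinate lies in the K^Q-span of the d elements
    \<kappa>_j; n independent coordinates then force d = n.\<close>
  have uniq: "bc i \<oplus> z i [^] q = lincomb (\<lambda>j. A j i) \<kappa> d" if i: "i < n" for i
  proof -
    let ?u = "\<lambda>i. bc i \<oplus> z i [^] q" and ?w = "\<lambda>i. lincomb (\<lambda>j. A j i) \<kappa> d"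
    have u: "?u \<in> {..<n} \<rightarrow> K"
      using bc(1) subfield_closed(4)[OF K] subfield_pow[OF K z(1)] by (simp add: Pi_iff)
    have w: "?w \<in> {..<n} \<rightarrow> K"
      by (intro Pi_I lincomb_in_subfield[OF K]) (use AK KQK \<kappa>(1) in auto)
    note uc = Pi_subset[OF u Kc] and wc = Pi_subset[OF w Kc]
    have mw: "(\<lambda>i. \<ominus> \<one> \<otimes> ?w i) \<in> {..<n} \<rightarrow> K"
      using w subfield_closed(5)[OF K subfield_closed(6)[OF K subfield_closed(3)[OF K]]] by auto
    have "lincomb (\<lambda>i. ?u i \<oplus> \<ominus> \<one> \<otimes> ?w i) \<beta>Q n = lincomb ?u \<beta>Q n \<oplus> lincomb (\<lambda>i. \<ominus> \<one> \<otimes> ?w i) \<beta>Q n"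
      by (rule lincomb_add[OF uc Pi_subset[OF mw Kc] \<beta>Qc])
    also have "lincomb (\<lambda>i. \<ominus> \<one> \<otimes> ?w i) \<beta>Q n = \<ominus> \<one> \<otimes> lincomb ?w \<beta>Q n"
      by (rule lincomb_smult[OF wc _ \<beta>Qc]) simp
    also have "lincomb ?u \<beta>Q n \<oplus> \<ominus> \<one> \<otimes> lincomb ?w \<beta>Q n = \<zero>"
      unfolding \<gamma>1[symmetric] \<gamma>2[symmetric] using \<gamma>S Sc by (auto simp: l_minus r_neg)
    finally have "?u i \<oplus> \<ominus> \<one> \<otimes> ?w i = \<zero>"
      using lin_indepD[OF \<beta>Q, of "\<lambda>i. ?u i \<oplus> \<ominus> \<one> \<otimes> ?w i" i] u mw i subfield_closed(4)[OF K] by auto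
    moreover have "?u i \<in> carrier R" "?w i \<in> carrier R" using uc wc i by auto
    ultimately show ?thesis by (simp add: l_minus minus_eq[symmetric])
  qed
  obtain d' where d': "d' \<le> d" "dimension d' KQ (lin_span KQ \<kappa> d)" using lin_span_dimension_le[OF KQ \<kappa>c] .
  have "n \<le> d'"
  proof (rule lin_indep_le_dimension[OF KQ d'(2) z(2)])
    show "(\<lambda>i. bc i \<oplus> z i [^] q) \<in> {..<n} \<rightarrow> lin_span KQ \<kappa> d"
    proof
      fix i assume i: "i \<in> {..<n}"
      have "lincomb (\<lambda>j. A j i) \<kappa> d \<in> lin_span KQ \<kappa> d"
        unfolding lin_span_def using AK i by (intro CollectI exI conjI refl) auto
      thus "bc i \<oplus> z i [^] q \<in> lin_span KQ \<kappa> d" using uniq i by simp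
    qed
  qed
  moreover have "d \<le> n" by (rule lin_indep_le_dimension[OF K S(3) \<epsilon>(1)]) (use \<epsilon>S in auto)
  ultimately have "d = n" using d' by simp
  hence "lin_span K \<epsilon> d = S" using lin_indep_eq_dimension[OF K _ \<epsilon>(1), of S] S(3) \<epsilon>S by auto
  hence "adjoin K {b \<oplus> s [^] (p ^ e)} = S" using \<epsilon>(2) by (simp add: \<gamma>_def q_def)
  thus ?thesis using sS by blast
qed

text \<open>Were \<open>K\<close> perfect, the coefficients of x^p along the p-th powers of a
  K-basis of \<open>S\<close> would be p-th powers. Then x^p would be the p-th power of an element
  of \<open>S\<close>, and Frobenius is injective.\<close>

lemma exists_non_pth_power:
  assumes K: "subfield K R" and S: "subfield S R" "K \<subseteq> S" "dimension n K S"
    and sep: "\<And>y. y \<in> S \<Longrightarrow> y \<in> adjoin K {y [^] p}"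
    and x: "x \<in> carrier R" "x \<notin> S" "x [^] p \<in> S"
  shows "\<exists>t\<in>K. \<forall>z\<in>K. z [^] p \<noteq> t"
proof (rule ccontr)
  assume "\<not> ?thesis"
  hence perf: "\<exists>z\<in>K. z [^] p = t" if "t \<in> K" for t using that by blast
  note Kc = subfield_closed(1)[OF K] and Sc = subfield_closed(1)[OF S(1)]
  obtain b where b: "lin_indep K b n" "lin_span K b n = S" using dimension_basis[OF K S(3)] .
  have bc: "b \<in> {..<n} \<rightarrow> carrier R" using lin_indep_carrier b(1) by blast
  let ?V = "lin_span K (\<lambda>i. b i [^] (p ^ 1)) n"
  have V: "subfield ?V R" "K \<subseteq> ?V" "\<And>x. x \<in> S \<Longrightarrow> x [^] (p ^ 1) \<in> ?V"
    using frob_span_subfield[OF K K S(1) bc b(2), of 1] subfield_pow[OF K] by blast+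
  have "x [^] p \<in> adjoin K {(x [^] p) [^] p}" using sep x(3) by blast
  hence "x [^] p \<in> ?V" using adjoin_least[OF V(1,2), of "{(x [^] p) [^] p}"] V(3)[OF x(3)] by auto
  then obtain c where c: "c \<in> {..<n} \<rightarrow> K" "x [^] p = lincomb c (\<lambda>i. b i [^] (p ^ 1)) n"
    by (auto simp: lin_span_def)
  have "\<exists>z. i < n \<longrightarrow> z \<in> K \<and> z [^] p = c i" for i using perf[of "c i"] c(1) by (cases "i < n") auto
  then obtain z where z: "\<And>i. i < n \<Longrightarrow> z i \<in> K" "\<And>i. i < n \<Longrightarrow> z i [^] p = c i" by metis
  have zK: "z \<in> {..<n} \<rightarrow> K" using z by auto
  have "(lincomb z b n) [^] (p ^ 1) = lincomb (\<lambda>i. z i [^] (p ^ 1)) (\<lambda>i. b i [^] (p ^ 1)) n"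
    by (rule frob_lincomb[OF Pi_subset[OF zK Kc] bc])
  also have "\<dots> = x [^] (p ^ 1)" unfolding power_one_right c(2)
    by (rule lincomb_cong) (use z(2) c(1) Kc bc in auto)
  finally have "lincomb z b n = x"
    using frob_inj lincomb_closed[OF Pi_subset[OF zK Kc] bc] x(1) by blast
  hence "x \<in> S" using zK b(2) by (auto simp: lin_span_def)
  thus False using x by simp
qed

text \<open>Shifting x_0 by \<open>s\<close> changes none of the fields of the tower, but it
  replaces x_0^(q_0) by x_0^(q_0) + s^(q_0), which can then be made a primitive element.\<close>

lemma normal_tower_shift:
  assumes nt: "normal_tower S x e r" and r: "0 < r" and s: "s \<in> S"
  shows "normal_tower S (\<lambda>i. if i = 0 then x 0 \<oplus> s else x i) e r"
proof -
  let ?x = "\<lambda>i. if i = 0 then x 0 \<oplus> s else x i"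
  have S: "subfield S R" using nt by (simp add: normal_tower_def)
  note Sc = subfield_closed(1)[OF S]
  have xc: "x i \<in> carrier R" if "i < r" for i using nt that by (simp add: normal_tower_def)
  have sc: "s \<in> carrier R" using s Sc by auto
  have xc': "?x i \<in> carrier R" if "i < r" for i using xc that sc by simp
  have eq: "adjoin S (?x ` {..<i}) = adjoin S (x ` {..<i})" if i: "i \<le> r" for i
  proof -
    have A: "subfield (adjoin S (x ` {..<i})) R" "subfield (adjoin S (?x ` {..<i})) R"
    proof -
      show "subfield (adjoin S (x ` {..<i})) R" by (rule adjoin_subfield[OF Sc]) (use xc i in auto)
      have "?x ` {..<i} \<subseteq> carrier R" 
      proof
        fix y assume "y \<in> ?x ` {..<i}"
        then obtain j where "j < i" "y = ?x j" by blast
        thus "y \<in> carrier R" using xc'[of j] i by simp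
      qed
      thus "subfield (adjoin S (?x ` {..<i})) R" by (rule adjoin_subfield[OF Sc])
    qed
    have mem: "x j \<in> adjoin S (x ` {..<i})" "?x j \<in> adjoin S (?x ` {..<i})" if "j < i" for j
      using that adjoin_incl(2)[of "x ` {..<i}" S] adjoin_incl(2)[of "?x ` {..<i}" S] by blast+
    have sm: "s \<in> adjoin S (x ` {..<i})" "s \<in> adjoin S (?x ` {..<i})"
      using s adjoin_incl(1)[of S] by blast+
    have "?x j \<in> adjoin S (x ` {..<i})" if "j < i" for j
      using mem(1)[OF that] sm subfield_closed(4)[OF A(1)] by auto
    moreover have "x j \<in> adjoin S (?x ` {..<i})" if j: "j < i" for j
    proof (cases "j = 0")
      case True
      have "x 0 \<oplus> s \<in> adjoin S (?x ` {..<i})" using mem(2)[OF j] True by simp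
      hence "(x 0 \<oplus> s) \<ominus> s \<in> adjoin S (?x ` {..<i})" using sm subfield_closed(7)[OF A(2)] by blast
      moreover have "(x 0 \<oplus> s) \<ominus> s = x 0"
        using xc[OF r] sc by (simp add: a_minus_def a_assoc r_neg)
      ultimately show ?thesis using True by simp
    next
      case False thus ?thesis using mem(2)[OF j] by simp
    qed
    ultimately have "?x ` {..<i} \<subseteq> adjoin S (x ` {..<i})" "x ` {..<i} \<subseteq> adjoin S (?x ` {..<i})" by blast+
    thus ?thesis using adjoin_least[OF A(1) adjoin_incl(1)] adjoin_least[OF A(2) adjoin_incl(1)]
      by (intro subset_antisym) blast+
  qed
  have e0: "adjoin S (x ` {..<0}) = S" using adjoin_id[OF S, of "{}"] by simp
  show ?thesis unfolding normal_tower_def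
  proof (intro conjI allI impI ballI S)
    fix i assume i: "i < r"
    show "?x i \<in> carrier R" by (rule xc'[OF i])
    show "1 \<le> e i" using nt i by (simp add: normal_tower_def)
    show "y [^] (p ^ e i) \<in> adjoin S (?x ` {..<i})" if "y \<in> carrier R" for y
      using nt i that eq[of i] by (simp add: normal_tower_def)
    show "?x i [^] (p ^ (e i - 1)) \<notin> adjoin S (?x ` {..<i})"
    proof (cases "i = 0")
      case False thus ?thesis using nt i eq[of i] by (simp add: normal_tower_def)
    next
      case True
      let ?k = "p ^ (e 0 - 1)"
      have n: "x 0 [^] ?k \<notin> S" using nt r e0 by (force simp: normal_tower_def)
      have "(x 0 \<oplus> s) [^] ?k \<notin> S"
      proof
        assume "(x 0 \<oplus> s) [^] ?k \<in> S"
        hence "x 0 [^] ?k \<oplus> s [^] ?k \<in> S" using frob_add[OF xc[OF r] sc] by simp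
        hence "(x 0 [^] ?k \<oplus> s [^] ?k) \<ominus> s [^] ?k \<in> S"
          using subfield_closed(7)[OF S] subfield_pow[OF S s] by blast
        moreover have "(x 0 [^] ?k \<oplus> s [^] ?k) \<ominus> s [^] ?k = x 0 [^] ?k"
          using xc[OF r] sc by (simp add: a_minus_def a_assoc r_neg)
        ultimately show False using n by simp
      qed
      thus ?thesis using True eq[of 0] e0 by simp
    qed
  next
    show "adjoin S (?x ` {..<r}) = carrier R" using nt eq[of r] by (simp add: normal_tower_def)
  qed
qed

lemma extension_type_normal_tower:
  assumes K: "subfield K R" and et: "extension_type K n es" and es: "es \<noteq> []" "\<forall>e\<in>set es. e \<ge> 1"
  obtains x where "normal_tower (separable_closure K) x (\<lambda>i. es ! i) (length es)"
    "adjoin K {x 0 [^] (p ^ (es ! 0))} = separable_closure K" "dimension n K (separable_closure K)" "K \<subseteq> separable_closure K"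
proof -
  let ?S = "separable_closure K" and ?e = "\<lambda>i. es ! i" and ?r = "length es"
  have dim: "dimension n K ?S" and it: "insep_type ?S es" using et by (auto simp: extension_type_def)
  obtain x where x: "normal_tower ?S x ?e ?r" using insep_type_imp_normal_tower[OF it es(2)] .
  have S: "subfield ?S R" using x by (simp add: normal_tower_def)
  have r: "0 < ?r" using es by simp
  have KS: "K \<subseteq> ?S"
  proof
    fix k assume k: "k \<in> K"
    obtain b where b: "lin_indep K b n" "lin_span K b n = ?S" using dimension_basis[OF K dim] .
    have "k \<otimes> \<one> \<in> lin_span K b n"
      by (rule lin_span_closed(5)[OF K lin_indep_carrier[OF b(1)] k]) (use b(2) subfield_closed(3)[OF S] in simp)
    thus "k \<in> ?S" using b(2) k subfield_closed(1)[OF K] by auto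
  qed
  have sep: "y \<in> adjoin K {y [^] p}" if "y \<in> ?S" for y
  proof -
    have "y \<in> carrier R" "separable_over K y" using that by (auto simp: separable_closure_def)
    thus ?thesis using separable_over_iff[OF K, of y] by (auto simp: separable_over_def)
  qed
  have e0: "adjoin ?S (x ` {..<0}) = ?S" using adjoin_id[OF S, of "{}"] by simp
  have x0: "x 0 \<in> carrier R" "x 0 [^] (p ^ (?e 0 - 1)) \<notin> ?S" "x 0 [^] (p ^ ?e 0) \<in> ?S" "1 \<le> ?e 0"
    using x r e0 unfolding normal_tower_def by force+
  obtain k where k: "?e 0 = Suc k" using x0(4) by (cases "?e 0") auto
  \<comment> \<open>This element lies outside \<open>S\<close> while its p-th power lies inside: the
    inseparability of the extension is what makes \<open>K\<close> imperfect.\<close>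
  have "(x 0 [^] (p ^ (?e 0 - 1))) [^] p = x 0 [^] (p ^ ?e 0)"
    using x0(1) unfolding k by (simp add: nat_pow_pow mult.commute)
  then obtain t where t: "t \<in> K" "\<And>z. z \<in> K \<Longrightarrow> z [^] p \<noteq> t"
    using exists_non_pth_power[OF K S KS dim sep, of "x 0 [^] (p ^ (?e 0 - 1))"] x0 by auto
  obtain s where s: "s \<in> ?S" "adjoin K {x 0 [^] (p ^ ?e 0) \<oplus> s [^] (p ^ ?e 0)} = ?S"
    using primitive_element[OF K S KS dim sep t x0(3)] by blast
  have "(x 0 \<oplus> s) [^] (p ^ ?e 0) = x 0 [^] (p ^ ?e 0) \<oplus> s [^] (p ^ ?e 0)"
    using frob_add x0(1) s(1) subfield_closed(1)[OF S] by auto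
  thus ?thesis using that[OF normal_tower_shift[OF x r s(1)] _ dim KS] s(2) by simp
qed

end

section \<open>The upper bound\<close>

text \<open>Positions start at 0, so position \<open>i\<close> carries s_(i+1) - (i+1) e_(i+1) in
  the usual numbering. The order of the list ensures that no subtraction is truncated.\<close>

lemma exponent_sum:
  assumes "sorted_wrt (\<ge>) (es :: nat list)" "i < length es"
  shows "sum_list (take (Suc i) es) - Suc i * es ! i = (\<Sum>j<i. es ! j - es ! i)"
proof -
  have ge: "es ! i \<le> es ! j" if "j < i" for j
    using sorted_wrt_nth_less[OF assms(1) that assms(2)] .
  have "sum_list (take (Suc i) es) = (\<Sum>j<Suc i. es ! j)"
    using assms(2) by (subst sum_list_sum_nth) (simp add: atLeast0LessThan)
  also have "\<dots> = (\<Sum>j<i. (es ! j - es ! i) + es ! i) + es ! i"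
    using ge by simp
  also have "\<dots> = (\<Sum>j<i. es ! j - es ! i) + Suc i * es ! i" by (simp add: sum.distrib)
  finally show ?thesis by simp
qed

lemma exponent_count:
  assumes "sorted_wrt (\<ge>) (es :: nat list)"
  shows "(\<Sum>i<length es. n * (p :: nat) ^ (\<Sum>j<i. es ! j - es ! i))
    = n * (\<Sum>i=1..length es. p ^ (sum_list (take i es) - i * es ! (i - 1)))"
proof -
  have "(\<Sum>i=1..length es. p ^ (sum_list (take i es) - i * es ! (i - 1)))
    = (\<Sum>i<length es. p ^ (sum_list (take (Suc i) es) - Suc i * es ! i))"
    by (rule sum.reindex_bij_witness[of _ Suc "\<lambda>i. i - 1"]) auto
  also have "\<dots> = (\<Sum>i<length es. p ^ (\<Sum>j<i. es ! j - es ! i))"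
    by (rule sum.cong) (use exponent_sum[OF assms] in auto)
  finally show ?thesis by (simp add: sum_distrib_left)
qed

context char_p_field
begin

text \<open>Generators and degrees for the monomials that express the power of x_i. The degree q_j /
  q_i is right because x_j^(q_i) raised to it is x_j^(q_j), which Pickert's theorem places in the
  field generated by powers of the predecessors.\<close>

definition tower_monomials :: "(nat \<Rightarrow> 'a) \<Rightarrow> (nat \<Rightarrow> nat) \<Rightarrow> nat \<Rightarrow> 'a \<Rightarrow> nat \<Rightarrow> ('a \<times> nat) list" where
  "tower_monomials x e n \<theta> i = (\<theta>, n) # map (\<lambda>j. (x j [^] (p ^ e i), p ^ (e j - e i))) [0..<i]"

lemma tower_monomials_size:
  "prod_list (map snd (tower_monomials x e n \<theta> i)) = n * p ^ (\<Sum>j<i. e j - e i)"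
proof -
  have "prod_list (map (\<lambda>j. p ^ (f j)) [0..<i]) = p ^ (\<Sum>j<i. f j)" for f :: "nat \<Rightarrow> nat"
    by (induction i) (auto simp: power_add)
  thus ?thesis by (simp add: tower_monomials_def comp_def)
qed

lemma tower_monomials_fst:
  "fst ` set (tower_monomials x e n \<theta> i) = insert \<theta> ((\<lambda>j. x j [^] (p ^ e i)) ` {..<i})"
  by (auto simp: tower_monomials_def image_image)

theorem ess_dim_le:
  assumes F: "subfield F R" and K: "subfield K R" "F \<subseteq> K" and et: "extension_type K n es"
    and es: "es \<noteq> []" "sorted_wrt (\<ge>) es" "\<forall>e\<in>set es. e \<ge> 1"
  shows "ess_dim F K \<le> enat (n * (\<Sum>i=1..length es. p ^ (sum_list (take i es) - i * es ! (i - 1))))"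
proof -
  define S where "S = separable_closure K"
  define r where "r = length es"
  define e where "e = (\<lambda>i. es ! i)"
  obtain x where x: "normal_tower S x e r" and gen: "adjoin K {x 0 [^] (p ^ e 0)} = S"
    and dimS: "dimension n K S" and KS: "K \<subseteq> S"
    using extension_type_normal_tower[OF K(1) et es(1,3)] unfolding S_def r_def e_def by metis
  define \<theta> where "\<theta> = x 0 [^] (p ^ e 0)"
  have r0: "0 < r" using es by (simp add: r_def)
  have anti: "e i \<le> e j" if "j < i" "i < r" for i j
    using sorted_wrt_nth_less[OF es(2) that(1)] that(2) by (simp add: e_def r_def)
  have S: "subfield S R" using x by (simp add: normal_tower_def)
  note Kc = subfield_closed(1)[OF K(1)] and Sc = subfield_closed(1)[OF S] and Fc = subfield_closed(1)[OF F]
  have xc: "x i \<in> carrier R" if "i < r" for i using x that by (simp add: normal_tower_def)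
  have \<theta>c: "\<theta> \<in> carrier R" using xc[OF r0] by (simp add: \<theta>_def)
  have gen': "adjoin K {\<theta>} = S" using gen by (simp add: \<theta>_def)
  have \<theta>S: "\<theta> \<in> S" using gen' adjoin_incl(2)[of "{\<theta>}" K] by auto
  have n0: "0 < n"
  proof (rule ccontr)
    assume "\<not> 0 < n"
    hence "S = {\<zero>}" using dimension_zero[OF K(1)] dimS by simp
    thus False using subfieldE(6)[OF S] subfield_closed(3)[OF S] by auto
  qed
  have "algebraic K \<theta>" using algebraic_of_finite_dimension[OF K(1) S finite_dimensionI[OF dimS] \<theta>S] .
  then obtain d where d: "lin_span K (\<lambda>i. \<theta> [^] i) d = S" "dimension d K S"
    using algebraic_relation[OF K(1) \<theta>c] gen' by metis
  have "d = n" by (rule dimension_is_inj[OF K(1) d(2) dimS])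
  hence spS: "lin_span K (\<lambda>i. \<theta> [^] i) n = S" using d by simp
  have \<theta>n: "\<theta> [^] n \<in> lin_span K (\<lambda>i. \<theta> [^] i) n" unfolding spS using subfield_pow[OF S \<theta>S] .
  let ?ps = "tower_monomials x e n \<theta>"
  define D where "D = (\<lambda>i. n * p ^ (\<Sum>j<i. e j - e i))"
  have rel: "x i [^] (p ^ e i) \<in> lin_span K (mixed (?ps i)) (D i)" if i: "i < r" for i
  proof -
    have yc: "(\<lambda>j. x j [^] (p ^ e i)) ` {..<i} \<subseteq> carrier R" using xc i by auto
    have "chain_spans S (map (\<lambda>j. (x j [^] (p ^ e i), p ^ (e j - e i))) [0..<i])"
    proof (rule chain_spans_map[OF S])
      fix j assume j: "j < i"
      have le: "e i \<le> e j" using anti[OF j i] .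
      have pw: "(x k [^] (p ^ e i)) [^] (p ^ (e j - e i)) = x k [^] (p ^ e j)" if "k < r" for k
        using le xc[OF that] by (simp add: nat_pow_pow power_add[symmetric])
      let ?B = "adjoin S ((\<lambda>j. x j [^] (p ^ e i)) ` {..<j})"
      have B: "subfield ?B R" by (rule adjoin_subfield[OF Sc]) (use xc i j in auto)
      have "x j [^] (p ^ e j) \<in> adjoin S ((\<lambda>k. x k [^] (p ^ e j)) ` {..<j})"
        by (rule pickert[OF x]) (use anti i j in auto)
      \<comment> \<open>Pickert's theorem supplies q_j-th powers of the predecessors; they are
        powers of their q_i-th powers because e_i <= e_j.\<close>
      moreover have "adjoin S ((\<lambda>k. x k [^] (p ^ e j)) ` {..<j}) \<subseteq> ?B"
      proof (rule adjoin_least[OF B adjoin_incl(1)])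
        show "(\<lambda>k. x k [^] (p ^ e j)) ` {..<j} \<subseteq> ?B"
        proof
          fix y assume "y \<in> (\<lambda>k. x k [^] (p ^ e j)) ` {..<j}"
          then obtain k where k: "k < j" "y = x k [^] (p ^ e j)" by auto
          have "x k [^] (p ^ e i) \<in> ?B" using k(1) adjoin_incl(2)[of "(\<lambda>j. x j [^] (p ^ e i)) ` {..<j}" S] by auto
          hence "(x k [^] (p ^ e i)) [^] (p ^ (e j - e i)) \<in> ?B" by (rule subfield_pow[OF B])
          thus "y \<in> ?B" using pw[of k] k i j by simp
        qed
      qed
      ultimately show "x j [^] p ^ e i \<in> carrier R \<and> 0 < p ^ (e j - e i) \<and>
         (x j [^] p ^ e i) [^] p ^ (e j - e i) \<in> adjoin S ((\<lambda>j. x j [^] p ^ e i) ` {..<j})"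
        using pw[of j] xc i j p_pos by auto
    qed
    hence ch: "chain_spans K (?ps i)" using \<theta>c n0 \<theta>n gen' by (simp add: tower_monomials_def)
    have "adjoin K (fst ` set (?ps i)) = adjoin (adjoin K {\<theta>}) ((\<lambda>j. x j [^] (p ^ e i)) ` {..<i})"
      unfolding tower_monomials_fst using adjoin_adjoin[OF Kc, of "{\<theta>}", OF _ yc] \<theta>c by simp
    hence "x i [^] (p ^ e i) \<in> adjoin K (fst ` set (?ps i))"
      unfolding gen' using pickert[OF x anti[OF _ i] i] by simp
    thus ?thesis using mixed_span[OF K(1) ch] unfolding tower_monomials_size D_def by blast
  qed
  \<comment> \<open>Index 0 stores the equation of \<theta> in place of a relation for x_0, whose
    q_0-th power is \<theta> by definition.\<close>
  have "\<exists>c. i < r \<longrightarrow> c \<in> {..<D i} \<rightarrow> K \<and> (if i = 0 then \<theta> [^] n = lincomb c (\<lambda>i. \<theta> [^] i) n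
     else x i [^] (p ^ e i) = lincomb c (mixed (?ps i)) (D i))" for i
  proof (cases "i = 0")
    case True
    have "D 0 = n" by (simp add: D_def)
    thus ?thesis using \<theta>n True by (auto simp: lin_span_def)
  next
    case False thus ?thesis using rel[of i] by (cases "i < r") (auto simp: lin_span_def)
  qed
  then obtain c where c: "\<And>i. i < r \<Longrightarrow> c i \<in> {..<D i} \<rightarrow> K"
    "\<And>i. i < r \<Longrightarrow> (if i = 0 then \<theta> [^] n = lincomb (c i) (\<lambda>i. \<theta> [^] i) n
     else x i [^] (p ^ e i) = lincomb (c i) (mixed (?ps i)) (D i))" by metis
  define C where "C = (\<Union>i\<in>{..<r}. c i ` {..<D i})"
  have CK: "C \<subseteq> K" using c(1) by (auto simp: C_def)
  have C: "finite C" "C \<subseteq> carrier R" using CK Kc by (auto simp: C_def)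
  have "card C \<le> (\<Sum>i<r. card (c i ` {..<D i}))" unfolding C_def by (rule card_UN_le) simp
  also have "\<dots> \<le> (\<Sum>i<r. D i)" by (rule sum_mono) (metis card_image_le card_lessThan finite_lessThan)
  finally have cardC: "card C \<le> (\<Sum>i<r. D i)" .
  define K0 where "K0 = adjoin F C"
  have K0: "subfield K0 R" unfolding K0_def by (rule adjoin_subfield[OF Fc C(2)])
  note K0c = subfield_closed(1)[OF K0]
  have K0K: "K0 \<subseteq> K" unfolding K0_def by (rule adjoin_least[OF K(1,2) CK])
  have FK0: "F \<subseteq> K0" unfolding K0_def by (rule adjoin_incl)
  have cK0: "c i j \<in> K0" if "i < r" "j < D i" for i j
  proof -
    have "c i j \<in> C" using that by (auto simp: C_def)
    thus ?thesis unfolding K0_def using adjoin_incl(2)[of C F] by blast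
  qed
  define S0 where "S0 = adjoin K0 {\<theta>}"
  define L0 where "L0 = adjoin S0 (x ` {..<r})"
  have S0: "subfield S0 R" unfolding S0_def by (rule adjoin_subfield[OF K0c]) (use \<theta>c in auto)
  note S0c = subfield_closed(1)[OF S0]
  have xr: "x ` {..<r} \<subseteq> carrier R" using xc by auto
  have L0: "subfield L0 R" unfolding L0_def by (rule adjoin_subfield[OF S0c xr])
  have inc: "K0 \<subseteq> S0" "\<theta> \<in> S0" "S0 \<subseteq> L0" "x ` {..<r} \<subseteq> L0"
    using adjoin_incl(1)[of K0 "{\<theta>}"] adjoin_incl(2)[of "{\<theta>}" K0] adjoin_incl[of S0 "x ` {..<r}"]
      adjoin_incl(2)[of "x ` {..<r}" S0] by (auto simp: S0_def L0_def)
  have pc: "(\<lambda>i. \<theta> [^] i) \<in> {..<n} \<rightarrow> carrier R" using \<theta>c by auto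
  have D0: "D 0 = n" by (simp add: D_def)
  have "\<theta> [^] n \<in> lin_span K0 (\<lambda>i. \<theta> [^] i) n"
    using c(2)[OF r0] cK0[OF r0] D0 by (auto simp: lin_span_def)
  then obtain d0 where d0: "d0 \<le> n" "dimension d0 K0 S0"
    using adjoin_dimension_le[OF K0 \<theta>c n0] unfolding S0_def by metis
  have step: "0 < p ^ e j \<and> x j [^] (p ^ e j) \<in> adjoin S0 (x ` {..<j})" if j: "j < r" for j
  proof
    show "0 < p ^ e j" using p_pos by simp
    let ?A = "adjoin S0 (x ` {..<j})"
    have A: "subfield ?A R" by (rule adjoin_subfield[OF S0c]) (use xc j in auto)
    have S0A: "S0 \<subseteq> ?A" by (rule adjoin_incl)
    show "x j [^] (p ^ e j) \<in> ?A"
    proof (cases "j = 0")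
      case True thus ?thesis using S0A inc(2) by (auto simp: \<theta>_def)
    next
      case False
      have "x t \<in> ?A" if "t < j" for t using that adjoin_incl(2)[of "x ` {..<j}" S0] by auto
      hence "x t [^] (p ^ e j) \<in> ?A" if "t < j" for t using subfield_pow[OF A] that by blast
      hence "fst ` set (?ps j) \<subseteq> ?A" unfolding tower_monomials_fst using inc(2) S0A by auto
      hence "mixed (?ps j) k \<in> ?A" for k by (rule mixed_in_subfield[OF A])
      moreover have "c j k \<in> ?A" if "k < D j" for k using cK0[OF j that] inc(1) S0A by blast
      ultimately have "lincomb (c j) (mixed (?ps j)) (D j) \<in> ?A" by (intro lincomb_in_subfield[OF A])
      thus ?thesis using c(2)[OF j] False by simp
    qed
  qed
  obtain d1 where d1: "d1 \<le> (\<Prod>j<r. p ^ e j)" "dimension d1 S0 L0"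
    using tower_dimension_le[OF S0 xc step] unfolding L0_def by blast
  have dL0: "dimension (d0 * d1) K0 L0" by (rule telescopic_base[OF K0 S0 d0(2) d1(2)])
  have dL: "dimension (n * (\<Prod>j<r. p ^ e j)) K (carrier R)"
    by (rule telescopic_base[OF K(1) S dimS normal_tower_dimension[OF x]])
  have comp: "generate_field R (L0 \<union> K) = carrier R"
  proof -
    have A: "subfield (adjoin K L0) R" by (rule adjoin_subfield[OF Kc subfield_closed(1)[OF L0]])
    have "S \<subseteq> adjoin K L0" unfolding gen'[symmetric]
      by (rule adjoin_least[OF A adjoin_incl(1)]) (use inc adjoin_incl(2)[of L0 K] in auto)
    hence "adjoin S (x ` {..<r}) \<subseteq> adjoin K L0"
      by (rule adjoin_least[OF A]) (use inc(4) adjoin_incl(2)[of L0 K] in blast)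
    hence "carrier R \<subseteq> adjoin K L0" using x by (simp add: normal_tower_def)
    thus ?thesis using subfield_closed(1)[OF A] by (simp add: Un_commute subset_antisym)
  qed
  \<comment> \<open>[L0:K0] is at most [L:K] by the relations over \<open>K0\<close>, and at least
    [L:K] because a K0-basis of \<open>L0\<close> spans \<open>L\<close> over
    \<open>K\<close>.\<close>
  obtain b where b: "lin_indep K0 b (d0 * d1)" "lin_span K0 b (d0 * d1) = L0" using dimension_basis[OF K0 dL0] .
  note bc = lin_indep_carrier[OF b(1)]
  have "lin_span K b (d0 * d1) = carrier R"
    using compositum_lin_span[OF K0 L0 K(1) K0K bc b(2)] comp by (simp add: Un_commute)
  then obtain d' where d': "d' \<le> d0 * d1" "dimension d' K (carrier R)"
    using lin_span_dimension_le[OF K(1) bc] by metis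
  have "n * (\<Prod>j<r. p ^ e j) = d'" by (rule dimension_is_inj[OF K(1) dL d'(2)])
  moreover have "d0 * d1 \<le> n * (\<Prod>j<r. p ^ e j)" using d0(1) d1(1) by (rule mult_le_mono)
  ultimately have eq: "d0 * d1 = n * (\<Prod>j<r. p ^ e j)" using d'(1) by simp
  have "descends_to K K0" unfolding descends_to_def
    using K0 K0K L0 inc comp dL0 dL eq by (metis subset_trans)
  hence "ess_dim F K \<le> trdeg F K0" unfolding ess_dim_def using FK0 by (intro INF_lower) simp
  also have "\<dots> \<le> enat (card C)"
    by (rule trdeg_le[OF F C]) (use algebraic_hull_incl(1)[OF Fc C(2)] in \<open>simp add: K0_def\<close>)
  also have "\<dots> \<le> enat (\<Sum>i<r. D i)" using cardC by simp
  also have "(\<Sum>i<r. D i) = n * (\<Sum>i=1..length es. p ^ (sum_list (take i es) - i * es ! (i - 1)))"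
    unfolding exponent_count[OF es(2), symmetric] by (simp add: D_def e_def r_def)
  finally show ?thesis .
qed

end

section \<open>Descent and the lower bound\<close>

context field
begin

lemma lin_indep_notin:
  assumes E: "subfield E R" and v: "lin_indep E v (Suc m)" shows "v m \<notin> lin_span E v m"
proof
  assume "v m \<in> lin_span E v m"
  then obtain c where c: "c \<in> {..<m} \<rightarrow> E" "v m = lincomb c v m" by (auto simp: lin_span_def)
  note Ec = subfield_closed(1)[OF E]
  have vc: "v \<in> {..<Suc m} \<rightarrow> carrier R" "v \<in> {..<m} \<rightarrow> carrier R" "v m \<in> carrier R"
    using lin_indep_carrier[OF v] by (auto simp: Pi_iff)
  let ?c = "\<lambda>i. if i < m then c i else \<ominus> \<one>"
  have cE: "?c \<in> {..<Suc m} \<rightarrow> E" using c(1) subfield_closed[OF E] by auto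
  have "lincomb ?c v (Suc m) = ?c m \<otimes> v m \<oplus> lincomb ?c v m"
    by (rule lincomb_Suc[OF Pi_subset[OF cE Ec] vc(1)])
  also have "lincomb ?c v m = v m" unfolding c(2)
    by (rule lincomb_cong) (use Pi_subset[OF c(1) Ec] vc(2) in auto)
  finally have "lincomb ?c v (Suc m) = \<zero>" using vc(3) by (simp add: l_minus l_neg)
  hence "?c m = \<zero>" using lin_indepD[OF v cE] by blast
  thus False by simp
qed

lemma lin_span_powers_mult:
  assumes E: "subfield E R" and t: "t \<in> carrier R"
    and y: "y \<in> lin_span E (\<lambda>i. t [^] i) a" and z: "z \<in> lin_span E (\<lambda>i. t [^] i) b"
  shows "y \<otimes> z \<in> lin_span E (\<lambda>i. t [^] i) (a + b)"
    and "t [^] a \<otimes> z \<in> lin_span E (\<lambda>i. t [^] i) (a + b)"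
proof -
  let ?P = "\<lambda>a. lin_span E (\<lambda>i. t [^] (i::nat)) a"
  note Ec = subfield_closed(1)[OF E]
  have pc: "(\<lambda>i. t [^] i) \<in> {..<a} \<rightarrow> carrier R" for a :: nat using t by auto
  note P = lin_span_closed[OF E pc]
  have zc: "z \<in> carrier R" using z P(1) by auto
  have 1: "t [^] i \<otimes> z \<in> ?P (a + b)" if "i \<le> a" for i
  proof -
    have "?P b \<subseteq> {z \<in> carrier R. t [^] i \<otimes> z \<in> ?P (a + b)}"
    proof (rule lin_span_minimal)
      fix c j assume cj: "c \<in> E" "j < b"
      have "t [^] i \<otimes> (c \<otimes> t [^] j) = c \<otimes> t [^] (i + j)"
        using cj Ec t by (auto simp: m_lcomm nat_pow_mult)
      moreover have "c \<otimes> t [^] (i + j) \<in> ?P (a + b)" by (rule P(5)[OF cj(1) P(6)]) (use cj that in simp)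
      ultimately show "c \<otimes> t [^] j \<in> {z \<in> carrier R. t [^] i \<otimes> z \<in> ?P (a + b)}" using cj Ec t by auto
    qed (use P(2,3) P(2)[of "a + b"] t Ec pc in \<open>auto simp: r_distr\<close>)
    thus ?thesis using z by auto
  qed
  thus "t [^] a \<otimes> z \<in> ?P (a + b)" by simp
  have "?P a \<subseteq> {y \<in> carrier R. y \<otimes> z \<in> ?P (a + b)}"
  proof (rule lin_span_minimal)
    fix c i assume ci: "c \<in> E" "i < a"
    have "c \<otimes> t [^] i \<otimes> z = c \<otimes> (t [^] i \<otimes> z)" using ci Ec t zc by (auto simp: m_assoc)
    moreover have "c \<otimes> (t [^] i \<otimes> z) \<in> ?P (a + b)" by (rule P(5)[OF ci(1) 1]) (use ci in simp)
    ultimately show "c \<otimes> t [^] i \<in> {y \<in> carrier R. y \<otimes> z \<in> ?P (a + b)}" using ci Ec t by auto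
  qed (use P(2,3) P(2)[of "a + b"] zc t Ec pc in \<open>auto simp: l_distr\<close>)
  thus "y \<otimes> z \<in> ?P (a + b)" using y by auto
qed

text \<open>The value at \<open>t\<close> of a monic polynomial of degree \<open>h\<close> over
  \<open>E\<close>; once \<open>t\<close> is transcendental, \<open>y\<close> determines the
  degree.\<close>

definition monic_in :: "'a set \<Rightarrow> 'a \<Rightarrow> nat \<Rightarrow> 'a \<Rightarrow> bool" where
  "monic_in E t h y \<longleftrightarrow> (\<exists>u \<in> lin_span E (\<lambda>i. t [^] i) h. y = t [^] h \<oplus> u)"

lemma monic_in_mult:
  assumes E: "subfield E R" and t: "t \<in> carrier R" and y: "monic_in E t a y" "monic_in E t b z"
  shows "monic_in E t (a + b) (y \<otimes> z)"
proof -
  let ?P = "\<lambda>a. lin_span E (\<lambda>i. t [^] (i::nat)) a"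
  have pc: "(\<lambda>i. t [^] i) \<in> {..<a} \<rightarrow> carrier R" for a :: nat using t by auto
  note P = lin_span_closed[OF E pc]
  obtain u where u: "u \<in> ?P a" "y = t [^] a \<oplus> u" using y(1) by (auto simp: monic_in_def)
  obtain v where v: "v \<in> ?P b" "z = t [^] b \<oplus> v" using y(2) by (auto simp: monic_in_def)
  have c: "u \<in> carrier R" "v \<in> carrier R" using u v P(1) by auto
  let ?w = "t [^] a \<otimes> v \<oplus> (t [^] b \<otimes> u \<oplus> u \<otimes> v)"
  have "t [^] b \<otimes> u \<in> ?P (a + b)" using lin_span_powers_mult(2)[OF E t v(1) u(1)] by (simp add: add.commute)
  hence "?w \<in> ?P (a + b)"
    using lin_span_powers_mult[OF E t u(1) v(1)] P(3) by blast
  moreover have "y \<otimes> z = t [^] (a + b) \<oplus> ?w"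
    unfolding u(2) v(2) using c t by (simp add: nat_pow_mult[symmetric] l_distr r_distr m_comm a_ac)
  ultimately show ?thesis by (auto simp: monic_in_def)
qed

lemma monic_in_power:
  assumes E: "subfield E R" and t: "t \<in> carrier R" and y: "monic_in E t a y" "y \<in> carrier R"
  shows "monic_in E t (a * k) (y [^] k)"
proof (induction k)
  case 0
  have "lin_span E (\<lambda>i. t [^] (i::nat)) 0 = {\<zero>}" by (auto simp: lin_span_def)
  thus ?case by (simp add: monic_in_def)
next
  case (Suc k)
  thus ?case using monic_in_mult[OF E t Suc y(1)] by (simp add: add.commute)
qed

lemma monic_in_self:
  assumes "subfield E R" "t \<in> carrier R" shows "monic_in E t h (t [^] h)"
  unfolding monic_in_def
  using lin_span_closed(2)[OF assms(1), of "\<lambda>i. t [^] i" h] assms(2) by (intro bexI[of _ \<zero>]) auto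

text \<open>Triangularity: the members before w_H lie in the span of the powers of \<open>t\<close>
  below \<open>H\<close>, while w_H involves t^H.\<close>

lemma monic_sequence_indep:
  assumes E: "subfield E R" and t: "t \<in> carrier R" "\<not> algebraic E t"
    and w: "\<And>h. h < H \<Longrightarrow> monic_in E t h (w h)"
  shows "lin_indep E w H"
  using w
proof (induction H)
  case 0 show ?case by (simp add: lin_indep_def)
next
  case (Suc H)
  let ?P = "\<lambda>a. lin_span E (\<lambda>i. t [^] (i::nat)) a"
  have pc: "(\<lambda>i. t [^] i) \<in> {..<a} \<rightarrow> carrier R" for a :: nat using t by auto
  note P = lin_span_closed[OF E pc]
  have wP: "w h \<in> ?P (Suc h)" "w h \<in> carrier R" if h: "h < Suc H" for h
  proof -
    obtain u where u: "u \<in> ?P h" "w h = t [^] h \<oplus> u" using Suc.prems[OF h] by (auto simp: monic_in_def)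
    have "u \<in> ?P (Suc h)" using lin_span_le[OF E pc, of h "Suc h"] u by auto
    thus "w h \<in> ?P (Suc h)" using P(3)[OF P(6)[of h "Suc h"]] u(2) by simp
    thus "w h \<in> carrier R" using P(1) by blast
  qed
  have "w H \<notin> lin_span E w H"
  proof
    assume a: "w H \<in> lin_span E w H"
    have "lin_span E w H \<subseteq> ?P H"
    proof (rule lin_span_minimal)
      show "c \<otimes> w i \<in> ?P H" if "c \<in> E" "i < H" for c i
        using P(5)[OF that(1)] wP(1)[of i] that lin_span_le[OF E pc, of "Suc i" H] by auto
    qed (use P(2,3) subfield_closed(1)[OF E] wP(2) in auto)
    hence wH: "w H \<in> ?P H" using a by blast
    obtain u where u: "u \<in> ?P H" "w H = t [^] H \<oplus> u" using Suc.prems[of H] by (auto simp: monic_in_def)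
    have "w H \<oplus> \<ominus> u \<in> ?P H" by (rule P(3)[OF wH P(4)[OF u(1)]])
    moreover have "w H \<oplus> \<ominus> u = t [^] H"
      using u P(1)[of H] t by (auto simp: a_assoc r_neg)
    ultimately show False
      using lin_indep_notin[OF E not_algebraic_lin_indep[OF E t, of "Suc H"]] by simp
  qed
  thus ?case using lin_indep_Suc[OF E Suc.IH] Suc.prems wP(2) by simp
qed

text \<open>
  After clearing denominators, a relation between the \<open>t\<^sup>i\<close> has coefficients in \<open>E[s]\<close>,
  but the products \<open>t\<^sup>i s\<^sup>j\<close> are monic in \<open>t\<close> of the pairwise distinct degrees \<open>i + n j\<close>.
\<close>

lemma powers_indep_over_monic:
  assumes E: "subfield E R" and t: "t \<in> carrier R" "\<not> algebraic E t"
    and s: "monic_in E t n s" "0 < n"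
  shows "lin_indep (adjoin E {s}) (\<lambda>i. t [^] i) n"
proof (rule ccontr)
  note Ec = subfield_closed(1)[OF E]
  have pc: "(\<lambda>i. t [^] i) \<in> {..<a} \<rightarrow> carrier R" for a :: nat using t by auto
  have sc: "s \<in> carrier R" using s(1) lin_span_closed(1)[OF E pc] t by (auto simp: monic_in_def)
  have spc: "(\<lambda>i. s [^] i) \<in> {..<a} \<rightarrow> carrier R" for a :: nat using sc by auto
  have sr: "subring (simple_extension E s) R"
    using simple_extension_is_subring[OF subfieldE(1)[OF E] sc] .
  have A: "subfield (adjoin E {s}) R" by (rule adjoin_subfield[OF Ec]) (use sc in auto)
  note Ac = subfield_closed(1)[OF A]
  assume "\<not> lin_indep (adjoin E {s}) (\<lambda>i. t [^] i) n"
  then obtain c l where c: "c \<in> {..<n} \<rightarrow> adjoin E {s}" "lincomb c (\<lambda>i. t [^] i) n = \<zero>" "l < n" "c l \<noteq> \<zero>"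
    using pc by (auto simp: lin_indep_def)
  obtain w where w: "w \<in> simple_extension E s - {\<zero>}" "\<And>i. i < n \<Longrightarrow> w \<otimes> c i \<in> simple_extension E s"
    using common_denominator[OF sr, of n c] c(1) adjoin_eq_generate_field_simple_extension[OF E sc] by auto
  have wc: "w \<in> carrier R" using w(1) subringE(1)[OF sr] by auto
  have cc: "c \<in> {..<n} \<rightarrow> carrier R" by (rule Pi_subset[OF c(1) Ac])
  obtain a m where a: "\<And>i. i < n \<Longrightarrow> a i \<in> {..<m} \<rightarrow> E"
    "\<And>i. i < n \<Longrightarrow> w \<otimes> c i = lincomb (a i) (\<lambda>i. s [^] i) m"
    using simple_extension_uniform[OF E sc, of n "\<lambda>i. w \<otimes> c i"] w(2) by blast
  have ac: "a i j \<in> carrier R" if "i < n" "j < m" for i j using a(1)[OF that(1)] that Ec by auto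
  \<comment> \<open>The coefficient of t^i s^j is stored at h = i + n j, which is also the degree of
    that product in \<open>t\<close>.\<close>
  define A' where "A' = (\<lambda>h. a (h mod n) (h div n))"
  have A'E: "A' \<in> {..<n * m} \<rightarrow> E"
  proof
    fix h assume "h \<in> {..<n * m}"
    hence "h div n < m" by (simp add: less_mult_imp_div_less mult.commute)
    thus "A' h \<in> E" using a(1)[of "h mod n"] s(2) by (auto simp: A'_def)
  qed
  let ?W = "\<lambda>h. (\<lambda>i. t [^] i) (h mod n) \<otimes> (\<lambda>i. s [^] i) (h div n)"
  have "lincomb A' ?W (n * m) = lincomb (\<lambda>b. lincomb (\<lambda>i. A' (n * b + i)) (\<lambda>i. t [^] i) n) (\<lambda>i. s [^] i) m"
    by (rule lincomb_blocks[OF Pi_subset[OF A'E Ec] pc spc])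
  also have "\<dots> = lincomb (\<lambda>b. lincomb (\<lambda>i. a i b) (\<lambda>i. t [^] i) n) (\<lambda>i. s [^] i) m"
  proof (rule lincomb_cong)
    show "lincomb (\<lambda>i. A' (n * b + i)) (\<lambda>i. t [^] i) n = lincomb (\<lambda>i. a i b) (\<lambda>i. t [^] i) n" if "b < m" for b
      by (rule lincomb_cong) (use ac that pc in \<open>auto simp: A'_def\<close>)
    show "(\<lambda>b. lincomb (\<lambda>i. a i b) (\<lambda>i. t [^] i) n) \<in> {..<m} \<rightarrow> carrier R"
      by (intro Pi_I lincomb_closed pc) (use ac in auto)
  qed (use spc in auto)
  also have "\<dots> = lincomb (\<lambda>i. lincomb (a i) (\<lambda>i. s [^] i) m) (\<lambda>i. t [^] i) n"
    by (rule lincomb_swap) (use ac pc spc in auto)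
  also have "\<dots> = lincomb (\<lambda>i. w \<otimes> c i) (\<lambda>i. t [^] i) n"
    by (rule lincomb_cong) (use a(2) cc wc pc in auto)
  also have "\<dots> = \<zero>" using lincomb_smult[OF cc wc pc] c(2) wc by simp
  finally have z: "lincomb A' ?W (n * m) = \<zero>" .
  have ind: "lin_indep E ?W (n * m)"
  proof (rule monic_sequence_indep[OF E t])
    fix h
    have "monic_in E t (h mod n + n * (h div n)) (t [^] (h mod n) \<otimes> s [^] (h div n))"
      by (rule monic_in_mult[OF E t(1) monic_in_self[OF E t(1)] monic_in_power[OF E t(1) s(1) sc]])
    thus "monic_in E t h (?W h)" by simp
  qed
  have "a l b = \<zero>" if b: "b < m" for b
  proof -
    have "n * b + l < n * Suc b" using c(3) by simp
    also have "\<dots> \<le> n * m" using b by (intro mult_le_mono) auto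
    finally have "A' (n * b + l) = \<zero>" by (rule lin_indepD[OF ind A'E z])
    thus ?thesis using c(3) by (simp add: A'_def)
  qed
  hence "w \<otimes> c l = \<zero>" using a(2)[OF c(3)] lincomb_zero[OF _ spc, of m "a l"] by simp
  thus False using w(1) wc cc c(3,4) integral[of w "c l"] by auto
qed

end

context char_p_field
begin

text \<open>The case s = t^n of \<open>powers_indep_over_monic\<close>: over E(t^n) the power t^a is
  independent of the lower ones, in particular of 1.\<close>

lemma pow_notin_adjoin_pow:
  fixes a n :: nat
  assumes E: "subfield E R" and t: "t \<in> carrier R" "\<not> algebraic E t" and a: "0 < a" "a < n"
  shows "t [^] a \<notin> adjoin E {t [^] n}"
proof
  let ?E = "adjoin E {t [^] n}"
  assume h: "t [^] a \<in> ?E"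
  have A: "subfield ?E R" by (rule adjoin_subfield[OF subfield_closed(1)[OF E]]) (use t in auto)
  have "lin_indep ?E (\<lambda>i. t [^] i) n"
    by (rule powers_indep_over_monic[OF E t monic_in_self[OF E t(1)]]) (use a in simp)
  hence "lin_indep ?E (\<lambda>i. t [^] i) (Suc a)"
    by (rule lin_indep_le[OF subfield_closed(2,1)[OF A]]) (use a in simp)
  hence "t [^] a \<notin> lin_span ?E (\<lambda>i. t [^] i) a" by (rule lin_indep_notin[OF A])
  thus False using h subfield_subset_lin_span_powers[OF A t(1) a(1)] by blast
qed

text \<open>Choose a smallest \<open>T\<close> in \<open>C\<close> over which \<open>C\<close> is
  algebraic. If \<open>T\<close> contained some t, let K_1 be generated over \<open>K0\<close> by
  the rest of \<open>T\<close>; then \<open>K\<close> is finite over K_1(t), and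
  \<open>subfield_eq_of_frobenius_span\<close> gives K_1(t) = K_1(t^p), against the transcendence of
  t over K_1.\<close>

lemma algebraic_of_frobenius_span:
  assumes K0: "subfield K0 R" and K: "subfield K R" "K0 \<subseteq> K"
    and C: "finite C" "C \<subseteq> K" "K = adjoin K0 C" and fr: "K \<subseteq> adjoin K0 ((\<lambda>x. x [^] p) ` K)"
  shows "C \<subseteq> algebraic_hull K0 {}"
proof -
  note K0c = subfield_closed(1)[OF K0] and Kc = subfield_closed(1)[OF K(1)]
  have Cc: "C \<subseteq> carrier R" using C Kc by blast
  let ?P = "\<lambda>T. T \<subseteq> C \<and> C \<subseteq> algebraic_hull K0 T"
  have P: "?P C" using algebraic_hull_incl(3)[OF K0c Cc] by blast
  obtain T where T: "?P T" and min: "\<And>T'. ?P T' \<Longrightarrow> card T \<le> card T'"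
    using ex_has_least_nat[of ?P C card, OF P] by metis
  have TC: "T \<subseteq> C" using T by simp
  have Tf: "finite T" "T \<subseteq> carrier R" using finite_subset[OF TC C(1)] subset_trans[OF TC Cc] by simp_all
  show ?thesis
  proof (cases "T = {}")
    case True thus ?thesis using T by simp
  next
    case False
    then obtain t where t: "t \<in> T" by blast
    let ?T = "T - {t}"
    have T'c: "?T \<subseteq> carrier R" and tc: "t \<in> carrier R" using Tf t by auto
    have tK: "t \<in> K" using T t C(2) by blast
    let ?K1 = "adjoin K0 ?T"
    have K1: "subfield ?K1 R" by (rule adjoin_subfield[OF K0c T'c])
    note K1c = subfield_closed(1)[OF K1]
    have na: "t \<notin> algebraic_hull K0 ?T"
    proof
      assume h: "t \<in> algebraic_hull K0 ?T"
      note H = algebraic_hull_incl[OF K0c T'c]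
      have "T \<subseteq> algebraic_hull K0 ?T" using h H(3) by blast
      hence "algebraic_hull K0 T \<subseteq> algebraic_hull K0 ?T" by (rule algebraic_hull_idem[OF K0c T'c H(2)])
      hence "?P ?T" using T by blast
      hence "card T \<le> card ?T" by (rule min)
      thus False using card_Diff1_less[OF Tf(1) t] by simp
    qed
    have trans: "\<not> algebraic ?K1 t" using na tc by (simp add: algebraic_hull_def)
    define E1 where "E1 = adjoin ?K1 {t}"
    define E where "E = adjoin ?K1 {t [^] p}"
    have E1: "subfield E1 R" unfolding E1_def by (rule adjoin_subfield[OF K1c]) (use tc in auto)
    have E: "subfield E R" unfolding E_def by (rule adjoin_subfield[OF K1c]) (use tc in auto)
    have K1K: "?K1 \<subseteq> K" by (rule adjoin_least[OF K]) (use T C(2) in auto)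
    have inc: "?K1 \<subseteq> E" "?K1 \<subseteq> E1" "t \<in> E1" "t [^] p \<in> E"
      using adjoin_incl(1)[of ?K1] adjoin_incl(2)[of "{t}" ?K1] adjoin_incl(2)[of "{t [^] p}" ?K1]
      by (auto simp: E_def E1_def)
    have EE1: "E \<subseteq> E1" unfolding E_def by (rule adjoin_least[OF E1 inc(2)]) (use subfield_pow[OF E1 inc(3)] in auto)
    have E1K: "E1 \<subseteq> K" unfolding E1_def by (rule adjoin_least[OF K(1) K1K]) (use tK in auto)
    have E1T: "E1 = adjoin K0 T"
      unfolding E1_def using adjoin_adjoin[OF K0c T'c, of "{t}"] tc t by (simp add: Un_insert_right insert_absorb)
    have "finite_dimension E1 (adjoin E1 C)"
      by (rule finite_dimension_adjoin[OF E1 C(1) Cc]) (use T in \<open>auto simp: algebraic_hull_def E1T\<close>)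
    moreover have "adjoin E1 C = K"
    proof
      show "adjoin E1 C \<subseteq> K" by (rule adjoin_least[OF K(1) E1K C(2)])
      have "K0 \<subseteq> E1" using adjoin_incl(1)[of K0] inc(2) by blast
      thus "K \<subseteq> adjoin E1 C" unfolding C(3)
        by (rule adjoin_mono) (use Cc subfield_closed(1)[OF E1] in auto)
    qed
    ultimately obtain d where d: "dimension d E1 K" by (auto simp: finite_dimension_def)
    have tpow: "t [^] p \<in> E" by (rule inc(4))
    obtain f where f: "dimension f E (adjoin E {t})" using adjoin_dimension_le_pow[OF E tc p_pos tpow] by metis
    have "adjoin E {t} = E1"
    proof
      show "adjoin E {t} \<subseteq> E1" by (rule adjoin_least[OF E1 EE1]) (use inc in auto)
      show "E1 \<subseteq> adjoin E {t}" unfolding E1_def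
        by (rule adjoin_mono[OF inc(1) subset_refl subfield_closed(1)[OF E]]) (use tc in auto)
    qed
    hence f': "finite_dimension E E1" using f finite_dimensionI by auto
    have "E1 = E"
    proof (rule subfield_eq_of_frobenius_span[OF E E1 K(1) EE1 E1K d f'])
      show "y [^] p \<in> E" if "y \<in> E1" for y
      proof -
        have "y [^] (p ^ 1) \<in> E"
          by (rule frob_adjoin[OF E K1c _ _ _ that[unfolded E1_def]])
            (use tc inc subfield_pow[OF K1] in auto)
        thus ?thesis by simp
      qed
      have "adjoin K0 ((\<lambda>x. x [^] p) ` K) \<subseteq> adjoin E ((\<lambda>x. x [^] p) ` K)"
        by (rule adjoin_mono) (use adjoin_incl(1)[of K0] inc(1) Kc subfield_closed(1)[OF E] in auto)
      thus "K \<subseteq> adjoin E ((\<lambda>x. x [^] p) ` K)" using fr by blast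
    qed
    hence "t [^] (1::nat) \<in> adjoin ?K1 {t [^] p}" using inc(3) tc by (simp add: E_def nat_pow_eone)
    thus ?thesis using pow_notin_adjoin_pow[OF K1 tc trans, of 1 p] p_gt_1 by simp
  qed
qed

text \<open>The working form of linear disjointness of \<open>LM\<close> and \<open>K\<close> over
  \<open>M\<close>: K-coordinates of an element of \<open>LM\<close>, relative to elements of
  \<open>LM\<close> that are independent over \<open>K\<close>, already lie in
  \<open>M\<close>.\<close>

definition coefficients_descend :: "'a set \<Rightarrow> 'a set \<Rightarrow> 'a set \<Rightarrow> bool" where
  "coefficients_descend K M LM \<longleftrightarrow> (\<forall>D v c. lin_indep K v D \<and> (\<forall>i<D. v i \<in> LM) \<and> c \<in> {..<D} \<rightarrow> K \<and>
     lincomb c v D \<in> LM \<longrightarrow> c \<in> {..<D} \<rightarrow> M)"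

text \<open>\<open>LM\<close> is the compositum of \<open>L0\<close> and \<open>M\<close>; a
  K0-basis of \<open>L0\<close> is a basis both of \<open>L\<close> over \<open>K\<close> and of
  \<open>LM\<close> over \<open>M\<close>. The p-th power of a K-combination of this basis has
  coefficients in K^p, hence in \<open>M\<close>, and involves only elements of
  \<open>L0\<close>.\<close>

lemma descent_field:
  assumes K: "subfield K R" and desc: "descends_to K K0"
  defines "M \<equiv> adjoin K0 ((\<lambda>x. x [^] p) ` K)"
  obtains LM where "subfield LM R" "M \<subseteq> LM" "\<And>x. x \<in> carrier R \<Longrightarrow> x [^] p \<in> LM"
    "coefficients_descend K M LM"
proof -
  obtain L0 d where K0: "subfield K0 R" "K0 \<subseteq> K" and L0: "subfield L0 R" "K0 \<subseteq> L0"
    and gen: "generate_field R (L0 \<union> K) = carrier R" and d: "dimension d K0 L0" "dimension d K (carrier R)"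
    using desc unfolding descends_to_def by blast
  note Kc = subfield_closed(1)[OF K] and K0c = subfield_closed(1)[OF K0(1)]
  have Kp: "(\<lambda>x. x [^] p) ` K \<subseteq> K" using subfield_pow[OF K] by auto
  have M: "subfield M R" unfolding M_def by (rule adjoin_subfield[OF K0c]) (use Kp Kc in auto)
  have MK: "M \<subseteq> K" unfolding M_def by (rule adjoin_least[OF K K0(2) Kp])
  have K0M: "K0 \<subseteq> M" unfolding M_def by (rule adjoin_incl)
  obtain b where b: "lin_indep K0 b d" "lin_span K0 b d = L0" using dimension_basis[OF K0(1) d(1)] .
  note bc = lin_indep_carrier[OF b(1)]
  have spK: "lin_span K b d = carrier R"
    using compositum_lin_span[OF K0(1) L0(1) K K0(2) bc b(2)] gen by (simp add: Un_commute)
  have bK: "lin_indep K b d" using lin_span_indep(1)[OF K _ _ bc, of d] spK d(2) by simp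
  define LM where "LM = lin_span M b d"
  have LMe: "LM = adjoin M L0" unfolding LM_def by (rule compositum_lin_span[OF K0(1) L0(1) M K0M bc b(2)])
  have LM: "subfield LM R" unfolding LMe
    by (rule adjoin_subfield[OF subfield_closed(1)[OF M] subfield_closed(1)[OF L0(1)]])
  have MLM: "M \<subseteq> LM" "L0 \<subseteq> LM" unfolding LMe by (rule adjoin_incl)+
  have dLM: "dimension d M LM" unfolding LM_def by (rule lin_indep_dimension[OF M lin_indep_mono[OF bK MK]])
  have bLM: "b i \<in> LM" if "i < d" for i using lin_span_closed(6)[OF M bc that] by (simp add: LM_def)
  have fr: "x [^] p \<in> LM" if x: "x \<in> carrier R" for x
  proof -
    obtain c where c: "c \<in> {..<d} \<rightarrow> K" "x = lincomb c b d"
      using x unfolding spK[symmetric] lin_span_def by auto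
    have "x [^] (p ^ 1) = lincomb (\<lambda>i. c i [^] (p ^ 1)) (\<lambda>i. b i [^] (p ^ 1)) d"
      unfolding c(2) by (rule frob_lincomb[OF Pi_subset[OF c(1) Kc] bc])
    also have "\<dots> \<in> LM"
    proof (rule lincomb_in_subfield[OF LM])
      fix i assume i: "i < d"
      have "c i [^] p \<in> M" unfolding M_def
        using c(1) i adjoin_incl(2)[of "(\<lambda>x. x [^] p) ` K" K0] by auto
      thus "c i [^] (p ^ 1) \<in> LM" using MLM by auto
      show "b i [^] (p ^ 1) \<in> LM" using subfield_pow[OF LM bLM[OF i]] .
    qed
    finally show ?thesis by simp
  qed
  show ?thesis
  proof (rule that[OF LM MLM(1) fr])
    show "coefficients_descend K M LM"
      unfolding coefficients_descend_def
    proof (intro allI impI Pi_I, elim conjE)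
      fix D v c j
      assume v: "lin_indep K v D" "\<forall>i<D. v i \<in> LM" and c: "c \<in> {..<D} \<rightarrow> K"
        and w': "lincomb c v D \<in> LM" and j': "j \<in> {..<D::nat}"
      define w where "w = lincomb c v D"
      have w: "w \<in> LM" "w = lincomb c v D" and j: "j < D" using w' j' by (auto simp: w_def)
      note vc = lin_indep_carrier[OF v(1)]
      \<comment> \<open>Otherwise v and w together are independent over \<open>M\<close> and extend
        to an M-basis of \<open>LM\<close>. This basis spans \<open>L\<close> over \<open>K\<close>
        and has d members, so it is independent over \<open>K\<close>, although w is a K-combination
        of v.\<close>
      have wspan: "w \<in> lin_span M v D"
      proof (rule ccontr)
        assume nw: "w \<notin> lin_span M v D"
        let ?u = "\<lambda>i. if i < D then v i else w"
        have uv: "lin_indep M ?u D" "lin_span M ?u D = lin_span M v D"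
          using lin_indep_cong[OF M lin_indep_mono[OF v(1) MK], of ?u] by auto
        have wc: "w \<in> carrier R" using w(1) subfield_closed(1)[OF LM] by auto
        have uD: "lin_indep M ?u (Suc D)" by (rule lin_indep_Suc[OF M uv(1)]) (use uv(2) nw wc in auto)
        note uc = lin_indep_carrier[OF uD]
        let ?Us = "map ?u [0..<Suc D]"
        have iU: "independent M ?Us" using lin_indep_iff_independent[OF M uc] uD by simp
        have "set ?Us \<subseteq> LM" using v(2) w(1) by auto
        then obtain Vs where Vs: "length (Vs @ ?Us) = d" "independent M (Vs @ ?Us)" "Span M (Vs @ ?Us) = LM"
          using complete_base[OF M dLM iU] by blast
        have VUc: "set (Vs @ ?Us) \<subseteq> carrier R" using independent_in_carrier[OF Vs(2)] .
        have "LM \<subseteq> Span K (Vs @ ?Us)"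
        proof -
          have "Span M (Vs @ ?Us) \<subseteq> Span K (Vs @ ?Us)"
            unfolding Span_eq_combine_set[OF M VUc] Span_eq_combine_set[OF K VUc] using MK by blast
          thus ?thesis using Vs(3) by simp
        qed
        hence "b ` {..<d} \<subseteq> Span K (Vs @ ?Us)" using bLM by auto
        hence "Span K (map b [0..<d]) \<subseteq> Span K (Vs @ ?Us)"
          by (intro mono_Span_subset[OF K _ VUc]) auto
        hence "carrier R \<subseteq> Span K (Vs @ ?Us)" using spK lin_span_eq_Span[OF K bc] by simp
        hence full: "Span K (Vs @ ?Us) = carrier R"
          using Span_in_carrier[OF Kc VUc] by blast
        obtain d' where d': "d' \<le> length (Vs @ ?Us)" "dimension d' K (carrier R)"
          "independent K (Vs @ ?Us) \<or> d' < length (Vs @ ?Us)"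
          using Span_dimension_le[OF K VUc] unfolding full by blast
        have "d' = d" by (rule dimension_is_inj[OF K d'(2) d(2)])
        hence "independent K (Vs @ ?Us)" using d'(3) Vs(1) by simp
        hence "independent K ?Us" by (rule independent_split(1)[OF K])
        hence "lin_indep K ?u (Suc D)" using lin_indep_iff_independent[OF K uc] by simp
        hence "?u D \<notin> lin_span K ?u D" by (rule lin_indep_notin[OF K])
        moreover have "lin_span K ?u D = lin_span K v D" using lin_indep_cong[OF K v(1), of ?u] by auto
        ultimately show False using w(2) c by (auto simp: lin_span_def)
      qed
      then obtain c' where c': "c' \<in> {..<D} \<rightarrow> M" "w = lincomb c' v D" by (auto simp: lin_span_def)
      have c'K: "c' \<in> {..<D} \<rightarrow> K" by (rule Pi_subset[OF c'(1) MK])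
      note cc = Pi_subset[OF c Kc] and cc' = Pi_subset[OF c'K Kc]
      have mK: "(\<lambda>i. \<ominus> \<one> \<otimes> c' i) \<in> {..<D} \<rightarrow> K"
        using c'K subfield_closed(5)[OF K subfield_closed(6)[OF K subfield_closed(3)[OF K]]] by auto
      have "lincomb (\<lambda>i. c i \<oplus> \<ominus> \<one> \<otimes> c' i) v D = lincomb c v D \<oplus> lincomb (\<lambda>i. \<ominus> \<one> \<otimes> c' i) v D"
        by (rule lincomb_add[OF cc Pi_subset[OF mK Kc] vc])
      also have "lincomb (\<lambda>i. \<ominus> \<one> \<otimes> c' i) v D = \<ominus> \<one> \<otimes> lincomb c' v D"
        by (rule lincomb_smult[OF cc' _ vc]) simp
      also have "lincomb c v D \<oplus> \<ominus> \<one> \<otimes> lincomb c' v D = \<zero>"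
        unfolding w(2)[symmetric] c'(2)[symmetric] using w(1) subfield_closed(1)[OF LM] by (auto simp: l_minus r_neg)
      finally have z: "lincomb (\<lambda>i. c i \<oplus> \<ominus> \<one> \<otimes> c' i) v D = \<zero>" .
      have "(\<lambda>i. c i \<oplus> \<ominus> \<one> \<otimes> c' i) \<in> {..<D} \<rightarrow> K"
        using c mK subfield_closed(4)[OF K] by (simp add: Pi_iff)
      hence "c j \<oplus> \<ominus> \<one> \<otimes> c' j = \<zero>" using lin_indepD[OF v(1) _ z j] by blast
      moreover have "c j \<in> carrier R" "c' j \<in> carrier R" using cc cc' j by auto
      ultimately have "c j = c' j" by (simp add: l_minus minus_eq[symmetric])
      thus "c j \<in> M" using c'(1) j by auto
    qed
  qed
qed

text \<open>Isolates what depends on the particular extension: \<open>rigid\<close> asks that every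
  M arising from a descent contain the coefficients. What remains is general: K = K_0 K^p makes
  \<open>C\<close> algebraic over K_0.\<close>

theorem ess_dim_ge:
  assumes F: "subfield F R" and K: "subfield K R" "K = adjoin F C"
    and C: "finite C" "C \<subseteq> carrier R" "hull_independent F C"
    and rigid: "\<And>M LM. \<lbrakk>subfield M R; F \<subseteq> M; M \<subseteq> K; subfield LM R; M \<subseteq> LM;
        \<And>x. x \<in> carrier R \<Longrightarrow> x [^] p \<in> LM;
        coefficients_descend K M LM\<rbrakk> \<Longrightarrow> C \<subseteq> M"
  shows "enat (card C) \<le> ess_dim F K"
  unfolding ess_dim_def
proof (rule INF_greatest)
  fix K0 assume "K0 \<in> {K0. F \<subseteq> K0 \<and> descends_to K K0}"
  hence FK0: "F \<subseteq> K0" and desc: "descends_to K K0" by auto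
  have K0: "subfield K0 R" "K0 \<subseteq> K" using desc by (auto simp: descends_to_def)
  note K0c = subfield_closed(1)[OF K0(1)] and Kc = subfield_closed(1)[OF K(1)] and Fc = subfield_closed(1)[OF F]
  let ?M = "adjoin K0 ((\<lambda>x. x [^] p) ` K)"
  have Kp: "(\<lambda>x. x [^] p) ` K \<subseteq> K" using subfield_pow[OF K(1)] by auto
  have M: "subfield ?M R" by (rule adjoin_subfield[OF K0c]) (use Kp Kc in auto)
  have MK: "?M \<subseteq> K" by (rule adjoin_least[OF K(1) K0(2) Kp])
  have FM: "F \<subseteq> ?M" using FK0 adjoin_incl(1)[of K0] by blast
  show "enat (card C) \<le> trdeg F K0"
  proof (rule descent_field[OF K(1) desc])
    fix LM
    assume LM: "subfield LM R" "?M \<subseteq> LM" "\<And>x. x \<in> carrier R \<Longrightarrow> x [^] p \<in> LM"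
      "coefficients_descend K ?M LM"
    have CM: "C \<subseteq> ?M" by (rule rigid[OF M FM MK LM])
    have "adjoin F C \<subseteq> ?M" by (rule adjoin_least[OF M FM CM])
    hence fr: "K \<subseteq> ?M" using K(2) by simp
    have CK: "C \<subseteq> K" unfolding K(2) by (rule adjoin_incl)
    have KC: "K = adjoin K0 C"
    proof
      show "K \<subseteq> adjoin K0 C" unfolding K(2)
        by (rule adjoin_least[OF adjoin_subfield[OF K0c C(2)]])
          (use FK0 adjoin_incl(1)[of K0 C] adjoin_incl(2)[of C K0] in blast)+
      show "adjoin K0 C \<subseteq> K" by (rule adjoin_least[OF K(1) K0(2) CK])
    qed
    have "C \<subseteq> algebraic_hull K0 {}" by (rule algebraic_of_frobenius_span[OF K0(1) K(1) K0(2) C(1) CK KC fr])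
    moreover have "adjoin K0 {} = adjoin F K0"
      using adjoin_id[OF K0(1), of "{}"] FK0 by (simp add: Un_absorb1 Un_commute)
    ultimately have "C \<subseteq> algebraic_hull F K0" by (simp add: algebraic_hull_def)
    thus ?thesis by (rule trdeg_ge[OF F K0c C])
  qed
qed

end

section \<open>The generic extension\<close>

context field
begin

lemma algebraic_hull_closed:
  assumes "F \<subseteq> carrier R" "A \<subseteq> carrier R" "x \<in> carrier R" "algebraic (algebraic_hull F A) x"
  shows "x \<in> algebraic_hull F A"
proof -
  note H = algebraic_hull_subfield[OF assms(1,2)]
  have "algebraic (adjoin F A) x"
    by (rule algebraic_trans[OF adjoin_subfield[OF assms(1,2)] H _ assms(3,4)]) (auto simp: algebraic_hull_def)
  thus ?thesis using assms(3) by (simp add: algebraic_hull_def)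
qed

lemma algebraic_hull_root:
  assumes "F \<subseteq> carrier R" "A \<subseteq> carrier R" "x \<in> carrier R" "x [^] (m::nat) \<in> algebraic_hull F A" "0 < m"
  shows "x \<in> algebraic_hull F A"
proof (rule algebraic_hull_closed[OF assms(1-3)])
  note H = algebraic_hull_subfield[OF assms(1,2)]
  obtain d where "dimension d (algebraic_hull F A) (adjoin (algebraic_hull F A) {x})"
    using adjoin_dimension_le_pow[OF H assms(3,5,4)] by metis
  moreover have "x \<in> adjoin (algebraic_hull F A) {x}" using adjoin_incl(2) by blast
  moreover have "subfield (adjoin (algebraic_hull F A) {x}) R"
    by (rule adjoin_subfield[OF subfield_closed(1)[OF H]]) (use assms(3) in simp)
  ultimately show "algebraic (algebraic_hull F A) x"
    using algebraic_of_finite_dimension[OF H _ finite_dimensionI] by blast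
qed

end

text \<open>\<open>L\<close> is the rational function field over \<open>F\<close> in the variables
  \<open>y i j\<close>. The variable \<open>y i 0\<close> serves as x_i itself, and for j > 0
  \<open>y i j\<close> serves as the coefficient of the j-th monomial. Generators and these
  coefficients are thus independent from the start, and only the coefficient of the trivial monomial
  is computed.\<close>

locale generic_tower = char_p_field R p for R (structure) and p +
  fixes F :: "'a set" and r n :: nat and e D :: "nat \<Rightarrow> nat" and y :: "nat \<Rightarrow> nat \<Rightarrow> 'a"
  assumes F: "subfield F R" and r_pos: "0 < r" and n_pos: "0 < n"
    and e_pos: "i < r \<Longrightarrow> 1 \<le> e i" and anti: "\<lbrakk>j \<le> i; i < r\<rbrakk> \<Longrightarrow> e i \<le> e j"
    and D: "D i = n * p ^ (\<Sum>j<i. e j - e i)"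
    and y_inj: "inj_on (\<lambda>(i, j). y i j) (SIGMA i:{..<r}. {..<D i})"
    and y_indep: "hull_independent F ((\<lambda>(i, j). y i j) ` (SIGMA i:{..<r}. {..<D i}))"
    and y_gen: "adjoin F ((\<lambda>(i, j). y i j) ` (SIGMA i:{..<r}. {..<D i})) = carrier R"
begin

text \<open>
  \<open>c i 0\<close> is chosen so that the \<open>c i j\<close> are the coordinates of \<open>T i\<close> in the monomials \<open>V i j\<close>
  (\<open>T_eq_lincomb\<close> below): these are the coefficients that a field of definition has to contain.
\<close>

definition x :: "nat \<Rightarrow> 'a" where "x i = y i 0"
definition \<theta> :: 'a where "\<theta> = x 0 [^] (p ^ e 0)"
definition V :: "nat \<Rightarrow> nat \<Rightarrow> 'a" where "V i = mixed (tower_monomials x e n \<theta> i)"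
definition T :: "nat \<Rightarrow> 'a" where "T i = (if i = 0 then \<theta> [^] n else x i [^] (p ^ e i))"
definition U :: "nat \<Rightarrow> 'a" where "U i = lincomb (\<lambda>j. if j = 0 then \<zero> else y i j) (V i) (D i)"
definition c :: "nat \<Rightarrow> nat \<Rightarrow> 'a" where "c i j = (if j = 0 then T i \<ominus> U i else y i j)"
definition J :: "(nat \<times> nat) set" where "J = (SIGMA i:{..<r}. {..<D i})"
definition C :: "'a set" where "C = (\<lambda>(i, j). c i j) ` J"
definition K :: "'a set" where "K = adjoin F C"
definition S :: "'a set" where "S = adjoin K {\<theta>}"
definition L :: "nat \<Rightarrow> 'a set" where "L i = adjoin S (x ` {..<i})"

lemma D_pos: "0 < D i" using n_pos p_pos by (simp add: D)

lemma Fc: "F \<subseteq> carrier R" using subfield_closed(1)[OF F] .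

lemma J_iff: "(i, j) \<in> J \<longleftrightarrow> i < r \<and> j < D i" by (auto simp: J_def)

lemma finite_J: "finite J" by (simp add: J_def)

lemma Y_closed: "(\<lambda>(i, j). y i j) ` J \<subseteq> carrier R"
  using adjoin_incl(2)[of "(\<lambda>(i, j). y i j) ` J" F] unfolding y_gen[folded J_def] .

lemma y_closed: "\<lbrakk>i < r; j < D i\<rbrakk> \<Longrightarrow> y i j \<in> carrier R"
  using Y_closed J_iff by (fastforce simp: image_subset_iff)

lemma x_closed: "i < r \<Longrightarrow> x i \<in> carrier R" using y_closed D_pos by (simp add: x_def)

lemma theta_closed: "\<theta> \<in> carrier R" using x_closed r_pos by (simp add: \<theta>_def)

lemma V_in_subfield:
  assumes "subfield E R" "\<theta> \<in> E" "\<And>j. j < i \<Longrightarrow> x j [^] (p ^ e i) \<in> E"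
  shows "V i j \<in> E"
  unfolding V_def by (rule mixed_in_subfield[OF assms(1)]) (use assms in \<open>auto simp: tower_monomials_fst\<close>)

lemma monomials_closed: "i < r \<Longrightarrow> fst ` set (tower_monomials x e n \<theta> i) \<subseteq> carrier R"
  using x_closed theta_closed by (auto simp: tower_monomials_fst)

lemma V_closed: "i < r \<Longrightarrow> V i \<in> A \<rightarrow> carrier R"
  unfolding V_def using mixed_closed[OF monomials_closed] by auto

lemma V_zero: "i < r \<Longrightarrow> V i 0 = \<one>"
  unfolding V_def by (rule mixed_zero[OF monomials_closed])

lemma D_0: "D 0 = n" by (simp add: D)

lemma V_theta: "j < n \<Longrightarrow> V 0 j = \<theta> [^] j"
  using theta_closed by (simp add: V_def tower_monomials_def)

lemma theta_pow_closed: "(\<lambda>i. \<theta> [^] (i::nat)) \<in> A \<rightarrow> carrier R"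
  using theta_closed by auto

lemma T_closed: "i < r \<Longrightarrow> T i \<in> carrier R" using x_closed theta_closed by (simp add: T_def)

lemma y_coeffs_closed: "i < r \<Longrightarrow> (\<lambda>j. if j = 0 then \<zero> else y i j) \<in> {..<D i} \<rightarrow> carrier R"
  using y_closed by auto

lemma U_closed: "i < r \<Longrightarrow> U i \<in> carrier R"
  unfolding U_def using y_coeffs_closed V_closed by blast

lemma c_closed: "i < r \<Longrightarrow> c i \<in> {..<D i} \<rightarrow> carrier R"
  using T_closed U_closed y_closed by (auto simp: c_def)

lemma T_eq_lincomb:
  assumes i: "i < r" shows "T i = lincomb (c i) (V i) (D i)"
proof -
  let ?d = "\<lambda>j. if j = 0 then c i 0 else \<zero>" and ?y = "\<lambda>j. if j = 0 then \<zero> else y i j"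
  note cl = c_closed[OF i] V_closed[OF i] T_closed[OF i] U_closed[OF i] y_coeffs_closed[OF i]
  have c0: "c i 0 \<in> carrier R" using cl D_pos by auto
  have "lincomb (c i) (V i) (D i) = lincomb (\<lambda>j. ?d j \<oplus> ?y j) (V i) (D i)"
    by (rule lincomb_cong) (use cl c0 y_closed[OF i] in \<open>auto simp: c_def\<close>)
  also have "\<dots> = lincomb ?d (V i) (D i) \<oplus> U i"
    unfolding U_def by (rule lincomb_add[OF _ cl(5,2)]) (use c0 in auto)
  also have "lincomb ?d (V i) (D i) = c i 0 \<otimes> V i 0"
    by (rule lincomb_delta[OF D_pos c0 cl(2)])
  also have "c i 0 \<otimes> V i 0 \<oplus> U i = T i"
    using cl c0 V_zero[OF i] by (simp add: c_def minus_eq a_assoc l_neg)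
  finally show ?thesis by simp
qed

lemma theta_relation: "\<theta> [^] n = lincomb (c 0) (\<lambda>j. \<theta> [^] j) n"
proof -
  have "\<theta> [^] n = lincomb (c 0) (V 0) n" using T_eq_lincomb[OF r_pos] by (simp add: T_def D_0)
  also have "\<dots> = lincomb (c 0) (\<lambda>j. \<theta> [^] j) n"
    by (rule lincomb_cong) (use V_theta c_closed[OF r_pos] theta_closed in \<open>auto simp: D_0\<close>)
  finally show ?thesis .
qed

lemma C_closed: "C \<subseteq> carrier R" using c_closed by (fastforce simp: C_def J_iff)

lemma c_in_C: "\<lbrakk>i < r; j < D i\<rbrakk> \<Longrightarrow> c i j \<in> C" by (force simp: C_def J_iff)

lemma card_Y: "card ((\<lambda>(i, j). y i j) ` J) = card J"
  using card_image[OF y_inj] by (simp add: J_def)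

text \<open>By induction on i, each x_i is in the hull. If it is \<open>c i 0\<close> that is given,
  the relation puts \<open>T i\<close> into the hull and x_i is a root of it; for i = 0 the relation
  is first read as a monic equation for \<theta>.\<close>

lemma Y_in_hull:
  assumes B: "B \<subseteq> carrier R"
    and y: "\<And>i j. \<lbrakk>i < r; j < D i; j \<noteq> 0\<rbrakk> \<Longrightarrow> y i j \<in> algebraic_hull F B"
    and xc: "\<And>i. i < r \<Longrightarrow> x i \<in> algebraic_hull F B \<or> c i 0 \<in> algebraic_hull F B"
  shows "(\<lambda>(i, j). y i j) ` J \<subseteq> algebraic_hull F B"
proof -
  let ?H = "algebraic_hull F B"
  note H = algebraic_hull_subfield[OF Fc B] and root = algebraic_hull_root[OF Fc B]
  note Hc = subfield_closed(1)[OF H]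
  have "x i \<in> ?H" if "i < r" for i
    using that
  proof (induction i rule: less_induct)
    case (less i)
    show ?case
    proof (cases "x i \<in> ?H")
      case False
      hence cH: "c i j \<in> ?H" if "j < D i" for j
        using xc[OF less.prems] y[OF less.prems that] by (cases "j = 0") (auto simp: c_def)
      show ?thesis
      proof (cases "i = 0")
        case True
        have "\<theta> [^] n \<in> lin_span ?H (\<lambda>j. \<theta> [^] j) n"
          unfolding theta_relation using cH True by (auto simp: lin_span_def D_0)
        then obtain d where "dimension d ?H (adjoin ?H {\<theta>})"
          using adjoin_dimension_le[OF H theta_closed n_pos] by metis
        moreover have "subfield (adjoin ?H {\<theta>}) R" by (rule adjoin_subfield[OF Hc]) (use theta_closed in simp)
        ultimately have "algebraic ?H \<theta>"
          using algebraic_of_finite_dimension[OF H _ finite_dimensionI] adjoin_incl(2)[of "{\<theta>}" ?H] by blast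
        hence "\<theta> \<in> ?H" by (rule algebraic_hull_closed[OF Fc B theta_closed])
        thus ?thesis using root[OF x_closed[OF less.prems], of "p ^ e 0"] p_pos True by (simp add: \<theta>_def)
      next
        case False
        have xs: "x j \<in> ?H" if "j < i" for j using less that by simp
        have "\<theta> \<in> ?H" unfolding \<theta>_def using subfield_pow[OF H xs[of 0]] False by simp
        hence "T i \<in> ?H" unfolding T_eq_lincomb[OF less.prems]
          by (intro lincomb_in_subfield[OF H] cH V_in_subfield[OF H]) (use subfield_pow[OF H xs] in auto)
        thus ?thesis using root[OF x_closed[OF less.prems], of "p ^ e i"] p_pos False by (simp add: T_def)
      qed
    qed simp
  qed
  thus ?thesis using y by (auto simp: J_iff x_def split: prod.splits) (metis neq0_conv)
qed

text \<open>Counting: if \<open>z\<close> were algebraic over F(B), all variables would be algebraic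
  over F(B), although \<open>B\<close> has fewer elements than there are variables.\<close>

lemma transcendental_of_card:
  assumes B: "finite B" "B \<subseteq> carrier R" "card B < card J" and z: "z \<in> carrier R"
    and Y: "(\<lambda>(i, j). y i j) ` J \<subseteq> algebraic_hull F (insert z B)"
  shows "\<not> algebraic (adjoin F B) z"
proof
  assume "algebraic (adjoin F B) z"
  hence zH: "z \<in> algebraic_hull F B" using z by (simp add: algebraic_hull_def)
  note H = algebraic_hull_incl[OF Fc B(2)]
  have "algebraic_hull F (insert z B) \<subseteq> algebraic_hull F B"
    by (rule algebraic_hull_idem[OF Fc B(2) H(2)]) (use zH H(3) in auto)
  hence "card ((\<lambda>(i, j). y i j) ` J) \<le> card B"
    using hull_independent_card_le[OF Fc _ Y_closed y_indep[folded J_def] B(1,2)] Y finite_J by blast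
  thus False using B(3) card_Y by simp
qed

text \<open>All variables are algebraic over the coefficients, and there are at most as many
  coefficients as variables. So no two coefficients coincide and none is algebraic over the
  others.\<close>

lemma C_basis: "hull_independent F C" "card C = card J"
proof -
  have fin: "finite C" using finite_J by (simp add: C_def)
  have le: "card C \<le> card J" unfolding C_def by (rule card_image_le[OF finite_J])
  note H = algebraic_hull_incl[OF Fc C_closed]
  have Y: "(\<lambda>(i, j). y i j) ` J \<subseteq> algebraic_hull F C"
  proof (rule Y_in_hull[OF C_closed])
    show "y i j \<in> algebraic_hull F C" if "i < r" "j < D i" "j \<noteq> 0" for i j
      using c_in_C[OF that(1,2)] that(3) H(3) by (auto simp: c_def)
    show "x i \<in> algebraic_hull F C \<or> c i 0 \<in> algebraic_hull F C" if "i < r" for i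
      using c_in_C[OF that D_pos] H(3) by blast
  qed
  have "card ((\<lambda>(i, j). y i j) ` J) \<le> card C"
    by (rule hull_independent_card_le[OF Fc _ Y_closed y_indep[folded J_def] fin C_closed Y]) (simp add: finite_J)
  thus eq: "card C = card J" using le card_Y by simp
  show "hull_independent F C" unfolding hull_independent_def
  proof
    fix a assume a: "a \<in> C"
    have "\<not> algebraic (adjoin F (C - {a})) a"
    proof (rule transcendental_of_card)
      show "card (C - {a}) < card J" using card_Diff1_less[OF fin a] eq by simp
      show "(\<lambda>(i, j). y i j) ` J \<subseteq> algebraic_hull F (insert a (C - {a}))"
        using Y a by (simp add: insert_absorb)
    qed (use fin C_closed a in auto)
    thus "a \<notin> algebraic_hull F (C - {a})" by (simp add: algebraic_hull_def)
  qed
qed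

section \<open>The type of the generic extension\<close>

lemma K_subfield: "subfield K R" unfolding K_def by (rule adjoin_subfield[OF Fc C_closed])
lemma S_subfield: "subfield S R"
  unfolding S_def by (rule adjoin_subfield[OF subfield_closed(1)[OF K_subfield]]) (use theta_closed in auto)
lemma L_subfield: "i \<le> r \<Longrightarrow> subfield (L i) R"
  unfolding L_def by (rule adjoin_subfield[OF subfield_closed(1)[OF S_subfield]]) (use x_closed in auto)
lemma FK: "F \<subseteq> K" unfolding K_def by (rule adjoin_incl)
lemma CK: "C \<subseteq> K" unfolding K_def by (rule adjoin_incl)
lemma KS: "K \<subseteq> S" unfolding S_def by (rule adjoin_incl)
lemma theta_S: "\<theta> \<in> S" unfolding S_def using adjoin_incl(2)[of "{\<theta>}"] by blast
lemma SL: "S \<subseteq> L i" unfolding L_def by (rule adjoin_incl)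
lemma x_L: "j < i \<Longrightarrow> x j \<in> L i" unfolding L_def using adjoin_incl(2)[of "x ` {..<i}"] by blast
lemma L_0: "L 0 = S" unfolding L_def using adjoin_id[OF S_subfield, of "{}"] by simp
lemma c_K: "\<lbrakk>i < r; j < D i\<rbrakk> \<Longrightarrow> c i j \<in> K" using c_in_C CK by blast

text \<open>\<theta> is transcendental over the field generated by all coefficients except
  \<open>c 0 0\<close>, and \<open>c 0 0\<close> is a monic polynomial of degree \<open>n\<close> in
  \<theta> over that field. Adjoining it gives \<open>K\<close>, so
  \<open>powers_indep_over_monic\<close> applies.\<close>

lemma theta_powers_indep: "lin_indep K (\<lambda>i. \<theta> [^] i) n"
proof -
  let ?B = "(\<lambda>(i, j). c i j) ` (J - {(0, 0)})"
  have J0: "(0, 0) \<in> J" using r_pos D_pos by (simp add: J_iff)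
  have B: "finite ?B" "?B \<subseteq> carrier R" using finite_J C_closed by (auto simp: C_def)
  have cB: "card ?B < card J"
    using card_image_le[of "J - {(0, 0)}" "\<lambda>(i, j). c i j"] card_Diff1_less[OF finite_J J0] finite_J
    by simp
  have ttB: "insert \<theta> ?B \<subseteq> carrier R" using B theta_closed by simp
  note H = algebraic_hull_incl[OF Fc ttB]
  have cH: "c i j \<in> algebraic_hull F (insert \<theta> ?B)" if "i < r" "j < D i" "(i, j) \<noteq> (0, 0)" for i j
    using that H(3) by (force simp: J_iff)
  have nt: "\<not> algebraic (adjoin F ?B) \<theta>"
  proof (rule transcendental_of_card[OF B cB theta_closed Y_in_hull[OF ttB]])
    show "y i j \<in> algebraic_hull F (insert \<theta> ?B)" if "i < r" "j < D i" "j \<noteq> 0" for i j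
      using cH[OF that(1,2)] that(3) by (simp add: c_def)
    show "x i \<in> algebraic_hull F (insert \<theta> ?B) \<or> c i 0 \<in> algebraic_hull F (insert \<theta> ?B)" if "i < r" for i
    proof (cases "i = 0")
      case True
      thus ?thesis
        using algebraic_hull_root[OF Fc ttB x_closed[OF that], of "p ^ e 0"] H(3) p_pos by (simp add: \<theta>_def)
    qed (use cH[OF that D_pos] in simp)
  qed
  have E: "subfield (adjoin F ?B) R" by (rule adjoin_subfield[OF Fc B(2)])
  have yB: "(\<lambda>j. if j = 0 then \<zero> else y 0 j) \<in> {..<n} \<rightarrow> adjoin F ?B"
  proof
    fix j assume j: "j \<in> {..<n}"
    show "(if j = 0 then \<zero> else y 0 j) \<in> adjoin F ?B"
    proof (cases "j = 0")
      case False
      hence "(0, j) \<in> J - {(0, 0)}" using j r_pos by (simp add: J_iff D_0)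
      hence "c 0 j \<in> ?B" by force
      thus ?thesis using adjoin_incl(2)[of ?B F] False by (auto simp: c_def)
    qed (use subfield_closed(2)[OF E] in simp)
  qed
  have "U 0 = lincomb (\<lambda>j. if j = 0 then \<zero> else y 0 j) (\<lambda>j. \<theta> [^] j) n"
    unfolding U_def D_0
    by (rule lincomb_cong) (use V_theta y_coeffs_closed[OF r_pos] theta_closed in \<open>auto simp: D_0\<close>)
  hence "U 0 \<in> lin_span (adjoin F ?B) (\<lambda>j. \<theta> [^] j) n"
    using yB by (auto simp: lin_span_def)
  hence "\<ominus> U 0 \<in> lin_span (adjoin F ?B) (\<lambda>j. \<theta> [^] j) n"
    by (rule lin_span_closed(4)[OF E theta_pow_closed])
  hence "monic_in (adjoin F ?B) \<theta> n (c 0 0)"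
    by (auto simp: monic_in_def c_def T_def minus_eq)
  hence "lin_indep (adjoin (adjoin F ?B) {c 0 0}) (\<lambda>i. \<theta> [^] i) n"
    by (rule powers_indep_over_monic[OF E theta_closed nt _ n_pos])
  moreover have "adjoin (adjoin F ?B) {c 0 0} = K"
  proof -
    have "C = ?B \<union> {c 0 0}" using J0 by (force simp: C_def)
    moreover have "c 0 0 \<in> carrier R" using c_in_C[OF r_pos D_pos] C_closed by blast
    ultimately show ?thesis using adjoin_adjoin[OF Fc B(2), of "{c 0 0}"] by (simp add: K_def)
  qed
  ultimately show ?thesis by simp
qed

lemma dimension_S: "dimension n K S"
proof -
  have "\<theta> [^] n \<in> lin_span K (\<lambda>j. \<theta> [^] j) n"
    unfolding theta_relation using c_K[OF r_pos] by (auto simp: lin_span_def D_0)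
  hence "lin_span K (\<lambda>j. \<theta> [^] j) n = S"
    unfolding S_def by (rule adjoin_eq_lin_span[OF K_subfield theta_closed n_pos])
  thus ?thesis using lin_indep_dimension[OF K_subfield theta_powers_indep] by simp
qed

text \<open>Let E be generated over \<open>F\<close> by the x_t with t < i and all coefficients
  except the \<open>c t 0\<close> with t <= i. These are recovered from E and x_i^(q_i), so
  \<open>L i\<close> lies in E(x_i^(q_i)). As x_i is transcendental over E, this field does not
  contain the power with exponent q_i / p.\<close>

lemma x_pow_notin:
  assumes i: "i < r" shows "x i [^] (p ^ (e i - 1)) \<notin> L i"
proof -
  let ?I = "{(t, j) \<in> J. j \<noteq> 0 \<or> i < t}"
  let ?B = "(\<lambda>(i, j). c i j) ` ?I \<union> x ` {..<i}"
  have fin: "finite ?I" by (rule finite_subset[OF _ finite_J]) auto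
  have B: "finite ?B" "?B \<subseteq> carrier R"
    using fin C_closed x_closed i by (auto simp: C_def)
  have JI: "J = ?I \<union> (\<lambda>t. (t, 0)) ` {..i}" "?I \<inter> (\<lambda>t. (t, 0)) ` {..i} = {}"
    using i D_pos by (auto simp: J_iff)
  \<comment> \<open>The i + 1 index pairs (t, 0) with t <= i are dropped and only i generators are
    added, so \<open>?B\<close> is smaller than \<open>J\<close>.\<close>
  have "card J = card ?I + card ((\<lambda>t. (t, 0::nat)) ` {..i})"
    by (subst JI(1), rule card_Un_disjoint[OF fin _ JI(2)]) simp
  also have "card ((\<lambda>t. (t, 0::nat)) ` {..i}) = Suc i" by (subst card_image) (auto simp: inj_on_def)
  finally have cJ: "card J = card ?I + Suc i" .
  have "card ?B \<le> card ((\<lambda>(i, j). c i j) ` ?I) + card (x ` {..<i})" by (rule card_Un_le)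
  also have "\<dots> \<le> card ?I + i"
    using card_image_le[OF fin, of "\<lambda>(i, j). c i j"] card_image_le[of "{..<i}" x] by simp
  finally have cB: "card ?B < card J" using cJ by simp
  have xB: "insert (x i) ?B \<subseteq> carrier R" using B(2) x_closed[OF i] by simp
  have cI: "c t j \<in> ?B" if "t < r" "j < D t" "j \<noteq> 0 \<or> i < t" for t j
    using that by (force simp: J_iff)
  note H = algebraic_hull_incl[OF Fc xB]
  have nt: "\<not> algebraic (adjoin F ?B) (x i)"
  proof (rule transcendental_of_card[OF B cB x_closed[OF i] Y_in_hull[OF xB]])
    show "y t j \<in> algebraic_hull F (insert (x i) ?B)" if "t < r" "j < D t" "j \<noteq> 0" for t j
      using cI[OF that(1,2)] that(3) H(3) by (auto simp: c_def)
    show "x t \<in> algebraic_hull F (insert (x i) ?B) \<or> c t 0 \<in> algebraic_hull F (insert (x i) ?B)" if "t < r" for t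
      using cI[OF that D_pos] H(3) by (cases t i rule: linorder_cases) auto
  qed
  let ?E = "adjoin F ?B" and ?q = "p ^ e i"
  have E: "subfield ?E R" by (rule adjoin_subfield[OF Fc B(2)])
  let ?E' = "adjoin ?E {x i [^] ?q}"
  have E': "subfield ?E' R"
    by (rule adjoin_subfield[OF subfield_closed(1)[OF E]]) (use x_closed[OF i] in simp)
  have EE': "?E \<subseteq> ?E'" "x i [^] ?q \<in> ?E'"
    using adjoin_incl(1)[of ?E "{x i [^] ?q}"] adjoin_incl(2)[of "{x i [^] ?q}" ?E] by auto
  have BE': "?B \<subseteq> ?E'" using adjoin_incl(2)[of ?B F] EE'(1) by blast
  have FE': "F \<subseteq> ?E'" using adjoin_incl(1)[of F ?B] EE'(1) by blast
  have xE': "x t \<in> ?E'" if "t < i" for t using BE' that by blast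
  \<comment> \<open>For i = 0, \<theta> is the adjoined power itself.\<close>
  have thE': "\<theta> \<in> ?E'"
    using subfield_pow[OF E' xE'[of 0]] EE'(2) by (cases "i = 0") (auto simp: \<theta>_def)
  have CE': "c t j \<in> ?E'" if "t < r" "j < D t" for t j
  proof (cases "j \<noteq> 0 \<or> i < t")
    case True thus ?thesis using cI[OF that] BE' by blast
  next
    case False
    hence ti: "t \<le> i" "j = 0" by auto
    have "T t \<in> ?E'"
      using subfield_pow[OF E' xE'[of t]] subfield_pow[OF E' thE'] EE'(2) ti by (cases "t = i") (auto simp: T_def)
    moreover have "U t \<in> ?E'" unfolding U_def
    proof (rule lincomb_in_subfield[OF E'])
      show "(if j = 0 then \<zero> else y t j) \<in> ?E'" if "j < D t" for j
      proof (cases "j = 0")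
        case False
        hence "c t j \<in> ?E'" using subsetD[OF BE' cI[OF \<open>t < r\<close> that]] by blast
        thus ?thesis using False by (simp only: c_def if_False)
      qed (use subfield_closed(2)[OF E'] in simp)
      show "V t j \<in> ?E'" for j
        by (rule V_in_subfield[OF E' thE']) (use subfield_pow[OF E' xE'] ti in simp)
    qed
    ultimately show ?thesis using subfield_closed(7)[OF E', of "T t" "U t"] ti(2) unfolding c_def by metis
  qed
  have "K \<subseteq> ?E'" unfolding K_def by (rule adjoin_least[OF E' FE']) (use CE' in \<open>auto simp: C_def J_iff\<close>)
  hence "S \<subseteq> ?E'" unfolding S_def by (intro adjoin_least[OF E']) (use thE' in auto)
  hence "L i \<subseteq> ?E'" unfolding L_def by (intro adjoin_least[OF E']) (use xE' in auto)
  moreover have "x i [^] (p ^ (e i - 1)) \<notin> ?E'"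
  proof (rule pow_notin_adjoin_pow[OF E x_closed[OF i] nt])
    show "p ^ (e i - 1) < p ^ e i" using p_gt_1 e_pos[OF i] by (intro power_strict_increasing) auto
  qed (use p_pos in simp)
  ultimately show ?thesis by blast
qed

lemma Y_gen_subset:
  assumes "subfield E R" "F \<subseteq> E" "\<And>i j. \<lbrakk>i < r; j < D i; j \<noteq> 0\<rbrakk> \<Longrightarrow> y i j \<in> E" "\<And>i. i < r \<Longrightarrow> x i \<in> E"
  shows "carrier R \<subseteq> E"
  unfolding y_gen[symmetric]
proof (rule adjoin_least[OF assms(1,2)], clarsimp)
  fix i j assume "i < r" "j < D i"
  thus "y i j \<in> E" using assms(3,4) by (cases "j = 0") (auto simp: x_def)
qed

text \<open>Checked on the generators of \<open>L\<close>. For t >= i and t > 0, the relation for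
  \<open>T t\<close> is raised to the power q_i / q_t: its coefficients stay in \<open>K\<close>,
  and the x_j^(q_t) in its monomials become x_j^(q_i), covered by induction.\<close>

lemma pow_in_L:
  assumes i: "i < r" and z: "z \<in> carrier R" shows "z [^] (p ^ e i) \<in> L i"
proof -
  note Li = L_subfield[OF less_imp_le[OF i]]
  have KL: "K \<subseteq> L i" using KS SL by blast
  have thL: "\<theta> \<in> L i" using theta_S SL by blast
  have xL: "x t [^] (p ^ e i) \<in> L i" if "t < r" for t
    using that
  proof (induction t rule: less_induct)
    case (less t)
    consider "t < i" | "t = 0" "i = 0" | "i \<le> t" "t \<noteq> 0" by linarith
    thus ?case
    proof cases
      case 1 thus ?thesis using subfield_pow[OF Li x_L] by blast
    next
      case 2 thus ?thesis using thL by (simp add: \<theta>_def)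
    next
      case 3
      let ?f = "p ^ (e i - e t)"
      have pw: "(z [^] (p ^ e t)) [^] ?f = z [^] (p ^ e i)" if "z \<in> carrier R" for z
        using that anti[OF 3(1) less.prems] by (simp add: nat_pow_pow power_add[symmetric])
      have W: "subfield {z \<in> carrier R. z [^] ?f \<in> L i} R" (is "subfield ?W R")
        by (rule frob_vimage_subfield[OF Li])
      have "T t \<in> ?W" unfolding T_eq_lincomb[OF less.prems]
      proof (intro lincomb_in_subfield[OF W] V_in_subfield[OF W])
        show "c t j \<in> ?W" if "j < D t" for j
          using subfield_pow[OF Li, of "c t j"] c_K[OF less.prems that] KL c_closed[OF less.prems] that by auto
        show "\<theta> \<in> ?W" using subfield_pow[OF Li thL] theta_closed by simp
        show "x j [^] (p ^ e t) \<in> ?W" if "j < t" for j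
          using less.IH[OF that] pw[of "x j"] x_closed[of j] less.prems that by simp
      qed
      thus ?thesis using 3(2) pw[OF x_closed[OF less.prems]] by (simp add: T_def)
    qed
  qed
  have "carrier R \<subseteq> {z \<in> carrier R. z [^] (p ^ e i) \<in> L i}"
  proof (rule Y_gen_subset[OF frob_vimage_subfield[OF Li]])
    show "F \<subseteq> {z \<in> carrier R. z [^] (p ^ e i) \<in> L i}" using FK KL Fc subfield_pow[OF Li] by auto
    show "y t j \<in> {z \<in> carrier R. z [^] (p ^ e i) \<in> L i}" if "t < r" "j < D t" "j \<noteq> 0" for t j
      using c_K[OF that(1,2)] that(3) KL subfield_pow[OF Li] y_closed[OF that(1,2)] by (auto simp: c_def)
  qed (use xL x_closed in auto)
  thus ?thesis using z by blast
qed

lemma tower: "normal_tower S x e r"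
  unfolding normal_tower_def
proof (intro conjI allI impI ballI S_subfield)
  have Lr: "subfield (L r) R" by (rule L_subfield) simp
  have "carrier R \<subseteq> L r"
  proof (rule Y_gen_subset[OF Lr])
    show "F \<subseteq> L r" using FK KS SL by blast
    show "y i j \<in> L r" if "i < r" "j < D i" "j \<noteq> 0" for i j
      using c_K[OF that(1,2)] that(3) KS SL[of r] by (auto simp: c_def)
  qed (rule x_L)
  thus "adjoin S (x ` {..<r}) = carrier R" using subfield_closed(1)[OF Lr] by (auto simp: L_def)
qed (use x_closed e_pos x_pow_notin pow_in_L in \<open>auto simp: L_def\<close>)

text \<open>For n > 1 the coefficient of the first power of \<theta> in its equation is the variable
  \<open>y 0 1\<close>. Inseparability would make it vanish by \<open>relation_coeff_zero\<close>,
  as p does not divide 1.\<close>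

lemma theta_separable: "\<theta> \<in> adjoin K {\<theta> [^] p}"
proof (cases "n = 1")
  case True
  have "\<theta> = lincomb (c 0) (\<lambda>j. \<theta> [^] j) 1" using theta_relation True theta_closed by (simp add: nat_pow_eone)
  also have "\<dots> \<in> K"
    by (rule lincomb_in_subfield[OF K_subfield]) (use c_K[OF r_pos] True subfield_closed(3)[OF K_subfield] in \<open>auto simp: D_0\<close>)
  finally show ?thesis using adjoin_incl(1)[of K] by blast
next
  case False
  hence n1: "1 < n" using n_pos by simp
  show ?thesis
  proof (rule ccontr)
    assume a: "\<theta> \<notin> adjoin K {\<theta> [^] p}"
    let ?d = "\<lambda>j. if j < n then c 0 j else \<ominus> \<one>"
    have dK: "?d \<in> {..<Suc n} \<rightarrow> K"
      using c_K[OF r_pos] subfield_closed(6)[OF K_subfield subfield_closed(3)[OF K_subfield]] by (auto simp: D_0)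
    note dc = Pi_subset[OF dK subfield_closed(1)[OF K_subfield]]
    have "lincomb ?d (\<lambda>i. \<theta> [^] i) (Suc n) = ?d n \<otimes> \<theta> [^] n \<oplus> lincomb ?d (\<lambda>i. \<theta> [^] i) n"
      by (rule lincomb_Suc[OF dc theta_pow_closed])
    also have "lincomb ?d (\<lambda>i. \<theta> [^] i) n = \<theta> [^] n" unfolding theta_relation
      by (rule lincomb_cong) (use c_closed[OF r_pos] theta_pow_closed in \<open>auto simp: D_0\<close>)
    finally have z: "lincomb ?d (\<lambda>i. \<theta> [^] i) (Suc n) = \<zero>" using theta_closed by (simp add: l_minus l_neg)
    have "?d 1 = \<zero>"
      by (rule relation_coeff_zero[OF K_subfield theta_closed a dK z theta_powers_indep]) (use n1 p_gt_1 in auto)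
    hence y0: "y 0 1 = \<zero>" using n1 by (simp add: c_def)
    have "y 0 1 \<in> (\<lambda>(i, j). y i j) ` J" using n1 r_pos by (force simp: J_iff D_0)
    hence "y 0 1 \<notin> algebraic_hull F ((\<lambda>(i, j). y i j) ` J - {y 0 1})"
      using y_indep[folded J_def] unfolding hull_independent_def by blast
    moreover have "subfield (algebraic_hull F ((\<lambda>(i, j). y i j) ` J - {y 0 1})) R"
      by (rule algebraic_hull_subfield[OF Fc]) (use Y_closed in blast)
    ultimately show False using y0 subfield_closed(2) by metis
  qed
qed

text \<open>A separable z lies in K(z^(q_0)), and q_0-th powers of all elements lie in
  \<open>S\<close>. Conversely, S = K(\<theta>) consists of separable elements because \<theta> is
  separable.\<close>

lemma separable_closure_K: "separable_closure K = S"
proof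
  have fd: "finite_dimension K S" using dimension_S by (rule finite_dimensionI)
  show "separable_closure K \<subseteq> S"
  proof
    fix z assume "z \<in> separable_closure K"
    hence z: "z \<in> carrier R" "separable_over K z" by (auto simp: separable_closure_def)
    have "algebraic K z" using z(2) by (simp add: separable_over_def)
    hence "z \<in> adjoin K {z [^] p}" using separable_over_iff[OF K_subfield z(1)] z(2) by blast
    hence "z \<in> adjoin K {z [^] (p ^ e 0)}" by (rule separable_adjoin_pow[OF K_subfield z(1)])
    moreover have "adjoin K {z [^] (p ^ e 0)} \<subseteq> S"
      by (rule adjoin_least[OF S_subfield KS]) (use pow_in_L[OF r_pos z(1)] L_0 in simp)
    ultimately show "z \<in> S" by blast
  qed
  show "S \<subseteq> separable_closure K"
  proof
    fix z assume z: "z \<in> S"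
    have zc: "z \<in> carrier R" using z subfield_closed(1)[OF S_subfield] by blast
    note alg = algebraic_of_finite_dimension[OF K_subfield S_subfield fd]
    have "z \<in> adjoin K {z [^] p}"
      by (rule simple_separable[OF K_subfield theta_closed alg[OF theta_S] theta_separable]) (use z S_def in simp)
    thus "z \<in> separable_closure K"
      using separable_over_iff[OF K_subfield zc alg[OF z]] zc by (simp add: separable_closure_def)
  qed
qed

theorem generic_extension_type: "extension_type K n (map e [0..<r])"
proof -
  have fdS: "finite_dimension S (carrier R)" using normal_tower_dimension[OF tower] by (rule finite_dimensionI)
  have "finite_dimension K (carrier R)"
    by (rule finite_dimension_trans[OF K_subfield S_subfield finite_dimensionI[OF dimension_S] fdS])
  moreover have "S \<noteq> carrier R" using x_pow_notin[OF r_pos] x_closed[OF r_pos] L_0 by auto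
  ultimately show ?thesis
    unfolding extension_type_def separable_closure_K
    using dimension_S normal_tower_imp_insep_type[OF tower r_pos fdS] by simp
qed

text \<open>The power x_m^(q_i) has degree q_m / q_i even over \<open>L m\<close>, which contains
  the field generated by \<open>S\<close> and the preceding powers; independence passes down to that
  smaller field.\<close>

lemma monomials_indep:
  assumes i: "i < r" shows "lin_indep K (V i) (D i)"
proof -
  let ?u = "\<lambda>j. x j [^] (p ^ e i)"
  have "chain_indep S (map (\<lambda>j. (?u j, p ^ (e j - e i))) [0..<m])" if "m \<le> i" for m
    using that
  proof (induction m)
    case (Suc m)
    have mr: "m < r" using Suc.prems i by simp
    have uc: "?u m \<in> carrier R" using x_closed[OF mr] by simp
    let ?d = "p ^ (e m - e i)"
    have im: "e i \<le> e m" using anti[of m i] Suc.prems i by simp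
    have fs: "fst ` set (map (\<lambda>j. (?u j, p ^ (e j - e i))) [0..<m]) = ?u ` {..<m}"
      by (simp add: image_image lessThan_atLeast0)
    have Lm: "subfield (L m) R" by (rule L_subfield) (use mr in simp)
    have sub: "adjoin S (?u ` {..<m}) \<subseteq> L m"
      by (rule adjoin_least[OF Lm SL]) (use subfield_pow[OF Lm x_L] in auto)
    have pw: "?u m [^] (p ^ b) = x m [^] (p ^ (e i + b))" for b
      using x_closed[OF mr] by (simp add: nat_pow_pow power_add)
    have ud: "?u m [^] ?d \<in> L m" using pw im pow_in_L[OF mr x_closed[OF mr]] by simp
    have "e m - e i = 0 \<or> ?u m [^] (p ^ (e m - e i - 1)) \<notin> L m"
    proof (cases "e m - e i = 0")
      case False
      hence "e i + (e m - e i - 1) = e m - 1" by simp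
      thus ?thesis using pw[of "e m - e i - 1"] x_pow_notin[OF mr] by simp
    qed simp
    hence dim: "dimension ?d (L m) (adjoin (L m) {?u m})" by (rule dimension_insep[OF Lm uc ud])
    have pc: "(\<lambda>b. ?u m [^] (b::nat)) \<in> {..<?d} \<rightarrow> carrier R" using uc by auto
    have d0: "0 < ?d" using p_pos by simp
    have "lin_span (L m) (\<lambda>b. ?u m [^] b) ?d = adjoin (L m) {?u m}"
      by (rule adjoin_eq_lin_span[OF Lm uc d0]) (use subfield_subset_lin_span_powers[OF Lm uc d0] ud in blast)
    hence "lin_indep (L m) (\<lambda>b. ?u m [^] b) ?d"
      using lin_span_indep(1)[OF Lm _ order_refl pc] dim by simp
    hence "lin_indep (adjoin S (?u ` {..<m})) (\<lambda>b. ?u m [^] b) ?d" by (rule lin_indep_mono[OF _ sub])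
    moreover have "fst ` set (map (\<lambda>j. (?u j, p ^ (e j - e i))) [0..<m]) \<subseteq> carrier R"
      unfolding fs using x_closed mr by auto
    ultimately show ?case
      using Suc chain_indep_snoc[OF S_subfield] fs uc d0 by simp
  qed simp
  hence "chain_indep K (tower_monomials x e n \<theta> i)"
    using theta_closed n_pos theta_powers_indep by (simp add: tower_monomials_def S_def)
  hence "lin_indep K (mixed (tower_monomials x e n \<theta> i)) (prod_list (map snd (tower_monomials x e n \<theta> i)))"
    by (rule mixed_indep[OF K_subfield])
  thus ?thesis by (simp only: V_def[abs_def] tower_monomials_size D)
qed

theorem generic_ess_dim_ge: "enat (\<Sum>i<r. D i) \<le> ess_dim F K"
proof -
  have "card J = (\<Sum>i<r. D i)" by (simp add: J_def)
  hence "enat (\<Sum>i<r. D i) = enat (card C)" using C_basis(2) by simp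
  also have "\<dots> \<le> ess_dim F K"
  proof (rule ess_dim_ge[OF F K_subfield K_def _ C_closed C_basis(1)])
    show "finite C" using finite_J by (simp add: C_def)
    fix M LM
    assume M: "subfield LM R" "M \<subseteq> LM" and pth: "\<And>x. x \<in> carrier R \<Longrightarrow> x [^] p \<in> LM"
      and desc: "coefficients_descend K M LM"
    have pw: "z [^] (p ^ b) \<in> LM" if "z \<in> carrier R" "1 \<le> b" for z b
    proof -
      have "z [^] (p ^ b) = (z [^] (p ^ (b - 1))) [^] p"
        using that by (simp add: nat_pow_pow power_Suc2[symmetric] del: power_Suc)
      thus ?thesis using pth that by simp
    qed
    have th: "\<theta> \<in> LM" unfolding \<theta>_def by (rule pw[OF x_closed[OF r_pos] e_pos[OF r_pos]])
    have "c i j \<in> M" if ij: "i < r" "j < D i" for i j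
    proof -
      have "V i j' \<in> LM" for j'
        by (rule V_in_subfield[OF M(1) th]) (use pw x_closed e_pos[OF ij(1)] ij in auto)
      moreover have "T i \<in> LM"
        using pw[OF x_closed[OF ij(1)] e_pos[OF ij(1)]] subfield_pow[OF M(1) th] by (simp add: T_def)
      moreover have "c i \<in> {..<D i} \<rightarrow> K" using c_K[OF ij(1)] by auto
      ultimately have "c i \<in> {..<D i} \<rightarrow> M"
        using desc monomials_indep[OF ij(1)] T_eq_lincomb[OF ij(1)] unfolding coefficients_descend_def by metis
      thus ?thesis using ij(2) by auto
    qed
    thus "C \<subseteq> M" by (auto simp: C_def J_iff)
  qed
  finally show ?thesis .
qed

end

section \<open>Purely transcendental extensions\<close>

text \<open>A polynomial over the image of \<open>E\<close> lifts coefficientwise, and evaluation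
  commutes with the injective \<open>h\<close>.\<close>

lemma (in ring_hom_ring) transcendental_image:
  assumes inj: "inj_on h (carrier R)" and E: "E \<subseteq> carrier R" and x: "x \<in> carrier R"
    and tr: "R.transcendental E x"
  shows "S.transcendental (h ` E) (h x)"
  unfolding S.transcendental_def
proof (rule inj_onI)
  have lift: "\<exists>p'\<in>carrier (univ_poly R E). p = map h p'"
    if p: "p \<in> carrier (univ_poly S (h ` E))" for p
  proof -
    let ?p = "map (inv_into E h) p"
    have pE: "set p \<subseteq> h ` E" "p \<noteq> [] \<Longrightarrow> lead_coeff p \<noteq> \<zero>\<^bsub>S\<^esub>"
      using p by (auto simp: univ_poly_carrier[symmetric] polynomial_def)
    have eq: "p = map h ?p"
      using pE(1) by (simp add: map_idI f_inv_into_f subset_iff)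
    have sE: "set ?p \<subseteq> E" using pE(1) by (auto simp: inv_into_into)
    have "lead_coeff ?p \<noteq> \<zero>\<^bsub>R\<^esub>" if "?p \<noteq> []"
    proof
      assume "lead_coeff ?p = \<zero>\<^bsub>R\<^esub>"
      hence "h (lead_coeff ?p) = \<zero>\<^bsub>S\<^esub>" by simp
      moreover have "h (lead_coeff ?p) = lead_coeff p"
        using that by (subst (2) eq) (simp add: hd_map)
      ultimately show False using pE(2) that by simp
    qed
    hence "?p \<in> carrier (univ_poly R E)"
      using sE by (auto simp: univ_poly_carrier[symmetric] polynomial_def)
    thus ?thesis using eq by blast
  qed
  fix p q assume pq: "p \<in> carrier (univ_poly S (h ` E))" "q \<in> carrier (univ_poly S (h ` E))"
    and eq: "S.eval p (h x) = S.eval q (h x)"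
  obtain p' q' where p': "p' \<in> carrier (univ_poly R E)" "p = map h p'"
    and q': "q' \<in> carrier (univ_poly R E)" "q = map h q'" using lift pq by metis
  have s: "set p' \<subseteq> carrier R" "set q' \<subseteq> carrier R"
    using p'(1) q'(1) E by (auto simp: univ_poly_carrier[symmetric] polynomial_def)
  have "h (R.eval p' x) = h (R.eval q' x)"
    using eq eval_hom'[OF x s(1)] eval_hom'[OF x s(2)] p'(2) q'(2) by simp
  hence "R.eval p' x = R.eval q' x"
    using inj R.eval_in_carrier[OF s(1) x] R.eval_in_carrier[OF s(2) x] by (meson inj_onD)
  thus "p = q" using tr p' q' unfolding R.transcendental_def by (auto dest: inj_onD)
qed

text \<open>Elements of the fraction field of \<open>R\<close> are encoded by \<open>h\<close>, applied to a chosen representative.\<close>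

locale fraction_coding = domain R for R (structure) +
  fixes h :: "'a \<times> 'a \<Rightarrow> 'c"
  assumes h_inj: "inj_on h (carrier R \<times> carrier R)"
begin

text \<open>The predicate depends only on the fraction a/b, so equivalent pairs receive the same
  representative. Elements thus remain pairs instead of becoming sets of pairs, as in a
  quotient.\<close>

definition rep :: "'a \<Rightarrow> 'a \<Rightarrow> 'a \<times> 'a" where
  "rep a b = (SOME u. fst u \<in> carrier R \<and> snd u \<in> carrier R - {\<zero>} \<and> a \<otimes> snd u = fst u \<otimes> b)"

definition frac :: "'a \<Rightarrow> 'a \<Rightarrow> 'c" where "frac a b = h (rep a b)"

definition numden :: "'c \<Rightarrow> 'a \<times> 'a" where
  "numden z = (SOME u. fst u \<in> carrier R \<and> snd u \<in> carrier R - {\<zero>} \<and> z = frac (fst u) (snd u))"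

text \<open>Operations on codes go through the numerator and denominator chosen by
  \<open>numden\<close>; \<open>frac_ops\<close> shows that the choice does not matter.\<close>

definition fraction_ring :: "'c ring" where
  "fraction_ring = \<lparr>carrier = {frac a b | a b. a \<in> carrier R \<and> b \<in> carrier R - {\<zero>}},
     monoid.mult = (\<lambda>z w. frac (fst (numden z) \<otimes> fst (numden w)) (snd (numden z) \<otimes> snd (numden w))),
     one = frac \<one> \<one>, ring.zero = frac \<zero> \<one>,
     ring.add = (\<lambda>z w. frac (fst (numden z) \<otimes> snd (numden w) \<oplus> fst (numden w) \<otimes> snd (numden z))
        (snd (numden z) \<otimes> snd (numden w)))\<rparr>"

lemma rep:
  assumes "a \<in> carrier R" "b \<in> carrier R - {\<zero>}"
  shows "fst (rep a b) \<in> carrier R" "snd (rep a b) \<in> carrier R - {\<zero>}"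
    "a \<otimes> snd (rep a b) = fst (rep a b) \<otimes> b"
proof -
  have "\<exists>u. fst u \<in> carrier R \<and> snd u \<in> carrier R - {\<zero>} \<and> a \<otimes> snd u = fst u \<otimes> b"
    by (rule exI[of _ "(a, b)"]) (use assms in simp)
  from someI_ex[OF this]
  show "fst (rep a b) \<in> carrier R" "snd (rep a b) \<in> carrier R - {\<zero>}"
    "a \<otimes> snd (rep a b) = fst (rep a b) \<otimes> b" unfolding rep_def by blast+
qed

lemma cross_trans:
  assumes "a \<in> carrier R" "b \<in> carrier R" "c \<in> carrier R" "d \<in> carrier R" "u \<in> carrier R"
    "v \<in> carrier R - {\<zero>}" "a \<otimes> v = u \<otimes> b" "u \<otimes> d = c \<otimes> v"
  shows "a \<otimes> d = c \<otimes> b"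
proof -
  have "v \<otimes> (a \<otimes> d) = (a \<otimes> v) \<otimes> d" using assms(1-6) by (simp add: m_ac)
  also have "\<dots> = (u \<otimes> d) \<otimes> b" unfolding assms(7) using assms(1-6) by (simp add: m_ac)
  also have "\<dots> = v \<otimes> (c \<otimes> b)" unfolding assms(8) using assms(1-6) by (simp add: m_ac)
  finally show ?thesis using m_lcancel[of v "a \<otimes> d" "c \<otimes> b"] assms(1-6) by simp
qed

lemma frac_eq:
  assumes a: "a \<in> carrier R" "b \<in> carrier R - {\<zero>}" and c: "c \<in> carrier R" "d \<in> carrier R - {\<zero>}"
  shows "frac a b = frac c d \<longleftrightarrow> a \<otimes> d = c \<otimes> b"
proof
  assume "frac a b = frac c d"
  moreover have "rep a b \<in> carrier R \<times> carrier R" "rep c d \<in> carrier R \<times> carrier R"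
    using rep(1,2)[OF a] rep(1,2)[OF c] by (simp_all add: mem_Times_iff)
  ultimately have "rep a b = rep c d" using inj_onD[OF h_inj] unfolding frac_def by simp
  thus "a \<otimes> d = c \<otimes> b"
    using cross_trans[of a b c d "fst (rep a b)" "snd (rep a b)"] rep[OF a] rep[OF c] a c by simp
next
  assume e: "a \<otimes> d = c \<otimes> b"
  have "(a \<otimes> v = u \<otimes> b) = (c \<otimes> v = u \<otimes> d)" if "u \<in> carrier R" "v \<in> carrier R" for u v
  proof
    assume "a \<otimes> v = u \<otimes> b"
    thus "c \<otimes> v = u \<otimes> d" using cross_trans[of c d u v a b] e a c that by simp
  next
    assume "c \<otimes> v = u \<otimes> d"
    thus "a \<otimes> v = u \<otimes> b" using cross_trans[of a b u v c d] e a c that by simp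
  qed
  hence "rep a b = rep c d" unfolding rep_def by (intro arg_cong[where f = Eps] ext) auto
  thus "frac a b = frac c d" by (simp add: frac_def)
qed

lemma frac_cases:
  assumes "z \<in> carrier fraction_ring"
  obtains a b where "a \<in> carrier R" "b \<in> carrier R" "b \<noteq> \<zero>" "z = frac a b"
  using assms by (auto simp: fraction_ring_def)

lemma numden:
  assumes "a \<in> carrier R" "b \<in> carrier R" "b \<noteq> \<zero>"
  shows "fst (numden (frac a b)) \<in> carrier R" "snd (numden (frac a b)) \<in> carrier R"
    "snd (numden (frac a b)) \<noteq> \<zero>" "fst (numden (frac a b)) \<otimes> b = a \<otimes> snd (numden (frac a b))"
proof -
  have "\<exists>u. fst u \<in> carrier R \<and> snd u \<in> carrier R - {\<zero>} \<and> frac a b = frac (fst u) (snd u)"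
    by (rule exI[of _ "(a, b)"]) (use assms in simp)
  from someI_ex[OF this]
  have n: "fst (numden (frac a b)) \<in> carrier R" "snd (numden (frac a b)) \<in> carrier R - {\<zero>}"
    "frac a b = frac (fst (numden (frac a b))) (snd (numden (frac a b)))" unfolding numden_def by blast+
  thus "fst (numden (frac a b)) \<in> carrier R" "snd (numden (frac a b)) \<in> carrier R"
    "snd (numden (frac a b)) \<noteq> \<zero>" by auto
  show "fst (numden (frac a b)) \<otimes> b = a \<otimes> snd (numden (frac a b))"
    using frac_eq[of a b "fst (numden (frac a b))" "snd (numden (frac a b))"] n assms by auto
qed

lemma frac_closed: "\<lbrakk>a \<in> carrier R; b \<in> carrier R; b \<noteq> \<zero>\<rbrakk> \<Longrightarrow> frac a b \<in> carrier fraction_ring"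
  by (auto simp: fraction_ring_def)

lemma frac_ops:
  assumes a: "a \<in> carrier R" "b \<in> carrier R" "b \<noteq> \<zero>" and c: "c \<in> carrier R" "d \<in> carrier R" "d \<noteq> \<zero>"
  shows "frac a b \<otimes>\<^bsub>fraction_ring\<^esub> frac c d = frac (a \<otimes> c) (b \<otimes> d)"
    "frac a b \<oplus>\<^bsub>fraction_ring\<^esub> frac c d = frac (a \<otimes> d \<oplus> c \<otimes> b) (b \<otimes> d)"
proof -
  obtain a' b' where n: "numden (frac a b) = (a', b')" by (cases "numden (frac a b)")
  obtain c' d' where m: "numden (frac c d) = (c', d')" by (cases "numden (frac c d)")
  note N = numden[OF a, unfolded n fst_conv snd_conv] and M = numden[OF c, unfolded m fst_conv snd_conv]
  have nz: "b' \<otimes> d' \<noteq> \<zero>" "b \<otimes> d \<noteq> \<zero>" using N M a c integral by blast+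
  have "(a' \<otimes> c') \<otimes> (b \<otimes> d) = (a' \<otimes> b) \<otimes> (c' \<otimes> d)" using N(1-3) M(1-3) a c by (simp add: m_ac)
  also have "\<dots> = (a \<otimes> c) \<otimes> (b' \<otimes> d')" unfolding N(4) M(4) using N(1-3) M(1-3) a c by (simp add: m_ac)
  finally have "frac (a' \<otimes> c') (b' \<otimes> d') = frac (a \<otimes> c) (b \<otimes> d)"
    using frac_eq[of "a' \<otimes> c'" "b' \<otimes> d'" "a \<otimes> c" "b \<otimes> d"] N M a c nz by simp
  thus "frac a b \<otimes>\<^bsub>fraction_ring\<^esub> frac c d = frac (a \<otimes> c) (b \<otimes> d)"
    by (simp add: fraction_ring_def n m)
  have "(a' \<otimes> d' \<oplus> c' \<otimes> b') \<otimes> (b \<otimes> d) = (a' \<otimes> b) \<otimes> (d' \<otimes> d) \<oplus> (c' \<otimes> d) \<otimes> (b' \<otimes> b)"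
    using N(1-3) M(1-3) a c by (simp add: m_ac l_distr r_distr)
  also have "\<dots> = (a \<otimes> d \<oplus> c \<otimes> b) \<otimes> (b' \<otimes> d')"
    unfolding N(4) M(4) using N(1-3) M(1-3) a c by (simp add: m_ac l_distr r_distr)
  finally have "frac (a' \<otimes> d' \<oplus> c' \<otimes> b') (b' \<otimes> d') = frac (a \<otimes> d \<oplus> c \<otimes> b) (b \<otimes> d)"
    using frac_eq[of "a' \<otimes> d' \<oplus> c' \<otimes> b'" "b' \<otimes> d'" "a \<otimes> d \<oplus> c \<otimes> b" "b \<otimes> d"] N M a c nz by simp
  thus "frac a b \<oplus>\<^bsub>fraction_ring\<^esub> frac c d = frac (a \<otimes> d \<oplus> c \<otimes> b) (b \<otimes> d)"
    by (simp add: fraction_ring_def n m)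
qed

lemma frac_one_zero: "\<one>\<^bsub>fraction_ring\<^esub> = frac \<one> \<one>" "\<zero>\<^bsub>fraction_ring\<^esub> = frac \<zero> \<one>"
  by (simp_all add: fraction_ring_def)

lemma fraction_ring_cring: "cring fraction_ring"
proof (rule cringI)
  show "abelian_group fraction_ring"
  proof (rule abelian_groupI)
    show "\<zero>\<^bsub>fraction_ring\<^esub> \<in> carrier fraction_ring" by (simp add: frac_one_zero frac_closed)
    fix x assume "x \<in> carrier fraction_ring"
    then obtain a b where x: "a \<in> carrier R" "b \<in> carrier R" "b \<noteq> \<zero>" "x = frac a b" by (rule frac_cases)
    show "\<zero>\<^bsub>fraction_ring\<^esub> \<oplus>\<^bsub>fraction_ring\<^esub> x = x" using x by (simp add: frac_one_zero frac_ops)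
    have "frac (\<ominus> a) b \<oplus>\<^bsub>fraction_ring\<^esub> x = frac (\<ominus> a \<otimes> b \<oplus> a \<otimes> b) (b \<otimes> b)" using x by (simp add: frac_ops)
    also have "\<dots> = \<zero>\<^bsub>fraction_ring\<^esub>" unfolding frac_one_zero
      using x integral[of b b] by (subst frac_eq) (auto simp: l_minus l_neg)
    finally show "\<exists>y\<in>carrier fraction_ring. y \<oplus>\<^bsub>fraction_ring\<^esub> x = \<zero>\<^bsub>fraction_ring\<^esub>"
      using frac_closed[of "\<ominus> a" b] x by blast
    fix y assume "y \<in> carrier fraction_ring"
    then obtain c d where y: "c \<in> carrier R" "d \<in> carrier R" "d \<noteq> \<zero>" "y = frac c d" by (rule frac_cases)
    have bd: "b \<otimes> d \<noteq> \<zero>" using x y integral by blast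
    show "x \<oplus>\<^bsub>fraction_ring\<^esub> y \<in> carrier fraction_ring" using x y bd by (simp add: frac_ops frac_closed)
    show "x \<oplus>\<^bsub>fraction_ring\<^esub> y = y \<oplus>\<^bsub>fraction_ring\<^esub> x"
      using x y by (simp add: frac_ops a_comm m_comm)
    fix z assume "z \<in> carrier fraction_ring"
    then obtain e f where z: "e \<in> carrier R" "f \<in> carrier R" "f \<noteq> \<zero>" "z = frac e f" by (rule frac_cases)
    have df: "d \<otimes> f \<noteq> \<zero>" using z y integral by blast
    show "(x \<oplus>\<^bsub>fraction_ring\<^esub> y) \<oplus>\<^bsub>fraction_ring\<^esub> z = x \<oplus>\<^bsub>fraction_ring\<^esub> (y \<oplus>\<^bsub>fraction_ring\<^esub> z)"
      using x(1-3) y(1-3) z(1-3) bd df unfolding x(4) y(4) z(4)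
      by (simp add: frac_ops l_distr r_distr a_assoc m_ac)
  qed
  show "comm_monoid fraction_ring"
  proof (rule comm_monoidI)
    show "\<one>\<^bsub>fraction_ring\<^esub> \<in> carrier fraction_ring" by (simp add: frac_one_zero frac_closed)
    fix x assume "x \<in> carrier fraction_ring"
    then obtain a b where x: "a \<in> carrier R" "b \<in> carrier R" "b \<noteq> \<zero>" "x = frac a b" by (rule frac_cases)
    show "\<one>\<^bsub>fraction_ring\<^esub> \<otimes>\<^bsub>fraction_ring\<^esub> x = x" using x by (simp add: frac_one_zero frac_ops)
    fix y assume "y \<in> carrier fraction_ring"
    then obtain c d where y: "c \<in> carrier R" "d \<in> carrier R" "d \<noteq> \<zero>" "y = frac c d" by (rule frac_cases)
    have bd: "b \<otimes> d \<noteq> \<zero>" using x y integral by blast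
    show "x \<otimes>\<^bsub>fraction_ring\<^esub> y \<in> carrier fraction_ring" using x y bd by (simp add: frac_ops frac_closed)
    show "x \<otimes>\<^bsub>fraction_ring\<^esub> y = y \<otimes>\<^bsub>fraction_ring\<^esub> x" using x y by (simp add: frac_ops m_comm)
    fix z assume "z \<in> carrier fraction_ring"
    then obtain e f where z: "e \<in> carrier R" "f \<in> carrier R" "f \<noteq> \<zero>" "z = frac e f" by (rule frac_cases)
    have df: "d \<otimes> f \<noteq> \<zero>" using z y integral by blast
    show "(x \<otimes>\<^bsub>fraction_ring\<^esub> y) \<otimes>\<^bsub>fraction_ring\<^esub> z = x \<otimes>\<^bsub>fraction_ring\<^esub> (y \<otimes>\<^bsub>fraction_ring\<^esub> z)"
      using x(1-3) y(1-3) z(1-3) bd df unfolding x(4) y(4) z(4)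
      by (simp add: frac_ops m_assoc)
  qed
  fix x y z assume "x \<in> carrier fraction_ring" "y \<in> carrier fraction_ring" "z \<in> carrier fraction_ring"
  note xyz = this
  obtain a b where x: "a \<in> carrier R" "b \<in> carrier R" "b \<noteq> \<zero>" "x = frac a b" by (rule frac_cases[OF xyz(1)])
  obtain c d where y: "c \<in> carrier R" "d \<in> carrier R" "d \<noteq> \<zero>" "y = frac c d" by (rule frac_cases[OF xyz(2)])
  obtain e f where z: "e \<in> carrier R" "f \<in> carrier R" "f \<noteq> \<zero>" "z = frac e f" by (rule frac_cases[OF xyz(3)])
  have nz: "b \<otimes> d \<noteq> \<zero>" "d \<otimes> f \<noteq> \<zero>" "b \<otimes> f \<noteq> \<zero>" using x y z integral by blast+
  have nz': "b \<otimes> d \<otimes> f \<noteq> \<zero>" "(b \<otimes> f) \<otimes> (d \<otimes> f) \<noteq> \<zero>" using nz x y z integral by (meson m_closed)+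
  have "(a \<otimes> d \<oplus> c \<otimes> b) \<otimes> e \<otimes> ((b \<otimes> f) \<otimes> (d \<otimes> f))
      = ((a \<otimes> e) \<otimes> (d \<otimes> f) \<oplus> (c \<otimes> e) \<otimes> (b \<otimes> f)) \<otimes> (b \<otimes> d \<otimes> f)"
    using x(1-2) y(1-2) z(1-2) by (simp add: l_distr r_distr m_ac)
  thus "(x \<oplus>\<^bsub>fraction_ring\<^esub> y) \<otimes>\<^bsub>fraction_ring\<^esub> z
      = x \<otimes>\<^bsub>fraction_ring\<^esub> z \<oplus>\<^bsub>fraction_ring\<^esub> y \<otimes>\<^bsub>fraction_ring\<^esub> z"
    using x(1-3) y(1-3) z(1-3) nz nz' unfolding x(4) y(4) z(4) by (simp add: frac_ops frac_eq)
qed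

lemma fraction_ring_field: "field fraction_ring"
proof (rule cring.cring_fieldI2[OF fraction_ring_cring])
  show "\<zero>\<^bsub>fraction_ring\<^esub> \<noteq> \<one>\<^bsub>fraction_ring\<^esub>" by (simp add: frac_one_zero frac_eq)
  fix x assume x: "x \<in> carrier fraction_ring" "x \<noteq> \<zero>\<^bsub>fraction_ring\<^esub>"
  from x(1) obtain a b where ab: "a \<in> carrier R" "b \<in> carrier R" "b \<noteq> \<zero>" "x = frac a b" by (rule frac_cases)
  have a: "a \<noteq> \<zero>" using x(2) ab by (auto simp: frac_one_zero frac_eq)
  have "a \<otimes> b \<noteq> \<zero>" using ab a integral by blast
  hence "x \<otimes>\<^bsub>fraction_ring\<^esub> frac b a = \<one>\<^bsub>fraction_ring\<^esub>"
    using ab a by (simp add: frac_ops frac_one_zero frac_eq m_comm)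
  thus "\<exists>y\<in>carrier fraction_ring. x \<otimes>\<^bsub>fraction_ring\<^esub> y = \<one>\<^bsub>fraction_ring\<^esub>"
    using frac_closed[OF ab(2,1) a] by blast
qed

lemma fraction_embedding:
  "(\<lambda>a. frac a \<one>) \<in> ring_hom R fraction_ring" "inj_on (\<lambda>a. frac a \<one>) (carrier R)"
  "z \<in> carrier fraction_ring \<Longrightarrow>
     \<exists>a\<in>carrier R. \<exists>b\<in>carrier R - {\<zero>}. z \<otimes>\<^bsub>fraction_ring\<^esub> frac b \<one> = frac a \<one>"
proof -
  show "(\<lambda>a. frac a \<one>) \<in> ring_hom R fraction_ring"
    by (rule ring_hom_memI) (simp_all add: frac_closed frac_ops frac_one_zero)
  show "inj_on (\<lambda>a. frac a \<one>) (carrier R)" by (rule inj_onI) (simp add: frac_eq)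
  assume "z \<in> carrier fraction_ring"
  then obtain a b where ab: "a \<in> carrier R" "b \<in> carrier R" "b \<noteq> \<zero>" "z = frac a b" by (rule frac_cases)
  hence "z \<otimes>\<^bsub>fraction_ring\<^esub> frac b \<one> = frac a \<one>" by (simp add: frac_ops frac_eq m_comm)
  thus "\<exists>a\<in>carrier R. \<exists>b\<in>carrier R - {\<zero>}. z \<otimes>\<^bsub>fraction_ring\<^esub> frac b \<one> = frac a \<one>"
    using ab by blast
qed

end

section \<open>Rational function fields carried by a given infinite type\<close>

lemma exists_inj_list_pairs:
  assumes "infinite (UNIV :: 'b set)" shows "\<exists>h :: 'b list \<times> 'b list \<Rightarrow> 'b. inj h"
proof -
  have "|lists (UNIV :: 'b set)| =o |UNIV :: 'b set|" by (rule card_of_lists_infinite[OF assms])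
  then obtain f where f: "bij_betw f (lists (UNIV :: 'b set)) (UNIV :: 'b set)"
    using card_of_ordIso by blast
  hence "inj f" by (simp add: bij_betw_def lists_UNIV)
  hence "inj (\<lambda>(u, v). f [f u, f v])" by (auto simp: inj_def)
  thus ?thesis by blast
qed

lemma (in field) eval_in_subfield:
  assumes E: "subfield E R" and x: "x \<in> E" and q: "set q \<subseteq> E" shows "eval q x \<in> E"
  using q
proof (induction q)
  case Nil thus ?case using subfield_closed(2)[OF E] by simp
next
  case (Cons a q)
  thus ?case using subfield_closed(4,5)[OF E] subfield_pow[OF E x] by simp
qed

text \<open>The fraction field of k[X], coded inside the type of \<open>k\<close>: polynomials are
  lists and fractions are pairs of lists, and an infinite type has room for such pairs. As the type
  does not grow, the construction can be iterated.\<close>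

lemma simple_transcendental_extension:
  fixes k :: "'b ring"
  assumes k: "field k" and inf: "infinite (UNIV :: 'b set)"
  obtains L :: "'b ring" and \<iota> t where "field L" "\<iota> \<in> ring_hom k L" "t \<in> carrier L"
    "t \<notin> field.algebraic_hull L (\<iota> ` carrier k) {}"
    "generate_field L (\<iota> ` carrier k \<union> {t}) = carrier L"
proof -
  interpret k: field k by (rule k)
  define P where "P = univ_poly k (carrier k)"
  note csr = k.carrier_is_subring
  interpret P: domain P unfolding P_def by (rule k.univ_poly_is_domain[OF csr])
  obtain h :: "'b list \<times> 'b list \<Rightarrow> 'b" where h: "inj h" using exists_inj_list_pairs[OF inf] by blast
  interpret frac: fraction_coding P h
    by unfold_locales (rule inj_on_subset[OF h subset_UNIV])
  define L where "L = frac.fraction_ring"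
  define \<phi> where "\<phi> = (\<lambda>a. frac.frac a \<one>\<^bsub>P\<^esub>)"
  note \<phi> = frac.fraction_embedding[folded L_def \<phi>_def]
  interpret L: field L unfolding L_def by (rule frac.fraction_ring_field)
  interpret \<phi>: ring_hom_ring P L \<phi> by (rule ring_hom_ringI2[OF P.ring_axioms L.ring_axioms \<phi>(1)])
  define \<iota> where "\<iota> = \<phi> \<circ> k.poly_of_const"
  define X' where "X' = var k"
  have con: "k.poly_of_const \<in> ring_hom k P"
    using k.canonical_embedding_is_hom[OF csr] by (simp add: P_def)
  have hom: "\<iota> \<in> ring_hom k L" unfolding \<iota>_def by (rule ring_hom_trans[OF con \<phi>(1)])
  interpret \<iota>: ring_hom_ring k L \<iota> by (rule ring_hom_ringI2[OF k.ring_axioms L.ring_axioms hom])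
  have X: "X' \<in> carrier P" unfolding X'_def P_def by (rule k.var_closed(1)[OF csr])
  have tc: "\<phi> X' \<in> carrier L" using X by simp
  have cc: "k.poly_of_const ` carrier k \<subseteq> carrier P" using ring_hom_closed[OF con] by blast
  \<comment> \<open>A polynomial is its own value at the indeterminate, with coefficients read as
    constants. This gives both the transcendence of the indeterminate and the generation of the
    field.\<close>
  have rw: "q = P.eval (map k.poly_of_const q) X'" if "q \<in> carrier P" for q
    using k.eval_rewrite[OF csr that[unfolded P_def]] by (simp add: P_def X'_def)
  have sk: "set q \<subseteq> carrier k" if "q \<in> carrier P" for q
    using that k.polynomial_incl unfolding P_def univ_poly_carrier[symmetric] by blast
  have trP: "P.transcendental (k.poly_of_const ` carrier k) X'"
    unfolding P.transcendental_def
  proof (rule inj_onI)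
    have lift: "\<exists>p'\<in>carrier P. p = map k.poly_of_const p'"
      if p: "p \<in> carrier (univ_poly P (k.poly_of_const ` carrier k))" for p
    proof -
      have pc: "p = [] \<or> set p \<subseteq> k.poly_of_const ` carrier k \<and> lead_coeff p \<noteq> \<zero>\<^bsub>P\<^esub>"
        using p by (auto simp: univ_poly_carrier[symmetric] polynomial_def)
      define q where "q = map (inv_into (carrier k) k.poly_of_const) p"
      have "set p \<subseteq> k.poly_of_const ` carrier k" using pc by auto
      hence q: "p = map k.poly_of_const q" "set q \<subseteq> carrier k"
        by (auto simp: q_def map_idI f_inv_into_f inv_into_into subset_iff)
      have "lead_coeff q \<noteq> \<zero>\<^bsub>k\<^esub>" if "q \<noteq> []"
      proof
        assume "lead_coeff q = \<zero>\<^bsub>k\<^esub>"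
        hence "lead_coeff p = k.poly_of_const \<zero>\<^bsub>k\<^esub>" using q(1) that by (simp add: hd_map)
        also have "\<dots> = \<zero>\<^bsub>P\<^esub>" by (simp add: k.poly_of_const_def P_def univ_poly_zero)
        finally show False using pc q(1) that by simp
      qed
      hence "q \<in> carrier P" using q(2) by (auto simp: P_def univ_poly_carrier[symmetric] polynomial_def)
      thus ?thesis using q(1) by blast
    qed
    fix p q assume pq: "p \<in> carrier (univ_poly P (k.poly_of_const ` carrier k))"
      "q \<in> carrier (univ_poly P (k.poly_of_const ` carrier k))" and eq: "P.eval p X' = P.eval q X'"
    obtain p' q' where "p' \<in> carrier P" "p = map k.poly_of_const p'" "q' \<in> carrier P" "q = map k.poly_of_const q'"
      using lift pq by metis
    thus "p = q" using eq rw by metis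
  qed
  have F: "subfield (\<iota> ` carrier k) L" by (rule \<iota>.img_is_subfield(2)[OF k.carrier_is_subfield]) simp
  have "L.transcendental (\<phi> ` k.poly_of_const ` carrier k) (\<phi> X')"
    by (rule \<phi>.transcendental_image[OF \<phi>(2) cc X trP])
  hence "\<phi> X' \<notin> L.algebraic_hull (\<iota> ` carrier k) {}"
    using L.adjoin_id[OF F, of "{}"] by (simp add: L.algebraic_hull_def \<iota>_def image_comp)
  moreover have "generate_field L (\<iota> ` carrier k \<union> {\<phi> X'}) = carrier L" (is "?E = _")
  proof
    have E: "subfield ?E L"
      by (rule L.adjoin_subfield) (use L.subfield_closed(1)[OF F] tc in auto)
    show "?E \<subseteq> carrier L" by (rule L.subfield_closed(1)[OF E])
    have \<phi>E: "\<phi> q \<in> ?E" if q: "q \<in> carrier P" for q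
    proof -
      have sq: "set (map k.poly_of_const q) \<subseteq> carrier P" using sk[OF q] cc by auto
      have "\<phi> q = \<phi> (P.eval (map k.poly_of_const q) X')" using rw[OF q] by simp
      also have "\<dots> = L.eval (map \<phi> (map k.poly_of_const q)) (\<phi> X')" by (rule \<phi>.eval_hom'[OF X sq])
      also have "\<dots> \<in> ?E"
      proof (rule L.eval_in_subfield[OF E])
        show "\<phi> X' \<in> ?E" using L.adjoin_incl(2)[of "{\<phi> X'}"] by blast
        have "set (map \<phi> (map k.poly_of_const q)) \<subseteq> \<iota> ` carrier k" using sk[OF q] by (auto simp: \<iota>_def)
        thus "set (map \<phi> (map k.poly_of_const q)) \<subseteq> ?E" using L.adjoin_incl(1)[of "\<iota> ` carrier k"] by blast
      qed
      finally show ?thesis .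
    qed
    show "carrier L \<subseteq> ?E"
    proof
      fix z assume z: "z \<in> carrier L"
      obtain a b where ab': "a \<in> carrier P" "b \<in> carrier P - {\<zero>\<^bsub>P\<^esub>}" "z \<otimes>\<^bsub>L\<^esub> \<phi> b = \<phi> a"
        using \<phi>(3)[OF z] unfolding \<phi>_def by blast
      have ab: "a \<in> carrier P" "b \<in> carrier P" "b \<noteq> \<zero>\<^bsub>P\<^esub>" "z \<otimes>\<^bsub>L\<^esub> \<phi> b = \<phi> a" using ab' by auto
      have "\<phi> b \<noteq> \<phi> \<zero>\<^bsub>P\<^esub>" using inj_onD[OF \<phi>(2)] ab(2,3) by blast
      hence b0: "\<phi> b \<noteq> \<zero>\<^bsub>L\<^esub>" by simp
      have bu: "\<phi> b \<in> Units L" using b0 ab(2) L.field_Units by simp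
      have "z = \<phi> a \<otimes>\<^bsub>L\<^esub> inv\<^bsub>L\<^esub> \<phi> b"
        unfolding ab(4)[symmetric] using z ab(2) bu by (simp add: L.m_assoc)
      thus "z \<in> ?E" using L.subfield_closed(5)[OF E \<phi>E[OF ab(1)] L.subfield_inv[OF E \<phi>E[OF ab(2)] b0]] by simp
    qed
  qed
  ultimately show ?thesis using that[OF L.field_axioms hom tc] by blast
qed

text \<open>Induction with varying base field: one element t is adjoined to \<open>k\<close>, then
  \<open>N\<close> more to k(t). The element t receives index 0 and the others are shifted.\<close>

lemma transcendental_extension:
  fixes k :: "'b ring" and N :: nat
  assumes "field k" "infinite (UNIV :: 'b set)"
  shows "\<exists>(L :: 'b ring) \<iota> y. field L \<and> \<iota> \<in> ring_hom k L \<and>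
    (\<forall>i<N. y i \<in> carrier L \<and> y i \<notin> field.algebraic_hull L (\<iota> ` carrier k) (y ` {..<i})) \<and>
    generate_field L (\<iota> ` carrier k \<union> y ` {..<N}) = carrier L"
  using assms(1)
proof (induction N arbitrary: k)
  case 0
  then interpret k: field k .
  have "generate_field k (id ` carrier k \<union> (\<lambda>i. undefined) ` {..<0::nat}) = carrier k"
    using k.adjoin_id[OF k.carrier_is_subfield, of "{}"] by simp
  moreover have "id \<in> ring_hom k k" by (rule ring_hom_memI) auto
  ultimately show ?case using 0 by blast
next
  case (Suc N)
  interpret k: field k by (rule Suc.prems)
  obtain k1 :: "'b ring" and \<iota>0 t where k1: "field k1" "\<iota>0 \<in> ring_hom k k1" "t \<in> carrier k1"
    "t \<notin> field.algebraic_hull k1 (\<iota>0 ` carrier k) {}"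
    "generate_field k1 (\<iota>0 ` carrier k \<union> {t}) = carrier k1"
    using simple_transcendental_extension[OF Suc.prems assms(2)] .
  interpret k1: field k1 by (rule k1(1))
  obtain L :: "'b ring" and \<iota>1 y where L: "field L" "\<iota>1 \<in> ring_hom k1 L"
    "\<And>i. i < N \<Longrightarrow> y i \<in> carrier L" "\<And>i. i < N \<Longrightarrow> y i \<notin> field.algebraic_hull L (\<iota>1 ` carrier k1) (y ` {..<i})"
    "generate_field L (\<iota>1 ` carrier k1 \<union> y ` {..<N}) = carrier L"
    using Suc.IH[OF k1(1)] by blast
  interpret L: field L by (rule L(1))
  interpret \<iota>1: ring_hom_ring k1 L \<iota>1 by (rule ring_hom_ringI2[OF k1.ring_axioms L.ring_axioms L(2)])
  interpret \<iota>0: ring_hom_ring k k1 \<iota>0 by (rule ring_hom_ringI2[OF k.ring_axioms k1.ring_axioms k1(2)])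
  have inj1: "inj_on \<iota>1 (carrier k1)" by (rule non_trivial_field_hom_is_inj[OF L(2) k1(1) L(1)])
  define \<iota> where "\<iota> = \<iota>1 \<circ> \<iota>0"
  define F where "F = \<iota> ` carrier k"
  define z where "z = (\<lambda>i. if i = 0 then \<iota>1 t else y (i - 1))"
  have hom: "\<iota> \<in> ring_hom k L" unfolding \<iota>_def by (rule ring_hom_trans[OF k1(2) L(2)])
  interpret \<iota>: ring_hom_ring k L \<iota> by (rule ring_hom_ringI2[OF k.ring_axioms L.ring_axioms hom])
  have F0: "subfield (\<iota>0 ` carrier k) k1" by (rule \<iota>0.img_is_subfield(2)[OF k.carrier_is_subfield]) simp
  have F: "subfield F L" unfolding F_def by (rule \<iota>.img_is_subfield(2)[OF k.carrier_is_subfield]) simp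
  note Fc = L.subfield_closed(1)[OF F]
  have FF: "F = \<iota>1 ` \<iota>0 ` carrier k" by (simp add: F_def \<iota>_def image_comp)
  have zc: "z i \<in> carrier L" if "i < Suc N" for i using that L(3)[of "i - 1"] k1(3) by (auto simp: z_def)
  have zs: "z ` {..<Suc i} = insert (\<iota>1 t) (y ` {..<i})" for i
    unfolding lessThan_Suc_eq_insert_0 image_insert image_image by (simp add: z_def)
  \<comment> \<open>The image of k(t) is generated by the images of \<open>k\<close> and t, so it
    lies in every subfield containing these.\<close>
  have sub: "\<iota>1 ` carrier k1 \<subseteq> E" if E: "subfield E L" "F \<subseteq> E" "\<iota>1 t \<in> E" for E
  proof -
    have gen: "u \<in> carrier k1 \<and> \<iota>1 u \<in> E" if "u \<in> generate_field k1 (\<iota>0 ` carrier k \<union> {t})" for u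
      using that
    proof (induction rule: generate_field.induct)
      case one thus ?case using L.subfield_closed(3)[OF E(1)] by simp
    next
      case (incl h) thus ?case using E(2,3) FF k1(3) by auto
    next
      case (a_inv h) thus ?case using L.subfield_closed(6)[OF E(1)] by simp
    next
      case (m_inv h)
      have hc: "h \<in> carrier k1" "h \<noteq> \<zero>\<^bsub>k1\<^esub>" "\<iota>1 h \<in> E" using m_inv by auto
      hence hu: "h \<in> Units k1" using k1.field_Units by simp
      have nz: "\<iota>1 h \<noteq> \<zero>\<^bsub>L\<^esub>" using inj_onD[OF inj1, of h "\<zero>\<^bsub>k1\<^esub>"] hc by auto
      have ic: "inv\<^bsub>k1\<^esub> h \<in> carrier k1" using hu by simp
      have "\<iota>1 h \<otimes>\<^bsub>L\<^esub> \<iota>1 (inv\<^bsub>k1\<^esub> h) = \<iota>1 (h \<otimes>\<^bsub>k1\<^esub> inv\<^bsub>k1\<^esub> h)" using hc ic by simp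
      also have "\<dots> = \<one>\<^bsub>L\<^esub>" using k1.Units_r_inv[OF hu] by simp
      finally have "\<iota>1 (inv\<^bsub>k1\<^esub> h) = inv\<^bsub>L\<^esub> \<iota>1 h" using hc(1) ic by (intro L.comm_inv_char[symmetric]) simp_all
      thus ?case using L.subfield_inv[OF E(1) hc(3) nz] ic by simp
    next
      case (eng_add h1 h2) thus ?case using L.subfield_closed(4)[OF E(1)] by simp
    next
      case (eng_mult h1 h2) thus ?case using L.subfield_closed(5)[OF E(1)] by simp
    qed
    show ?thesis using gen unfolding k1(5) by blast
  qed
  have "z i \<notin> L.algebraic_hull F (z ` {..<i})" if i: "i < Suc N" for i
  proof (cases i)
    case 0
    have "k1.transcendental (\<iota>0 ` carrier k) t"
      using k1(3,4) k1.adjoin_id[OF F0, of "{}"] by (auto simp: k1.algebraic_hull_def)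
    hence "L.transcendental F (\<iota>1 t)" unfolding FF
      by (rule \<iota>1.transcendental_image[OF inj1 k1.subfield_closed(1)[OF F0] k1(3)])
    thus ?thesis using 0 L.adjoin_id[OF F, of "{}"] by (simp add: z_def L.algebraic_hull_def)
  next
    case (Suc j)
    have j: "j < N" using i Suc by simp
    let ?H = "L.algebraic_hull (\<iota>1 ` carrier k1) (y ` {..<j})"
    have c: "\<iota>1 ` carrier k1 \<subseteq> carrier L" "y ` {..<j} \<subseteq> carrier L" using L(3) j by auto
    note H = L.algebraic_hull_incl[OF c]
    have "F \<subseteq> ?H" "insert (\<iota>1 t) (y ` {..<j}) \<subseteq> ?H"
      using H(2,3) k1(3) k1.subfield_closed(1)[OF F0] unfolding FF by auto
    hence "L.algebraic_hull F (z ` {..<i}) \<subseteq> ?H" unfolding Suc zs by (rule L.algebraic_hull_idem[OF c])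
    thus ?thesis using L(4)[OF j] Suc by (auto simp: z_def)
  qed
  moreover have "generate_field L (F \<union> z ` {..<Suc N}) = carrier L" (is "?E = _")
  proof
    have zN: "z ` {..<Suc N} \<subseteq> carrier L" using zc by auto
    have E: "subfield ?E L" by (rule L.adjoin_subfield[OF Fc zN])
    show "?E \<subseteq> carrier L" by (rule L.subfield_closed(1)[OF E])
    have "z ` {..<Suc N} \<subseteq> ?E" "F \<subseteq> ?E" by (rule L.adjoin_incl)+
    hence "\<iota>1 t \<in> ?E" "y ` {..<N} \<subseteq> ?E" "F \<subseteq> ?E" unfolding zs by auto
    thus "carrier L \<subseteq> ?E" unfolding L(5)[symmetric] using L.adjoin_least[OF E sub[OF E]] by blast
  qed
  ultimately show ?case using L.field_axioms hom zc unfolding F_def by blast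
qed

context field
begin

text \<open>By exchange, if adding \<open>x\<close> made some element of \<open>A\<close> dependent,
  then \<open>x\<close> itself would be dependent on \<open>A\<close>.\<close>

lemma hull_independent_insert:
  assumes F: "F \<subseteq> carrier R" and A: "A \<subseteq> carrier R" "hull_independent F A"
    and x: "x \<in> carrier R" "x \<notin> algebraic_hull F A"
  shows "hull_independent F (insert x A)"
  unfolding hull_independent_def
proof
  fix a assume a: "a \<in> insert x A"
  show "a \<notin> algebraic_hull F (insert x A - {a})"
  proof (cases "a = x")
    case True
    have "x \<notin> A" using x algebraic_hull_incl(3)[OF F A(1)] by blast
    thus ?thesis using True x(2) by (simp add: Diff_insert_absorb)
  next
    case False
    hence aA: "a \<in> A" and eq: "insert x A - {a} = insert x (A - {a})" using a by auto
    have na: "a \<notin> algebraic_hull F (A - {a})" using A(2) aA by (simp add: hull_independent_def)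
    have "x \<in> algebraic_hull F (insert a (A - {a}))" if "a \<in> algebraic_hull F (insert x (A - {a}))"
      by (rule algebraic_hull_exchange[OF F _ x(1) that na]) (use A(1) in auto)
    thus ?thesis using x(2) aA unfolding eq by (auto simp: insert_absorb)
  qed
qed

lemma hull_independent_sequence:
  fixes N :: nat
  assumes F: "F \<subseteq> carrier R" and y: "\<And>i. i < N \<Longrightarrow> y i \<in> carrier R"
    "\<And>i. i < N \<Longrightarrow> y i \<notin> algebraic_hull F (y ` {..<i})"
  shows "hull_independent F (y ` {..<N})" "inj_on y {..<N}"
proof -
  have "hull_independent F (y ` {..<M}) \<and> inj_on y {..<M}" if "M \<le> N" for M
    using that
  proof (induction M)
    case (Suc M)
    have c: "y ` {..<M} \<subseteq> carrier R" using y(1) Suc.prems by auto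
    have "y M \<notin> y ` {..<M}" using y(2)[of M] Suc.prems algebraic_hull_incl(3)[OF F c] by auto
    thus ?case using Suc hull_independent_insert[OF F c _ y(1) y(2)]
      by (simp add: lessThan_Suc)
  qed (simp add: hull_independent_def)
  thus "hull_independent F (y ` {..<N})" "inj_on y {..<N}" by auto
qed

end

section \<open>The maximal essential dimension\<close>

lemma characteristic_ring_hom:
  assumes "field k" "field L" and hom: "\<iota> \<in> ring_hom k L"
  shows "characteristic L = characteristic k"
proof -
  interpret k: field k by fact
  interpret L: field L by fact
  interpret \<iota>: ring_hom_ring k L \<iota> by (rule ring_hom_ringI2[OF k.ring_axioms L.ring_axioms hom])
  have inj: "inj_on \<iota> (carrier k)" by (rule non_trivial_field_hom_is_inj[OF hom assms(1,2)])
  have "\<iota> ([m] \<cdot>\<^bsub>k\<^esub> \<one>\<^bsub>k\<^esub>) = [m] \<cdot>\<^bsub>L\<^esub> \<one>\<^bsub>L\<^esub>" for m :: nat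
    by (induction m) simp_all
  hence eq: "[m] \<cdot>\<^bsub>L\<^esub> \<one>\<^bsub>L\<^esub> = \<zero>\<^bsub>L\<^esub> \<longleftrightarrow> [m] \<cdot>\<^bsub>k\<^esub> \<one>\<^bsub>k\<^esub> = \<zero>\<^bsub>k\<^esub>" for m :: nat
    using inj_onD[OF inj, of "[m] \<cdot>\<^bsub>k\<^esub> \<one>\<^bsub>k\<^esub>" "\<zero>\<^bsub>k\<^esub>"] by (metis \<iota>.hom_zero k.add.nat_pow_closed k.one_closed k.zero_closed)
  show ?thesis unfolding characteristic_def eq ..
qed

text \<open>\<open>k\<close> is copied into the target type along \<open>g\<close>, one variable is
  adjoined for each pair (i, j), and a bijection converts the consecutive numbering of the variables
  into the double index of \<open>generic_tower\<close>.\<close>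

lemma generic_extension_exists:
  fixes k :: "('a, 'm) ring_scheme" and g :: "'a \<Rightarrow> 'b" and e :: "nat \<Rightarrow> nat"
  assumes k: "field k" "characteristic k = p" "p > 0" and "0 < n" "0 < r"
    and e: "\<And>i. i < r \<Longrightarrow> 1 \<le> e i" "\<And>i j. \<lbrakk>j \<le> i; i < r\<rbrakk> \<Longrightarrow> e i \<le> e j"
    and inf: "infinite (UNIV :: 'b set)" and g: "inj_on g (carrier k)"
  obtains L :: "'b ring" and K \<iota> where "field L" "subfield K L" "\<iota> \<in> ring_hom k L" "\<iota> ` carrier k \<subseteq> K"
    "ring.extension_type L K n (map e [0..<r])"
    "enat (\<Sum>i<r. n * p ^ (\<Sum>j<i. e j - e i)) \<le> ring.ess_dim L (\<iota> ` carrier k) K"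
proof -
  interpret k: field k by (rule k(1))
  define D where "D = (\<lambda>i. n * p ^ (\<Sum>j<i. e j - e i))"
  let ?J = "SIGMA i:{..<r}. {..<D i}"
  define N where "N = card ?J"
  let ?k = "image_ring g k"
  have k': "field ?k" by (rule k.inj_imp_image_ring_is_field[OF g])
  have hg: "g \<in> ring_hom k ?k" using inj_imp_image_ring_iso[OF g] by (simp add: ring_iso_def)
  obtain L :: "'b ring" and \<iota>1 y where L: "field L" "\<iota>1 \<in> ring_hom ?k L"
    "\<forall>i<N. y i \<in> carrier L \<and> y i \<notin> field.algebraic_hull L (\<iota>1 ` carrier ?k) (y ` {..<i})"
    "generate_field L (\<iota>1 ` carrier ?k \<union> y ` {..<N}) = carrier L"
    using transcendental_extension[OF k' inf, of N] by (elim exE conjE)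
  interpret L: field L by (rule L(1))
  define \<iota> where "\<iota> = \<iota>1 \<circ> g"
  define F where "F = \<iota> ` carrier k"
  have hom: "\<iota> \<in> ring_hom k L" unfolding \<iota>_def by (rule ring_hom_trans[OF hg L(2)])
  interpret \<iota>: ring_hom_ring k L \<iota> by (rule ring_hom_ringI2[OF k.ring_axioms L.ring_axioms hom])
  have FF: "\<iota>1 ` carrier ?k = F" by (simp add: F_def \<iota>_def image_ring_carrier image_comp)
  have F: "subfield F L" unfolding F_def by (rule \<iota>.img_is_subfield(2)[OF k.carrier_is_subfield]) simp
  note Fc = L.subfield_closed(1)[OF F]
  have ind: "L.hull_independent F (y ` {..<N})" "inj_on y {..<N}"
    using L.hull_independent_sequence[OF Fc, of N y] L(3)[unfolded FF] by blast+
  obtain f where f: "bij_betw f ?J {..<N}"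
    using finite_same_card_bij[of ?J "{..<N}"] unfolding N_def by auto
  let ?y = "\<lambda>i j. y (f (i, j))"
  have img: "(\<lambda>(i, j). ?y i j) ` ?J = y ` {..<N}"
  proof -
    have "(\<lambda>(i, j). ?y i j) = y \<circ> f" by auto
    thus ?thesis using f by (metis bij_betw_imp_surj_on image_comp)
  qed
  interpret gt: generic_tower L p F r n e D ?y
  proof (intro generic_tower.intro char_p_field.intro char_p_field_axioms.intro generic_tower_axioms.intro
      L.field_axioms F)
    show "characteristic L = p" using characteristic_ring_hom[OF k(1) L(1) hom] k(2) by simp
    have "inj_on (y \<circ> f) ?J"
      using f ind(2) by (intro comp_inj_on) (auto simp: bij_betw_def)
    moreover have "(\<lambda>(i, j). ?y i j) = y \<circ> f" by auto
    ultimately show "inj_on (\<lambda>(i, j). ?y i j) ?J" by simp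
    show "L.hull_independent F ((\<lambda>(i, j). ?y i j) ` ?J)" unfolding img by (rule ind)
    show "generate_field L (F \<union> (\<lambda>(i, j). ?y i j) ` ?J) = carrier L"
      unfolding img using L(4) by (simp add: FF)
  qed (use assms F in \<open>auto simp: D_def\<close>)
  show ?thesis
    by (rule that[OF L(1) gt.K_subfield hom])
      (use gt.FK gt.generic_extension_type gt.generic_ess_dim_ge in \<open>simp_all add: F_def D_def\<close>)
qed

text \<open>The type that carries the fields L matters only through its size: an infinite type with
  room for \<open>k\<close> has room for the generic extension, and the upper bound holds for every
  L.\<close>

theorem theorem1p2:
  fixes k :: "('a, 'm) ring_scheme"
    and p n :: nat
    and es :: "nat list"
    and g :: "'a \<Rightarrow> 'b"
  assumes "field k"
    and "characteristic k = p" and "p > 0"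
    and "n \<ge> 1"
    and "es \<noteq> []" and "sorted_wrt (\<ge>) es" and "\<forall>e\<in>set es. e \<ge> 1"
    and "infinite (UNIV :: 'b set)" and "inj_on g (carrier k)"
  shows "finite (ed_values TYPE('b) k n es) \<and> ed_values TYPE('b) k n es \<noteq> {} \<and>
    tau TYPE('b) k n es =
      enat (n * (\<Sum>i=1..length es. p ^ (sum_list (take i es) - i * es ! (i - 1))))"
proof -
  let ?N = "n * (\<Sum>i=1..length es. p ^ (sum_list (take i es) - i * es ! (i - 1)))"
  let ?V = "ed_values TYPE('b) k n es"
  have le: "ring.ess_dim L (\<iota> ` carrier k) K \<le> enat ?N"
    if L: "field L" "subfield K L" and \<iota>: "\<iota> \<in> ring_hom k L" "\<iota> ` carrier k \<subseteq> K"
      and et: "ring.extension_type L K n es" for L :: "'b ring" and K \<iota>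
  proof -
    interpret k: field k by fact
    interpret L: field L by (rule L(1))
    interpret L: char_p_field L p
      by unfold_locales (use characteristic_ring_hom[OF assms(1) L(1) \<iota>(1)] assms in auto)
    interpret \<iota>: ring_hom_ring k L \<iota> by (rule ring_hom_ringI2[OF k.ring_axioms L.ring_axioms \<iota>(1)])
    have "subfield (\<iota> ` carrier k) L" by (rule \<iota>.img_is_subfield(2)[OF k.carrier_is_subfield]) simp
    thus ?thesis by (rule L.ess_dim_le[OF _ L(2) \<iota>(2) et assms(5-7)])
  qed
  have bound: "v \<le> enat ?N" if "v \<in> ?V" for v
    using that le unfolding ed_values_def by blast
  \<comment> \<open>A set of extended naturals with a finite bound is finite, so that
    \<open>Max\<close> is meaningful.\<close>
  hence fin: "finite ?V" by (meson finite_enat_bounded)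
  have anti: "es ! i \<le> es ! j" if "j \<le> i" "i < length es" for i j
    using that assms(6) by (cases "j = i") (auto simp: sorted_wrt_iff_nth_less)
  obtain L :: "'b ring" and K \<iota> where ex: "field L" "subfield K L" "\<iota> \<in> ring_hom k L" "\<iota> ` carrier k \<subseteq> K"
    "ring.extension_type L K n (map ((!) es) [0..<length es])"
    "enat (\<Sum>i<length es. n * p ^ (\<Sum>j<i. es ! j - es ! i)) \<le> ring.ess_dim L (\<iota> ` carrier k) K"
  proof (rule generic_extension_exists[OF assms(1-3) _ _ _ anti assms(8,9), of n "length es" "\<lambda>i. i"])
    show "1 \<le> es ! i" if "i < length es" for i using assms(7) that by simp
  qed (use assms(4,5) in auto)
  have et: "ring.extension_type L K n es" using ex(5) by (simp add: map_nth)
  have "ring.ess_dim L (\<iota> ` carrier k) K = enat ?N"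
    using le[OF ex(1-4) et] ex(6) unfolding exponent_count[OF assms(6)] by (rule antisym)
  hence mem: "enat ?N \<in> ?V" unfolding ed_values_def using ex(1-4) et by (smt (verit) mem_Collect_eq)
  have "Max ?V = enat ?N" by (rule Max_eqI[OF fin bound mem])
  thus ?thesis using fin mem unfolding tau_def by blast
qed

end
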